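(* Let $k\ge1$ and let $(G,\Lambda)$ be a pseudo-free self-similar $k$-graph (with $\Lambda$ finitely aligned). Consider the following conditions: (1) the Exel–Pardo groupoid $\mathcal G_{G,\Lambda}$ is amenable; (2) the action $G\curvearrowright\partial\Lambda$ is amenable; (3) the stabilizer of every vertex for the action $G\curvearrowright\Lambda^0$ is amenable. Then $(3)\Rightarrow(2)\Rightarrow(1)$. If $(G,\Lambda)$ is countable, then $(1)\Rightarrow(2)$. If either $\Lambda$ is row-finite or $k=1$, then $(2)\Rightarrow(3)$, so if in addition $(G,\Lambda)$ is countable, then all three conditions are equivalent.
   Context: $k$-graphs. $\mathbb Z_+=\{0,1,2,\dots\}$; $\vee,\wedge$ denote coordinatewise max and min. A $k$-graph is a small category $\Lambda$ (identified with its set of morphisms) with a functor $d\colon\Lambda\to\mathbb Z_+^k$ such that whenever $d(\mu)=n+m$ there are unique $\alpha,\beta$ with $d(\alpha)=n$, $d(\beta)=m$, $\mu=\alpha\beta$. $\Lambda^n=d^{-1}(n)$; $\Lambda^0$ is identified with the set of objects (vertices); $r,s\colon\Lambda\to\Lambda^0$ are codomain and domain. $v\Lambda^n=\{\lambda\in\Lambda^n:r(\lambda)=v\}$, $v\Lambda=\{\lambda:r(\lambda)=v\}$. $\Lambda^{\min}(\lambda,\mu)=\{(\alpha,\beta):\lambda\alpha=\mu\beta,\ d(\lambda\alpha)=d(\lambda)\vee d(\mu)\}$; $\Lambda$ is finitely aligned if all these sets are finite (a standing assumption), row-finite if all sets $v\Lambda^n$ are finite. Paths. For $m\in(\mathbb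 Z_+\cup\{\infty\})^k$ let $\Omega_{m,k}=\{(p,q)\in\mathbb Z_+^k\times\mathbb Z_+^k:p\le q\le m\}$ be the $k$-graph with $r(p,q)=p$, $s(p,q)=q$, $d(p,q)=q-p$, $(n,p)(p,q)=(n,q)$. $X_\Lambda$ is the set of degree-preserving functors $x\colon\Omega_{m,k}\to\Lambda$ over all $m$; $d(x)=m$, $x(n)=x(n,n)$, $r(x)=x(0)$. $\Lambda\subset X_\Lambda$ via $x(0,d(\lambda))=\lambda$. For $n\le d(x)$ in $\mathbb Z_+^k$, $\sigma^n(x)(p,q)=x(n+p,n+q)$; $\lambda x$ denotes concatenation ($s(\lambda)=r(x)$). $Z(\lambda)$ is the set of $x\in X_\Lambda$ of the form $\lambda y$; the sets $Z_F(\lambda)=Z(\lambda)\setminus\bigcup_{\alpha\in F}Z(\lambda\alpha)$, $F\subset s(\lambda)\Lambda$ finite, are a basis of a Hausdorff locally compact topology on $X_\Lambda$. A set $B\subset v\Lambda$ is exhaustive for $v$ if for each $\lambda\in v\Lambda$ there is $\mu\in B$ with $\Lambda^{\min}(\lambda,\mu)\ne\emptyset$. $\partial\Lambda\subset X_\Lambda$ (boundary paths) is the closed set of $x$ such that for every $m\in\mathbb Z_+^k$, $m\le d(x)$, and every finite exhaustive $B\subset x(m)\Lambda$ there is $\lambda\in B$ with $x(m,m+d(\lambda))=\lambda$. Self-similar $k$-graphs. $(G,\Lambda)$ is a self-similar $k$-graph if the discrete group $G$ acts on the set $\Lambda$ preserving $d$ and commuting with $r$ and $s$, and we are given a map $G\times\Lambda\to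 G$, $(g,\mu)\mapsto g|_\mu$, with: $g\cdot(\mu\nu)=(g\cdot\mu)(g|_\mu\cdot\nu)$ and $g|_{\mu\nu}=(g|_\mu)|_\nu$ when $s(\mu)=r(\nu)$; $(gh)|_\mu=g|_{h\cdot\mu}h|_\mu$; $g|_v=g$ for $v\in\Lambda^0$. It is pseudo-free if $g\cdot\mu=\mu$ and $g|_\mu=1_G$ imply $g=1_G$; countable if $G$ and $\Lambda$ are countable. $G$ acts by homeomorphisms on $X_\Lambda$, preserving $\partial\Lambda$, by $(g\cdot x)(n,m)=g|_{x(0,n)}\cdot x(n,m)$. Exel–Pardo groupoid. Let $Q_k(G)$ be the quotient of the group of all maps $f\colon\mathbb Z_+^k\to G$ (pointwise product) identifying $f_1,f_2$ if for some $m$ they agree at all $n\ge m$. For $m\in\mathbb Z^k$, the automorphism $\mathcal T_m$ of $Q_k(G)$ is induced by $\mathcal T_m(f)(n)=f(n-m)$ if $n\ge m$ and $1_G$ otherwise. For $x\in X_\Lambda$, $[g|_x]\in Q_k(G)$ is the class of $n\mapsto g|_{x(0,n\wedge d(x))}$. $\mathcal G_{G,\Lambda}$ is the set of quadruples $(\mu(g\cdot x),\mathcal T_{d(\mu)}([g|_x]),d(\mu)-d(\nu),\nu x)$ with $x\in\partial\Lambda$, $g\in G$, $\mu,\nu\in\Lambda$, $s(\nu)=r(x)$, $s(\mu)=g\cdot r(x)$, with product $(x,q,m,y)(y,q',n,z)=(x,q\mathcal T_m(q'),m+n,z)$, unit space $\partial\Lambda$, and topology with basis consisting of the sets of such quadruples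 with fixed $\mu,g,\nu$ ($s(\mu)=g\cdot s(\nu)$) and $x$ ranging over $Z_F(s(\nu))\cap\partial\Lambda$, $F\subset s(\nu)\Lambda$ finite. In the pseudo-free case this is a Hausdorff locally compact étale groupoid. Amenability. A Hausdorff locally compact étale groupoid $\mathcal G$ is amenable if there is a net $(f_i)_i$ of positive continuous functions on $\mathcal G$ with $\sum_{s(g)=x}f_i(g)=1$ for all $i,x$ and $\sum_{s(g)=r(h)}|f_i(gh)-f_i(g)|\to0$ uniformly on compact sets of $h\in\mathcal G$. An action $G\curvearrowright X$ of a discrete group on a locally compact space is amenable if the transformation groupoid $G\ltimes X$ is amenable. *)

theory Defs
  imports "HOL-Analysis.Analysis" "HOL-Algebra.Group_Action" "HOL-Library.Function_Algebras"
begin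

section \<open>k-graphs\<close>

text \<open>Multi-indices are functions on an index type \<open>'k\<close>, with the pointwise order, lattice and
  algebraic operations; the rank k is the cardinality of \<open>'k\<close>.\<close>

abbreviation enatv :: "('k \<Rightarrow> nat) \<Rightarrow> 'k \<Rightarrow> enat" where
  "enatv n \<equiv> (\<lambda>i. enat (n i))"

abbreviation intv :: "('k \<Rightarrow> nat) \<Rightarrow> 'k \<Rightarrow> int" where
  "intv n \<equiv> (\<lambda>i. int (n i))"

text \<open>A category is given by its morphisms only, objects being identified with identity morphisms.
  The product \<open>\<mu> \<cdot> \<nu>\<close> is meaningful only when \<open>src \<mu> = rng \<nu>\<close>.\<close>

record ('a, 'k) kgraph =
  Mor :: "'a set"
  rng :: "'a \<Rightarrow> 'a"
  src :: "'a \<Rightarrow> 'a"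
  cmp :: "'a \<Rightarrow> 'a \<Rightarrow> 'a"  (infixl "\<cdot>\<index>" 70)
  deg :: "'a \<Rightarrow> 'k \<Rightarrow> nat"

locale k_graph =
  fixes \<Lambda> :: "('a, 'k) kgraph" (structure)
  assumes rng_closed: "\<mu> \<in> Mor \<Lambda> \<Longrightarrow> rng \<Lambda> \<mu> \<in> Mor \<Lambda>"
    and src_closed: "\<mu> \<in> Mor \<Lambda> \<Longrightarrow> src \<Lambda> \<mu> \<in> Mor \<Lambda>"
    and rng_rng: "\<mu> \<in> Mor \<Lambda> \<Longrightarrow> rng \<Lambda> (rng \<Lambda> \<mu>) = rng \<Lambda> \<mu>"
    and src_rng: "\<mu> \<in> Mor \<Lambda> \<Longrightarrow> src \<Lambda> (rng \<Lambda> \<mu>) = rng \<Lambda> \<mu>"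
    and rng_src: "\<mu> \<in> Mor \<Lambda> \<Longrightarrow> rng \<Lambda> (src \<Lambda> \<mu>) = src \<Lambda> \<mu>"
    and src_src: "\<mu> \<in> Mor \<Lambda> \<Longrightarrow> src \<Lambda> (src \<Lambda> \<mu>) = src \<Lambda> \<mu>"
    and cmp_closed: "\<lbrakk>\<mu> \<in> Mor \<Lambda>; \<nu> \<in> Mor \<Lambda>; src \<Lambda> \<mu> = rng \<Lambda> \<nu>\<rbrakk> \<Longrightarrow> \<mu> \<cdot> \<nu> \<in> Mor \<Lambda>"
    and rng_cmp: "\<lbrakk>\<mu> \<in> Mor \<Lambda>; \<nu> \<in> Mor \<Lambda>; src \<Lambda> \<mu> = rng \<Lambda> \<nu>\<rbrakk> \<Longrightarrow> rng \<Lambda> (\<mu> \<cdot> \<nu>) = rng \<Lambda> \<mu>"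
    and src_cmp: "\<lbrakk>\<mu> \<in> Mor \<Lambda>; \<nu> \<in> Mor \<Lambda>; src \<Lambda> \<mu> = rng \<Lambda> \<nu>\<rbrakk> \<Longrightarrow> src \<Lambda> (\<mu> \<cdot> \<nu>) = src \<Lambda> \<nu>"
    and cmp_assoc: "\<lbrakk>\<mu> \<in> Mor \<Lambda>; \<nu> \<in> Mor \<Lambda>; \<kappa> \<in> Mor \<Lambda>; src \<Lambda> \<mu> = rng \<Lambda> \<nu>; src \<Lambda> \<nu> = rng \<Lambda> \<kappa>\<rbrakk>
        \<Longrightarrow> (\<mu> \<cdot> \<nu>) \<cdot> \<kappa> = \<mu> \<cdot> (\<nu> \<cdot> \<kappa>)"
    and rng_cmp_id: "\<mu> \<in> Mor \<Lambda> \<Longrightarrow> rng \<Lambda> \<mu> \<cdot> \<mu> = \<mu>"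
    and cmp_src_id: "\<mu> \<in> Mor \<Lambda> \<Longrightarrow> \<mu> \<cdot> src \<Lambda> \<mu> = \<mu>"
    and deg_cmp: "\<lbrakk>\<mu> \<in> Mor \<Lambda>; \<nu> \<in> Mor \<Lambda>; src \<Lambda> \<mu> = rng \<Lambda> \<nu>\<rbrakk>
        \<Longrightarrow> deg \<Lambda> (\<mu> \<cdot> \<nu>) = deg \<Lambda> \<mu> + deg \<Lambda> \<nu>"
    and unique_factorization: "\<lbrakk>\<mu> \<in> Mor \<Lambda>; deg \<Lambda> \<mu> = n + m\<rbrakk>
        \<Longrightarrow> \<exists>!(\<alpha>, \<beta>). \<alpha> \<in> Mor \<Lambda> \<and> \<beta> \<in> Mor \<Lambda> \<and> src \<Lambda> \<alpha> = rng \<Lambda> \<beta>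
              \<and> deg \<Lambda> \<alpha> = n \<and> deg \<Lambda> \<beta> = m \<and> \<mu> = \<alpha> \<cdot> \<beta>"

definition level :: "('a, 'k) kgraph \<Rightarrow> ('k \<Rightarrow> nat) \<Rightarrow> 'a set" where
  "level \<Lambda> n = {\<mu> \<in> Mor \<Lambda>. deg \<Lambda> \<mu> = n}"

text \<open>Unique factorization makes the morphisms of degree zero exactly the identities.\<close>

abbreviation vertices :: "('a, 'k) kgraph \<Rightarrow> 'a set" where
  "vertices \<Lambda> \<equiv> level \<Lambda> 0"

definition starting :: "('a, 'k) kgraph \<Rightarrow> 'a \<Rightarrow> 'a set" where
  "starting \<Lambda> v = {\<mu> \<in> Mor \<Lambda>. rng \<Lambda> \<mu> = v}"

definition Lmin :: "('a, 'k) kgraph \<Rightarrow> 'a \<Rightarrow> 'a \<Rightarrow> ('a \<times> 'a) set" where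
  "Lmin \<Lambda> \<mu> \<nu> = {(\<alpha>, \<beta>). \<alpha> \<in> Mor \<Lambda> \<and> \<beta> \<in> Mor \<Lambda> \<and> src \<Lambda> \<mu> = rng \<Lambda> \<alpha> \<and> src \<Lambda> \<nu> = rng \<Lambda> \<beta>
      \<and> cmp \<Lambda> \<mu> \<alpha> = cmp \<Lambda> \<nu> \<beta> \<and> deg \<Lambda> (cmp \<Lambda> \<mu> \<alpha>) = sup (deg \<Lambda> \<mu>) (deg \<Lambda> \<nu>)}"

definition finitely_aligned :: "('a, 'k) kgraph \<Rightarrow> bool" where
  "finitely_aligned \<Lambda> \<longleftrightarrow> (\<forall>\<mu>\<in>Mor \<Lambda>. \<forall>\<nu>\<in>Mor \<Lambda>. finite (Lmin \<Lambda> \<mu> \<nu>))"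

definition row_finite :: "('a, 'k) kgraph \<Rightarrow> bool" where
  "row_finite \<Lambda> \<longleftrightarrow> (\<forall>v\<in>vertices \<Lambda>. \<forall>n. finite (starting \<Lambda> v \<inter> level \<Lambda> n))"

definition exhaustive :: "('a, 'k) kgraph \<Rightarrow> 'a \<Rightarrow> 'a set \<Rightarrow> bool" where
  "exhaustive \<Lambda> v B \<longleftrightarrow>
     B \<subseteq> starting \<Lambda> v \<and> (\<forall>\<mu>\<in>starting \<Lambda> v. \<exists>\<nu>\<in>B. Lmin \<Lambda> \<mu> \<nu> \<noteq> {})"


section \<open>Paths\<close>

definition Omega :: "('k \<Rightarrow> enat) \<Rightarrow> (('k \<Rightarrow> nat) \<times> ('k \<Rightarrow> nat), 'k) kgraph" where
  "Omega m = \<lparr> Mor = {(p, q). p \<le> q \<and> enatv q \<le> m},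
               rng = (\<lambda>(p, q). (p, p)),
               src = (\<lambda>(p, q). (q, q)),
               cmp = (\<lambda>(n, p) (p', q). (n, q)),
               deg = (\<lambda>(p, q). q - p) \<rparr>"

text \<open>Functors are extensional (\<open>undefined\<close> outside the source category), so that equality of functors
  is equality of functions.\<close>

definition kgraph_functor :: "('b, 'k) kgraph \<Rightarrow> ('a, 'k) kgraph \<Rightarrow> ('b \<Rightarrow> 'a) \<Rightarrow> bool" where
  "kgraph_functor \<Gamma> \<Lambda> f \<longleftrightarrow>
     f \<in> Mor \<Gamma> \<rightarrow>\<^sub>E Mor \<Lambda> \<and>
     (\<forall>a\<in>Mor \<Gamma>. f (rng \<Gamma> a) = rng \<Lambda> (f a) \<and> f (src \<Gamma> a) = src \<Lambda> (f a) \<and> deg \<Lambda> (f a) = deg \<Gamma> a) \<and>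
     (\<forall>a\<in>Mor \<Gamma>. \<forall>b\<in>Mor \<Gamma>. src \<Gamma> a = rng \<Gamma> b \<longrightarrow> f (cmp \<Gamma> a b) = cmp \<Lambda> (f a) (f b))"

text \<open>A path is stored together with its degree.\<close>

type_synonym ('a, 'k) path = "('k \<Rightarrow> enat) \<times> (('k \<Rightarrow> nat) \<times> ('k \<Rightarrow> nat) \<Rightarrow> 'a)"

abbreviation pdeg :: "('a, 'k) path \<Rightarrow> 'k \<Rightarrow> enat" where
  "pdeg x \<equiv> fst x"

abbreviation seg :: "('a, 'k) path \<Rightarrow> ('k \<Rightarrow> nat) \<Rightarrow> ('k \<Rightarrow> nat) \<Rightarrow> 'a" where
  "seg x p q \<equiv> snd x (p, q)"

abbreviation prng :: "('a, 'k) path \<Rightarrow> 'a" where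
  "prng x \<equiv> seg x 0 0"

definition paths :: "('a, 'k) kgraph \<Rightarrow> ('a, 'k) path set" where
  "paths \<Lambda> = {(m, x). kgraph_functor (Omega m) \<Lambda> x}"

definition shift :: "('k \<Rightarrow> nat) \<Rightarrow> ('a, 'k) path \<Rightarrow> ('a, 'k) path" where
  "shift n x = (pdeg x - enatv n,
     \<lambda>(p, q) \<in> Mor (Omega (pdeg x - enatv n)). seg x (n + p) (n + q))"

text \<open>The concatenation \<open>\<mu>x\<close> for \<open>src \<mu> = prng x\<close>, characterized by its initial segment and its tail.\<close>

definition path_concat :: "('a, 'k) kgraph \<Rightarrow> 'a \<Rightarrow> ('a, 'k) path \<Rightarrow> ('a, 'k) path" where
  "path_concat \<Lambda> \<mu> x = (THE z. z \<in> paths \<Lambda> \<and> enatv (deg \<Lambda> \<mu>) \<le> pdeg z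
      \<and> seg z 0 (deg \<Lambda> \<mu>) = \<mu> \<and> shift (deg \<Lambda> \<mu>) z = x)"

definition Z :: "('a, 'k) kgraph \<Rightarrow> 'a \<Rightarrow> ('a, 'k) path set" where
  "Z \<Lambda> \<mu> = {path_concat \<Lambda> \<mu> y | y. y \<in> paths \<Lambda> \<and> src \<Lambda> \<mu> = prng y}"

definition ZF :: "('a, 'k) kgraph \<Rightarrow> 'a \<Rightarrow> 'a set \<Rightarrow> ('a, 'k) path set" where
  "ZF \<Lambda> \<mu> F = Z \<Lambda> \<mu> - (\<Union>\<alpha>\<in>F. Z \<Lambda> (cmp \<Lambda> \<mu> \<alpha>))"

definition path_topology :: "('a, 'k) kgraph \<Rightarrow> ('a, 'k) path topology" where
  "path_topology \<Lambda> = topology_generated_by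
     {ZF \<Lambda> \<mu> F | \<mu> F. \<mu> \<in> Mor \<Lambda> \<and> finite F \<and> F \<subseteq> starting \<Lambda> (src \<Lambda> \<mu>)}"

definition boundary_paths :: "('a, 'k) kgraph \<Rightarrow> ('a, 'k) path set" where
  "boundary_paths \<Lambda> = {x \<in> paths \<Lambda>. \<forall>m. enatv m \<le> pdeg x \<longrightarrow>
     (\<forall>B. finite B \<and> exhaustive \<Lambda> (seg x m m) B \<longrightarrow>
        (\<exists>\<mu>\<in>B. enatv (m + deg \<Lambda> \<mu>) \<le> pdeg x \<and> seg x m (m + deg \<Lambda> \<mu>) = \<mu>))}"

definition boundary_topology :: "('a, 'k) kgraph \<Rightarrow> ('a, 'k) path topology" where
  "boundary_topology \<Lambda> = subtopology (path_topology \<Lambda>) (boundary_paths \<Lambda>)"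


section \<open>Self-similar k-graphs\<close>

text \<open>\<open>act g \<mu>\<close> is the action and \<open>res g \<mu>\<close> is the restriction of g to \<open>\<mu>\<close>. That \<open>act g \<mu>\<close> and
  \<open>act (res g \<mu>) \<nu>\<close> are composable is part of the meaning of the first self-similarity identity.\<close>

locale self_similar_kgraph = k_graph \<Lambda> + group_action G "Mor \<Lambda>" act
  for G :: "('g, 'b) monoid_scheme" and \<Lambda> :: "('a, 'k) kgraph"
    and act :: "'g \<Rightarrow> 'a \<Rightarrow> 'a" and res :: "'g \<Rightarrow> 'a \<Rightarrow> 'g" +
  assumes act_deg: "\<lbrakk>g \<in> carrier G; \<mu> \<in> Mor \<Lambda>\<rbrakk> \<Longrightarrow> deg \<Lambda> (act g \<mu>) = deg \<Lambda> \<mu>"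
    and act_rng: "\<lbrakk>g \<in> carrier G; \<mu> \<in> Mor \<Lambda>\<rbrakk> \<Longrightarrow> act g (rng \<Lambda> \<mu>) = rng \<Lambda> (act g \<mu>)"
    and act_src: "\<lbrakk>g \<in> carrier G; \<mu> \<in> Mor \<Lambda>\<rbrakk> \<Longrightarrow> act g (src \<Lambda> \<mu>) = src \<Lambda> (act g \<mu>)"
    and res_closed: "\<lbrakk>g \<in> carrier G; \<mu> \<in> Mor \<Lambda>\<rbrakk> \<Longrightarrow> res g \<mu> \<in> carrier G"
    and act_composable: "\<lbrakk>g \<in> carrier G; \<mu> \<in> Mor \<Lambda>; \<nu> \<in> Mor \<Lambda>; src \<Lambda> \<mu> = rng \<Lambda> \<nu>\<rbrakk>
        \<Longrightarrow> src \<Lambda> (act g \<mu>) = rng \<Lambda> (act (res g \<mu>) \<nu>)"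
    and act_cmp: "\<lbrakk>g \<in> carrier G; \<mu> \<in> Mor \<Lambda>; \<nu> \<in> Mor \<Lambda>; src \<Lambda> \<mu> = rng \<Lambda> \<nu>\<rbrakk>
        \<Longrightarrow> act g (cmp \<Lambda> \<mu> \<nu>) = cmp \<Lambda> (act g \<mu>) (act (res g \<mu>) \<nu>)"
    and res_cmp: "\<lbrakk>g \<in> carrier G; \<mu> \<in> Mor \<Lambda>; \<nu> \<in> Mor \<Lambda>; src \<Lambda> \<mu> = rng \<Lambda> \<nu>\<rbrakk>
        \<Longrightarrow> res g (cmp \<Lambda> \<mu> \<nu>) = res (res g \<mu>) \<nu>"
    and res_mult: "\<lbrakk>g \<in> carrier G; h \<in> carrier G; \<mu> \<in> Mor \<Lambda>\<rbrakk>
        \<Longrightarrow> res (g \<otimes>\<^bsub>G\<^esub> h) \<mu> = res g (act h \<mu>) \<otimes>\<^bsub>G\<^esub> res h \<mu>"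
    and res_vertex: "\<lbrakk>g \<in> carrier G; v \<in> vertices \<Lambda>\<rbrakk> \<Longrightarrow> res g v = g"

definition pseudo_free ::
  "('g, 'b) monoid_scheme \<Rightarrow> ('a, 'k) kgraph \<Rightarrow> ('g \<Rightarrow> 'a \<Rightarrow> 'a) \<Rightarrow> ('g \<Rightarrow> 'a \<Rightarrow> 'g) \<Rightarrow> bool" where
  "pseudo_free G \<Lambda> act res \<longleftrightarrow>
     (\<forall>g\<in>carrier G. \<forall>\<mu>\<in>Mor \<Lambda>. act g \<mu> = \<mu> \<and> res g \<mu> = \<one>\<^bsub>G\<^esub> \<longrightarrow> g = \<one>\<^bsub>G\<^esub>)"

definition countable_kgraph_action :: "('g, 'b) monoid_scheme \<Rightarrow> ('a, 'k) kgraph \<Rightarrow> bool" where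
  "countable_kgraph_action G \<Lambda> \<longleftrightarrow> countable (carrier G) \<and> countable (Mor \<Lambda>)"

definition path_act ::
  "('g \<Rightarrow> 'a \<Rightarrow> 'a) \<Rightarrow> ('g \<Rightarrow> 'a \<Rightarrow> 'g) \<Rightarrow> 'g \<Rightarrow> ('a, 'k) path \<Rightarrow> ('a, 'k) path" where
  "path_act act res g x =
     (pdeg x, \<lambda>(n, m) \<in> Mor (Omega (pdeg x)). act (res g (seg x 0 n)) (seg x n m))"


section \<open>Amenability\<close>

text \<open>The range, source and product of a topological groupoid whose set of arrows is the underlying
  set of \<open>arrow_top\<close>. Units form a set of a separate type.\<close>

record ('e, 'u) top_groupoid =
  arrow_top :: "'e topology"
  unit_set :: "'u set"
  gsrc :: "'e \<Rightarrow> 'u"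
  grng :: "'e \<Rightarrow> 'u"
  gmult :: "'e \<Rightarrow> 'e \<Rightarrow> 'e"

definition source_fibre :: "('e, 'u) top_groupoid \<Rightarrow> 'u \<Rightarrow> 'e set" where
  "source_fibre \<G> u = {a \<in> topspace (arrow_top \<G>). gsrc \<G> a = u}"

text \<open>Intended for Hausdorff locally compact etale groupoids. A net of functions enters through its
  filter of tails: conversely, a proper filter F is the filter of tails of the net
  \<open>(E, f) \<mapsto> f\<close> indexed by the pairs with \<open>E\<close> in F and \<open>f \<in> E\<close>. Fibres can be uncountable,
  so sums are unordered.\<close>

definition amenable_groupoid :: "('e, 'u) top_groupoid \<Rightarrow> bool" where
  "amenable_groupoid \<G> \<longleftrightarrow>
     (\<exists>F :: ('e \<Rightarrow> real) filter. F \<noteq> bot \<and>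
        F \<le> principal {f. continuous_map (arrow_top \<G>) euclideanreal f
                \<and> (\<forall>a\<in>topspace (arrow_top \<G>). 0 \<le> f a)
                \<and> (\<forall>u\<in>unit_set \<G>. (f has_sum 1) (source_fibre \<G> u))} \<and>
        (\<forall>K. compactin (arrow_top \<G>) K \<longrightarrow>
           uniform_limit K (\<lambda>f h. \<Sum>\<^sub>\<infinity>a\<in>source_fibre \<G> (grng \<G> h). \<bar>f (gmult \<G> a h) - f a\<bar>)
             (\<lambda>h. 0) F))"

definition transformation_groupoid ::
  "('g, 'b) monoid_scheme \<Rightarrow> 'x topology \<Rightarrow> ('g \<Rightarrow> 'x \<Rightarrow> 'x) \<Rightarrow> ('g \<times> 'x, 'x) top_groupoid" where
  "transformation_groupoid G X \<phi> =
     \<lparr> arrow_top = prod_topology (discrete_topology (carrier G)) X,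
       unit_set = topspace X,
       gsrc = (\<lambda>(g, x). x),
       grng = (\<lambda>(g, x). \<phi> g x),
       gmult = (\<lambda>(g, y) (h, x). (g \<otimes>\<^bsub>G\<^esub> h, x)) \<rparr>"

definition amenable_action ::
  "('g, 'b) monoid_scheme \<Rightarrow> 'x topology \<Rightarrow> ('g \<Rightarrow> 'x \<Rightarrow> 'x) \<Rightarrow> bool" where
  "amenable_action G X \<phi> \<longleftrightarrow> amenable_groupoid (transformation_groupoid G X \<phi>)"

text \<open>A discrete group is an etale groupoid with one unit; amenability in the sense above is then
  Reiter's condition.\<close>

definition group_groupoid :: "('g, 'b) monoid_scheme \<Rightarrow> ('g, unit) top_groupoid" where
  "group_groupoid G =
     \<lparr> arrow_top = discrete_topology (carrier G),
       unit_set = UNIV,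
       gsrc = (\<lambda>g. ()),
       grng = (\<lambda>g. ()),
       gmult = (\<lambda>g h. g \<otimes>\<^bsub>G\<^esub> h) \<rparr>"

definition amenable_group :: "('g, 'b) monoid_scheme \<Rightarrow> bool" where
  "amenable_group G \<longleftrightarrow> amenable_groupoid (group_groupoid G)"


section \<open>The Exel--Pardo groupoid\<close>

definition Qrel ::
  "('g, 'b) monoid_scheme \<Rightarrow> ((('k \<Rightarrow> nat) \<Rightarrow> 'g) \<times> (('k \<Rightarrow> nat) \<Rightarrow> 'g)) set" where
  "Qrel G = {(f1, f2). f1 \<in> UNIV \<rightarrow> carrier G \<and> f2 \<in> UNIV \<rightarrow> carrier G
               \<and> (\<exists>m. \<forall>n\<ge>m. f1 n = f2 n)}"

text \<open>Elements of \<open>Q\<^sub>k(G)\<close> are equivalence classes; product and translation are induced from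
  representatives.\<close>

type_synonym ('g, 'k) Qelem = "(('k \<Rightarrow> nat) \<Rightarrow> 'g) set"

definition Qgroup :: "('g, 'b) monoid_scheme \<Rightarrow> ('g, 'k) Qelem monoid" where
  "Qgroup G =
     \<lparr> carrier = (UNIV \<rightarrow> carrier G) // Qrel G,
       mult = (\<lambda>p q. \<Union>f1\<in>p. \<Union>f2\<in>q. Qrel G `` {\<lambda>n. f1 n \<otimes>\<^bsub>G\<^esub> f2 n}),
       one = Qrel G `` {\<lambda>n. \<one>\<^bsub>G\<^esub>} \<rparr>"

definition translate ::
  "('g, 'b) monoid_scheme \<Rightarrow> ('k \<Rightarrow> int) \<Rightarrow> (('k \<Rightarrow> nat) \<Rightarrow> 'g) \<Rightarrow> ('k \<Rightarrow> nat) \<Rightarrow> 'g" where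
  "translate G m f n = (if m \<le> intv n then f (\<lambda>i. nat (int (n i) - m i)) else \<one>\<^bsub>G\<^esub>)"

definition Qtranslate ::
  "('g, 'b) monoid_scheme \<Rightarrow> ('k \<Rightarrow> int) \<Rightarrow> ('g, 'k) Qelem \<Rightarrow> ('g, 'k) Qelem" where
  "Qtranslate G m q = (\<Union>f\<in>q. Qrel G `` {translate G m f})"

definition path_res ::
  "('g, 'b) monoid_scheme \<Rightarrow> ('g \<Rightarrow> 'a \<Rightarrow> 'g) \<Rightarrow> 'g \<Rightarrow> ('a, 'k) path \<Rightarrow> ('g, 'k) Qelem" where
  "path_res G res g x = Qrel G `` {\<lambda>n. res g (seg x 0 (\<lambda>i. the_enat (min (enat (n i)) (pdeg x i))))}"

type_synonym ('g, 'a, 'k) ep_arrow =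
  "('a, 'k) path \<times> ('g, 'k) Qelem \<times> ('k \<Rightarrow> int) \<times> ('a, 'k) path"

definition ep_quadruple ::
  "('g, 'b) monoid_scheme \<Rightarrow> ('a, 'k) kgraph \<Rightarrow> ('g \<Rightarrow> 'a \<Rightarrow> 'a) \<Rightarrow> ('g \<Rightarrow> 'a \<Rightarrow> 'g)
     \<Rightarrow> 'a \<Rightarrow> 'g \<Rightarrow> 'a \<Rightarrow> ('a, 'k) path \<Rightarrow> ('g, 'a, 'k) ep_arrow" where
  "ep_quadruple G \<Lambda> act res \<mu> g \<nu> x =
     (path_concat \<Lambda> \<mu> (path_act act res g x),
      Qtranslate G (intv (deg \<Lambda> \<mu>)) (path_res G res g x),
      intv (deg \<Lambda> \<mu>) - intv (deg \<Lambda> \<nu>),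
      path_concat \<Lambda> \<nu> x)"

definition ep_topology ::
  "('g, 'b) monoid_scheme \<Rightarrow> ('a, 'k) kgraph \<Rightarrow> ('g \<Rightarrow> 'a \<Rightarrow> 'a) \<Rightarrow> ('g \<Rightarrow> 'a \<Rightarrow> 'g)
     \<Rightarrow> ('g, 'a, 'k) ep_arrow topology" where
  "ep_topology G \<Lambda> act res = topology_generated_by
     {ep_quadruple G \<Lambda> act res \<mu> g \<nu> ` (ZF \<Lambda> (src \<Lambda> \<nu>) F \<inter> boundary_paths \<Lambda>) | \<mu> g \<nu> F.
        \<mu> \<in> Mor \<Lambda> \<and> g \<in> carrier G \<and> \<nu> \<in> Mor \<Lambda> \<and> src \<Lambda> \<mu> = act g (src \<Lambda> \<nu>)
        \<and> finite F \<and> F \<subseteq> starting \<Lambda> (src \<Lambda> \<nu>)}"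

definition exel_pardo_groupoid ::
  "('g, 'b) monoid_scheme \<Rightarrow> ('a, 'k) kgraph \<Rightarrow> ('g \<Rightarrow> 'a \<Rightarrow> 'a) \<Rightarrow> ('g \<Rightarrow> 'a \<Rightarrow> 'g)
     \<Rightarrow> (('g, 'a, 'k) ep_arrow, ('a, 'k) path) top_groupoid" where
  "exel_pardo_groupoid G \<Lambda> act res =
     \<lparr> arrow_top = ep_topology G \<Lambda> act res,
       unit_set = boundary_paths \<Lambda>,
       gsrc = (\<lambda>(x, q, m, y). y),
       grng = (\<lambda>(x, q, m, y). x),
       gmult = (\<lambda>(x, q, m, y) (y', q', n, z). (x, q \<otimes>\<^bsub>Qgroup G\<^esub> Qtranslate G m q', m + n, z)) \<rparr>"


section \<open>Underlying sets of the topologies\<close>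

lemma shift_0: "x \<in> paths \<Lambda> \<Longrightarrow> shift 0 x = x"
proof -
  assume x: "x \<in> paths \<Lambda>"
  have d: "pdeg x - enatv 0 = pdeg x"
    by (rule ext) (simp add: zero_enat_def[symmetric])
  have "snd x \<in> extensional (Mor (Omega (pdeg x)))"
    using x by (auto simp: paths_def kgraph_functor_def PiE_def)
  then have "restrict (snd x) (Mor (Omega (pdeg x))) = snd x"
    by (rule extensional_restrict)
  then show ?thesis
    unfolding shift_def d by (simp add: prod_eq_iff case_prod_unfold)
qed

context k_graph
begin

lemma prng_vertex:
  assumes "x \<in> paths \<Lambda>"
  shows "prng x \<in> vertices \<Lambda>" "src \<Lambda> (prng x) = prng x"
proof -
  have f: "kgraph_functor (Omega (pdeg x)) \<Lambda> (snd x)"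
    using assms by (auto simp: paths_def)
  have 0: "(0, 0) \<in> Mor (Omega (pdeg x))"
    by (auto simp: Omega_def le_fun_def zero_enat_def[symmetric])
  have "src (Omega (pdeg x)) (0, 0) = (0, 0)" "deg (Omega (pdeg x)) (0, 0) = 0"
    by (auto simp: Omega_def)
  with f 0 show "prng x \<in> vertices \<Lambda>" "src \<Lambda> (prng x) = prng x"
    unfolding kgraph_functor_def level_def by (auto dest: PiE_mem)
qed

lemma concat_vertex:
  assumes "x \<in> paths \<Lambda>"
  shows "path_concat \<Lambda> (prng x) x = x"
proof -
  have d: "deg \<Lambda> (prng x) = 0"
    using prng_vertex(1)[OF assms] by (simp add: level_def)
  have le: "enatv 0 \<le> pdeg x"
    by (auto simp: le_fun_def zero_enat_def[symmetric])
  show ?thesis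
    unfolding path_concat_def d
  proof (rule the_equality)
    show "x \<in> paths \<Lambda> \<and> enatv 0 \<le> pdeg x \<and> prng x = prng x \<and> shift 0 x = x"
      using assms le shift_0[OF assms] by blast
  next
    fix z assume "z \<in> paths \<Lambda> \<and> enatv 0 \<le> pdeg z \<and> prng z = prng x \<and> shift 0 z = x"
    then show "z = x" using shift_0[of z \<Lambda>] by simp
  qed
qed

lemma in_Z_prng: "x \<in> paths \<Lambda> \<Longrightarrow> x \<in> Z \<Lambda> (prng x)"
  unfolding Z_def using concat_vertex[of x] prng_vertex(2)[of x]
  by (intro CollectI exI[of _ x]) simp

end

lemma (in k_graph) Z_vertexD:
  assumes "\<mu> \<in> Mor \<Lambda>" "x \<in> Z \<Lambda> (src \<Lambda> \<mu>)"
  shows "x \<in> paths \<Lambda>" "prng x = src \<Lambda> \<mu>"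
proof -
  obtain y where y: "x = path_concat \<Lambda> (src \<Lambda> \<mu>) y" "y \<in> paths \<Lambda>" "src \<Lambda> (src \<Lambda> \<mu>) = prng y"
    using assms(2) unfolding Z_def by blast
  then have "src \<Lambda> \<mu> = prng y"
    using src_src[OF assms(1)] by simp
  then show "x \<in> paths \<Lambda>" "prng x = src \<Lambda> \<mu>"
    using y concat_vertex[OF y(2)] by simp_all
qed

lemma (in self_similar_kgraph) topspace_ep_topology:
  "topspace (ep_topology G \<Lambda> act res) =
     {ep_quadruple G \<Lambda> act res \<mu> g \<nu> x | \<mu> g \<nu> x.
        x \<in> boundary_paths \<Lambda> \<and> g \<in> carrier G \<and> \<mu> \<in> Mor \<Lambda> \<and> \<nu> \<in> Mor \<Lambda>
        \<and> src \<Lambda> \<nu> = prng x \<and> src \<Lambda> \<mu> = act g (prng x)}" (is "_ = ?R")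
proof -
  have top: "topspace (ep_topology G \<Lambda> act res) = \<Union>
     {ep_quadruple G \<Lambda> act res \<mu> g \<nu> ` (ZF \<Lambda> (src \<Lambda> \<nu>) F \<inter> boundary_paths \<Lambda>) | \<mu> g \<nu> F.
        \<mu> \<in> Mor \<Lambda> \<and> g \<in> carrier G \<and> \<nu> \<in> Mor \<Lambda> \<and> src \<Lambda> \<mu> = act g (src \<Lambda> \<nu>)
        \<and> finite F \<and> F \<subseteq> starting \<Lambda> (src \<Lambda> \<nu>)}" (is "_ = \<Union>?B")
    unfolding ep_topology_def by (rule topology_generated_by_topspace)
  have "\<Union>?B \<subseteq> ?R"
  proof
    fix a assume "a \<in> \<Union>?B"
    then obtain \<mu> g \<nu> F x where *: "\<mu> \<in> Mor \<Lambda>" "g \<in> carrier G" "\<nu> \<in> Mor \<Lambda>"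
      "src \<Lambda> \<mu> = act g (src \<Lambda> \<nu>)" "x \<in> ZF \<Lambda> (src \<Lambda> \<nu>) F" "x \<in> boundary_paths \<Lambda>"
      "a = ep_quadruple G \<Lambda> act res \<mu> g \<nu> x" by auto
    then have "prng x = src \<Lambda> \<nu>"
      using Z_vertexD(2) by (auto simp: ZF_def)
    then show "a \<in> ?R" using *
      by (intro CollectI exI[of _ \<mu>] exI[of _ g] exI[of _ \<nu>] exI[of _ x]) simp
  qed
  moreover have "?R \<subseteq> \<Union>?B"
  proof
    fix a assume "a \<in> ?R"
    then obtain \<mu> g \<nu> x where *: "x \<in> boundary_paths \<Lambda>" "g \<in> carrier G" "\<mu> \<in> Mor \<Lambda>"
      "\<nu> \<in> Mor \<Lambda>" "src \<Lambda> \<nu> = prng x" "src \<Lambda> \<mu> = act g (prng x)"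
      "a = ep_quadruple G \<Lambda> act res \<mu> g \<nu> x" by blast
    then have "x \<in> ZF \<Lambda> (src \<Lambda> \<nu>) {} \<inter> boundary_paths \<Lambda>"
      using in_Z_prng by (auto simp: ZF_def boundary_paths_def)
    then have "a \<in> ep_quadruple G \<Lambda> act res \<mu> g \<nu> ` (ZF \<Lambda> (src \<Lambda> \<nu>) {} \<inter> boundary_paths \<Lambda>)"
      using * by blast
    moreover have "ep_quadruple G \<Lambda> act res \<mu> g \<nu> ` (ZF \<Lambda> (src \<Lambda> \<nu>) {} \<inter> boundary_paths \<Lambda>) \<in> ?B"
      using * by (intro CollectI exI[of _ \<mu>] exI[of _ g] exI[of _ \<nu>] exI[of _ "{}"]) simp
    ultimately show "a \<in> \<Union>?B" by blast
  qed
  ultimately show ?thesis unfolding top by blast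
qed

end

theory Submission
  imports Defs
begin

text \<open>A path is identified with the filter of its initial segments, so that the topology, the action and
  the concatenation of paths become statements about finite sets of morphisms, and an arrow of the
  Exel--Pardo groupoid \<open>(\<mu>(g \<cdot> x), \<dots>, \<nu>x)\<close> is handled through refinement along an initial segment of \<open>x\<close>
  and, by pseudo-freeness, uniqueness of \<open>\<mu>\<close> and \<open>g\<close> for given \<open>\<nu>\<close> and \<open>x\<close>.

  If vertex stabilizers are amenable, the equivariant map \<open>x \<mapsto> r(x)\<close> onto the discrete vertex set
  transports their almost invariant densities to the boundary. Conversely, the stabilizer of \<open>v\<close> acts on a
  compact set of boundary paths starting at \<open>v\<close> all of whose initial segments have finite orbits: a density
  on this set depends, up to an error, on finitely many initial segments only, and can be averaged over the
  finitely many possibilities.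

  From the action to the groupoid: a density \<open>\<phi>\<close> for the action gives, for every choice of a
  level \<open>p(x) \<le> d(x)\<close>, a density supported on the arrows \<open>(g, \<sigma>\<^sup>p(x))\<close> composed with \<open>x \<rightarrow> \<sigma>\<^sup>p(x)\<close>.
  It is almost invariant under an arrow from \<open>\<nu>x\<close> to \<open>\<mu>(g \<cdot> x)\<close> whenever the levels of both paths cut off
  the same segment of \<open>x\<close>. The levels are the joins of the degrees, bounded by \<open>n\<close>, of the initial segments
  that belong to a finite set \<open>E\<^sub>i\<close>. For an increasing sequence of such sets, closed up under the arrows in
  question, the levels for both paths interlace, hence differ for a bounded number of \<open>i\<close> only, and averaging
  over \<open>i\<close> and over \<open>n\<close> in a large cube makes the error small.

  From the groupoid to the action in the countable case: the groupoid is covered by countably many right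
  translation invariant sets, each the disjoint union of the translates of one bisection by the elements of
  \<open>G\<close>. Taking the first set that contains a given arrow yields a locally constant equivariant map from the
  groupoid to \<open>G\<close>, along which densities are pushed forward.\<close>

section \<open>The prefix order of a k-graph\<close>

text \<open>A level read off from \<open>init x \<inter> E\<close> with \<open>E\<close> finite is
  locally constant; the price is that \<open>E\<close> need not be invariant under the arrows.
  Enlarging \<open>E\<close> step by step replaces invariance by interlacing: two interlaced levels
  that exceed fixed degrees by at most \<open>m\<close> can disagree only as often as one of them
  grows. Hence two averages, one over the steps, and one over \<open>n\<close>, because the levels
  at source and range are compared at \<open>deg \<nu> + m\<close> and \<open>deg \<mu> + m\<close>,
  which costs only a boundary layer of a cube.

  In the converse direction countability enters through the order of the naturals: the first family
  containing an arrow is recognized by excluding finitely many earlier ones, which keeps the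
  resulting map to \<open>G\<close> locally constant.

  Amenability is used throughout as one density per compact set and \<open>\<epsilon>\<close>, with
  estimates stated for all finite partial sums.\<close>

lemma enatv_le_iff: "enatv n \<le> enatv m \<longleftrightarrow> n \<le> m"
  by (simp add: le_fun_def)

lemma enatv_mono: "n \<le> m \<Longrightarrow> enatv m \<le> d \<Longrightarrow> enatv n \<le> d"
  using enatv_le_iff order_trans by blast

lemma enatv_sup: "enatv n \<le> d \<Longrightarrow> enatv m \<le> d \<Longrightarrow> enatv (sup n m) \<le> d"
  by (auto simp: le_fun_def sup_fun_def sup_max max_def)

lemma enatv_0 [simp]: "enatv 0 \<le> d"
  by (simp add: le_fun_def zero_enat_def[symmetric])

lemma fun_nat_diff: "(n :: 'k \<Rightarrow> nat) \<le> m \<Longrightarrow> n + (m - n) = m"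
  by (auto simp: le_fun_def fun_eq_iff)

context k_graph
begin

abbreviation (input) cpb where "cpb \<mu> \<nu> \<equiv> \<mu> \<in> Mor \<Lambda> \<and> \<nu> \<in> Mor \<Lambda> \<and> src \<Lambda> \<mu> = rng \<Lambda> \<nu>"

text \<open>By additivity the right factors have equal degrees too, so both pairs are the unique
  factorization of one morphism at one splitting of its degree.\<close>

lemma cmp_inject:
  assumes "cpb \<alpha> \<beta>" "cpb \<alpha>' \<beta>'" "\<alpha> \<cdot> \<beta> = \<alpha>' \<cdot> \<beta>'" "deg \<Lambda> \<alpha> = deg \<Lambda> \<alpha>'"
  shows "\<alpha> = \<alpha>'" "\<beta> = \<beta>'"
proof -
  have d: "deg \<Lambda> (\<alpha> \<cdot> \<beta>) = deg \<Lambda> \<alpha> + deg \<Lambda> \<beta>"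
    using assms deg_cmp by blast
  have "deg \<Lambda> \<alpha> + deg \<Lambda> \<beta>' = deg \<Lambda> \<alpha> + deg \<Lambda> \<beta>"
    using assms deg_cmp by metis
  then have d': "deg \<Lambda> \<beta>' = deg \<Lambda> \<beta>" by simp
  have "\<alpha> \<cdot> \<beta> \<in> Mor \<Lambda>" using assms cmp_closed by blast
  from unique_factorization[OF this d]
  have "(\<alpha>, \<beta>) = (\<alpha>', \<beta>')"
    by (rule ex1E) (use assms d' in \<open>smt (verit) case_prod_conv\<close>)
  then show "\<alpha> = \<alpha>'" "\<beta> = \<beta>'" by auto
qed

lemma cmp_cancel:
  "cpb \<alpha> \<beta> \<Longrightarrow> cpb \<alpha> \<beta>' \<Longrightarrow> \<alpha> \<cdot> \<beta> = \<alpha> \<cdot> \<beta>' \<Longrightarrow> \<beta> = \<beta>'"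
  using cmp_inject by blast

lemma factor_obtain:
  assumes "\<mu> \<in> Mor \<Lambda>" "n \<le> deg \<Lambda> \<mu>"
  obtains \<alpha> \<beta> where "cpb \<alpha> \<beta>" "deg \<Lambda> \<alpha> = n" "deg \<Lambda> \<beta> = deg \<Lambda> \<mu> - n" "\<mu> = \<alpha> \<cdot> \<beta>"
proof -
  have "deg \<Lambda> \<mu> = n + (deg \<Lambda> \<mu> - n)" using fun_nat_diff[OF assms(2)] by simp
  from ex1_implies_ex[OF unique_factorization[OF assms(1) this]] obtain x where
    x: "case x of (\<alpha>, \<beta>) \<Rightarrow> cpb \<alpha> \<beta> \<and> deg \<Lambda> \<alpha> = n \<and> deg \<Lambda> \<beta> = deg \<Lambda> \<mu> - n \<and> \<mu> = \<alpha> \<cdot> \<beta>"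
    by auto
  show ?thesis by (rule that[of "fst x" "snd x"]) (use x in \<open>auto simp: case_prod_unfold\<close>)
qed

lemma deg_src [simp]: "\<mu> \<in> Mor \<Lambda> \<Longrightarrow> deg \<Lambda> (src \<Lambda> \<mu>) = 0"
  using deg_cmp[of \<mu> "src \<Lambda> \<mu>"] by (simp add: src_closed rng_src cmp_src_id)

lemma deg_rng [simp]: "\<mu> \<in> Mor \<Lambda> \<Longrightarrow> deg \<Lambda> (rng \<Lambda> \<mu>) = 0"
  using deg_cmp[of "rng \<Lambda> \<mu>" \<mu>] by (simp add: rng_closed src_rng rng_cmp_id)

lemma src_vertex: "\<mu> \<in> Mor \<Lambda> \<Longrightarrow> src \<Lambda> \<mu> \<in> vertices \<Lambda>"
  by (simp add: level_def src_closed)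

lemma rng_vertex: "\<mu> \<in> Mor \<Lambda> \<Longrightarrow> rng \<Lambda> \<mu> \<in> vertices \<Lambda>"
  by (simp add: level_def rng_closed)

text \<open>\<open>rng \<Lambda> v \<cdot> v\<close> and \<open>v \<cdot> src \<Lambda> v\<close>
  both factor \<open>v\<close> into two morphisms of degree 0, so they coincide factor by
  factor.\<close>

lemma vertexD:
  assumes "v \<in> vertices \<Lambda>"
  shows "v \<in> Mor \<Lambda>" "rng \<Lambda> v = v" "src \<Lambda> v = v" "deg \<Lambda> v = 0"
proof -
  show v: "v \<in> Mor \<Lambda>" and d: "deg \<Lambda> v = 0" using assms by (auto simp: level_def)
  show r: "rng \<Lambda> v = v"
    by (rule cmp_inject(1)[of "rng \<Lambda> v" v v "src \<Lambda> v"])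
      (simp_all add: v d src_rng rng_src rng_closed src_closed rng_cmp_id cmp_src_id)
  then show "src \<Lambda> v = v" using src_rng[OF v] by simp
qed

lemma deg_0D: "\<mu> \<in> Mor \<Lambda> \<Longrightarrow> deg \<Lambda> \<mu> = 0 \<Longrightarrow> \<mu> \<in> vertices \<Lambda>"
  by (simp add: level_def)

definition pre :: "'a \<Rightarrow> 'a \<Rightarrow> bool" where
  "pre \<zeta> \<mu> \<longleftrightarrow> (\<exists>\<kappa>. cpb \<zeta> \<kappa> \<and> \<mu> = \<zeta> \<cdot> \<kappa>)"

lemma pre_cmp: "cpb \<zeta> \<kappa> \<Longrightarrow> pre \<zeta> (\<zeta> \<cdot> \<kappa>)"
  by (auto simp: pre_def)

lemma pre_Mor: "pre \<zeta> \<mu> \<Longrightarrow> \<zeta> \<in> Mor \<Lambda>" "pre \<zeta> \<mu> \<Longrightarrow> \<mu> \<in> Mor \<Lambda>"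
  by (auto simp: pre_def cmp_closed)

lemma pre_rng: "pre \<zeta> \<mu> \<Longrightarrow> rng \<Lambda> \<mu> = rng \<Lambda> \<zeta>"
  by (auto simp: pre_def rng_cmp)

lemma pre_deg: "pre \<zeta> \<mu> \<Longrightarrow> deg \<Lambda> \<zeta> \<le> deg \<Lambda> \<mu>"
  by (auto simp: pre_def deg_cmp le_fun_def)

lemma pre_refl: "\<mu> \<in> Mor \<Lambda> \<Longrightarrow> pre \<mu> \<mu>"
  unfolding pre_def by (intro exI[of _ "src \<Lambda> \<mu>"]) (simp add: src_closed rng_src cmp_src_id)

lemma pre_vertex: "\<mu> \<in> Mor \<Lambda> \<Longrightarrow> pre (rng \<Lambda> \<mu>) \<mu>"
  unfolding pre_def by (intro exI[of _ \<mu>]) (simp add: rng_closed src_rng rng_cmp_id)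

lemma pre_trans: 
  assumes "pre \<zeta> \<mu>" "pre \<mu> \<nu>" shows "pre \<zeta> \<nu>"
proof -
  obtain a b where a: "cpb \<zeta> a" "\<mu> = \<zeta> \<cdot> a" and b: "cpb \<mu> b" "\<nu> = \<mu> \<cdot> b"
    using assms by (auto simp: pre_def)
  then have "src \<Lambda> a = rng \<Lambda> b" by (simp add: src_cmp)
  then show ?thesis unfolding pre_def using a b
    by (intro exI[of _ "a \<cdot> b"]) (simp add: cmp_closed cmp_assoc rng_cmp)
qed

lemma pre_left:
  assumes "cpb \<mu> \<zeta>" "pre \<zeta> \<nu>"
  shows "pre (\<mu> \<cdot> \<zeta>) (\<mu> \<cdot> \<nu>)"
proof -
  obtain \<kappa> where k: "cpb \<zeta> \<kappa>" "\<nu> = \<zeta> \<cdot> \<kappa>" using assms by (auto simp: pre_def)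
  then show ?thesis using assms pre_cmp[of "\<mu> \<cdot> \<zeta>" \<kappa>]
    by (simp add: cmp_closed src_cmp cmp_assoc)
qed

lemma pre_left_cancel:
  assumes "cpb \<mu> \<zeta>" "cpb \<mu> \<nu>" "pre (\<mu> \<cdot> \<zeta>) (\<mu> \<cdot> \<nu>)"
  shows "pre \<zeta> \<nu>"
proof -
  obtain \<kappa> where k: "cpb (\<mu> \<cdot> \<zeta>) \<kappa>" "\<mu> \<cdot> \<nu> = (\<mu> \<cdot> \<zeta>) \<cdot> \<kappa>" using assms(3) by (auto simp: pre_def)
  then have c: "cpb \<zeta> \<kappa>" using assms by (simp add: src_cmp)
  have "\<mu> \<cdot> \<nu> = \<mu> \<cdot> (\<zeta> \<cdot> \<kappa>)" using cmp_assoc c assms(1) k(2) by metis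
  moreover have "cpb \<mu> (\<zeta> \<cdot> \<kappa>)" using c assms(1) cmp_closed rng_cmp by simp
  ultimately have "\<nu> = \<zeta> \<cdot> \<kappa>"
    using cmp_cancel assms(2) by blast
  with c show ?thesis by (auto simp: pre_def)
qed

text \<open>Below a fixed \<open>\<omega>\<close> the prefix order is the order of degrees: cutting
  \<open>\<mu>\<close> at the degree of \<open>\<zeta>\<close> gives a second prefix of
  \<open>\<omega>\<close> of that degree, which must be \<open>\<zeta>\<close>.\<close>

lemma pre_linear:
  assumes "pre \<zeta> \<omega>" "pre \<mu> \<omega>" "deg \<Lambda> \<zeta> \<le> deg \<Lambda> \<mu>"
  shows "pre \<zeta> \<mu>"
proof -
  obtain a where a: "cpb \<mu> a" "\<omega> = \<mu> \<cdot> a" using assms by (auto simp: pre_def)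
  obtain b where b: "cpb \<zeta> b" "\<omega> = \<zeta> \<cdot> b" using assms by (auto simp: pre_def)
  obtain \<alpha> \<beta> where f: "cpb \<alpha> \<beta>" "deg \<Lambda> \<alpha> = deg \<Lambda> \<zeta>" "\<mu> = \<alpha> \<cdot> \<beta>"
    using factor_obtain[of \<mu> "deg \<Lambda> \<zeta>"] a assms(3) by metis
  have s: "src \<Lambda> \<beta> = rng \<Lambda> a" using f a by (simp add: src_cmp)
  have "\<alpha> \<cdot> (\<beta> \<cdot> a) = \<zeta> \<cdot> b" using a b f s by (simp add: cmp_assoc)
  then have "\<alpha> = \<zeta>" using cmp_inject(1)[of \<alpha> "\<beta> \<cdot> a" \<zeta> b] a b f s by (simp add: cmp_closed rng_cmp)
  with f show ?thesis by (auto simp: pre_def)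
qed

lemma pre_deg_eq: "pre \<zeta> \<omega> \<Longrightarrow> pre \<mu> \<omega> \<Longrightarrow> deg \<Lambda> \<zeta> = deg \<Lambda> \<mu> \<Longrightarrow> \<zeta> = \<mu>"
  unfolding pre_def using cmp_inject(1) by metis

lemma pre_same_deg: "pre \<zeta> \<mu> \<Longrightarrow> deg \<Lambda> \<zeta> = deg \<Lambda> \<mu> \<Longrightarrow> \<zeta> = \<mu>"
  using pre_deg_eq pre_refl pre_Mor by blast

lemma pre_obtain:
  assumes "\<mu> \<in> Mor \<Lambda>" "n \<le> deg \<Lambda> \<mu>"
  obtains \<zeta> where "pre \<zeta> \<mu>" "deg \<Lambda> \<zeta> = n"
  using factor_obtain[OF assms] pre_cmp by metis

text \<open>The prefix of \<open>\<omega>\<close> whose degree is the join does it. Thus every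
  common extension contains a minimal one.\<close>

lemma pre_join:
  assumes "pre \<zeta> \<omega>" "pre \<mu> \<omega>"
  obtains \<kappa> where "pre \<zeta> \<kappa>" "pre \<mu> \<kappa>" "pre \<kappa> \<omega>" "deg \<Lambda> \<kappa> = sup (deg \<Lambda> \<zeta>) (deg \<Lambda> \<mu>)"
proof -
  have "sup (deg \<Lambda> \<zeta>) (deg \<Lambda> \<mu>) \<le> deg \<Lambda> \<omega>" using assms by (intro sup_least pre_deg)
  then obtain \<kappa> where "pre \<kappa> \<omega>" "deg \<Lambda> \<kappa> = sup (deg \<Lambda> \<zeta>) (deg \<Lambda> \<mu>)"
    by (rule pre_obtain[OF pre_Mor(2)[OF assms(1)]])
  moreover from this have "pre \<zeta> \<kappa>" "pre \<mu> \<kappa>"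
    by (auto intro!: pre_linear[OF assms(1)] pre_linear[OF assms(2)])
  ultimately show ?thesis using that by blast
qed

text \<open>Minimal common extensions. They carry the same information as \<open>Lmin\<close>, with
  the products recorded instead of the pairs of cofactors; finite alignment makes these sets
  finite.\<close>

definition mce :: "'a \<Rightarrow> 'a \<Rightarrow> 'a set" where
  "mce \<zeta> \<mu> = {\<kappa>. pre \<zeta> \<kappa> \<and> pre \<mu> \<kappa> \<and> deg \<Lambda> \<kappa> = sup (deg \<Lambda> \<zeta>) (deg \<Lambda> \<mu>)}"

lemma Lmin_iff:
  "(\<alpha>, \<beta>) \<in> Lmin \<Lambda> \<mu> \<nu> \<and> \<mu> \<in> Mor \<Lambda> \<and> \<nu> \<in> Mor \<Lambda> \<longleftrightarrow>
     cpb \<mu> \<alpha> \<and> cpb \<nu> \<beta> \<and> \<mu> \<cdot> \<alpha> = \<nu> \<cdot> \<beta> \<and> \<mu> \<cdot> \<alpha> \<in> mce \<mu> \<nu>"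
proof -
  have "pre \<mu> (\<mu> \<cdot> \<alpha>) \<and> pre \<nu> (\<mu> \<cdot> \<alpha>)" if "cpb \<mu> \<alpha>" "cpb \<nu> \<beta>" "\<mu> \<cdot> \<alpha> = \<nu> \<cdot> \<beta>"
    using that pre_cmp[of \<mu> \<alpha>] pre_cmp[of \<nu> \<beta>] by simp
  then show ?thesis unfolding Lmin_def mce_def by blast
qed

lemma mce_subset_Lmin: "\<mu> \<in> Mor \<Lambda> \<Longrightarrow> \<nu> \<in> Mor \<Lambda> \<Longrightarrow> mce \<mu> \<nu> \<subseteq> (\<lambda>(\<alpha>, \<beta>). \<mu> \<cdot> \<alpha>) ` Lmin \<Lambda> \<mu> \<nu>"
proof
  fix \<kappa> assume m: "\<mu> \<in> Mor \<Lambda>" "\<nu> \<in> Mor \<Lambda>" "\<kappa> \<in> mce \<mu> \<nu>"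
  then obtain \<alpha> \<beta> where "cpb \<mu> \<alpha>" "\<kappa> = \<mu> \<cdot> \<alpha>" "cpb \<nu> \<beta>" "\<kappa> = \<nu> \<cdot> \<beta>"
    by (auto simp: mce_def pre_def)
  then have "(\<alpha>, \<beta>) \<in> Lmin \<Lambda> \<mu> \<nu>" using m Lmin_iff by metis
  then show "\<kappa> \<in> (\<lambda>(\<alpha>, \<beta>). \<mu> \<cdot> \<alpha>) ` Lmin \<Lambda> \<mu> \<nu>" using \<open>\<kappa> = \<mu> \<cdot> \<alpha>\<close> by force
qed

text \<open>A common extension of any degree can be cut down to a minimal one, so exhaustiveness is
  a matter of compatibility in the prefix order.\<close>

lemma Lmin_nonempty_iff:
  assumes "\<mu> \<in> Mor \<Lambda>" "\<nu> \<in> Mor \<Lambda>"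
  shows "Lmin \<Lambda> \<mu> \<nu> \<noteq> {} \<longleftrightarrow> (\<exists>\<omega>. pre \<mu> \<omega> \<and> pre \<nu> \<omega>)"
proof
  assume "Lmin \<Lambda> \<mu> \<nu> \<noteq> {}"
  then obtain \<alpha> \<beta> where "(\<alpha>, \<beta>) \<in> Lmin \<Lambda> \<mu> \<nu>" by auto
  then show "\<exists>\<omega>. pre \<mu> \<omega> \<and> pre \<nu> \<omega>" using assms Lmin_iff[of \<alpha> \<beta> \<mu> \<nu>] by (auto simp: mce_def)
next
  assume "\<exists>\<omega>. pre \<mu> \<omega> \<and> pre \<nu> \<omega>"
  then have "mce \<mu> \<nu> \<noteq> {}" using pre_join[of \<mu> _ \<nu>] unfolding mce_def by blast
  then show "Lmin \<Lambda> \<mu> \<nu> \<noteq> {}" using mce_subset_Lmin[OF assms] by auto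
qed

end

locale fa_kgraph = k_graph \<Lambda> for \<Lambda> :: "('a, 'k::finite) kgraph" (structure) +
  assumes fa: "finitely_aligned \<Lambda>"
begin

lemma finite_mce: "finite (mce \<mu> \<nu>)"
proof (cases "\<mu> \<in> Mor \<Lambda> \<and> \<nu> \<in> Mor \<Lambda>")
  case True
  then show ?thesis using fa mce_subset_Lmin[of \<mu> \<nu>]
    by (meson finitely_aligned_def finite_imageI finite_subset)
next
  case False
  then have "mce \<mu> \<nu> = {}" by (auto simp: mce_def dest: pre_Mor)
  then show ?thesis by simp
qed

end

section \<open>Paths as filters of morphisms\<close>

text \<open>This set determines the path (\<open>paths_eqI\<close>), and under finite alignment with
  finite rank the filters of the prefix order are exactly the sets that occur
  (\<open>filt_path\<close>).\<close>

definition init :: "('a, 'k) path \<Rightarrow> 'a set" where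
  "init x = {seg x 0 n | n. enatv n \<le> pdeg x}"

lemma zero_le_fun: "(0 :: 'z \<Rightarrow> nat) \<le> n"
  by (simp add: le_fun_def)

context k_graph
begin

lemma paths_iff:
  "(m, x) \<in> paths \<Lambda> \<longleftrightarrow> x \<in> extensional {(p, q). p \<le> q \<and> enatv q \<le> m} \<and>
     (\<forall>p q. p \<le> q \<longrightarrow> enatv q \<le> m \<longrightarrow> x (p, q) \<in> Mor \<Lambda> \<and> x (p, p) = rng \<Lambda> (x (p, q))
        \<and> x (q, q) = src \<Lambda> (x (p, q)) \<and> deg \<Lambda> (x (p, q)) = q - p) \<and>
     (\<forall>p q r. p \<le> q \<longrightarrow> q \<le> r \<longrightarrow> enatv r \<le> m \<longrightarrow> x (p, r) = x (p, q) \<cdot> x (q, r))"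
  (is "_ \<longleftrightarrow> ?R")
proof
  assume "(m, x) \<in> paths \<Lambda>"
  then have f: "kgraph_functor (Omega m) \<Lambda> x" by (simp add: paths_def)
  have 1: "x (p, q) \<in> Mor \<Lambda> \<and> x (p, p) = rng \<Lambda> (x (p, q))
        \<and> x (q, q) = src \<Lambda> (x (p, q)) \<and> deg \<Lambda> (x (p, q)) = q - p" if "p \<le> q" "enatv q \<le> m" for p q
  proof -
    have "(p, q) \<in> Mor (Omega m)" using that by (simp add: Omega_def)
    then have "x (p, q) \<in> Mor \<Lambda>" "x (rng (Omega m) (p, q)) = rng \<Lambda> (x (p, q))"
      "x (src (Omega m) (p, q)) = src \<Lambda> (x (p, q))" "deg \<Lambda> (x (p, q)) = deg (Omega m) (p, q)"
      using f unfolding kgraph_functor_def by blast+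
    then show ?thesis by (simp add: Omega_def)
  qed
  have 2: "x (p, r) = x (p, q) \<cdot> x (q, r)" if "p \<le> q" "q \<le> r" "enatv r \<le> m" for p q r
  proof -
    have "(p, q) \<in> Mor (Omega m)" "(q, r) \<in> Mor (Omega m)"
      using that enatv_mono by (auto simp: Omega_def)
    moreover have "src (Omega m) (p, q) = rng (Omega m) (q, r)" by (simp add: Omega_def)
    ultimately have "x (cmp (Omega m) (p, q) (q, r)) = x (p, q) \<cdot> x (q, r)"
      using f unfolding kgraph_functor_def by blast
    then show ?thesis by (simp add: Omega_def)
  qed
  have "x \<in> Mor (Omega m) \<rightarrow>\<^sub>E Mor \<Lambda>" using f unfolding kgraph_functor_def by (rule conjunct1)
  then have "x \<in> extensional {(p, q). p \<le> q \<and> enatv q \<le> m}"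
    by (simp add: PiE_def Omega_def)
  then show ?R by (intro conjI allI impI; (intro 1[THEN conjunct1] 1[THEN conjunct2, THEN conjunct1] 
     1[THEN conjunct2, THEN conjunct2, THEN conjunct1] 1[THEN conjunct2, THEN conjunct2, THEN conjunct2] 2)?)
next
  assume ?R
  then show "(m, x) \<in> paths \<Lambda>"
    unfolding paths_def kgraph_functor_def PiE_def by (auto simp: Omega_def)
qed

lemma
  assumes "x \<in> paths \<Lambda>" "p \<le> q" "enatv q \<le> pdeg x"
  shows seg_Mor: "seg x p q \<in> Mor \<Lambda>"
    and seg_rng: "rng \<Lambda> (seg x p q) = seg x p p"
    and seg_src: "src \<Lambda> (seg x p q) = seg x q q"
    and seg_deg: "deg \<Lambda> (seg x p q) = q - p"
proof -
  have "(pdeg x, snd x) \<in> paths \<Lambda>" using assms by simp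
  note * = this[unfolded paths_iff, THEN conjunct2, THEN conjunct1, rule_format, OF assms(2,3)]
  show "seg x p q \<in> Mor \<Lambda>" using * by (rule conjunct1)
  show "rng \<Lambda> (seg x p q) = seg x p p" by (rule sym) (use * in \<open>elim conjE\<close>)
  show "src \<Lambda> (seg x p q) = seg x q q" by (rule sym) (use * in \<open>elim conjE\<close>)
  show "deg \<Lambda> (seg x p q) = q - p" using * by (elim conjE)
qed

lemma seg_cmp:
  assumes "x \<in> paths \<Lambda>" "p \<le> q" "q \<le> r" "enatv r \<le> pdeg x"
  shows "seg x p r = seg x p q \<cdot> seg x q r"
proof -
  have "(pdeg x, snd x) \<in> paths \<Lambda>" using assms by simp
  from this[unfolded paths_iff, THEN conjunct2, THEN conjunct2, rule_format, OF assms(2-4)] show ?thesis .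
qed

lemma seg_cpb:
  assumes "x \<in> paths \<Lambda>" "p \<le> q" "q \<le> r" "enatv r \<le> pdeg x"
  shows "cpb (seg x p q) (seg x q r)"
proof -
  have q: "enatv q \<le> pdeg x" using assms enatv_mono by blast
  show ?thesis
    using seg_Mor[OF assms(1,2) q] seg_Mor[OF assms(1,3,4)] seg_src[OF assms(1,2) q] seg_rng[OF assms(1,3,4)]
    by simp
qed

lemma seg_pre:
  assumes "x \<in> paths \<Lambda>" "p \<le> q" "q \<le> r" "enatv r \<le> pdeg x"
  shows "pre (seg x p q) (seg x p r)"
  using pre_cmp[OF seg_cpb[OF assms]] seg_cmp[OF assms] by simp

lemma seg0_deg: "x \<in> paths \<Lambda> \<Longrightarrow> enatv n \<le> pdeg x \<Longrightarrow> deg \<Lambda> (seg x 0 n) = n"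
  using seg_deg[of x 0 n] zero_le_fun by simp

lemma init_Mor: "x \<in> paths \<Lambda> \<Longrightarrow> \<mu> \<in> init x \<Longrightarrow> \<mu> \<in> Mor \<Lambda>"
  using seg_Mor[OF _ zero_le_fun, of x] unfolding init_def by blast

lemma init_seg: "enatv n \<le> pdeg x \<Longrightarrow> seg x 0 n \<in> init x"
  by (auto simp: init_def)

lemma init_deg:
  assumes "x \<in> paths \<Lambda>" "\<mu> \<in> init x"
  shows "enatv (deg \<Lambda> \<mu>) \<le> pdeg x" "seg x 0 (deg \<Lambda> \<mu>) = \<mu>"
  using assms(2) seg0_deg[OF assms(1)] unfolding init_def by force+

lemma init_iff: "x \<in> paths \<Lambda> \<Longrightarrow> \<mu> \<in> init x \<longleftrightarrow> enatv (deg \<Lambda> \<mu>) \<le> pdeg x \<and> seg x 0 (deg \<Lambda> \<mu>) = \<mu>"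
  using init_deg init_seg by metis

lemma init_rng: "x \<in> paths \<Lambda> \<Longrightarrow> \<mu> \<in> init x \<Longrightarrow> rng \<Lambda> \<mu> = prng x"
  using seg_rng[OF _ zero_le_fun, of x] unfolding init_def by blast

lemma prng_init: "x \<in> paths \<Lambda> \<Longrightarrow> prng x \<in> init x"
  by (rule init_seg) (rule enatv_0)

lemma init_src: "x \<in> paths \<Lambda> \<Longrightarrow> \<mu> \<in> init x \<Longrightarrow> src \<Lambda> \<mu> = seg x (deg \<Lambda> \<mu>) (deg \<Lambda> \<mu>)"
  using init_deg[of x \<mu>] seg_src[of x 0 "deg \<Lambda> \<mu>"] zero_le_fun by metis

definition filt :: "'a set \<Rightarrow> bool" where
  "filt S \<longleftrightarrow> S \<subseteq> Mor \<Lambda> \<and> S \<noteq> {} \<and> (\<forall>\<mu> \<nu>. pre \<mu> \<nu> \<longrightarrow> \<nu> \<in> S \<longrightarrow> \<mu> \<in> S)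
     \<and> (\<forall>\<mu>\<in>S. \<forall>\<nu>\<in>S. \<exists>\<omega>\<in>S. pre \<mu> \<omega> \<and> pre \<nu> \<omega>)"

lemma init_hered:
  assumes "x \<in> paths \<Lambda>" "\<nu> \<in> init x" "pre \<mu> \<nu>"
  shows "\<mu> \<in> init x"
proof -
  have *: "deg \<Lambda> \<mu> \<le> deg \<Lambda> \<nu>" "enatv (deg \<Lambda> \<nu>) \<le> pdeg x" "seg x 0 (deg \<Lambda> \<nu>) = \<nu>"
    using assms pre_deg init_deg by auto
  then have le: "enatv (deg \<Lambda> \<mu>) \<le> pdeg x" using enatv_mono by blast
  have "pre (seg x 0 (deg \<Lambda> \<mu>)) \<nu>" using seg_pre[OF assms(1) zero_le_fun *(1,2)] * by simp
  then have "seg x 0 (deg \<Lambda> \<mu>) = \<mu>"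
    using pre_deg_eq[OF _ assms(3)] seg0_deg[OF assms(1) le] by simp
  then show ?thesis using init_seg[OF le] by simp
qed

lemma init_directed:
  assumes "x \<in> paths \<Lambda>" "\<mu> \<in> init x" "\<nu> \<in> init x"
  obtains \<omega> where "\<omega> \<in> init x" "\<omega> \<in> mce \<mu> \<nu>"
proof -
  let ?n = "sup (deg \<Lambda> \<mu>) (deg \<Lambda> \<nu>)"
  have *: "enatv ?n \<le> pdeg x" using init_deg[OF assms(1)] assms enatv_sup by blast
  have "pre \<mu> (seg x 0 ?n)" "pre \<nu> (seg x 0 ?n)"
    using seg_pre[OF assms(1) zero_le_fun sup_ge1 *] seg_pre[OF assms(1) zero_le_fun sup_ge2 *]
      init_deg(2)[OF assms(1,2)] init_deg(2)[OF assms(1,3)] by metis+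
  then have "seg x 0 ?n \<in> mce \<mu> \<nu>" using seg0_deg[OF assms(1) *] unfolding mce_def by blast
  then show ?thesis using that[OF init_seg[OF *]] by blast
qed

lemma filt_init: "x \<in> paths \<Lambda> \<Longrightarrow> filt (init x)"
  unfolding filt_def
proof (intro conjI allI impI ballI)
  assume x: "x \<in> paths \<Lambda>"
  show "init x \<subseteq> Mor \<Lambda>" using init_Mor[OF x] by auto
  show "init x \<noteq> {}" using prng_init[OF x] by auto
  fix \<mu> \<nu>
  show "\<mu> \<in> init x" if "pre \<mu> \<nu>" "\<nu> \<in> init x" using init_hered[OF x that(2,1)] .
  show "\<exists>\<omega>\<in>init x. pre \<mu> \<omega> \<and> pre \<nu> \<omega>" if "\<mu> \<in> init x" "\<nu> \<in> init x"
    using init_directed[OF x that] by (auto simp: mce_def)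
qed

lemma init_linear:
  assumes "x \<in> paths \<Lambda>" "\<mu> \<in> init x" "\<nu> \<in> init x" "deg \<Lambda> \<mu> \<le> deg \<Lambda> \<nu>"
  shows "pre \<mu> \<nu>"
  using init_directed[OF assms(1-3)] assms(4) pre_linear by (auto simp: mce_def)

lemma init_deg_eq:
  "x \<in> paths \<Lambda> \<Longrightarrow> \<mu> \<in> init x \<Longrightarrow> \<nu> \<in> init x \<Longrightarrow> deg \<Lambda> \<mu> = deg \<Lambda> \<nu> \<Longrightarrow> \<mu> = \<nu>"
  using init_deg(2) by metis

text \<open>The degree is recovered coordinatewise from the degrees of the initial segments, and the
  segment from \<open>p\<close> to \<open>q\<close> by left cancellation from the initial segments
  of degrees \<open>p\<close> and \<open>q\<close>.\<close>

lemma paths_eqI: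
  assumes x: "x \<in> paths \<Lambda>" and y: "y \<in> paths \<Lambda>" and eq: "init x = init y"
  shows "x = y"
proof -
  have le: "pdeg x i \<le> pdeg y i" if x: "x \<in> paths \<Lambda>" and y: "y \<in> paths \<Lambda>" and eq: "init x = init y"
    for x y and i
  proof (rule ccontr)
    assume "\<not> pdeg x i \<le> pdeg y i"
    then have lt: "pdeg y i < pdeg x i" by simp
    then obtain k where k: "pdeg y i = enat k" by (cases "pdeg y i") auto
    \<comment> \<open>Supported in coordinate \<open>i\<close> alone, one above the finite value of
      \<open>pdeg y\<close> there: still below \<open>pdeg x\<close>, no longer below
      \<open>pdeg y\<close>.\<close>
    define n where "n = (\<lambda>j. if j = i then Suc k else 0)"
    have n: "enatv n \<le> pdeg x" using lt k by (auto simp: n_def le_fun_def Suc_ile_eq zero_enat_def[symmetric])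
    have "seg x 0 n \<in> init y" using init_seg[OF n] eq by simp
    then have "enatv n \<le> pdeg y" using init_deg[OF y] seg0_deg[OF x n] by metis
    then have "enat (Suc k) \<le> enat k" using k by (auto simp: n_def le_fun_def dest: spec[of _ i])
    then show False by simp
  qed
  have d: "pdeg x = pdeg y" using le[OF x y eq] le[OF y x eq[symmetric]] by (auto simp: fun_eq_iff intro: antisym)
  have s0: "seg x 0 n = seg y 0 n" if "enatv n \<le> pdeg x" for n
    using init_deg[OF y, of "seg x 0 n"] init_seg[OF that] eq seg0_deg[OF x that] by simp
  have s: "seg x p q = seg y p q" if "p \<le> q" "enatv q \<le> pdeg x" for p q
  proof (rule cmp_cancel[of "seg x 0 p"])
    show "cpb (seg x 0 p) (seg x p q)" by (rule seg_cpb[OF x zero_le_fun that])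
    have p: "enatv p \<le> pdeg x" using that enatv_mono by blast
    show "cpb (seg x 0 p) (seg y p q)" using seg_cpb[OF y zero_le_fun that(1)] s0[OF p] that(2) d by simp
    show "seg x 0 p \<cdot> seg x p q = seg x 0 p \<cdot> seg y p q"
      using seg_cmp[OF x zero_le_fun that] seg_cmp[OF y zero_le_fun that(1)] s0[OF p] s0[OF that(2)] that(2) d by simp
  qed
  have "snd x = snd y"
  proof (rule extensionalityI)
    have "(pdeg x, snd x) \<in> paths \<Lambda>" "(pdeg y, snd y) \<in> paths \<Lambda>" using x y by simp_all
    from this[unfolded paths_iff] show "snd x \<in> extensional {(p, q). p \<le> q \<and> enatv q \<le> pdeg x}"
      "snd y \<in> extensional {(p, q). p \<le> q \<and> enatv q \<le> pdeg x}" unfolding d by blast+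
  qed (use s in auto)
  with d show ?thesis by (simp add: prod_eq_iff)
qed

lemma filt_ub:
  assumes "filt S" "finite A" "A \<subseteq> S"
  obtains \<omega> where "\<omega> \<in> S" "\<And>\<mu>. \<mu> \<in> A \<Longrightarrow> pre \<mu> \<omega>"
proof -
  have "\<exists>\<omega>\<in>S. \<forall>\<mu>\<in>A. pre \<mu> \<omega>" using assms(2,3)
  proof induction
    case empty
    then show ?case using assms(1) by (auto simp: filt_def)
  next
    case (insert a A)
    then obtain \<omega> where "\<omega> \<in> S" "\<forall>\<mu>\<in>A. pre \<mu> \<omega>" by auto
    moreover then obtain \<omega>' where "\<omega>' \<in> S" "pre a \<omega>'" "pre \<omega> \<omega>'"
      using assms(1) insert.prems unfolding filt_def by (meson insert_subset)
    ultimately show ?case using pre_trans by (intro bexI[of _ \<omega>']) auto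
  qed
  then show ?thesis using that by auto
qed

lemma filt_deg_eq:
  "filt S \<Longrightarrow> \<mu> \<in> S \<Longrightarrow> \<nu> \<in> S \<Longrightarrow> deg \<Lambda> \<mu> = deg \<Lambda> \<nu> \<Longrightarrow> \<mu> = \<nu>"
  unfolding filt_def using pre_deg_eq by meson

end

section \<open>Every filter of morphisms comes from a path\<close>

context fa_kgraph
begin

definition filt_deg :: "'a set \<Rightarrow> 'k \<Rightarrow> enat" where
  "filt_deg S i = (SUP \<mu>\<in>S. enat (deg \<Lambda> \<mu> i))"

text \<open>A supremum of naturals that is at least \<open>n i\<close> is reached by some member of
  \<open>S\<close>. There are finitely many coordinates, so one member dominates all these choices
  by directedness, and its prefix of degree \<open>n\<close> is again in \<open>S\<close>.\<close>

lemma filt_deg_iff: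
  assumes "filt S"
  shows "enatv n \<le> filt_deg S \<longleftrightarrow> (\<exists>\<mu>\<in>S. deg \<Lambda> \<mu> = n)"
proof
  assume n: "enatv n \<le> filt_deg S"
  have "\<exists>\<mu>\<in>S. n i \<le> deg \<Lambda> \<mu> i" for i
  proof (rule ccontr)
    assume "\<not> ?thesis"
    then have lt: "\<And>\<mu>. \<mu> \<in> S \<Longrightarrow> deg \<Lambda> \<mu> i < n i" by (auto simp: not_le)
    then have "filt_deg S i \<le> enat (n i - 1)" unfolding filt_deg_def
      by (intro SUP_least) force
    moreover have "enat (n i) \<le> filt_deg S i" using n by (auto simp: le_fun_def)
    moreover have "n i > 0" using lt assms unfolding filt_def by fastforce
    ultimately have "enat (n i) \<le> enat (n i - 1)" by (meson order_trans)
    then show False using \<open>n i > 0\<close> by simp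
  qed
  then obtain f where f: "\<And>i. f i \<in> S" "\<And>i. n i \<le> deg \<Lambda> (f i) i" by metis
  obtain \<omega> where w: "\<omega> \<in> S" "\<And>\<mu>. \<mu> \<in> range f \<Longrightarrow> pre \<mu> \<omega>"
    using filt_ub[OF assms, of "range f"] f by auto
  have "n \<le> deg \<Lambda> \<omega>"
    unfolding le_fun_def using f(2) w(2)[THEN pre_deg] by (meson le_funD order_trans rangeI)
  then show "\<exists>\<mu>\<in>S. deg \<Lambda> \<mu> = n" using pre_obtain w(1) assms unfolding filt_def by (metis subsetD)
next
  assume "\<exists>\<mu>\<in>S. deg \<Lambda> \<mu> = n"
  then show "enatv n \<le> filt_deg S" unfolding filt_deg_def le_fun_def by (auto intro: SUP_upper)
qed

text \<open>The member \<open>e q\<close> of degree \<open>q\<close> is unique, and the segment from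
  \<open>p\<close> to \<open>q\<close> has to be the cofactor \<open>t p q\<close> of
  \<open>e p\<close> in \<open>e q\<close>. Functoriality is uniqueness of cofactors, that is, left
  cancellation.\<close>

lemma filt_path:
  assumes S: "filt S"
  obtains x where "x \<in> paths \<Lambda>" "init x = S"
proof -
  define m where "m = filt_deg S"
  define e where "e n = (SOME \<mu>. \<mu> \<in> S \<and> deg \<Lambda> \<mu> = n)" for n
  have e: "e n \<in> S" "deg \<Lambda> (e n) = n" "e n \<in> Mor \<Lambda>" if "enatv n \<le> m" for n
    using someI_ex[of "\<lambda>\<mu>. \<mu> \<in> S \<and> deg \<Lambda> \<mu> = n"] filt_deg_iff[OF S, of n] that S
    unfolding e_def m_def filt_def by auto
  have e_eq: "e (deg \<Lambda> \<mu>) = \<mu>" "enatv (deg \<Lambda> \<mu>) \<le> m" if "\<mu> \<in> S" for \<mu>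
  proof -
    show *: "enatv (deg \<Lambda> \<mu>) \<le> m" unfolding m_def using filt_deg_iff[OF S] that by auto
    show "e (deg \<Lambda> \<mu>) = \<mu>" using filt_deg_eq[OF S e(1)[OF *] that e(2)[OF *]] .
  qed
  define t where "t p q = (SOME \<kappa>. cpb (e p) \<kappa> \<and> e q = e p \<cdot> \<kappa>)" for p q
  have t: "cpb (e p) (t p q)" "e q = e p \<cdot> t p q" if pq: "p \<le> q" "enatv q \<le> m" for p q
  proof -
    have p: "enatv p \<le> m" using pq enatv_mono by blast
    obtain \<omega> where w: "pre (e p) \<omega>" "pre (e q) \<omega>" using S e[OF p] e[OF pq(2)] unfolding filt_def by blast
    then have "pre (e p) (e q)" using pre_linear[OF w] e[OF p] e[OF pq(2)] pq by simp
    then show "cpb (e p) (t p q)" "e q = e p \<cdot> t p q"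
      using someI_ex[of "\<lambda>\<kappa>. cpb (e p) \<kappa> \<and> e q = e p \<cdot> \<kappa>"] unfolding pre_def t_def by auto
  qed
  have t_unique: "t p q = \<kappa>" if "p \<le> q" "enatv q \<le> m" "cpb (e p) \<kappa>" "e q = e p \<cdot> \<kappa>" for p q \<kappa>
    using cmp_cancel[of "e p" "t p q" \<kappa>] t[OF that(1,2)] that by simp
  have tid: "t p p = src \<Lambda> (e p)" if "enatv p \<le> m" for p
    using t_unique[of p p "src \<Lambda> (e p)"] that e[OF that] src_closed rng_src cmp_src_id by simp
  define x where "x = (m, restrict (\<lambda>(p, q). t p q) {(p, q). p \<le> q \<and> enatv q \<le> m})"
  have snd_x: "snd x (p, q) = t p q" if "p \<le> q" "enatv q \<le> m" for p q
    using that by (simp add: x_def)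
  have "x \<in> paths \<Lambda>"
    unfolding x_def paths_iff
  proof (intro conjI allI impI)
    fix p q assume pq: "p \<le> q" "enatv q \<le> m"
    then have p: "enatv p \<le> m" using enatv_mono by blast
    let ?x = "restrict (\<lambda>(p, q). t p q) {(p, q). p \<le> q \<and> enatv q \<le> m}"
    have x: "?x (p, q) = t p q" "?x (p, p) = t p p" "?x (q, q) = t q q" using pq p by auto
    show "?x (p, q) \<in> Mor \<Lambda>" unfolding x using t pq by blast
    show "?x (p, p) = rng \<Lambda> (?x (p, q))" unfolding x using t[OF pq] tid[OF p] by simp
    show "?x (q, q) = src \<Lambda> (?x (p, q))" unfolding x using t[OF pq] tid[OF pq(2)] src_cmp by metis
    have "q = p + deg \<Lambda> (t p q)" using t[OF pq] deg_cmp e p pq by metis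
    then show "deg \<Lambda> (?x (p, q)) = q - p" unfolding x by (metis add_diff_cancel_left')
  next
    fix p q r assume pqr: "p \<le> q" "q \<le> r" "enatv r \<le> m"
    let ?x = "restrict (\<lambda>(p, q). t p q) {(p, q). p \<le> q \<and> enatv q \<le> m}"
    have q: "enatv q \<le> m" and pr: "p \<le> r" using pqr enatv_mono by auto
    have x: "?x (p, q) = t p q" "?x (q, r) = t q r" "?x (p, r) = t p r" using pqr q pr by auto
    have 1: "cpb (t p q) (t q r)" using t[OF pqr(1) q] t[OF pqr(2,3)] src_cmp by metis
    have "t p r = t p q \<cdot> t q r"
    proof (rule t_unique[OF pr pqr(3)])
      show "cpb (e p) (t p q \<cdot> t q r)" using t[OF pqr(1) q] 1 cmp_closed rng_cmp by simp
      show "e r = e p \<cdot> (t p q \<cdot> t q r)"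
        using t[OF pqr(1) q] t[OF pqr(2,3)] 1 cmp_assoc by metis
    qed
    then show "?x (p, r) = ?x (p, q) \<cdot> ?x (q, r)" unfolding x .
  qed auto
  moreover have "init x = S"
  proof -
    have s0: "seg x 0 n = e n" if "enatv n \<le> m" for n
    proof -
      have "e 0 \<in> vertices \<Lambda>" using deg_0D[OF e(3)[OF enatv_0] e(2)[OF enatv_0]] .
      then have "e n = t 0 n" using t(1,2)[OF zero_le_fun that] rng_cmp_id vertexD[of "e 0"] by metis
      then show ?thesis using snd_x[OF zero_le_fun that] by simp
    qed
    have "pdeg x = m" by (simp add: x_def)
    then have "init x = (\<lambda>n. seg x 0 n) ` {n. enatv n \<le> m}" unfolding init_def by blast
    also have "\<dots> = e ` {n. enatv n \<le> m}" by (rule image_cong) (use s0 in auto)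
    also have "\<dots> = S" 
    proof (intro equalityI subsetI)
      fix \<mu> assume "\<mu> \<in> S"
      then show "\<mu> \<in> e ` {n. enatv n \<le> m}" using e_eq by (metis (mono_tags) image_eqI mem_Collect_eq)
    qed (use e(1) in auto)
    finally show ?thesis .
  qed
  ultimately show ?thesis using that by blast
qed

end

section \<open>Tails of paths\<close>

lemma shift_le_iff:
  assumes "enatv n \<le> d" shows "enatv q \<le> d - enatv n \<longleftrightarrow> enatv (n + q) \<le> d"
proof -
  have "enat (q i) \<le> d i - enat (n i) \<longleftrightarrow> enat (n i + q i) \<le> d i" for i
    using le_funD[OF assms, of i] by (cases "d i") auto
  then show ?thesis by (simp add: le_fun_def)
qed

lemma pdeg_shift: "pdeg (shift n x) = pdeg x - enatv n"
  by (simp add: shift_def)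

context k_graph
begin

lemma seg_shift:
  assumes "enatv n \<le> pdeg x" "p \<le> q" "enatv (n + q) \<le> pdeg x"
  shows "seg (shift n x) p q = seg x (n + p) (n + q)"
proof -
  have "(p, q) \<in> Mor (Omega (pdeg x - enatv n))"
    using assms shift_le_iff[OF assms(1), of q] by (simp add: Omega_def)
  then show ?thesis by (simp add: shift_def)
qed

lemma shift_paths:
  assumes "x \<in> paths \<Lambda>" "enatv n \<le> pdeg x"
  shows "shift n x \<in> paths \<Lambda>"
proof -
  have *: "shift n x = (pdeg x - enatv n, snd (shift n x))" by (simp add: shift_def)
  note s = seg_shift[OF assms(2)] and le = shift_le_iff[OF assms(2)]
  have "(pdeg x - enatv n, snd (shift n x)) \<in> paths \<Lambda>"
    unfolding paths_iff
  proof (intro conjI allI impI)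
    show "snd (shift n x) \<in> extensional {(p, q). p \<le> q \<and> enatv q \<le> pdeg x - enatv n}"
      by (simp add: shift_def Omega_def)
  next
    fix p q assume p: "p \<le> q" and "enatv q \<le> pdeg x - enatv n"
    then have q: "enatv (n + q) \<le> pdeg x" using le by simp
    have pq: "n + p \<le> n + q" using p by (simp add: le_fun_def)
    have p': "enatv (n + p) \<le> pdeg x" using enatv_mono[OF pq q] .
    note seg = s[OF p q] s[OF order_refl q] s[OF order_refl p']
    show "seg (shift n x) p q \<in> Mor \<Lambda>" "seg (shift n x) p p = rng \<Lambda> (seg (shift n x) p q)"
      "seg (shift n x) q q = src \<Lambda> (seg (shift n x) p q)"
      unfolding seg
      by (rule seg_Mor[OF assms(1) pq q], rule seg_rng[OF assms(1) pq q, symmetric],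
          rule seg_src[OF assms(1) pq q, symmetric])
    show "deg \<Lambda> (seg (shift n x) p q) = q - p"
      unfolding seg seg_deg[OF assms(1) pq q] by (auto simp: fun_eq_iff)
  next
    fix p q r assume p: "p \<le> q" "q \<le> r" and "enatv r \<le> pdeg x - enatv n"
    then have r: "enatv (n + r) \<le> pdeg x" using le by simp
    have pq: "n + p \<le> n + q" "n + q \<le> n + r" "p \<le> r" using p by (auto simp: le_fun_def intro: order_trans)
    have q: "enatv (n + q) \<le> pdeg x" using enatv_mono[OF pq(2) r] .
    show "seg (shift n x) p r = seg (shift n x) p q \<cdot> seg (shift n x) q r"
      unfolding s[OF p(1) q] s[OF p(2) r] s[OF pq(3) r] by (rule seg_cmp[OF assms(1) pq(1,2) r])
  qed
  with * show ?thesis by metis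
qed

abbreviation tail where
  "tail \<mu> \<equiv> shift (deg \<Lambda> \<mu>)"

lemma tail_paths: "x \<in> paths \<Lambda> \<Longrightarrow> \<mu> \<in> init x \<Longrightarrow> tail \<mu> x \<in> paths \<Lambda>"
  using shift_paths init_deg by blast

text \<open>Left cancellation identifies the segments after \<open>\<mu>\<close> with the extensions
  of \<open>\<mu>\<close> along \<open>x\<close>. Later facts on shifts use this dictionary and no
  longer speak of positions.\<close>

lemma tail_init:
  assumes "x \<in> paths \<Lambda>" "\<mu> \<in> init x"
  shows "\<kappa> \<in> init (tail \<mu> x) \<longleftrightarrow> cpb \<mu> \<kappa> \<and> \<mu> \<cdot> \<kappa> \<in> init x"
proof -
  let ?n = "deg \<Lambda> \<mu>"
  have n: "enatv ?n \<le> pdeg x" "seg x 0 ?n = \<mu>" using init_deg[OF assms] .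
  note s = seg_shift[OF n(1) zero_le_fun]
  show ?thesis
  proof
    assume "\<kappa> \<in> init (tail \<mu> x)"
    then obtain q where q: "enatv (?n + q) \<le> pdeg x" and k: "\<kappa> = seg x ?n (?n + q)"
      using s shift_le_iff[OF n(1)] unfolding init_def pdeg_shift by auto
    have le: "?n \<le> ?n + q" by (simp add: le_fun_def)
    have "cpb (seg x 0 ?n) (seg x ?n (?n + q))" by (rule seg_cpb[OF assms(1) zero_le_fun le q])
    then have "cpb \<mu> \<kappa>" by (simp only: n(2) k)
    moreover have "seg x 0 (?n + q) = seg x 0 ?n \<cdot> seg x ?n (?n + q)"
      by (rule seg_cmp[OF assms(1) zero_le_fun le q])
    then have "\<mu> \<cdot> \<kappa> = seg x 0 (?n + q)" by (simp only: n(2) k)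
    moreover have "seg x 0 (?n + q) \<in> init x" by (rule init_seg[OF q])
    ultimately show "cpb \<mu> \<kappa> \<and> \<mu> \<cdot> \<kappa> \<in> init x" by metis
  next
    assume c: "cpb \<mu> \<kappa> \<and> \<mu> \<cdot> \<kappa> \<in> init x"
    then have q: "enatv (?n + deg \<Lambda> \<kappa>) \<le> pdeg x" "seg x 0 (?n + deg \<Lambda> \<kappa>) = \<mu> \<cdot> \<kappa>"
      using init_deg[OF assms(1), of "\<mu> \<cdot> \<kappa>"] deg_cmp[of \<mu> \<kappa>] by auto
    have le: "?n \<le> ?n + deg \<Lambda> \<kappa>" by (simp add: le_fun_def)
    have 1: "cpb (seg x 0 ?n) (seg x ?n (?n + deg \<Lambda> \<kappa>))" by (rule seg_cpb[OF assms(1) zero_le_fun le q(1)])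
    have 2: "seg x 0 (?n + deg \<Lambda> \<kappa>) = seg x 0 ?n \<cdot> seg x ?n (?n + deg \<Lambda> \<kappa>)"
      by (rule seg_cmp[OF assms(1) zero_le_fun le q(1)])
    have "\<kappa> = seg x ?n (?n + deg \<Lambda> \<kappa>)"
      by (rule cmp_cancel[of \<mu>]) (use c 1 2 n(2) q(2) in \<open>simp_all only:\<close>)
    also have "\<dots> = seg (tail \<mu> x) 0 (deg \<Lambda> \<kappa>)" using s[OF q(1)] by simp
    finally show "\<kappa> \<in> init (tail \<mu> x)"
      using init_seg[of "deg \<Lambda> \<kappa>" "tail \<mu> x"] shift_le_iff[OF n(1)] q(1) by (simp add: pdeg_shift)
  qed
qed

lemma tail_prng: "x \<in> paths \<Lambda> \<Longrightarrow> \<mu> \<in> init x \<Longrightarrow> prng (tail \<mu> x) = src \<Lambda> \<mu>"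
  using prng_init[OF tail_paths] tail_init[of x \<mu> "prng (tail \<mu> x)"] prng_vertex(1)[OF tail_paths]
    vertexD(2) by metis

text \<open>The initial segments extending \<open>\<mu>\<close> are cofinal in
  \<open>init x\<close>, and exactly these are recorded by the tail.\<close>

lemma tail_inject:
  assumes "x \<in> paths \<Lambda>" "y \<in> paths \<Lambda>" "\<mu> \<in> init x" "\<mu> \<in> init y" "tail \<mu> x = tail \<mu> y"
  shows "x = y"
proof -
  have "init x \<subseteq> init y" if "x \<in> paths \<Lambda>" "y \<in> paths \<Lambda>" "\<mu> \<in> init x" "\<mu> \<in> init y" "tail \<mu> x = tail \<mu> y"
    for x y
  proof
    note t = that
    fix \<xi> assume "\<xi> \<in> init x"
    then obtain \<omega> where w: "\<omega> \<in> init x" "pre \<xi> \<omega>" "pre \<mu> \<omega>"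
      using init_directed[OF t(1) _ t(3)] unfolding mce_def by blast
    then obtain \<kappa> where k: "cpb \<mu> \<kappa>" "\<omega> = \<mu> \<cdot> \<kappa>" unfolding pre_def by auto
    then have "\<kappa> \<in> init (tail \<mu> y)" using tail_init[OF t(1,3)] t(5) w by simp
    then have "\<omega> \<in> init y" using tail_init[OF t(2,4)] k by simp
    then show "\<xi> \<in> init y" using init_hered[OF t(2) _ w(2)] by blast
  qed
  from this[OF assms] this[OF assms(2,1,4,3) assms(5)[symmetric]] show ?thesis
    using paths_eqI[OF assms(1,2)] by simp
qed

lemma tail_tail:
  assumes "x \<in> paths \<Lambda>" "cpb \<mu> \<nu>" "\<mu> \<cdot> \<nu> \<in> init x"
  shows "tail \<nu> (tail \<mu> x) = tail (\<mu> \<cdot> \<nu>) x"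
proof -
  have m: "\<mu> \<in> init x" using init_hered[OF assms(1,3)] pre_cmp assms(2) by blast
  have n: "\<nu> \<in> init (tail \<mu> x)" using tail_init[OF assms(1) m] assms by blast
  have c: "cpb \<nu> \<kappa> \<and> cpb \<mu> (\<nu> \<cdot> \<kappa>) \<and> \<mu> \<cdot> (\<nu> \<cdot> \<kappa>) \<in> init x \<longleftrightarrow> cpb (\<mu> \<cdot> \<nu>) \<kappa> \<and> (\<mu> \<cdot> \<nu>) \<cdot> \<kappa> \<in> init x" for \<kappa>
    using assms(2) by (metis cmp_assoc cmp_closed rng_cmp src_cmp)
  show ?thesis
  proof (rule paths_eqI)
    show "tail \<nu> (tail \<mu> x) \<in> paths \<Lambda>" by (intro tail_paths m n assms)
    show "tail (\<mu> \<cdot> \<nu>) x \<in> paths \<Lambda>" by (intro tail_paths assms)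
    show "init (tail \<nu> (tail \<mu> x)) = init (tail (\<mu> \<cdot> \<nu>) x)"
      using tail_init[OF tail_paths[OF assms(1) m] n] tail_init[OF assms(1) m] tail_init[OF assms(1,3)] c
      by blast
  qed
qed

section \<open>Boundary paths\<close>

lemma exhaustive_iff:
  "exhaustive \<Lambda> v B \<longleftrightarrow> B \<subseteq> starting \<Lambda> v \<and> (\<forall>\<mu>\<in>starting \<Lambda> v. \<exists>\<nu>\<in>B. \<exists>\<omega>. pre \<mu> \<omega> \<and> pre \<nu> \<omega>)"
proof -
  have "Lmin \<Lambda> \<mu> \<nu> \<noteq> {} \<longleftrightarrow> (\<exists>\<omega>. pre \<mu> \<omega> \<and> pre \<nu> \<omega>)" if "B \<subseteq> starting \<Lambda> v" "\<mu> \<in> starting \<Lambda> v" "\<nu> \<in> B" for \<mu> \<nu>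
    using that by (intro Lmin_nonempty_iff) (auto simp: starting_def)
  then show ?thesis unfolding exhaustive_def by blast
qed

text \<open>The positions \<open>m\<close> become initial segments \<open>\<mu>\<close> of degree
  \<open>m\<close>, so being a boundary path is a condition on the filter \<open>init x\<close>
  alone. For a fixed pair of \<open>\<mu>\<close> and \<open>B\<close> it involves finitely many
  morphisms, which later gives closedness.\<close>

lemma boundary_iff:
  "x \<in> boundary_paths \<Lambda> \<longleftrightarrow> x \<in> paths \<Lambda> \<and>
     (\<forall>\<mu>\<in>init x. \<forall>B. finite B \<and> exhaustive \<Lambda> (src \<Lambda> \<mu>) B \<longrightarrow> (\<exists>\<beta>\<in>B. \<mu> \<cdot> \<beta> \<in> init x))"
proof (cases "x \<in> paths \<Lambda>")
  case x: True
  have *: "enatv (m + deg \<Lambda> \<beta>) \<le> pdeg x \<and> seg x m (m + deg \<Lambda> \<beta>) = \<beta> \<longleftrightarrow> seg x 0 m \<cdot> \<beta> \<in> init x"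
    if m: "enatv m \<le> pdeg x" and b: "\<beta> \<in> starting \<Lambda> (seg x m m)" for m \<beta>
  proof -
    have d: "deg \<Lambda> (seg x 0 m) = m" using seg0_deg[OF x m] .
    have "seg x 0 m \<cdot> \<beta> \<in> init x \<longleftrightarrow> \<beta> \<in> init (shift m x)"
      using tail_init[OF x init_seg[OF m], of \<beta>] b seg_src[OF x zero_le_fun m] seg_Mor[OF x zero_le_fun m]
      unfolding d by (simp add: starting_def)
    also have "\<dots> \<longleftrightarrow> enatv (deg \<Lambda> \<beta>) \<le> pdeg (shift m x) \<and> seg (shift m x) 0 (deg \<Lambda> \<beta>) = \<beta>"
      using init_iff[OF shift_paths[OF x m]] .
    also have "\<dots> \<longleftrightarrow> enatv (m + deg \<Lambda> \<beta>) \<le> pdeg x \<and> seg x m (m + deg \<Lambda> \<beta>) = \<beta>"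
      unfolding pdeg_shift shift_le_iff[OF m] using seg_shift[OF m zero_le_fun, of "deg \<Lambda> \<beta>"] by auto
    finally show ?thesis by simp
  qed
  have s: "exhaustive \<Lambda> v B \<Longrightarrow> \<beta> \<in> B \<Longrightarrow> \<beta> \<in> starting \<Lambda> v" for v B \<beta> by (auto simp: exhaustive_def)
  show ?thesis
  proof (intro iffI conjI ballI allI impI)
    fix \<mu> B assume "x \<in> boundary_paths \<Lambda>" "\<mu> \<in> init x" and B: "finite B \<and> exhaustive \<Lambda> (src \<Lambda> \<mu>) B"
    moreover note m = init_deg[OF x \<open>\<mu> \<in> init x\<close>] and sm = init_src[OF x \<open>\<mu> \<in> init x\<close>]
    ultimately obtain \<beta> where b: "\<beta> \<in> B"
      "enatv (deg \<Lambda> \<mu> + deg \<Lambda> \<beta>) \<le> pdeg x \<and> seg x (deg \<Lambda> \<mu>) (deg \<Lambda> \<mu> + deg \<Lambda> \<beta>) = \<beta>"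
      unfolding boundary_paths_def by auto
    have "\<beta> \<in> starting \<Lambda> (seg x (deg \<Lambda> \<mu>) (deg \<Lambda> \<mu>))" using s[OF conjunct2[OF B] b(1)] sm by simp
    then have "seg x 0 (deg \<Lambda> \<mu>) \<cdot> \<beta> \<in> init x" by (rule iffD1[OF *[OF m(1)] b(2)])
    then show "\<exists>\<beta>\<in>B. \<mu> \<cdot> \<beta> \<in> init x" using b m by auto
  next
    assume r: "x \<in> paths \<Lambda> \<and>
      (\<forall>\<mu>\<in>init x. \<forall>B. finite B \<and> exhaustive \<Lambda> (src \<Lambda> \<mu>) B \<longrightarrow> (\<exists>\<beta>\<in>B. \<mu> \<cdot> \<beta> \<in> init x))"
    have "\<exists>\<beta>\<in>B. enatv (m + deg \<Lambda> \<beta>) \<le> pdeg x \<and> seg x m (m + deg \<Lambda> \<beta>) = \<beta>"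
      if m: "enatv m \<le> pdeg x" and B: "finite B" "exhaustive \<Lambda> (seg x m m) B" for m B
    proof -
      obtain \<beta> where "\<beta> \<in> B" "seg x 0 m \<cdot> \<beta> \<in> init x"
        using r init_seg[OF m] B seg_src[OF x zero_le_fun m] by metis
      then show ?thesis using *[OF m] s[OF B(2)] by metis
    qed
    then show "x \<in> boundary_paths \<Lambda>" unfolding boundary_paths_def using x by blast
  qed (rule x)
next
  case False
  then show ?thesis by (simp add: boundary_paths_def)
qed

lemma boundary_paths: "x \<in> boundary_paths \<Lambda> \<Longrightarrow> x \<in> paths \<Lambda>"
  by (simp add: boundary_paths_def)

lemma boundaryD:
  "x \<in> boundary_paths \<Lambda> \<Longrightarrow> \<mu> \<in> init x \<Longrightarrow> finite B \<Longrightarrow> exhaustive \<Lambda> (src \<Lambda> \<mu>) B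
    \<Longrightarrow> \<exists>\<beta>\<in>B. \<mu> \<cdot> \<beta> \<in> init x"
  using boundary_iff by blast

lemma boundary_tail:
  assumes "x \<in> boundary_paths \<Lambda>" "\<mu> \<in> init x"
  shows "tail \<mu> x \<in> boundary_paths \<Lambda>"
proof -
  have x: "x \<in> paths \<Lambda>" using assms boundary_paths by blast
  show ?thesis
    unfolding boundary_iff
  proof (intro conjI ballI allI impI)
    fix \<nu> B assume n: "\<nu> \<in> init (tail \<mu> x)" and B: "finite B \<and> exhaustive \<Lambda> (src \<Lambda> \<nu>) B"
    then have mn: "cpb \<mu> \<nu>" "\<mu> \<cdot> \<nu> \<in> init x" using tail_init[OF x assms(2)] by auto
    then obtain \<beta> where b: "\<beta> \<in> B" "(\<mu> \<cdot> \<nu>) \<cdot> \<beta> \<in> init x"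
      using boundaryD[OF assms(1) mn(2)] B src_cmp by metis
    then have "cpb \<nu> \<beta>" using B mn by (auto simp: exhaustive_def starting_def)
    then have "\<nu> \<cdot> \<beta> \<in> init (tail \<mu> x)"
      using tail_init[OF x assms(2)] b mn cmp_assoc cmp_closed rng_cmp by simp
    then show "\<exists>\<beta>\<in>B. \<nu> \<cdot> \<beta> \<in> init (tail \<mu> x)" using b by blast
  qed (rule tail_paths[OF x assms(2)])
qed

end

section \<open>Concatenation\<close>

context fa_kgraph
begin

text \<open>The path is obtained from the filter generated by the products
  \<open>\<mu> \<cdot> \<kappa>\<close> with \<open>\<kappa>\<close> in \<open>init y\<close>;
  \<open>tail_inject\<close> provides the uniqueness required by the definite description.\<close>

lemma concat:
  assumes "y \<in> paths \<Lambda>" "\<mu> \<in> Mor \<Lambda>" "src \<Lambda> \<mu> = prng y"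
  shows concat_paths: "path_concat \<Lambda> \<mu> y \<in> paths \<Lambda>"
    and concat_init: "\<mu> \<in> init (path_concat \<Lambda> \<mu> y)"
    and tail_concat: "tail \<mu> (path_concat \<Lambda> \<mu> y) = y"
proof -
  define S where "S = {\<xi>. \<exists>\<kappa>\<in>init y. pre \<xi> (\<mu> \<cdot> \<kappa>)}"
  have c: "cpb \<mu> \<kappa>" if "\<kappa> \<in> init y" for \<kappa>
    using that assms init_Mor init_rng by auto
  have "filt S"
    unfolding filt_def
  proof (intro conjI allI impI ballI)
    show "S \<subseteq> Mor \<Lambda>" unfolding S_def using pre_Mor by blast
    show "S \<noteq> {}" unfolding S_def using prng_init[OF assms(1)] c pre_refl cmp_closed by blast
    show "\<xi> \<in> S" if "pre \<xi> \<nu>" "\<nu> \<in> S" for \<xi> \<nu> using that pre_trans unfolding S_def by blast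
    fix \<xi> \<nu> assume "\<xi> \<in> S" "\<nu> \<in> S"
    then obtain a b where a: "a \<in> init y" "pre \<xi> (\<mu> \<cdot> a)" and b: "b \<in> init y" "pre \<nu> (\<mu> \<cdot> b)"
      unfolding S_def by blast
    then obtain \<omega> where w: "\<omega> \<in> init y" "pre a \<omega>" "pre b \<omega>"
      using init_directed[OF assms(1) a(1) b(1)] unfolding mce_def by blast
    then have "pre \<xi> (\<mu> \<cdot> \<omega>)" "pre \<nu> (\<mu> \<cdot> \<omega>)"
      using a b pre_trans pre_left[OF c] by blast+
    moreover have "\<mu> \<cdot> \<omega> \<in> S" unfolding S_def using w pre_refl c cmp_closed by blast
    ultimately show "\<exists>\<omega>\<in>S. pre \<xi> \<omega> \<and> pre \<nu> \<omega>" by blast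
  qed
  then obtain z where z: "z \<in> paths \<Lambda>" "init z = S" using filt_path by blast
  have m: "\<mu> \<in> init z"
    unfolding z(2) S_def using prng_init[OF assms(1)] c pre_cmp by blast
  have t: "tail \<mu> z = y"
  proof (rule paths_eqI[OF tail_paths[OF z(1) m] assms(1)])
    show "init (tail \<mu> z) = init y"
    proof (intro equalityI subsetI)
      fix \<kappa> assume "\<kappa> \<in> init (tail \<mu> z)"
      then have k: "cpb \<mu> \<kappa>" "\<mu> \<cdot> \<kappa> \<in> S" using tail_init[OF z(1) m] z(2) by auto
      then obtain a where "a \<in> init y" "pre (\<mu> \<cdot> \<kappa>) (\<mu> \<cdot> a)" unfolding S_def by blast
      then show "\<kappa> \<in> init y" using pre_left_cancel[OF k(1)] c init_hered[OF assms(1)] by blast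
    next
      fix \<kappa> assume k: "\<kappa> \<in> init y"
      then have "\<mu> \<cdot> \<kappa> \<in> S" unfolding S_def using pre_refl c cmp_closed by blast
      then show "\<kappa> \<in> init (tail \<mu> z)" using tail_init[OF z(1) m] z(2) c[OF k] by simp
    qed
  qed
  have "path_concat \<Lambda> \<mu> y = z"
    unfolding path_concat_def
  proof (rule the_equality)
    show "z \<in> paths \<Lambda> \<and> enatv (deg \<Lambda> \<mu>) \<le> pdeg z \<and> seg z 0 (deg \<Lambda> \<mu>) = \<mu> \<and> tail \<mu> z = y"
      using z(1) init_deg[OF z(1) m] t by blast
  next
    fix z' assume z': "z' \<in> paths \<Lambda> \<and> enatv (deg \<Lambda> \<mu>) \<le> pdeg z' \<and> seg z' 0 (deg \<Lambda> \<mu>) = \<mu> \<and> tail \<mu> z' = y"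
    then have "\<mu> \<in> init z'" using init_iff by blast
    then show "z' = z" using tail_inject[of z' z \<mu>] z' z(1) m t by simp
  qed
  with z(1) m t show "path_concat \<Lambda> \<mu> y \<in> paths \<Lambda>" "\<mu> \<in> init (path_concat \<Lambda> \<mu> y)" "tail \<mu> (path_concat \<Lambda> \<mu> y) = y"
    by simp_all
qed

lemma concat_eqI:
  assumes "z \<in> paths \<Lambda>" "\<mu> \<in> init z" "tail \<mu> z = y"
  shows "path_concat \<Lambda> \<mu> y = z"
proof -
  have *: "y \<in> paths \<Lambda>" "\<mu> \<in> Mor \<Lambda>" "src \<Lambda> \<mu> = prng y"
    using assms tail_paths init_Mor tail_prng by metis+
  show ?thesis
    using tail_inject[OF concat_paths[OF *] assms(1) concat_init[OF *] assms(2)] tail_concat[OF *] assms(3) by simp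
qed

lemma concat_tail: "z \<in> paths \<Lambda> \<Longrightarrow> \<mu> \<in> init z \<Longrightarrow> path_concat \<Lambda> \<mu> (tail \<mu> z) = z"
  using concat_eqI by blast

lemma concat_init_cmp:
  assumes "y \<in> paths \<Lambda>" "cpb \<mu> \<kappa>" "src \<Lambda> \<mu> = prng y"
  shows "\<mu> \<cdot> \<kappa> \<in> init (path_concat \<Lambda> \<mu> y) \<longleftrightarrow> \<kappa> \<in> init y"
  using tail_init[OF concat_paths concat_init, of y \<mu> \<kappa>] tail_concat[of y \<mu>] assms by simp

lemma concat_assoc:
  assumes "y \<in> paths \<Lambda>" "cpb \<mu> \<nu>" "src \<Lambda> \<nu> = prng y"
  shows "path_concat \<Lambda> (\<mu> \<cdot> \<nu>) y = path_concat \<Lambda> \<mu> (path_concat \<Lambda> \<nu> y)"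
proof -
  let ?w = "path_concat \<Lambda> \<nu> y" let ?z = "path_concat \<Lambda> \<mu> ?w"
  have w: "?w \<in> paths \<Lambda>" "\<nu> \<in> init ?w" "tail \<nu> ?w = y" using concat[of y \<nu>] assms by auto
  then have s: "src \<Lambda> \<mu> = prng ?w" using assms init_rng by metis
  then have z: "?z \<in> paths \<Lambda>" "\<mu> \<in> init ?z" "tail \<mu> ?z = ?w" using concat[of ?w \<mu>] w assms by auto
  have mn: "\<mu> \<cdot> \<nu> \<in> init ?z" using concat_init_cmp[OF w(1) assms(2) s] w(2) by simp
  show ?thesis
    by (rule concat_eqI[OF z(1) mn]) (use tail_tail[OF z(1) assms(2) mn] z w in simp)
qed

lemma prng_concat:
  "y \<in> paths \<Lambda> \<Longrightarrow> \<mu> \<in> Mor \<Lambda> \<Longrightarrow> src \<Lambda> \<mu> = prng y \<Longrightarrow> prng (path_concat \<Lambda> \<mu> y) = rng \<Lambda> \<mu>"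
  using concat_init concat_paths init_rng by metis

lemma Z_iff:
  assumes "\<mu> \<in> Mor \<Lambda>" shows "x \<in> Z \<Lambda> \<mu> \<longleftrightarrow> x \<in> paths \<Lambda> \<and> \<mu> \<in> init x"
proof
  assume "x \<in> Z \<Lambda> \<mu>"
  then show "x \<in> paths \<Lambda> \<and> \<mu> \<in> init x" unfolding Z_def using concat assms by auto
next
  assume "x \<in> paths \<Lambda> \<and> \<mu> \<in> init x"
  then show "x \<in> Z \<Lambda> \<mu>" unfolding Z_def using concat_tail[of x \<mu>] tail_paths[of x \<mu>] tail_prng[of x \<mu>]
    by (metis (mono_tags, lifting) mem_Collect_eq)
qed

lemma finite_ext: "finite {\<alpha>. cpb \<rho> \<alpha> \<and> \<rho> \<cdot> \<alpha> \<in> mce \<rho> \<beta>}"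
proof (rule finite_imageD)
  show "finite ((\<cdot>) \<rho> ` {\<alpha>. cpb \<rho> \<alpha> \<and> \<rho> \<cdot> \<alpha> \<in> mce \<rho> \<beta>})"
    by (rule finite_subset[OF _ finite_mce[of \<rho> \<beta>]]) auto
  show "inj_on ((\<cdot>) \<rho>) {\<alpha>. cpb \<rho> \<alpha> \<and> \<rho> \<cdot> \<alpha> \<in> mce \<rho> \<beta>}"
    using cmp_cancel by (auto simp: inj_on_def)
qed

text \<open>The position \<open>\<nu>\<close> need not lie behind \<open>\<mu>\<close>, so the given
  exhaustive set is first transported to the source of a common extension \<open>\<omega>\<close>,
  which is a position on \<open>y\<close>.\<close>

lemma boundary_concat:
  assumes "y \<in> boundary_paths \<Lambda>" "\<mu> \<in> Mor \<Lambda>" "src \<Lambda> \<mu> = prng y"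
  shows "path_concat \<Lambda> \<mu> y \<in> boundary_paths \<Lambda>"
proof -
  have y: "y \<in> paths \<Lambda>" using assms boundary_paths by blast
  let ?x = "path_concat \<Lambda> \<mu> y"
  have x: "?x \<in> paths \<Lambda>" "\<mu> \<in> init ?x" using concat[OF y assms(2,3)] by auto
  show ?thesis
    unfolding boundary_iff
  proof (intro conjI ballI allI impI)
    fix \<nu> B assume n: "\<nu> \<in> init ?x" and B: "finite B \<and> exhaustive \<Lambda> (src \<Lambda> \<nu>) B"
    obtain \<omega> where w: "\<omega> \<in> init ?x" "pre \<mu> \<omega>" "pre \<nu> \<omega>"
      using init_directed[OF x(1,2) n] unfolding mce_def by blast
    obtain \<kappa> where k: "cpb \<mu> \<kappa>" "\<omega> = \<mu> \<cdot> \<kappa>" using w(2) unfolding pre_def by blast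
    obtain \<rho> where r: "cpb \<nu> \<rho>" "\<omega> = \<nu> \<cdot> \<rho>" using w(3) unfolding pre_def by blast
    have ky: "\<kappa> \<in> init y" using concat_init_cmp[OF y k(1) assms(3)] w(1) k(2) by simp
    have sk: "src \<Lambda> \<kappa> = src \<Lambda> \<rho>" using k r src_cmp by metis
    \<comment> \<open>The cofactors over \<open>\<rho>\<close> of minimal common extensions with
      members of \<open>B\<close>. They are finitely many, and exhaustive at
      \<open>src \<rho>\<close> because anything behind \<open>\<rho>\<close> is compatible with
      some \<open>\<beta>\<close> and hence with such a cofactor.\<close>
    define E where "E = (\<Union>\<beta>\<in>B. {\<alpha>. cpb \<rho> \<alpha> \<and> \<rho> \<cdot> \<alpha> \<in> mce \<rho> \<beta>})"
    have "finite E" unfolding E_def using B finite_ext by blast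
    moreover have "exhaustive \<Lambda> (src \<Lambda> \<kappa>) E"
      unfolding exhaustive_iff sk
    proof (intro conjI ballI)
      show "E \<subseteq> starting \<Lambda> (src \<Lambda> \<rho>)" unfolding E_def starting_def by auto
      fix \<tau> assume "\<tau> \<in> starting \<Lambda> (src \<Lambda> \<rho>)"
      then have t: "cpb \<rho> \<tau>" using r by (auto simp: starting_def)
      then have "\<rho> \<cdot> \<tau> \<in> starting \<Lambda> (src \<Lambda> \<nu>)" using r by (auto simp: starting_def cmp_closed rng_cmp)
      then obtain \<beta> \<omega>' where b: "\<beta> \<in> B" "pre (\<rho> \<cdot> \<tau>) \<omega>'" "pre \<beta> \<omega>'"
        using B unfolding exhaustive_iff by blast
      have "pre \<rho> \<omega>'" using b(2) pre_cmp[OF t] pre_trans by blast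
      then obtain \<theta> where th: "pre \<rho> \<theta>" "pre \<beta> \<theta>" "pre \<theta> \<omega>'" "\<theta> \<in> mce \<rho> \<beta>"
        using pre_join[OF _ b(3)] unfolding mce_def by blast
      then obtain \<alpha> where a: "cpb \<rho> \<alpha>" "\<theta> = \<rho> \<cdot> \<alpha>" unfolding pre_def by blast
      then have "\<alpha> \<in> E" using th b unfolding E_def by blast
      obtain \<psi> where p: "cpb \<rho> \<psi>" "\<omega>' = \<rho> \<cdot> \<psi>" using \<open>pre \<rho> \<omega>'\<close> unfolding pre_def by blast
      have "pre \<tau> \<psi>" "pre \<alpha> \<psi>"
        using pre_left_cancel[OF t p(1)] pre_left_cancel[OF a(1) p(1)] b(2) th(3) a(2) p(2) by auto
      then show "\<exists>\<nu>\<in>E. \<exists>\<omega>. pre \<tau> \<omega> \<and> pre \<nu> \<omega>" using \<open>\<alpha> \<in> E\<close> by blast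
    qed
    ultimately obtain \<alpha> where a: "\<alpha> \<in> E" "\<kappa> \<cdot> \<alpha> \<in> init y" using boundaryD[OF assms(1) ky] by blast
    then obtain \<beta> where b: "\<beta> \<in> B" "cpb \<rho> \<alpha>" "\<rho> \<cdot> \<alpha> \<in> mce \<rho> \<beta>" unfolding E_def by blast
    have ka: "cpb \<kappa> \<alpha>" using b(2) k sk by simp
    have "\<mu> \<cdot> (\<kappa> \<cdot> \<alpha>) \<in> init ?x"
      using concat_init_cmp[OF y _ assms(3), of "\<kappa> \<cdot> \<alpha>"] a(2) k(1) ka cmp_closed rng_cmp by simp
    moreover have "\<mu> \<cdot> (\<kappa> \<cdot> \<alpha>) = \<nu> \<cdot> (\<rho> \<cdot> \<alpha>)" using k r ka b(2) cmp_assoc by metis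
    moreover have "pre (\<nu> \<cdot> \<beta>) (\<nu> \<cdot> (\<rho> \<cdot> \<alpha>))"
    proof (rule pre_left)
      show "cpb \<nu> \<beta>" using b(1) B r by (auto simp: exhaustive_def starting_def)
      show "pre \<beta> (\<rho> \<cdot> \<alpha>)" using b(3) by (simp add: mce_def)
    qed
    ultimately have "\<nu> \<cdot> \<beta> \<in> init ?x" using init_hered[OF x(1)] by metis
    then show "\<exists>\<beta>\<in>B. \<nu> \<cdot> \<beta> \<in> init ?x" using b by blast
  qed (rule x(1))
qed

end

section \<open>The action on paths\<close>

locale ss_kgraph = self_similar_kgraph G \<Lambda> act res + fa_kgraph \<Lambda>
  for G :: "('g, 'b) monoid_scheme" and \<Lambda> :: "('a, 'k::finite) kgraph" (structure)
    and act :: "'g \<Rightarrow> 'a \<Rightarrow> 'a" and res :: "'g \<Rightarrow> 'a \<Rightarrow> 'g"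

sublocale ss_kgraph \<subseteq> gr: group G
  using group_hom group_hom.axioms(1) by blast

context ss_kgraph
begin

abbreviation pact where "pact \<equiv> path_act act res"

lemma act_closed: "g \<in> carrier G \<Longrightarrow> \<mu> \<in> Mor \<Lambda> \<Longrightarrow> act g \<mu> \<in> Mor \<Lambda>"
  using element_image by blast

lemma act_mult: "g \<in> carrier G \<Longrightarrow> h \<in> carrier G \<Longrightarrow> \<mu> \<in> Mor \<Lambda> \<Longrightarrow> act (g \<otimes>\<^bsub>G\<^esub> h) \<mu> = act g (act h \<mu>)"
  using composition_rule by blast

lemma act_one: "\<mu> \<in> Mor \<Lambda> \<Longrightarrow> act \<one>\<^bsub>G\<^esub> \<mu> = \<mu>"
  using id_eq_one by (metis restrict_apply')

lemma act_inv_act: "g \<in> carrier G \<Longrightarrow> \<mu> \<in> Mor \<Lambda> \<Longrightarrow> act (inv\<^bsub>G\<^esub> g) (act g \<mu>) = \<mu>"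
  using orbit_sym_aux by blast

lemma act_act_inv: "g \<in> carrier G \<Longrightarrow> \<mu> \<in> Mor \<Lambda> \<Longrightarrow> act g (act (inv\<^bsub>G\<^esub> g) \<mu>) = \<mu>"
  using act_mult[of g "inv\<^bsub>G\<^esub> g" \<mu>] act_one by simp

lemma act_inject: "g \<in> carrier G \<Longrightarrow> \<mu> \<in> Mor \<Lambda> \<Longrightarrow> \<nu> \<in> Mor \<Lambda> \<Longrightarrow> act g \<mu> = act g \<nu> \<Longrightarrow> \<mu> = \<nu>"
  using act_inv_act by metis

lemma act_vertex: "g \<in> carrier G \<Longrightarrow> v \<in> vertices \<Lambda> \<Longrightarrow> act g v \<in> vertices \<Lambda>"
  by (simp add: level_def act_closed act_deg)

lemma act_cpb:
  assumes "g \<in> carrier G" "cpb \<mu> \<nu>"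
  shows "cpb (act g \<mu>) (act (res g \<mu>) \<nu>)"
  using assms act_closed act_composable res_closed by simp

lemma act_pre: "g \<in> carrier G \<Longrightarrow> pre \<mu> \<nu> \<Longrightarrow> pre (act g \<mu>) (act g \<nu>)"
  unfolding pre_def using act_cpb act_cmp by metis

text \<open>\<open>src \<Lambda> \<mu>\<close> is composable after \<open>\<mu>\<close>, so its
  image under the restriction, again a vertex, must be the source of \<open>act g \<mu>\<close>.
  Hence \<open>g\<close> and its restriction agree on this vertex.\<close>

lemma act_res_src:
  assumes "g \<in> carrier G" "\<mu> \<in> Mor \<Lambda>"
  shows "act (res g \<mu>) (src \<Lambda> \<mu>) = act g (src \<Lambda> \<mu>)"
proof -
  have "src \<Lambda> (act g \<mu>) = rng \<Lambda> (act (res g \<mu>) (src \<Lambda> \<mu>))"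
    using act_composable[OF assms src_closed[OF assms(2)]] rng_src[OF assms(2)] by simp
  also have "\<dots> = act (res g \<mu>) (src \<Lambda> \<mu>)"
    using vertexD(2)[OF act_vertex[OF res_closed[OF assms] src_vertex[OF assms(2)]]] .
  finally show ?thesis using act_src[OF assms] by simp
qed

lemma res_one:
  assumes "\<mu> \<in> Mor \<Lambda>" shows "res \<one>\<^bsub>G\<^esub> \<mu> = \<one>\<^bsub>G\<^esub>"
proof -
  have "res \<one>\<^bsub>G\<^esub> \<mu> = res \<one>\<^bsub>G\<^esub> \<mu> \<otimes>\<^bsub>G\<^esub> res \<one>\<^bsub>G\<^esub> \<mu>"
    using res_mult[of "\<one>\<^bsub>G\<^esub>" "\<one>\<^bsub>G\<^esub>" \<mu>] assms act_one by simp
  then show ?thesis using gr.l_cancel_one'[of "res \<one>\<^bsub>G\<^esub> \<mu>" "res \<one>\<^bsub>G\<^esub> \<mu>"] assms res_closed by simp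
qed

lemma res_inv:
  assumes "g \<in> carrier G" "\<mu> \<in> Mor \<Lambda>"
  shows "res (inv\<^bsub>G\<^esub> g) (act g \<mu>) = inv\<^bsub>G\<^esub> (res g \<mu>)"
proof -
  have "res (inv\<^bsub>G\<^esub> g) (act g \<mu>) \<otimes>\<^bsub>G\<^esub> res g \<mu> = \<one>\<^bsub>G\<^esub>"
    using res_mult[of "inv\<^bsub>G\<^esub> g" g \<mu>] assms res_one by simp
  then show ?thesis using gr.inv_equality assms res_closed act_closed by simp
qed

lemma path_act_seg:
  "p \<le> q \<Longrightarrow> enatv q \<le> pdeg x \<Longrightarrow> seg (pact g x) p q = act (res g (seg x 0 p)) (seg x p q)"
  by (simp add: path_act_def Omega_def)

lemma pdeg_path_act [simp]: "pdeg (pact g x) = pdeg x"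
  by (simp add: path_act_def)

lemma path_act_paths:
  assumes g: "g \<in> carrier G" and x: "x \<in> paths \<Lambda>"
  shows "pact g x \<in> paths \<Lambda>"
proof -
  have "(pdeg x, snd (pact g x)) \<in> paths \<Lambda>"
    unfolding paths_iff
  proof (intro conjI allI impI)
    show "snd (pact g x) \<in> extensional {(p, q). p \<le> q \<and> enatv q \<le> pdeg x}"
      by (simp add: path_act_def Omega_def)
  next
    fix p q assume pq: "p \<le> q" "enatv q \<le> pdeg x"
    then have p: "enatv p \<le> pdeg x" using enatv_mono by blast
    let ?h = "res g (seg x 0 p)"
    have h: "?h \<in> carrier G" using res_closed[OF g seg_Mor[OF x zero_le_fun p]] .
    have m: "seg x p q \<in> Mor \<Lambda>" using seg_Mor[OF x pq] .
    note s = path_act_seg[OF pq] path_act_seg[OF order_refl p] path_act_seg[OF order_refl pq(2)]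
    show "seg (pact g x) p q \<in> Mor \<Lambda>" unfolding s using act_closed[OF h m] .
    show "seg (pact g x) p p = rng \<Lambda> (seg (pact g x) p q)"
      unfolding s using act_rng[OF h m] seg_rng[OF x pq] by simp
    have "res g (seg x 0 q) = res ?h (seg x p q)"
      using res_cmp[OF g, of "seg x 0 p" "seg x p q"] seg_cpb[OF x zero_le_fun pq] seg_cmp[OF x zero_le_fun pq]
      by simp
    then show "seg (pact g x) q q = src \<Lambda> (seg (pact g x) p q)"
      unfolding s using act_src[OF h m] act_res_src[OF h m] seg_src[OF x pq] by simp
    show "deg \<Lambda> (seg (pact g x) p q) = q - p"
      unfolding s using act_deg[OF h m] seg_deg[OF x pq] by simp
  next
    fix p q r assume pq: "p \<le> q" "q \<le> r" "enatv r \<le> pdeg x"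
    then have q: "enatv q \<le> pdeg x" "p \<le> r" using enatv_mono by auto
    then have p: "enatv p \<le> pdeg x" using pq enatv_mono by blast
    let ?h = "res g (seg x 0 p)"
    have h: "?h \<in> carrier G" using res_closed[OF g seg_Mor[OF x zero_le_fun p]] .
    have "res g (seg x 0 q) = res ?h (seg x p q)"
      using res_cmp[OF g, of "seg x 0 p" "seg x p q"] seg_cpb[OF x zero_le_fun pq(1) q(1)]
        seg_cmp[OF x zero_le_fun pq(1) q(1)] by simp
    then show "seg (pact g x) p r = seg (pact g x) p q \<cdot> seg (pact g x) q r"
      unfolding path_act_seg[OF pq(1) q(1)] path_act_seg[OF pq(2,3)] path_act_seg[OF q(2) pq(3)]
      using act_cmp[OF h] seg_cpb[OF x pq] seg_cmp[OF x pq] by simp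
  qed
  moreover have "pact g x = (pdeg x, snd (pact g x))" by (simp add: path_act_def)
  ultimately show ?thesis by metis
qed

lemma path_act_seg0:
  assumes "g \<in> carrier G" "x \<in> paths \<Lambda>" "enatv n \<le> pdeg x"
  shows "seg (pact g x) 0 n = act g (seg x 0 n)"
  using path_act_seg[OF zero_le_fun assms(3), of g] res_vertex[OF assms(1) prng_vertex(1)[OF assms(2)]] by simp

lemma prng_path_act: "g \<in> carrier G \<Longrightarrow> x \<in> paths \<Lambda> \<Longrightarrow> prng (pact g x) = act g (prng x)"
  by (rule path_act_seg0) (simp_all del: zero_fun_apply)

lemma path_act_init:
  assumes "g \<in> carrier G" "x \<in> paths \<Lambda>"
  shows "init (pact g x) = act g ` init x"
proof -
  have "init (pact g x) = (\<lambda>n. seg (pact g x) 0 n) ` {n. enatv n \<le> pdeg x}" unfolding init_def by auto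
  also have "\<dots> = (\<lambda>n. act g (seg x 0 n)) ` {n. enatv n \<le> pdeg x}"
    by (rule image_cong) (use path_act_seg0[OF assms] in auto)
  also have "\<dots> = act g ` init x" unfolding init_def by auto
  finally show ?thesis .
qed

lemma path_act_init_iff:
  assumes "g \<in> carrier G" "x \<in> paths \<Lambda>" "\<mu> \<in> Mor \<Lambda>"
  shows "\<mu> \<in> init (pact g x) \<longleftrightarrow> act (inv\<^bsub>G\<^esub> g) \<mu> \<in> init x"
proof
  assume "\<mu> \<in> init (pact g x)"
  then show "act (inv\<^bsub>G\<^esub> g) \<mu> \<in> init x"
    unfolding path_act_init[OF assms(1,2)] using act_inv_act[OF assms(1) init_Mor[OF assms(2)]] by auto
next
  assume "act (inv\<^bsub>G\<^esub> g) \<mu> \<in> init x"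
  then show "\<mu> \<in> init (pact g x)"
    unfolding path_act_init[OF assms(1,2)] using act_act_inv[OF assms(1,3)] by (metis imageI)
qed

lemma act_init_iff:
  assumes "g \<in> carrier G" "x \<in> paths \<Lambda>" "\<mu> \<in> Mor \<Lambda>"
  shows "act g \<mu> \<in> init (pact g x) \<longleftrightarrow> \<mu> \<in> init x"
  using path_act_init_iff[OF assms(1,2) act_closed[OF assms(1,3)]] act_inv_act assms by simp

lemma path_act_mult:
  assumes "g \<in> carrier G" "h \<in> carrier G" "x \<in> paths \<Lambda>"
  shows "pact (g \<otimes>\<^bsub>G\<^esub> h) x = pact g (pact h x)"
proof (rule paths_eqI)
  show "init (pact (g \<otimes>\<^bsub>G\<^esub> h) x) = init (pact g (pact h x))"
    using assms path_act_init path_act_paths act_mult init_Mor[OF assms(3)] by (auto simp: image_image)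
qed (use assms path_act_paths in auto)

lemma path_act_one: "x \<in> paths \<Lambda> \<Longrightarrow> pact \<one>\<^bsub>G\<^esub> x = x"
  by (rule paths_eqI) (use path_act_paths path_act_init act_one init_Mor in auto)

lemma path_act_inv:
  assumes "g \<in> carrier G" "x \<in> paths \<Lambda>"
  shows "pact g (pact (inv\<^bsub>G\<^esub> g) x) = x" "pact (inv\<^bsub>G\<^esub> g) (pact g x) = x"
  using path_act_mult[of g "inv\<^bsub>G\<^esub> g" x] path_act_mult[of "inv\<^bsub>G\<^esub> g" g x] path_act_one assms by simp_all

text \<open>On initial segments this is the first self-similarity identity: what follows
  \<open>\<mu>\<close> is moved by \<open>res g \<mu>\<close> and not by \<open>g\<close>.\<close>

lemma tail_act:
  assumes g: "g \<in> carrier G" and x: "x \<in> paths \<Lambda>" and m: "\<mu> \<in> init x"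
  shows "tail (act g \<mu>) (pact g x) = pact (res g \<mu>) (tail \<mu> x)"
proof (rule paths_eqI)
  have mM: "\<mu> \<in> Mor \<Lambda>" using init_Mor[OF x m] .
  have h: "res g \<mu> \<in> carrier G" using res_closed[OF g mM] .
  have gm: "act g \<mu> \<in> init (pact g x)" using act_init_iff[OF g x mM] m by simp
  have gx: "pact g x \<in> paths \<Lambda>" using path_act_paths[OF g x] .
  have t: "tail \<mu> x \<in> paths \<Lambda>" using tail_paths[OF x m] .
  show "tail (act g \<mu>) (pact g x) \<in> paths \<Lambda>" using tail_paths[OF gx gm] .
  show "pact (res g \<mu>) (tail \<mu> x) \<in> paths \<Lambda>" using path_act_paths[OF h t] .
  show "init (tail (act g \<mu>) (pact g x)) = init (pact (res g \<mu>) (tail \<mu> x))"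
  proof (intro equalityI subsetI)
    fix \<kappa> assume "\<kappa> \<in> init (tail (act g \<mu>) (pact g x))"
    then have k: "cpb (act g \<mu>) \<kappa>" "act g \<mu> \<cdot> \<kappa> \<in> init (pact g x)" using tail_init[OF gx gm] by auto
    define \<kappa>' where "\<kappa>' = act (inv\<^bsub>G\<^esub> (res g \<mu>)) \<kappa>"
    have k': "\<kappa>' \<in> Mor \<Lambda>" "act (res g \<mu>) \<kappa>' = \<kappa>" unfolding \<kappa>'_def using act_closed h k act_act_inv by auto
    have "act (res g \<mu>) (rng \<Lambda> \<kappa>') = act (res g \<mu>) (src \<Lambda> \<mu>)"
      using act_rng[OF h k'(1)] k k' act_src[OF g mM] act_res_src[OF g mM] by simp
    then have c: "cpb \<mu> \<kappa>'" using act_inject[OF h] k' mM rng_closed src_closed by metis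
    then have "act g (\<mu> \<cdot> \<kappa>') \<in> init (pact g x)" using act_cmp[OF g] k k' by simp
    then have "\<mu> \<cdot> \<kappa>' \<in> init x" using act_init_iff[OF g x] c cmp_closed by blast
    then have "\<kappa>' \<in> init (tail \<mu> x)" using tail_init[OF x m] c by simp
    then show "\<kappa> \<in> init (pact (res g \<mu>) (tail \<mu> x))" using path_act_init[OF h t] k' by auto
  next
    fix \<kappa> assume "\<kappa> \<in> init (pact (res g \<mu>) (tail \<mu> x))"
    then obtain \<kappa>' where "\<kappa>' \<in> init (tail \<mu> x)" and k: "\<kappa> = act (res g \<mu>) \<kappa>'"
      using path_act_init[OF h t] by auto
    then have c: "cpb \<mu> \<kappa>'" "\<mu> \<cdot> \<kappa>' \<in> init x" using tail_init[OF x m] by auto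
    then have "act g \<mu> \<cdot> \<kappa> \<in> init (pact g x)" using act_init_iff[OF g x, of "\<mu> \<cdot> \<kappa>'"] act_cmp[OF g] k cmp_closed by simp
    then show "\<kappa> \<in> init (tail (act g \<mu>) (pact g x))" using tail_init[OF gx gm] act_cpb[OF g c(1)] k by simp
  qed
qed

lemma exhaustive_act:
  assumes h: "h \<in> carrier G" and v: "v \<in> Mor \<Lambda>" and B: "exhaustive \<Lambda> v B"
  shows "exhaustive \<Lambda> (act h v) (act h ` B)"
  unfolding exhaustive_iff
proof (intro conjI ballI)
  show "act h ` B \<subseteq> starting \<Lambda> (act h v)"
    using B act_closed[OF h] act_rng[OF h] by (force simp: exhaustive_iff starting_def)
  fix \<tau> assume t: "\<tau> \<in> starting \<Lambda> (act h v)"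
  then have "act (inv\<^bsub>G\<^esub> h) \<tau> \<in> starting \<Lambda> v"
    using act_closed act_rng[symmetric] act_inv_act h v by (auto simp: starting_def)
  then obtain \<beta> \<omega> where b: "\<beta> \<in> B" "pre (act (inv\<^bsub>G\<^esub> h) \<tau>) \<omega>" "pre \<beta> \<omega>"
    using B unfolding exhaustive_iff by blast
  have "act h (act (inv\<^bsub>G\<^esub> h) \<tau>) = \<tau>" using act_act_inv h t by (auto simp: starting_def)
  then have "pre \<tau> (act h \<omega>)" "pre (act h \<beta>) (act h \<omega>)"
    using act_pre[OF h b(2)] act_pre[OF h b(3)] by auto
  then show "\<exists>\<nu>\<in>act h ` B. \<exists>\<omega>. pre \<tau> \<omega> \<and> pre \<nu> \<omega>" using b by blast
qed

lemma boundary_act: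
  assumes g: "g \<in> carrier G" and x: "x \<in> boundary_paths \<Lambda>"
  shows "pact g x \<in> boundary_paths \<Lambda>"
proof -
  have xp: "x \<in> paths \<Lambda>" using x boundary_paths by blast
  show ?thesis
    unfolding boundary_iff
  proof (intro conjI ballI allI impI)
    show "pact g x \<in> paths \<Lambda>" using path_act_paths[OF g xp] .
    fix \<nu> B assume "\<nu> \<in> init (pact g x)" and B: "finite B \<and> exhaustive \<Lambda> (src \<Lambda> \<nu>) B"
    then obtain \<mu> where m: "\<mu> \<in> init x" "\<nu> = act g \<mu>" using path_act_init[OF g xp] by auto
    have mM: "\<mu> \<in> Mor \<Lambda>" using init_Mor[OF xp m(1)] .
    \<comment> \<open>Extensions behind \<open>\<mu>\<close> are moved by this restriction, so the
      exhaustive set has to be pulled back by its inverse rather than by the inverse of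
      \<open>g\<close>.\<close>
    define h where "h = res g \<mu>"
    have h: "h \<in> carrier G" unfolding h_def using res_closed[OF g mM] .
    have s: "src \<Lambda> \<nu> = act h (src \<Lambda> \<mu>)" using act_res_src[OF g mM] act_src[OF g mM] m(2) by (simp add: h_def)
    have "exhaustive \<Lambda> (act (inv\<^bsub>G\<^esub> h) (src \<Lambda> \<nu>)) (act (inv\<^bsub>G\<^esub> h) ` B)"
      using exhaustive_act[of "inv\<^bsub>G\<^esub> h" "src \<Lambda> \<nu>" B] h B s act_closed[OF h src_closed[OF mM]] by simp
    then have "exhaustive \<Lambda> (src \<Lambda> \<mu>) (act (inv\<^bsub>G\<^esub> h) ` B)"
      using s act_inv_act[OF h src_closed[OF mM]] by simp
    then obtain \<beta> where b: "\<beta> \<in> B" "\<mu> \<cdot> act (inv\<^bsub>G\<^esub> h) \<beta> \<in> init x"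
      using boundaryD[OF x m(1), of "act (inv\<^bsub>G\<^esub> h) ` B"] B by auto
    have bM: "\<beta> \<in> Mor \<Lambda>" "rng \<Lambda> \<beta> = src \<Lambda> \<nu>" using B b(1) by (auto simp: exhaustive_def starting_def)
    have c: "cpb \<mu> (act (inv\<^bsub>G\<^esub> h) \<beta>)"
      using act_closed[of "inv\<^bsub>G\<^esub> h" \<beta>] act_rng[of "inv\<^bsub>G\<^esub> h" \<beta>] h bM mM s act_inv_act[OF h src_closed[OF mM]]
      by simp
    have "act g (\<mu> \<cdot> act (inv\<^bsub>G\<^esub> h) \<beta>) \<in> init (pact g x)"
      using act_init_iff[OF g xp] b(2) c cmp_closed by blast
    then have "\<nu> \<cdot> \<beta> \<in> init (pact g x)" using act_cmp[OF g] c act_act_inv[OF h bM(1)] m(2) h_def by simp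
    then show "\<exists>\<beta>\<in>B. \<nu> \<cdot> \<beta> \<in> init (pact g x)" using b(1) by blast
  qed
qed

end

section \<open>The topology of the boundary path space\<close>

lemma openin_finite_Ball:
  assumes "finite F" "\<And>a. a \<in> F \<Longrightarrow> openin X {x \<in> topspace X. P a x}"
  shows "openin X {x \<in> topspace X. \<forall>a\<in>F. P a x}"
  using assms
proof induction
  case (insert a F)
  have "{x \<in> topspace X. \<forall>b\<in>insert a F. P b x} = {x \<in> topspace X. P a x} \<inter> {x \<in> topspace X. \<forall>b\<in>F. P b x}"
    by auto
  with insert show ?case by (simp add: openin_Int)
qed simp

context fa_kgraph
begin

lemma ZF_iff:
  assumes "\<mu> \<in> Mor \<Lambda>" "F \<subseteq> starting \<Lambda> (src \<Lambda> \<mu>)"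
  shows "x \<in> ZF \<Lambda> \<mu> F \<longleftrightarrow> x \<in> paths \<Lambda> \<and> \<mu> \<in> init x \<and> (\<forall>\<alpha>\<in>F. \<mu> \<cdot> \<alpha> \<notin> init x)"
proof -
  have "x \<in> Z \<Lambda> (\<mu> \<cdot> \<alpha>) \<longleftrightarrow> x \<in> paths \<Lambda> \<and> \<mu> \<cdot> \<alpha> \<in> init x" if "\<alpha> \<in> F" for \<alpha>
    by (rule Z_iff, rule cmp_closed) (use that assms in \<open>auto simp: starting_def\<close>)
  then show ?thesis unfolding ZF_def using Z_iff[OF assms(1)] by blast
qed

lemma openin_ZF:
  "\<mu> \<in> Mor \<Lambda> \<Longrightarrow> finite F \<Longrightarrow> F \<subseteq> starting \<Lambda> (src \<Lambda> \<mu>) \<Longrightarrow> openin (path_topology \<Lambda>) (ZF \<Lambda> \<mu> F)"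
  unfolding path_topology_def by (rule topology_generated_by_Basis) blast

lemma topspace_path_topology: "topspace (path_topology \<Lambda>) = paths \<Lambda>"
proof
  show "topspace (path_topology \<Lambda>) \<subseteq> paths \<Lambda>"
    unfolding path_topology_def topology_generated_by_topspace using ZF_iff by auto
  show "paths \<Lambda> \<subseteq> topspace (path_topology \<Lambda>)"
  proof
    fix x assume x: "x \<in> paths \<Lambda>"
    then have v: "prng x \<in> Mor \<Lambda>" using prng_init init_Mor by blast
    have "x \<in> ZF \<Lambda> (prng x) {}" using ZF_iff[OF v] x prng_init by auto
    then show "x \<in> topspace (path_topology \<Lambda>)" using openin_ZF[OF v, of "{}"] openin_subset by blast
  qed
qed

lemma topspace_boundary: "topspace (boundary_topology \<Lambda>) = boundary_paths \<Lambda>"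
  unfolding boundary_topology_def using boundary_paths topspace_path_topology by auto

lemma openin_init: "openin (path_topology \<Lambda>) {x \<in> paths \<Lambda>. \<mu> \<in> init x}"
proof (cases "\<mu> \<in> Mor \<Lambda>")
  case True
  then have "{x \<in> paths \<Lambda>. \<mu> \<in> init x} = ZF \<Lambda> \<mu> {}" using ZF_iff by auto
  then show ?thesis using openin_ZF[OF True] by simp
next
  case False
  then have "{x \<in> paths \<Lambda>. \<mu> \<in> init x} = {}" using init_Mor by blast
  then show ?thesis by (simp only: openin_empty)
qed

text \<open>If \<open>\<mu>\<close> starts at the range of \<open>x\<close>, it is excluded by a
  basic set at that vertex; otherwise no path in the cylinder of that vertex has it as a segment.
  Cylinder sets are therefore clopen.\<close>

lemma openin_not_init: "openin (path_topology \<Lambda>) {x \<in> paths \<Lambda>. \<mu> \<notin> init x}"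
proof (subst openin_subopen, intro ballI)
  fix x assume x: "x \<in> {x \<in> paths \<Lambda>. \<mu> \<notin> init x}"
  then have v: "prng x \<in> vertices \<Lambda>" "prng x \<in> init x" using prng_vertex(1) prng_init by auto
  show "\<exists>W. openin (path_topology \<Lambda>) W \<and> x \<in> W \<and> W \<subseteq> {x \<in> paths \<Lambda>. \<mu> \<notin> init x}"
  proof (cases "\<mu> \<in> Mor \<Lambda> \<and> rng \<Lambda> \<mu> = prng x")
    case True
    then have m: "\<mu> \<in> Mor \<Lambda>" "prng x \<cdot> \<mu> = \<mu>" "{\<mu>} \<subseteq> starting \<Lambda> (src \<Lambda> (prng x))"
      using rng_cmp_id[of \<mu>] vertexD(3)[OF v(1)] by (auto simp: starting_def)
    have "openin (path_topology \<Lambda>) (ZF \<Lambda> (prng x) {\<mu>})"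
      using openin_ZF m vertexD(1)[OF v(1)] by simp
    moreover have "x \<in> ZF \<Lambda> (prng x) {\<mu>}" "ZF \<Lambda> (prng x) {\<mu>} \<subseteq> {x \<in> paths \<Lambda>. \<mu> \<notin> init x}"
      using ZF_iff[OF vertexD(1)[OF v(1)] m(3)] x m v by auto
    ultimately show ?thesis by blast
  next
    case False
    have "{y \<in> paths \<Lambda>. prng x \<in> init y} \<subseteq> {x \<in> paths \<Lambda>. \<mu> \<notin> init x}"
    proof safe
      fix y assume y: "y \<in> paths \<Lambda>" "prng x \<in> init y" "\<mu> \<in> init y"
      then have "rng \<Lambda> \<mu> = prng x" using init_rng[OF y(1)] vertexD(2)[OF v(1)] by metis
      then show False using False init_Mor[OF y(1,3)] by blast
    qed
    then show ?thesis using openin_init[of "prng x"] x v by blast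
  qed
qed

lemma openin_boundary_init: 
  "openin (boundary_topology \<Lambda>) {x \<in> boundary_paths \<Lambda>. \<mu> \<in> init x}"
  "openin (boundary_topology \<Lambda>) {x \<in> boundary_paths \<Lambda>. \<mu> \<notin> init x}"
proof -
  have "{x \<in> boundary_paths \<Lambda>. \<mu> \<in> init x} = {x \<in> paths \<Lambda>. \<mu> \<in> init x} \<inter> boundary_paths \<Lambda>"
    "{x \<in> boundary_paths \<Lambda>. \<mu> \<notin> init x} = {x \<in> paths \<Lambda>. \<mu> \<notin> init x} \<inter> boundary_paths \<Lambda>"
    using boundary_paths by auto
  then show "openin (boundary_topology \<Lambda>) {x \<in> boundary_paths \<Lambda>. \<mu> \<in> init x}"
    "openin (boundary_topology \<Lambda>) {x \<in> boundary_paths \<Lambda>. \<mu> \<notin> init x}"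
    unfolding boundary_topology_def using openin_init[of \<mu>] openin_not_init[of \<mu>]
    by (auto simp: openin_subtopology)
qed

lemma openin_class:
  assumes "finite L"
  shows "openin (boundary_topology \<Lambda>) {y \<in> boundary_paths \<Lambda>. init y \<inter> L = M \<inter> L}"
proof -
  have "{y \<in> boundary_paths \<Lambda>. init y \<inter> L = M \<inter> L} =
     {y \<in> topspace (boundary_topology \<Lambda>). \<forall>a\<in>L. a \<in> init y \<longleftrightarrow> a \<in> M}"
    unfolding topspace_boundary by blast
  moreover have "openin (boundary_topology \<Lambda>) \<dots>"
  proof (rule openin_finite_Ball[OF assms])
    fix a
    show "openin (boundary_topology \<Lambda>) {y \<in> topspace (boundary_topology \<Lambda>). (a \<in> init y) = (a \<in> M)}"
      unfolding topspace_boundary by (cases "a \<in> M") (use openin_boundary_init[of a] in simp_all)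
  qed
  ultimately show ?thesis by simp
qed

lemma openin_path_local:
  assumes "openin (path_topology \<Lambda>) W" "x \<in> W"
  shows "\<exists>L. finite L \<and> (\<forall>y\<in>paths \<Lambda>. init y \<inter> L = init x \<inter> L \<longrightarrow> y \<in> W)"
proof -
  define \<S> where "\<S> = {ZF \<Lambda> \<mu> F | \<mu> F. \<mu> \<in> Mor \<Lambda> \<and> finite F \<and> F \<subseteq> starting \<Lambda> (src \<Lambda> \<mu>)}"
  have "generate_topology_on \<S> W"
    using assms(1) unfolding path_topology_def openin_topology_generated_by_iff \<S>_def .
  then show ?thesis using assms(2)
  proof (induction arbitrary: x)
    case (Int a b)
    then have "x \<in> a" "x \<in> b" by auto
    obtain L where "finite L" "\<forall>y\<in>paths \<Lambda>. init y \<inter> L = init x \<inter> L \<longrightarrow> y \<in> a"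
      using Int.IH(1)[OF \<open>x \<in> a\<close>] by blast
    moreover obtain M where "finite M" "\<forall>y\<in>paths \<Lambda>. init y \<inter> M = init x \<inter> M \<longrightarrow> y \<in> b"
      using Int.IH(2)[OF \<open>x \<in> b\<close>] by blast
    ultimately show ?case by (intro exI[of _ "L \<union> M"]) blast
  next
    case (UN K)
    then obtain k where "k \<in> K" "x \<in> k" by blast
    with UN.IH[OF this] show ?case by blast
  next
    case (Basis s)
    then obtain \<mu> F where s: "s = ZF \<Lambda> \<mu> F" "\<mu> \<in> Mor \<Lambda>" "finite F" "F \<subseteq> starting \<Lambda> (src \<Lambda> \<mu>)"
      unfolding \<S>_def by blast
    show ?case
    proof (intro exI[of _ "insert \<mu> ((\<cdot>) \<mu> ` F)"] conjI ballI impI)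
      fix y assume "y \<in> paths \<Lambda>"
        and eq: "init y \<inter> insert \<mu> ((\<cdot>) \<mu> ` F) = init x \<inter> insert \<mu> ((\<cdot>) \<mu> ` F)"
      have "a \<in> init y \<longleftrightarrow> a \<in> init x" if "a \<in> insert \<mu> ((\<cdot>) \<mu> ` F)" for a
        using eq that by blast
      then show "y \<in> s" using Basis(2) \<open>y \<in> paths \<Lambda>\<close> unfolding s(1) ZF_iff[OF s(2,4)] by auto
    qed (use s in simp)
  qed simp
qed

text \<open>The topology is that of pointwise convergence of the indicator functions of
  \<open>init x\<close>. Continuity and compactness below are always argued with such finite test
  sets \<open>L\<close>.\<close>

lemma openin_boundary_iff:
  "openin (boundary_topology \<Lambda>) W \<longleftrightarrow> W \<subseteq> boundary_paths \<Lambda> \<and>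
     (\<forall>x\<in>W. \<exists>L. finite L \<and> (\<forall>y\<in>boundary_paths \<Lambda>. init y \<inter> L = init x \<inter> L \<longrightarrow> y \<in> W))"
proof (intro iffI conjI ballI)
  assume W: "openin (boundary_topology \<Lambda>) W"
  then show "W \<subseteq> boundary_paths \<Lambda>" using openin_subset topspace_boundary by blast
  fix x assume "x \<in> W"
  obtain T where T: "openin (path_topology \<Lambda>) T" "W = T \<inter> boundary_paths \<Lambda>"
    using W unfolding boundary_topology_def openin_subtopology by blast
  then obtain L where "finite L" "\<forall>y\<in>paths \<Lambda>. init y \<inter> L = init x \<inter> L \<longrightarrow> y \<in> T"
    using openin_path_local[OF T(1)] \<open>x \<in> W\<close> by blast
  then show "\<exists>L. finite L \<and> (\<forall>y\<in>boundary_paths \<Lambda>. init y \<inter> L = init x \<inter> L \<longrightarrow> y \<in> W)"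
    using T(2) boundary_paths by blast
next
  assume W: "W \<subseteq> boundary_paths \<Lambda> \<and>
     (\<forall>x\<in>W. \<exists>L. finite L \<and> (\<forall>y\<in>boundary_paths \<Lambda>. init y \<inter> L = init x \<inter> L \<longrightarrow> y \<in> W))"
  show "openin (boundary_topology \<Lambda>) W"
  proof (subst openin_subopen, intro ballI)
    fix x assume x: "x \<in> W"
    then obtain L where L: "finite L" "\<forall>y\<in>boundary_paths \<Lambda>. init y \<inter> L = init x \<inter> L \<longrightarrow> y \<in> W" using W by blast
    then show "\<exists>T. openin (boundary_topology \<Lambda>) T \<and> x \<in> T \<and> T \<subseteq> W"
      using openin_class[OF L(1), of "init x"] x W by (intro exI[of _ "{y \<in> boundary_paths \<Lambda>. init y \<inter> L = init x \<inter> L}"]) auto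
  qed
qed

end

subsection \<open>Compactness\<close>

lemma compact_UNIV_fun_bool: "compact (UNIV :: ('a \<Rightarrow> bool) set)"
proof -
  have "compact_space (euclidean :: bool topology)"
    by (simp add: compact_space_def compactin_euclidean_iff finite_imp_compact)
  then have "compact_space (product_topology (\<lambda>i :: 'a. euclidean :: bool topology) UNIV)"
    by (simp add: compact_space_product_topology)
  then show ?thesis
    unfolding euclidean_product_topology by (simp add: compact_space_def compactin_euclidean_iff)
qed

lemma open_coordinate: "open {f :: 'a \<Rightarrow> bool. f a = c}"
proof -
  have "open ((\<lambda>f :: 'a \<Rightarrow> bool. f a) -` {c})"
    by (rule open_vimage) (simp_all add: open_discrete)
  then show ?thesis by (simp add: vimage_def)
qed

lemma closed_coordinate: "closed {f :: 'a \<Rightarrow> bool. f a}"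
proof -
  have "- {f :: 'a \<Rightarrow> bool. f a} = {f. f a = False}" by auto
  then show ?thesis unfolding closed_def by (simp only: open_coordinate)
qed

lemma closed_finite_Bex: "finite A \<Longrightarrow> closed {f :: 'a \<Rightarrow> bool. \<exists>a\<in>A. f a}"
  unfolding Collect_bex_eq by (intro closed_UN ballI closed_coordinate)

context fa_kgraph
begin

text \<open>The filters together with the empty set, viewed in the cube of truth-valued functions.
  Directedness is expressed through the finite sets \<open>mce a b\<close>, since an existential
  over a finite set is a closed condition.\<close>

definition filtc :: "('a \<Rightarrow> bool) set" where
  "filtc = {f. (\<forall>a. f a \<longrightarrow> a \<in> Mor \<Lambda>) \<and> (\<forall>a b. pre a b \<longrightarrow> f b \<longrightarrow> f a)
     \<and> (\<forall>a b. f a \<longrightarrow> f b \<longrightarrow> (\<exists>\<omega>\<in>mce a b. f \<omega>))}"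

lemma closed_filtc: "closed filtc"
  unfolding filtc_def
  by (intro closed_Collect_conj closed_Collect_all closed_Collect_imp closed_Collect_const closed_coordinate
      closed_finite_Bex finite_mce open_Collect_const) (use open_coordinate[of _ True] in simp_all)

lemma filt_hered: "filt S \<Longrightarrow> pre a b \<Longrightarrow> b \<in> S \<Longrightarrow> a \<in> S"
  unfolding filt_def by blast

lemma filt_directed: "filt S \<Longrightarrow> a \<in> S \<Longrightarrow> b \<in> S \<Longrightarrow> \<exists>\<omega>\<in>S. pre a \<omega> \<and> pre b \<omega>"
  unfolding filt_def by simp

lemma filtc_iff: "(\<lambda>a. a \<in> S) \<in> filtc \<and> S \<noteq> {} \<longleftrightarrow> filt S"
proof
  assume "(\<lambda>a. a \<in> S) \<in> filtc \<and> S \<noteq> {}"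
  then show "filt S" unfolding filtc_def filt_def mce_def by blast
next
  assume S: "filt S"
  have "\<exists>\<omega>\<in>mce a b. \<omega> \<in> S" if ab: "a \<in> S" "b \<in> S" for a b
  proof -
    obtain \<omega> where w: "\<omega> \<in> S" "pre a \<omega>" "pre b \<omega>" using filt_directed[OF S ab] by blast
    obtain \<kappa> where k: "pre a \<kappa>" "pre b \<kappa>" "pre \<kappa> \<omega>" "deg \<Lambda> \<kappa> = sup (deg \<Lambda> a) (deg \<Lambda> b)"
      by (rule pre_join[OF w(2,3)])
    then have "\<kappa> \<in> mce a b" by (simp add: mce_def)
    then show ?thesis using filt_hered[OF S k(3) w(1)] by blast
  qed
  then show "(\<lambda>a. a \<in> S) \<in> filtc \<and> S \<noteq> {}" using S unfolding filtc_def filt_def by blast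
qed

lemma filt_principal:
  assumes "\<mu> \<in> Mor \<Lambda>" shows "filt {\<kappa>. pre \<kappa> \<mu>}"
  unfolding filt_def using assms pre_refl pre_trans pre_Mor(1) by blast

text \<open>A finite test set \<open>L\<close> at \<open>x\<close> corresponds to an open box of the
  cube, so open covers can be transferred to the compact image of \<open>K\<close>.\<close>

lemma compactin_boundary:
  assumes "K \<subseteq> boundary_paths \<Lambda>" "closed ((\<lambda>x a. a \<in> init x) ` K)"
  shows "compactin (boundary_topology \<Lambda>) K"
  unfolding compactin_def
proof (intro conjI allI impI)
  show "K \<subseteq> topspace (boundary_topology \<Lambda>)" using assms topspace_boundary by simp
  fix \<U> assume U: "(\<forall>U\<in>\<U>. openin (boundary_topology \<Lambda>) U) \<and> K \<subseteq> \<Union>\<U>"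
  have "\<exists>U L. U \<in> \<U> \<and> finite L \<and> (\<forall>y\<in>boundary_paths \<Lambda>. init y \<inter> L = init x \<inter> L \<longrightarrow> y \<in> U)" if xK: "x \<in> K" for x
  proof -
    obtain V where V: "V \<in> \<U>" "x \<in> V" using U xK by blast
    then have "openin (boundary_topology \<Lambda>) V" using U by blast
    then show ?thesis using V unfolding openin_boundary_iff by blast
  qed
  then obtain U L where UL: "\<And>x. x \<in> K \<Longrightarrow> U x \<in> \<U>" "\<And>x. x \<in> K \<Longrightarrow> finite (L x)"
    "\<And>x y. x \<in> K \<Longrightarrow> y \<in> boundary_paths \<Lambda> \<Longrightarrow> init y \<inter> L x = init x \<inter> L x \<Longrightarrow> y \<in> U x" by metis
  define V where "V x = (\<Inter>a\<in>L x. {f. f a = (a \<in> init x)})" for x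
  have op: "open (V x)" if "x \<in> K" for x
    unfolding V_def using UL(2)[OF that] open_coordinate by (intro open_INT) auto
  have "compact ((\<lambda>x a. a \<in> init x) ` K)"
    using compact_Int_closed[OF compact_UNIV_fun_bool assms(2)] by simp
  then obtain C where C: "C \<subseteq> K" "finite C" "(\<lambda>x a. a \<in> init x) ` K \<subseteq> (\<Union>x\<in>C. V x)"
    by (rule compactE_image[of _ K V]) (use op in \<open>auto simp: V_def\<close>)
  have "K \<subseteq> \<Union>(U ` C)"
  proof
    fix y assume y: "y \<in> K"
    then obtain x where x: "x \<in> C" "(\<lambda>a. a \<in> init y) \<in> V x" using C(3) by blast
    then have "init y \<inter> L x = init x \<inter> L x" unfolding V_def by auto
    then show "y \<in> \<Union>(U ` C)" using UL(3) x(1) C(1) y assms(1) by blast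
  qed
  then show "\<exists>\<F>. finite \<F> \<and> \<F> \<subseteq> \<U> \<and> K \<subseteq> \<Union>\<F>" using C UL(1) by (intro exI[of _ "U ` C"]) auto
qed

lemma compactin_boundary_init:
  "compactin (boundary_topology \<Lambda>) {x \<in> boundary_paths \<Lambda>. \<mu> \<in> init x \<and> init x \<inter> A = {}}"
proof (rule compactin_boundary)
  let ?K = "{x \<in> boundary_paths \<Lambda>. \<mu> \<in> init x \<and> init x \<inter> A = {}}"
  define E where "E = {(\<nu>, B). finite B \<and> exhaustive \<Lambda> (src \<Lambda> \<nu>) B}"
  \<comment> \<open>\<open>f \<mu>\<close> excludes the empty set from \<open>filtc\<close>. The
    last factor is the boundary condition, closed because each \<open>B\<close> is finite.\<close>
  define C where "C = filtc \<inter> {f. f \<mu>} \<inter> {f. \<forall>a. f a \<longrightarrow> a \<notin> A}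
     \<inter> {f. \<forall>p. p \<in> E \<longrightarrow> f (fst p) \<longrightarrow> (\<exists>\<omega>\<in>(\<cdot>) (fst p) ` snd p. f \<omega>)}"
  have "(\<lambda>x a. a \<in> init x) ` ?K = C"
  proof (intro equalityI subsetI)
    fix f assume "f \<in> (\<lambda>x a. a \<in> init x) ` ?K"
    then obtain x where x: "x \<in> boundary_paths \<Lambda>" "\<mu> \<in> init x" "init x \<inter> A = {}" and f: "f = (\<lambda>a. a \<in> init x)"
      by blast
    have "f \<in> filtc" unfolding f using filtc_iff filt_init[OF boundary_paths[OF x(1)]] by blast
    moreover have "\<exists>\<omega>\<in>(\<cdot>) (fst p) ` snd p. f \<omega>" if "p \<in> E" "f (fst p)" for p
      using boundaryD[OF x(1)] that unfolding E_def f by auto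
    ultimately show "f \<in> C" using x unfolding C_def f by blast
  next
    fix f assume f: "f \<in> C"
    then have "filt {a. f a}" using filtc_iff[of "{a. f a}"] unfolding C_def by auto
    then obtain x where x: "x \<in> paths \<Lambda>" "init x = {a. f a}" using filt_path by blast
    have "\<exists>\<beta>\<in>B. \<nu> \<cdot> \<beta> \<in> init x" if "\<nu> \<in> init x" "finite B" "exhaustive \<Lambda> (src \<Lambda> \<nu>) B" for \<nu> B
    proof -
      have "(\<nu>, B) \<in> E" using that unfolding E_def by simp
      then show ?thesis using f that x(2) unfolding C_def by force
    qed
    then have "x \<in> ?K" using x f unfolding boundary_iff C_def by blast
    moreover have "f = (\<lambda>a. a \<in> init x)" using x by simp
    ultimately show "f \<in> (\<lambda>x a. a \<in> init x) ` ?K" by blast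
  qed
  moreover have "closed C"
  proof -
    have E: "finite (snd p)" if "p \<in> E" for p using that unfolding E_def by auto
    have "closed {f. p \<in> E \<longrightarrow> f (fst p) \<longrightarrow> (\<exists>\<omega>\<in>(\<cdot>) (fst p) ` snd p. f \<omega>)}" for p
    proof (cases "p \<in> E")
      case True
      then show ?thesis using open_coordinate[of "fst p" True]
        by (simp only: True simp_thms) (intro closed_Collect_imp closed_finite_Bex finite_imageI E True, simp_all)
    qed simp
    moreover have "closed {f :: 'a \<Rightarrow> bool. f a \<longrightarrow> a \<notin> A}" for a
      using open_coordinate[of a True] by (intro closed_Collect_imp closed_Collect_const) simp
    ultimately show ?thesis
      unfolding C_def by (intro closed_Int closed_filtc closed_coordinate closed_Collect_all)
  qed
  ultimately show "closed ((\<lambda>x a. a \<in> init x) ` ?K)" by simp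
qed auto

lemma compactin_Z: "compactin (boundary_topology \<Lambda>) {x \<in> boundary_paths \<Lambda>. \<mu> \<in> init x}"
  using compactin_boundary_init[of \<mu> "{}"] by simp

text \<open>A maximal filter is a boundary path: if \<open>B\<close> is finite and exhaustive at the source of a member
  \<open>\<mu>\<close>, then by finiteness some \<open>\<mu>\<beta>\<close> is compatible with all members,
  and compactness yields a filter containing it.\<close>

lemma boundary_nonempty:
  assumes v: "v \<in> vertices \<Lambda>"
  obtains x where "x \<in> boundary_paths \<Lambda>" "v \<in> init x"
proof -
  define \<F> where "\<F> = {S. filt S \<and> v \<in> S}"
  have "\<F> \<noteq> {}" using filt_principal[OF vertexD(1)[OF v]] pre_refl[OF vertexD(1)[OF v]] unfolding \<F>_def by blast
  moreover have "\<Union>C \<in> \<F>" if "C \<noteq> {}" "subset.chain \<F> C" for C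
  proof -
    have C: "\<And>S. S \<in> C \<Longrightarrow> filt S \<and> v \<in> S" "\<And>S T. S \<in> C \<Longrightarrow> T \<in> C \<Longrightarrow> S \<subseteq> T \<or> T \<subseteq> S"
      using that(2) unfolding subset.chain_def \<F>_def by auto
    have "filt (\<Union>C)"
      unfolding filt_def
    proof (intro conjI allI impI ballI)
      show "\<Union>C \<subseteq> Mor \<Lambda>" "\<Union>C \<noteq> {}" using C(1) that(1) unfolding filt_def by blast+
      show "\<mu> \<in> \<Union>C" if "pre \<mu> \<nu>" "\<nu> \<in> \<Union>C" for \<mu> \<nu> using C(1) that unfolding filt_def by blast
      fix \<mu> \<nu> assume "\<mu> \<in> \<Union>C" "\<nu> \<in> \<Union>C"
      then obtain S where "S \<in> C" "\<mu> \<in> S" "\<nu> \<in> S" using C(2) by blast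
      then show "\<exists>\<omega>\<in>\<Union>C. pre \<mu> \<omega> \<and> pre \<nu> \<omega>" using C(1) unfolding filt_def by blast
    qed
    then show ?thesis using C(1) that(1) unfolding \<F>_def by blast
  qed
  ultimately obtain M where M: "M \<in> \<F>" "\<And>S. S \<in> \<F> \<Longrightarrow> M \<subseteq> S \<Longrightarrow> S = M"
    using subset_Zorn_nonempty[of \<F>] by blast
  have fM: "filt M" "v \<in> M" using M(1) unfolding \<F>_def by auto
  obtain x where x: "x \<in> paths \<Lambda>" "init x = M" using filt_path[OF fM(1)] .
  have "\<exists>\<beta>\<in>B. \<mu> \<cdot> \<beta> \<in> M" if m: "\<mu> \<in> M" and B: "finite B" "exhaustive \<Lambda> (src \<Lambda> \<mu>) B" for \<mu> B
  proof -
    have mM: "\<mu> \<in> Mor \<Lambda>" using m fM(1) unfolding filt_def by blast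
    have b: "cpb \<mu> \<beta>" if "\<beta> \<in> B" for \<beta> using that B(2) mM by (auto simp: exhaustive_def starting_def)
    have "\<exists>\<beta>\<in>B. \<forall>\<nu>\<in>M. \<exists>\<omega>. pre (\<mu> \<cdot> \<beta>) \<omega> \<and> pre \<nu> \<omega>"
    proof (rule ccontr)
      assume "\<not> ?thesis"
      then obtain n where n: "\<And>\<beta>. \<beta> \<in> B \<Longrightarrow> n \<beta> \<in> M" "\<And>\<beta> \<omega>. \<beta> \<in> B \<Longrightarrow> pre (\<mu> \<cdot> \<beta>) \<omega> \<Longrightarrow> \<not> pre (n \<beta>) \<omega>"
        by metis
      \<comment> \<open>A member above \<open>\<mu>\<close> and above all the supposedly
        incompatible members at once; exhaustiveness at its cofactor over \<open>\<mu>\<close>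
        produces a \<open>\<beta>\<close> compatible with it, against the choice of
        \<open>n \<beta>\<close>.\<close>
      obtain \<omega> where w: "\<omega> \<in> M" "\<And>\<nu>. \<nu> \<in> insert \<mu> (n ` B) \<Longrightarrow> pre \<nu> \<omega>"
        using filt_ub[OF fM(1), of "insert \<mu> (n ` B)"] B(1) n(1) m by blast
      then obtain \<kappa> where k: "cpb \<mu> \<kappa>" "\<omega> = \<mu> \<cdot> \<kappa>" unfolding pre_def by blast
      then have "\<kappa> \<in> starting \<Lambda> (src \<Lambda> \<mu>)" by (simp add: starting_def)
      then obtain \<beta> \<psi> where bp: "\<beta> \<in> B" "pre \<kappa> \<psi>" "pre \<beta> \<psi>" using B(2) unfolding exhaustive_iff by blast
      have "pre \<omega> (\<mu> \<cdot> \<psi>)" "pre (\<mu> \<cdot> \<beta>) (\<mu> \<cdot> \<psi>)" using pre_left[OF k(1) bp(2)] pre_left[OF b[OF bp(1)] bp(3)] k(2) by auto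
      then show False using n(2)[OF bp(1)] w(2)[of "n \<beta>"] bp(1) pre_trans by blast
    qed
    then obtain \<beta> where bB: "\<beta> \<in> B" and comp: "\<And>\<nu>. \<nu> \<in> M \<Longrightarrow> \<exists>\<omega>. pre (\<mu> \<cdot> \<beta>) \<omega> \<and> pre \<nu> \<omega>" by blast
    define D where "D \<nu> = filtc \<inter> {f. f (\<mu> \<cdot> \<beta>)} \<inter> {f. f \<nu>}" for \<nu>
    have "UNIV \<inter> \<Inter>(D ` M) \<noteq> {}"
    proof (rule compact_imp_fip[OF compact_UNIV_fun_bool])
      show "closed T" if "T \<in> D ` M" for T
        using that unfolding D_def by (auto intro!: closed_Int closed_filtc closed_coordinate)
      fix F' assume "finite F'" "F' \<subseteq> D ` M"
      then obtain N where N: "N \<subseteq> M" "finite N" "F' = D ` N" by (meson finite_subset_image)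
      obtain \<nu> where n: "\<nu> \<in> M" "\<And>\<xi>. \<xi> \<in> N \<Longrightarrow> pre \<xi> \<nu>" using filt_ub[OF fM(1) N(2,1)] by blast
      \<comment> \<open>The principal filter of this common extension lies in the finite
        intersection, as \<open>\<nu>\<close> bounds all of \<open>N\<close>.\<close>
      obtain \<omega> where w: "pre (\<mu> \<cdot> \<beta>) \<omega>" "pre \<nu> \<omega>" using comp[OF n(1)] by blast
      have "(\<lambda>a. a \<in> {\<kappa>. pre \<kappa> \<omega>}) \<in> filtc" using filtc_iff filt_principal[OF pre_Mor(2)[OF w(1)]] by blast
      then have "(\<lambda>a. pre a \<omega>) \<in> UNIV \<inter> \<Inter>F'"
        using w n(2) pre_trans unfolding N(3) D_def by auto
      then show "UNIV \<inter> \<Inter>F' \<noteq> {}" by blast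
    qed
    then obtain f where f: "\<And>\<nu>. \<nu> \<in> M \<Longrightarrow> f \<in> D \<nu>" by blast
    then have f1: "f \<in> filtc" "f (\<mu> \<cdot> \<beta>)" "\<And>\<nu>. \<nu> \<in> M \<Longrightarrow> f \<nu>" using m unfolding D_def by auto
    then have "filt {a. f a}" using filtc_iff[of "{a. f a}"] by auto
    then have "{a. f a} = M" using M(2)[of "{a. f a}"] f1(3) fM(2) unfolding \<F>_def by blast
    then show ?thesis using f1(2) bB by blast
  qed
  then have "x \<in> boundary_paths \<Lambda>" unfolding boundary_iff using x by blast
  then show ?thesis using that x fM(2) by blast
qed

end

section \<open>Amenability\<close>

subsection \<open>Bounds for unordered sums of nonnegative functions\<close>

text \<open>Bounding all finite partial sums needs no summability proof and yields summability for
  nonnegative functions, whereas a bound on \<open>infsum\<close> alone would be empty: that value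
  is 0 for families without a sum.\<close>

definition fsum_le :: "('a \<Rightarrow> real) \<Rightarrow> 'a set \<Rightarrow> real \<Rightarrow> bool" where
  "fsum_le F A c \<longleftrightarrow> (\<forall>X. finite X \<longrightarrow> X \<subseteq> A \<longrightarrow> sum F X \<le> c)"

lemma fsum_leD: "fsum_le F A c \<Longrightarrow> finite X \<Longrightarrow> X \<subseteq> A \<Longrightarrow> sum F X \<le> c"
  by (simp add: fsum_le_def)

lemma fsum_le_has_sum:
  assumes "(F has_sum c) A" "\<And>a. a \<in> A \<Longrightarrow> 0 \<le> F a"
  shows "fsum_le F A c"
  unfolding fsum_le_def using finite_sum_le_has_sum[OF assms(1)] assms(2) by blast

lemma fsum_le_infsum:
  assumes "F summable_on A" "\<And>a. a \<in> A \<Longrightarrow> 0 \<le> F a"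
  shows "fsum_le F A (infsum F A)"
  using fsum_le_has_sum has_sum_infsum assms by blast

lemma fsum_le_summable:
  assumes "fsum_le F A c" "\<And>a. a \<in> A \<Longrightarrow> 0 \<le> F a"
  shows "F summable_on A" "infsum F A \<le> c"
proof -
  show *: "F summable_on A"
  proof (rule nonneg_bdd_above_summable_on)
    show "bdd_above (sum F ` {X. X \<subseteq> A \<and> finite X})"
      by (rule bdd_aboveI[of _ c]) (use assms(1) in \<open>auto simp: fsum_le_def\<close>)
  qed (rule assms(2))
  show "infsum F A \<le> c"
    by (rule infsum_le_finite_sums[OF *]) (rule fsum_leD[OF assms(1)])
qed

lemma fsum_le_mono:
  assumes "fsum_le H A c" "\<And>a. a \<in> A \<Longrightarrow> F a \<le> H a" "c \<le> d"
  shows "fsum_le F A d"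
  unfolding fsum_le_def
proof (intro allI impI)
  fix X assume X: "finite X" "X \<subseteq> A"
  have "sum F X \<le> sum H X" by (rule sum_mono) (use X assms(2) in auto)
  also have "\<dots> \<le> c" by (rule fsum_leD[OF assms(1) X])
  finally show "sum F X \<le> d" using assms(3) by simp
qed

lemma fsum_le_weaken: "fsum_le F A c \<Longrightarrow> c \<le> d \<Longrightarrow> fsum_le F A d"
  by (rule fsum_le_mono) auto

lemma fsum_le_add: "fsum_le F A c \<Longrightarrow> fsum_le H A d \<Longrightarrow> fsum_le (\<lambda>a. F a + H a) A (c + d)"
  unfolding fsum_le_def by (simp add: sum.distrib add_mono)

lemma fsum_le_sum:
  assumes "\<And>i. i \<in> I \<Longrightarrow> fsum_le (F i) A (c i)"
  shows "fsum_le (\<lambda>a. \<Sum>i\<in>I. F i a) A (\<Sum>i\<in>I. c i)"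
  unfolding fsum_le_def
proof (intro allI impI)
  fix X assume X: "finite X" "X \<subseteq> A"
  have "(\<Sum>a\<in>X. \<Sum>i\<in>I. F i a) = (\<Sum>i\<in>I. \<Sum>a\<in>X. F i a)" by (rule sum.swap)
  also have "\<dots> \<le> (\<Sum>i\<in>I. c i)" by (rule sum_mono) (use assms X fsum_leD in blast)
  finally show "(\<Sum>a\<in>X. \<Sum>i\<in>I. F i a) \<le> (\<Sum>i\<in>I. c i)" .
qed

lemma fsum_le_cmult: "fsum_le F A c \<Longrightarrow> 0 \<le> r \<Longrightarrow> fsum_le (\<lambda>a. r * F a) A (r * c)"
  unfolding fsum_le_def by (simp add: sum_distrib_left[symmetric] mult_left_mono)

lemma fsum_le_reindex:
  assumes "fsum_le F B c" "inj_on r A" "r ` A \<subseteq> B"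
  shows "fsum_le (\<lambda>a. F (r a)) A c"
  unfolding fsum_le_def
proof (intro allI impI)
  fix X assume X: "finite X" "X \<subseteq> A"
  have "(\<Sum>a\<in>X. F (r a)) = sum F (r ` X)"
    using sum.reindex[OF inj_on_subset[OF assms(2) X(2)], of F] by (simp add: o_def)
  also have "\<dots> \<le> c" using fsum_leD[OF assms(1)] X assms(3) by blast
  finally show "(\<Sum>a\<in>X. F (r a)) \<le> c" .
qed

lemma fsum_le_abs_diff:
  assumes "fsum_le F A c" "fsum_le H A d" "\<And>a. a \<in> A \<Longrightarrow> 0 \<le> F a" "\<And>a. a \<in> A \<Longrightarrow> 0 \<le> H a"
  shows "fsum_le (\<lambda>a. \<bar>F a - H a\<bar>) A (c + d)"
proof (rule fsum_le_mono[OF fsum_le_add[OF assms(1,2)]])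
  show "\<bar>F a - H a\<bar> \<le> F a + H a" if "a \<in> A" for a using assms(3,4)[OF that] by linarith
qed simp

lemma fsum_le_triangle:
  assumes "fsum_le (\<lambda>a. \<bar>F a - H a\<bar>) A c" "fsum_le (\<lambda>a. \<bar>H a - K a\<bar>) A d"
  shows "fsum_le (\<lambda>a. \<bar>F a - K a\<bar>) A (c + d)"
  by (rule fsum_le_mono[OF fsum_le_add[OF assms]]) auto

text \<open>The upper bound comes from the complementary class: it has at least the mass seen by
  \<open>X\<close>, and the total is \<open>c\<close>. So finitely many arguments locate the mass of
  a class from both sides.\<close>

lemma class_sum_bounds:
  fixes f :: "'a \<Rightarrow> real"
  assumes f: "(f has_sum c) A" "\<And>a. a \<in> A \<Longrightarrow> 0 \<le> f a" and X: "finite X" "X \<subseteq> A"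
  shows "sum f {a \<in> X. P a} \<le> (\<Sum>\<^sub>\<infinity>a\<in>{a \<in> A. P a}. f a)"
    "(\<Sum>\<^sub>\<infinity>a\<in>{a \<in> A. P a}. f a) \<le> c - sum f {a \<in> X. \<not> P a}"
proof -
  have s: "f summable_on B" if "B \<subseteq> A" for B
    using summable_on_subset_banach[OF has_sum_imp_summable[OF f(1)] that] .
  have lower: "sum f {a \<in> X. Q a} \<le> infsum f {a \<in> A. Q a}" for Q
    by (rule fsum_leD[OF fsum_le_infsum]) (use s f(2) X in auto)
  show "sum f {a \<in> X. P a} \<le> (\<Sum>\<^sub>\<infinity>a\<in>{a \<in> A. P a}. f a)" by (rule lower)
  have "infsum f ({a \<in> A. P a} \<union> {a \<in> A. \<not> P a}) = infsum f {a \<in> A. P a} + infsum f {a \<in> A. \<not> P a}"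
    by (rule infsum_Un_disjoint) (use s in auto)
  moreover have "{a \<in> A. P a} \<union> {a \<in> A. \<not> P a} = A" by blast
  ultimately show "(\<Sum>\<^sub>\<infinity>a\<in>{a \<in> A. P a}. f a) \<le> c - sum f {a \<in> X. \<not> P a}"
    using lower[of "\<lambda>a. \<not> P a"] infsumI[OF f(1)] by simp
qed

lemma has_sum_pushforward:
  fixes f :: "'a \<Rightarrow> real"
  assumes f: "(f has_sum c) A" "\<And>a. a \<in> A \<Longrightarrow> 0 \<le> f a" and \<kappa>: "\<kappa> ` A \<subseteq> B"
  shows "((\<lambda>b. \<Sum>\<^sub>\<infinity>a\<in>{a \<in> A. \<kappa> a = b}. f a) has_sum c) B"
proof (rule has_sum_SigmaD)
  let ?S = "Sigma B (\<lambda>b. {a \<in> A. \<kappa> a = b})"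
  have "bij_betw (\<lambda>a. (\<kappa> a, a)) A ?S"
    using \<kappa> by (auto simp: bij_betw_def inj_on_def)
  from has_sum_reindex_bij_betw[OF this, of "\<lambda>p. f (snd p)" c] f(1)
  show "((\<lambda>p. f (snd p)) has_sum c) ?S" by simp
  fix b assume "b \<in> B"
  have "f summable_on {a \<in> A. \<kappa> a = b}"
    by (rule summable_on_subset[OF has_sum_imp_summable[OF f(1)]]) auto
  then show "((\<lambda>a. f (snd (b, a))) has_sum (\<Sum>\<^sub>\<infinity>a\<in>{a \<in> A. \<kappa> a = b}. f a)) {a \<in> A. \<kappa> a = b}"
    by simp
qed

text \<open>Summing over classes does not increase the l1 distance. Here \<open>\<rho>\<close>
  matches the two index sets and \<open>\<sigma>\<close> the two sets of labels, so the class of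
  \<open>b\<close> corresponds to the class of \<open>\<sigma> b\<close>.\<close>

lemma fsum_le_pushforward:
  fixes f :: "'a \<Rightarrow> real" and f' :: "'c \<Rightarrow> real"
  assumes f: "f summable_on A" "\<And>a. a \<in> A \<Longrightarrow> 0 \<le> f a"
    and f': "f' summable_on A'" "\<And>a. a \<in> A' \<Longrightarrow> 0 \<le> f' a"
    and \<rho>: "bij_betw \<rho> A A'" and \<kappa>: "\<kappa> ` A \<subseteq> B" and \<sigma>: "inj_on \<sigma> B"
    and eq: "\<And>a. a \<in> A \<Longrightarrow> \<kappa>' (\<rho> a) = \<sigma> (\<kappa> a)"
    and le: "fsum_le (\<lambda>a. \<bar>f' (\<rho> a) - f a\<bar>) A c"
  shows "fsum_le (\<lambda>b. \<bar>(\<Sum>\<^sub>\<infinity>a\<in>{a \<in> A'. \<kappa>' a = \<sigma> b}. f' a) - (\<Sum>\<^sub>\<infinity>a\<in>{a \<in> A. \<kappa> a = b}. f a)\<bar>) B c"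
proof -
  let ?D = "\<lambda>a. \<bar>f' (\<rho> a) - f a\<bar>"
  note D = fsum_le_summable[OF le]
  have D1: "?D summable_on A" "infsum ?D A \<le> c" using D by simp_all
  have "((\<lambda>b. \<Sum>\<^sub>\<infinity>a\<in>{a \<in> A. \<kappa> a = b}. ?D a) has_sum infsum ?D A) B"
    by (rule has_sum_pushforward[OF has_sum_infsum[OF D1(1)] _ \<kappa>]) simp
  then have "fsum_le (\<lambda>b. \<Sum>\<^sub>\<infinity>a\<in>{a \<in> A. \<kappa> a = b}. ?D a) B (infsum ?D A)"
    by (rule fsum_le_has_sum) (simp add: infsum_nonneg)
  then show ?thesis
  proof (rule fsum_le_mono)
    fix b assume b: "b \<in> B"
    let ?A = "{a \<in> A. \<kappa> a = b}"
    have inj: "inj_on \<rho> ?A" using bij_betw_imp_inj_on[OF \<rho>] by (rule inj_on_subset) auto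
    have img: "{a \<in> A'. \<kappa>' a = \<sigma> b} = \<rho> ` ?A"
    proof (intro equalityI subsetI)
      fix a' assume a': "a' \<in> {a \<in> A'. \<kappa>' a = \<sigma> b}"
      then obtain a where a: "a \<in> A" "a' = \<rho> a" using \<rho> unfolding bij_betw_def by auto
      then have "\<sigma> (\<kappa> a) = \<sigma> b" using eq a' by auto
      then have "\<kappa> a = b" using \<sigma> b \<kappa> a(1) unfolding inj_on_def by blast
      then show "a' \<in> \<rho> ` ?A" using a by blast
    next
      fix a' assume "a' \<in> \<rho> ` ?A"
      then show "a' \<in> {a \<in> A'. \<kappa>' a = \<sigma> b}" using eq \<rho> unfolding bij_betw_def by auto
    qed
    have s': "(\<lambda>a. f' (\<rho> a)) summable_on ?A"
    proof -
      have "f' summable_on \<rho> ` ?A" by (rule summable_on_subset[OF f'(1)]) (use img in blast)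
      then show ?thesis using summable_on_reindex[OF inj, of f'] by (simp add: o_def)
    qed
    have s: "f summable_on ?A" "?D summable_on ?A"
      by (rule summable_on_subset[OF f(1)], blast, rule summable_on_subset[OF D1(1)], blast)
    have i: "infsum f' {a \<in> A'. \<kappa>' a = \<sigma> b} = (\<Sum>\<^sub>\<infinity>a\<in>?A. f' (\<rho> a))"
      unfolding img using infsum_reindex[OF inj, of f'] by (simp add: o_def)
    have "(\<Sum>\<^sub>\<infinity>a\<in>?A. f' (\<rho> a)) \<le> (\<Sum>\<^sub>\<infinity>a\<in>?A. f a + ?D a)"
      by (rule infsum_mono[OF s' summable_on_add[OF s]]) auto
    moreover have "(\<Sum>\<^sub>\<infinity>a\<in>?A. f a) \<le> (\<Sum>\<^sub>\<infinity>a\<in>?A. f' (\<rho> a) + ?D a)"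
      by (rule infsum_mono[OF s(1) summable_on_add[OF s' s(2)]]) auto
    ultimately show "\<bar>infsum f' {a \<in> A'. \<kappa>' a = \<sigma> b} - infsum f ?A\<bar> \<le> infsum ?D ?A"
      unfolding i infsum_add[OF s] infsum_add[OF s' s(2)] by simp
  qed (rule D1(2))
qed

subsection \<open>Amenability without filters\<close>

abbreviation fibre_density :: "('e, 'u) top_groupoid \<Rightarrow> ('e \<Rightarrow> real) \<Rightarrow> bool" where
  "fibre_density \<G> f \<equiv> continuous_map (arrow_top \<G>) euclideanreal f
     \<and> (\<forall>a\<in>topspace (arrow_top \<G>). 0 \<le> f a) \<and> (\<forall>u\<in>unit_set \<G>. (f has_sum 1) (source_fibre \<G> u))"

text \<open>Pairs \<open>(K, \<epsilon>)\<close> are directed under union and minimum, so one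
  density per pair already generates a filter. The assumptions make right translation an injection
  between source fibres; the differences then have partial sums at most 2 and are summable, so that
  the \<open>infsum\<close> in the definition is a genuine sum.\<close>

lemma amenable_groupoid_iff:
  assumes unit: "\<And>h. h \<in> topspace (arrow_top \<G>) \<Longrightarrow> grng \<G> h \<in> unit_set \<G> \<and> gsrc \<G> h \<in> unit_set \<G>"
    and mult: "\<And>h a. h \<in> topspace (arrow_top \<G>) \<Longrightarrow> a \<in> source_fibre \<G> (grng \<G> h)
        \<Longrightarrow> gmult \<G> a h \<in> source_fibre \<G> (gsrc \<G> h)"
    and inj: "\<And>h. h \<in> topspace (arrow_top \<G>) \<Longrightarrow> inj_on (\<lambda>a. gmult \<G> a h) (source_fibre \<G> (grng \<G> h))"
  shows "amenable_groupoid \<G> \<longleftrightarrow> (\<forall>K \<epsilon>. compactin (arrow_top \<G>) K \<longrightarrow> \<epsilon> > 0 \<longrightarrow>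
     (\<exists>f. fibre_density \<G> f \<and>
       (\<forall>h\<in>K. fsum_le (\<lambda>a. \<bar>f (gmult \<G> a h) - f a\<bar>) (source_fibre \<G> (grng \<G> h)) \<epsilon>)))"
proof
  assume "amenable_groupoid \<G>"
  then obtain F :: "('a \<Rightarrow> real) filter" where F: "F \<noteq> bot" "F \<le> principal {f. fibre_density \<G> f}"
    and K: "\<And>K. compactin (arrow_top \<G>) K \<Longrightarrow>
      uniform_limit K (\<lambda>f h. \<Sum>\<^sub>\<infinity>a\<in>source_fibre \<G> (grng \<G> h). \<bar>f (gmult \<G> a h) - f a\<bar>) (\<lambda>h. 0) F"
    unfolding amenable_groupoid_def by blast
  show "\<forall>K \<epsilon>. compactin (arrow_top \<G>) K \<longrightarrow> \<epsilon> > 0 \<longrightarrow>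
     (\<exists>f. fibre_density \<G> f \<and>
       (\<forall>h\<in>K. fsum_le (\<lambda>a. \<bar>f (gmult \<G> a h) - f a\<bar>) (source_fibre \<G> (grng \<G> h)) \<epsilon>))"
  proof (intro allI impI)
    fix K and \<epsilon> :: real assume comp: "compactin (arrow_top \<G>) K" and e: "\<epsilon> > 0"
    have "eventually (\<lambda>f. fibre_density \<G> f) F"
      using filter_leD[OF F(2), of "fibre_density \<G>"] by (simp add: eventually_principal)
    moreover have "eventually (\<lambda>f. \<forall>h\<in>K.
        dist (\<Sum>\<^sub>\<infinity>a\<in>source_fibre \<G> (grng \<G> h). \<bar>f (gmult \<G> a h) - f a\<bar>) 0 < \<epsilon>) F"
      using K[OF comp] e unfolding uniform_limit_iff by blast
    ultimately have "eventually (\<lambda>f. fibre_density \<G> f \<and> (\<forall>h\<in>K.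
        dist (\<Sum>\<^sub>\<infinity>a\<in>source_fibre \<G> (grng \<G> h). \<bar>f (gmult \<G> a h) - f a\<bar>) 0 < \<epsilon>)) F"
      by (rule eventually_conj)
    from eventually_happens'[OF F(1) this] obtain f where fd: "fibre_density \<G> f \<and> (\<forall>h\<in>K.
        dist (\<Sum>\<^sub>\<infinity>a\<in>source_fibre \<G> (grng \<G> h). \<bar>f (gmult \<G> a h) - f a\<bar>) 0 < \<epsilon>)"
      by (rule exE)
    note f = conjunct1[OF fd] and d = bspec[OF conjunct2[OF fd]]
    have "fsum_le (\<lambda>a. \<bar>f (gmult \<G> a h) - f a\<bar>) (source_fibre \<G> (grng \<G> h)) \<epsilon>" if h: "h \<in> K" for h
    proof -
      have hG: "h \<in> topspace (arrow_top \<G>)" using comp h unfolding compactin_def by blast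
      let ?A = "source_fibre \<G> (grng \<G> h)" and ?B = "source_fibre \<G> (gsrc \<G> h)"
      have nn: "\<And>u a. a \<in> source_fibre \<G> u \<Longrightarrow> 0 \<le> f a" using f unfolding source_fibre_def by blast
      have "fsum_le f ?A 1" "fsum_le f ?B 1"
        using f unit[OF hG] nn by (auto intro!: fsum_le_has_sum)
      moreover from this(2) have "fsum_le (\<lambda>a. f (gmult \<G> a h)) ?A 1"
        by (rule fsum_le_reindex[OF _ inj[OF hG]]) (use mult[OF hG] in auto)
      ultimately have "fsum_le (\<lambda>a. \<bar>f (gmult \<G> a h) - f a\<bar>) ?A (1 + 1)"
        by (intro fsum_le_abs_diff) (use nn mult[OF hG] in auto)
      then have s: "(\<lambda>a. \<bar>f (gmult \<G> a h) - f a\<bar>) summable_on ?A"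
        by (rule fsum_le_summable(1)) simp
      have "infsum (\<lambda>a. \<bar>f (gmult \<G> a h) - f a\<bar>) ?A \<le> \<epsilon>" using d[OF h] by (simp add: dist_real_def)
      with fsum_le_infsum[OF s] show ?thesis by (auto intro: fsum_le_weaken)
    qed
    with f show "\<exists>f. fibre_density \<G> f \<and>
       (\<forall>h\<in>K. fsum_le (\<lambda>a. \<bar>f (gmult \<G> a h) - f a\<bar>) (source_fibre \<G> (grng \<G> h)) \<epsilon>)" by blast
  qed
next
  assume *: "\<forall>K \<epsilon>. compactin (arrow_top \<G>) K \<longrightarrow> \<epsilon> > 0 \<longrightarrow>
     (\<exists>f. fibre_density \<G> f \<and>
       (\<forall>h\<in>K. fsum_le (\<lambda>a. \<bar>f (gmult \<G> a h) - f a\<bar>) (source_fibre \<G> (grng \<G> h)) \<epsilon>))"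
  define S where "S p = {f. fibre_density \<G> f \<and> (\<forall>h\<in>fst p.
      fsum_le (\<lambda>a. \<bar>f (gmult \<G> a h) - f a\<bar>) (source_fibre \<G> (grng \<G> h)) (snd p))}" for p :: "'a set \<times> real"
  define B where "B = {p. compactin (arrow_top \<G>) (fst p) \<and> snd p > (0::real)}"
  define F where "F = (INF p\<in>B. principal (S p))"
  have ne: "({}, 1) \<in> B" unfolding B_def by simp
  have base: "eventually P F \<longleftrightarrow> (\<exists>p\<in>B. eventually P (principal (S p)))" for P
    unfolding F_def
  proof (rule eventually_INF_base)
    fix p q assume pq: "p \<in> B" "q \<in> B"
    show "\<exists>x\<in>B. principal (S x) \<le> inf (principal (S p)) (principal (S q))"
    proof (intro bexI)
      let ?x = "(fst p \<union> fst q, min (snd p) (snd q))"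
      show "?x \<in> B" using pq unfolding B_def by (simp add: compactin_Un)
      have "fsum_le H A (min (snd p) (snd q)) \<Longrightarrow> fsum_le H A (snd p)"
        "fsum_le H A (min (snd p) (snd q)) \<Longrightarrow> fsum_le H A (snd q)" for H and A :: "'a set"
        by (erule fsum_le_weaken, simp)+
      note w = this
      have "S ?x \<subseteq> S p \<inter> S q"
      proof
        fix f assume "f \<in> S ?x"
        then have "fibre_density \<G> f" and le: "\<And>h. h \<in> fst p \<union> fst q \<Longrightarrow>
            fsum_le (\<lambda>a. \<bar>f (gmult \<G> a h) - f a\<bar>) (source_fibre \<G> (grng \<G> h)) (min (snd p) (snd q))"
          unfolding S_def by simp_all
        then show "f \<in> S p \<inter> S q" unfolding S_def using w(1)[OF le] w(2)[OF le] by simp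
      qed
      then show "principal (S ?x) \<le> inf (principal (S p)) (principal (S q))" by simp
    qed
  qed (use ne in blast)
  have Sne: "S p \<noteq> {}" if "p \<in> B" for p
    using * that unfolding B_def S_def by auto
  have "F \<noteq> bot"
    unfolding trivial_limit_def base using Sne by (auto simp: eventually_principal)
  moreover have "F \<le> principal {f. fibre_density \<G> f}"
    unfolding le_principal base using ne by (auto simp: eventually_principal S_def)
  moreover have "uniform_limit K (\<lambda>f h. \<Sum>\<^sub>\<infinity>a\<in>source_fibre \<G> (grng \<G> h). \<bar>f (gmult \<G> a h) - f a\<bar>) (\<lambda>h. 0) F"
    if K: "compactin (arrow_top \<G>) K" for K
    unfolding uniform_limit_iff
  proof (intro allI impI)
    fix e :: real assume e: "e > 0"
    have "(K, e / 2) \<in> B" using K e unfolding B_def by simp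
    moreover have "eventually (\<lambda>f. \<forall>h\<in>K.
        dist (\<Sum>\<^sub>\<infinity>a\<in>source_fibre \<G> (grng \<G> h). \<bar>f (gmult \<G> a h) - f a\<bar>) 0 < e) (principal (S (K, e / 2)))"
      unfolding eventually_principal
    proof (intro ballI)
      fix f h assume "f \<in> S (K, e / 2)" "h \<in> K"
      then have "fsum_le (\<lambda>a. \<bar>f (gmult \<G> a h) - f a\<bar>) (source_fibre \<G> (grng \<G> h)) (e / 2)"
        unfolding S_def by simp
      then have "(\<Sum>\<^sub>\<infinity>a\<in>source_fibre \<G> (grng \<G> h). \<bar>f (gmult \<G> a h) - f a\<bar>) \<le> e / 2"
        by (rule fsum_le_summable(2)) simp
      then show "dist (\<Sum>\<^sub>\<infinity>a\<in>source_fibre \<G> (grng \<G> h). \<bar>f (gmult \<G> a h) - f a\<bar>) 0 < e"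
        using e infsum_nonneg[of "source_fibre \<G> (grng \<G> h)" "\<lambda>a. \<bar>f (gmult \<G> a h) - f a\<bar>"]
        by (simp add: dist_real_def)
    qed
    ultimately show "eventually (\<lambda>f. \<forall>h\<in>K.
        dist (\<Sum>\<^sub>\<infinity>a\<in>source_fibre \<G> (grng \<G> h). \<bar>f (gmult \<G> a h) - f a\<bar>) 0 < e) F"
      unfolding base by blast
  qed
  ultimately show "amenable_groupoid \<G>" unfolding amenable_groupoid_def by blast
qed

lemma continuous_map_discrete_times:
  assumes "\<And>g. g \<in> A \<Longrightarrow> continuous_map X Y (\<lambda>x. f (g, x))"
  shows "continuous_map (prod_topology (discrete_topology A) X) Y f"
  unfolding continuous_map_def
proof (intro conjI allI impI)
  show "f \<in> topspace (prod_topology (discrete_topology A) X) \<rightarrow> topspace Y"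
    using assms by (force simp: continuous_map_def Pi_iff)
  fix U assume U: "openin Y U"
  have "{p \<in> topspace (prod_topology (discrete_topology A) X). f p \<in> U}
      = (\<Union>g\<in>A. {g} \<times> {x \<in> topspace X. f (g, x) \<in> U})" by auto
  moreover have "openin (prod_topology (discrete_topology A) X) ({g} \<times> {x \<in> topspace X. f (g, x) \<in> U})"
    if "g \<in> A" for g
    using assms[OF that] U that unfolding continuous_map_def openin_prod_Times_iff by auto
  ultimately show "openin (prod_topology (discrete_topology A) X)
      {p \<in> topspace (prod_topology (discrete_topology A) X). f p \<in> U}" by auto
qed

text \<open>The group is discrete, so a compact set of arrows lies in a rectangle
  \<open>S \<times> C\<close> with \<open>S\<close> finite. Here \<open>f g x\<close> is the weight
  of the arrow \<open>(g, x)\<close>, whose source is \<open>x\<close>.\<close>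

lemma amenable_action_iff:
  fixes G (structure)
  assumes "group G" and act: "\<And>g x. g \<in> carrier G \<Longrightarrow> x \<in> topspace X \<Longrightarrow> \<phi> g x \<in> topspace X"
  shows "amenable_action G X \<phi> \<longleftrightarrow> (\<forall>S C \<epsilon>. finite S \<longrightarrow> S \<subseteq> carrier G \<longrightarrow> compactin X C \<longrightarrow> \<epsilon> > 0 \<longrightarrow>
     (\<exists>f. (\<forall>g\<in>carrier G. continuous_map X euclideanreal (f g)) \<and> (\<forall>g\<in>carrier G. \<forall>x\<in>topspace X. 0 \<le> f g x)
        \<and> (\<forall>x\<in>topspace X. ((\<lambda>g. f g x) has_sum 1) (carrier G))
        \<and> (\<forall>h\<in>S. \<forall>x\<in>C. fsum_le (\<lambda>g. \<bar>f (g \<otimes> h) x - f g (\<phi> h x)\<bar>) (carrier G) \<epsilon>)))"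
proof -
  interpret group G by fact
  let ?T = "transformation_groupoid G X \<phi>"
  have arr: "arrow_top ?T = prod_topology (discrete_topology (carrier G)) X" "unit_set ?T = topspace X"
    "gsrc ?T p = snd p" "grng ?T p = \<phi> (fst p) (snd p)"
    "gmult ?T p q = (fst p \<otimes> fst q, snd q)" for p q
    unfolding transformation_groupoid_def by (auto simp: case_prod_unfold)
  have fib: "source_fibre ?T u = (\<lambda>g. (g, u)) ` carrier G" if "u \<in> topspace X" for u
    using that unfolding source_fibre_def arr by auto
  have inj: "inj_on (\<lambda>g. (g, u)) (carrier G)" if "u \<in> topspace X" for u by (rule inj_onI) simp
  have dens: "fibre_density ?T f \<longleftrightarrow> (\<forall>g\<in>carrier G. continuous_map X euclideanreal (\<lambda>x. f (g, x)))
      \<and> (\<forall>g\<in>carrier G. \<forall>x\<in>topspace X. 0 \<le> f (g, x)) \<and> (\<forall>x\<in>topspace X. ((\<lambda>g. f (g, x)) has_sum 1) (carrier G))" for f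
  proof -
    have "continuous_map (prod_topology (discrete_topology (carrier G)) X) euclideanreal f
      \<longleftrightarrow> (\<forall>g\<in>carrier G. continuous_map X euclideanreal (\<lambda>x. f (g, x)))"
    proof (intro iffI ballI)
      fix g assume f: "continuous_map (prod_topology (discrete_topology (carrier G)) X) euclideanreal f"
        and g: "g \<in> carrier G"
      have "continuous_map X (prod_topology (discrete_topology (carrier G)) X) (\<lambda>x. (g, x))"
        using g by (simp add: continuous_map_pairwise o_def)
      from continuous_map_compose[OF this f] show "continuous_map X euclideanreal (\<lambda>x. f (g, x))"
        by (simp add: o_def)
    qed (rule continuous_map_discrete_times, blast)
    moreover have "(f has_sum 1) (source_fibre ?T u) \<longleftrightarrow> ((\<lambda>g. f (g, u)) has_sum 1) (carrier G)"
      if "u \<in> topspace X" for u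
      unfolding fib[OF that] has_sum_reindex[OF inj[OF that]] by (simp add: o_def)
    ultimately show ?thesis unfolding arr by auto
  qed
  have red: "fsum_le (\<lambda>a. \<bar>f (gmult ?T a p) - f a\<bar>) (source_fibre ?T (grng ?T p)) \<epsilon> \<longleftrightarrow>
      fsum_le (\<lambda>g. \<bar>f (g \<otimes> fst p, snd p) - f (g, \<phi> (fst p) (snd p))\<bar>) (carrier G) \<epsilon>"
    if p: "fst p \<in> carrier G" "snd p \<in> topspace X" for p f \<epsilon>
  proof
    assume "fsum_le (\<lambda>a. \<bar>f (gmult ?T a p) - f a\<bar>) (source_fibre ?T (grng ?T p)) \<epsilon>"
    from fsum_le_reindex[OF this[unfolded arr fib[OF act[OF p]]] inj[OF act[OF p]]]
    show "fsum_le (\<lambda>g. \<bar>f (g \<otimes> fst p, snd p) - f (g, \<phi> (fst p) (snd p))\<bar>) (carrier G) \<epsilon>" by simp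
  next
    assume r: "fsum_le (\<lambda>g. \<bar>f (g \<otimes> fst p, snd p) - f (g, \<phi> (fst p) (snd p))\<bar>) (carrier G) \<epsilon>"
    have "fsum_le (\<lambda>a. \<bar>f (fst a \<otimes> fst p, snd p) - f (fst a, \<phi> (fst p) (snd p))\<bar>) (source_fibre ?T (grng ?T p)) \<epsilon>"
      unfolding arr fib[OF act[OF p]] by (rule fsum_le_reindex[OF r]) (auto simp: inj_on_def)
    then show "fsum_le (\<lambda>a. \<bar>f (gmult ?T a p) - f a\<bar>) (source_fibre ?T (grng ?T p)) \<epsilon>"
      unfolding arr fib[OF act[OF p]] by (rule fsum_le_mono) auto
  qed
  have "amenable_action G X \<phi> \<longleftrightarrow> (\<forall>K \<epsilon>. compactin (arrow_top ?T) K \<longrightarrow> \<epsilon> > 0 \<longrightarrow>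
     (\<exists>f. fibre_density ?T f \<and>
       (\<forall>h\<in>K. fsum_le (\<lambda>a. \<bar>f (gmult ?T a h) - f a\<bar>) (source_fibre ?T (grng ?T h)) \<epsilon>)))"
    unfolding amenable_action_def
  proof (rule amenable_groupoid_iff)
    fix p assume "p \<in> topspace (arrow_top ?T)"
    then have p: "fst p \<in> carrier G" "snd p \<in> topspace X" unfolding arr by auto
    show "grng ?T p \<in> unit_set ?T \<and> gsrc ?T p \<in> unit_set ?T" unfolding arr using p act by simp
    show "gmult ?T a p \<in> source_fibre ?T (gsrc ?T p)" if "a \<in> source_fibre ?T (grng ?T p)" for a
      using that p unfolding arr fib[OF p(2)] fib[OF act[OF p]] by auto
    show "inj_on (\<lambda>a. gmult ?T a p) (source_fibre ?T (grng ?T p))"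
      using p unfolding arr fib[OF act[OF p]] by (auto simp: inj_on_def)
  qed
  also have "\<dots> \<longleftrightarrow> (\<forall>S C \<epsilon>. finite S \<longrightarrow> S \<subseteq> carrier G \<longrightarrow> compactin X C \<longrightarrow> \<epsilon> > 0 \<longrightarrow>
     (\<exists>f. (\<forall>g\<in>carrier G. continuous_map X euclideanreal (f g)) \<and> (\<forall>g\<in>carrier G. \<forall>x\<in>topspace X. 0 \<le> f g x)
        \<and> (\<forall>x\<in>topspace X. ((\<lambda>g. f g x) has_sum 1) (carrier G))
        \<and> (\<forall>h\<in>S. \<forall>x\<in>C. fsum_le (\<lambda>g. \<bar>f (g \<otimes> h) x - f g (\<phi> h x)\<bar>) (carrier G) \<epsilon>)))"
    (is "?L \<longleftrightarrow> ?R")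
  proof
    assume L: ?L
    show ?R
    proof (intro allI impI)
      fix S C and \<epsilon> :: real
      assume S: "finite S" "S \<subseteq> carrier G" "compactin X C" "\<epsilon> > 0"
      have "compactin (arrow_top ?T) (S \<times> C)"
        unfolding arr compactin_Times using S by (simp add: compactin_discrete_topology)
      from L[rule_format, OF this S(4)] obtain f where f0: "fibre_density ?T f \<and>
        (\<forall>h\<in>S \<times> C. fsum_le (\<lambda>a. \<bar>f (gmult ?T a h) - f a\<bar>) (source_fibre ?T (grng ?T h)) \<epsilon>)"
        by (rule exE)
      note f = conjunct1[OF f0] bspec[OF conjunct2[OF f0]]
      have "fsum_le (\<lambda>g. \<bar>f (g \<otimes> h, x) - f (g, \<phi> h x)\<bar>) (carrier G) \<epsilon>" if "h \<in> S" "x \<in> C" for h x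
        using f(2)[of "(h, x)"] red[of "(h, x)"] that S(2) compactin_subset_topspace[OF S(3)] by auto
      then show "\<exists>f. (\<forall>g\<in>carrier G. continuous_map X euclideanreal (f g)) \<and> (\<forall>g\<in>carrier G. \<forall>x\<in>topspace X. 0 \<le> f g x)
        \<and> (\<forall>x\<in>topspace X. ((\<lambda>g. f g x) has_sum 1) (carrier G))
        \<and> (\<forall>h\<in>S. \<forall>x\<in>C. fsum_le (\<lambda>g. \<bar>f (g \<otimes> h) x - f g (\<phi> h x)\<bar>) (carrier G) \<epsilon>)"
        using f(1) unfolding dens by (intro exI[of _ "\<lambda>g x. f (g, x)"]) simp
    qed
  next
    assume R: ?R
    show ?L
    proof (intro allI impI)
      fix K and \<epsilon> :: real
      assume K: "compactin (arrow_top ?T) K" "\<epsilon> > 0"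
      have "compactin (discrete_topology (carrier G)) (fst ` K)"
        by (rule image_compactin[OF K(1)]) (simp add: arr continuous_map_fst)
      then have S: "finite (fst ` K)" "fst ` K \<subseteq> carrier G" by (auto simp: compactin_discrete_topology)
      have C: "compactin X (snd ` K)"
        by (rule image_compactin[OF K(1)]) (simp add: arr continuous_map_snd)
      obtain f where f: "(\<forall>g\<in>carrier G. continuous_map X euclideanreal (f g))"
        "(\<forall>g\<in>carrier G. \<forall>x\<in>topspace X. 0 \<le> f g x)"
        "(\<forall>x\<in>topspace X. ((\<lambda>g. f g x) has_sum 1) (carrier G))"
        "\<forall>h\<in>fst ` K. \<forall>x\<in>snd ` K. fsum_le (\<lambda>g. \<bar>f (g \<otimes> h) x - f g (\<phi> h x)\<bar>) (carrier G) \<epsilon>"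
        using R[rule_format, OF S C K(2)] by (elim exE conjE)
      have "fibre_density ?T (\<lambda>p. f (fst p) (snd p))" unfolding dens using f by simp
      moreover have "fsum_le (\<lambda>a. \<bar>(\<lambda>p. f (fst p) (snd p)) (gmult ?T a h) - (\<lambda>p. f (fst p) (snd p)) a\<bar>)
          (source_fibre ?T (grng ?T h)) \<epsilon>" if h: "h \<in> K" for h
      proof -
        have "fst h \<in> fst ` K" "snd h \<in> snd ` K" using h by auto
        moreover from this have "fst h \<in> carrier G" "snd h \<in> topspace X"
          using S(2) compactin_subset_topspace[OF C] by blast+
        ultimately show ?thesis using red[of h "\<lambda>p. f (fst p) (snd p)" \<epsilon>] f(4) by simp
      qed
      ultimately show "\<exists>f. fibre_density ?T f \<and>
       (\<forall>h\<in>K. fsum_le (\<lambda>a. \<bar>f (gmult ?T a h) - f a\<bar>) (source_fibre ?T (grng ?T h)) \<epsilon>)" by blast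
    qed
  qed
  finally show ?thesis .
qed

lemma amenable_group_iff:
  fixes G (structure)
  assumes "group G"
  shows "amenable_group G \<longleftrightarrow> (\<forall>S \<epsilon>. finite S \<longrightarrow> S \<subseteq> carrier G \<longrightarrow> \<epsilon> > 0 \<longrightarrow>
     (\<exists>f. (\<forall>g\<in>carrier G. 0 \<le> f g) \<and> (f has_sum 1) (carrier G)
        \<and> (\<forall>h\<in>S. fsum_le (\<lambda>g. \<bar>f (g \<otimes> h) - f g\<bar>) (carrier G) \<epsilon>)))"
proof -
  interpret group G by fact
  let ?T = "group_groupoid G"
  have arr: "arrow_top ?T = discrete_topology (carrier G)" "unit_set ?T = UNIV" "gmult ?T = (\<otimes>)"
    and fib: "source_fibre ?T u = carrier G" for u
    unfolding group_groupoid_def source_fibre_def by auto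
  have "amenable_group G \<longleftrightarrow> (\<forall>K \<epsilon>. compactin (arrow_top ?T) K \<longrightarrow> \<epsilon> > 0 \<longrightarrow>
     (\<exists>f. fibre_density ?T f \<and>
       (\<forall>h\<in>K. fsum_le (\<lambda>a. \<bar>f (gmult ?T a h) - f a\<bar>) (source_fibre ?T (grng ?T h)) \<epsilon>)))"
    unfolding amenable_group_def
  proof (rule amenable_groupoid_iff)
    fix h assume "h \<in> topspace (arrow_top ?T)"
    then have h: "h \<in> carrier G" unfolding arr by simp
    show "grng ?T h \<in> unit_set ?T \<and> gsrc ?T h \<in> unit_set ?T" unfolding arr by simp
    show "gmult ?T a h \<in> source_fibre ?T (gsrc ?T h)" if "a \<in> source_fibre ?T (grng ?T h)" for a
      using that h unfolding arr fib by simp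
    show "inj_on (\<lambda>a. gmult ?T a h) (source_fibre ?T (grng ?T h))"
      using h unfolding arr fib by (auto simp: inj_on_def)
  qed
  also have "\<dots> \<longleftrightarrow> (\<forall>S \<epsilon>. finite S \<longrightarrow> S \<subseteq> carrier G \<longrightarrow> \<epsilon> > 0 \<longrightarrow>
     (\<exists>f. (\<forall>g\<in>carrier G. 0 \<le> f g) \<and> (f has_sum 1) (carrier G)
        \<and> (\<forall>h\<in>S. fsum_le (\<lambda>g. \<bar>f (g \<otimes> h) - f g\<bar>) (carrier G) \<epsilon>)))"
    unfolding arr fib compactin_discrete_topology by (simp add: arr) blast
  finally show ?thesis .
qed

subsection \<open>Actions on the boundary and vertex stabilizers\<close>

lemma has_sum_finite_sum:
  fixes F :: "'i \<Rightarrow> 'a \<Rightarrow> real"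
  assumes "finite I" "\<And>i. i \<in> I \<Longrightarrow> (F i has_sum c i) A"
  shows "((\<lambda>a. \<Sum>i\<in>I. F i a) has_sum (\<Sum>i\<in>I. c i)) A"
  using assms by induction (auto intro: has_sum_add)

lemma fsum_le_extend:
  assumes "fsum_le F H c"
  shows "fsum_le (\<lambda>a. if a \<in> H then F a else 0) A c"
  unfolding fsum_le_def
proof (intro allI impI)
  fix X assume X: "finite X" "X \<subseteq> A"
  have "(\<Sum>a\<in>X. if a \<in> H then F a else 0) = sum F (X \<inter> H)" using sum.inter_restrict[OF X(1), of F H] by simp
  also have "\<dots> \<le> c" using fsum_leD[OF assms, of "X \<inter> H"] X by simp
  finally show "(\<Sum>a\<in>X. if a \<in> H then F a else 0) \<le> c" .
qed

lemma (in group) bij_betw_r_mult: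
  assumes "c \<in> carrier G" shows "bij_betw (\<lambda>g. g \<otimes> c) (carrier G) (carrier G)"
  by (rule bij_betw_byWitness[where f' = "\<lambda>g. g \<otimes> inv c"]) (use assms in \<open>auto simp: m_assoc\<close>)

lemma (in group) subgroup_r_mult_iff:
  assumes "subgroup H G" "k \<in> H" "m \<in> carrier G"
  shows "m \<otimes> k \<in> H \<longleftrightarrow> m \<in> H"
proof
  assume "m \<otimes> k \<in> H"
  then have "m \<otimes> k \<otimes> inv k \<in> H" using assms by (meson subgroup.m_closed subgroup.m_inv_closed)
  then show "m \<in> H" using assms subgroup.mem_carrier[OF assms(1)] by (simp add: m_assoc)
qed (rule subgroup.m_closed[OF assms(1) _ assms(2)])

text \<open>With \<open>t g\<close> a chosen element of the coset \<open>g <# H\<close>, take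
  \<open>\<kappa> g = inv (t g) \<otimes> g\<close>. Densities on the group are pushed to the
  subgroup along this equivariant map.\<close>

lemma (in group) coset_transversal:
  assumes H: "subgroup H G"
  obtains \<kappa> where "\<And>g. g \<in> carrier G \<Longrightarrow> \<kappa> g \<in> H"
    "\<And>g h. g \<in> carrier G \<Longrightarrow> h \<in> H \<Longrightarrow> \<kappa> (g \<otimes> h) = \<kappa> g \<otimes> h"
proof -
  define t where "t g = (SOME t. t \<in> g <# H)" for g
  have HG: "H \<subseteq> carrier G" using subgroup.subset[OF H] .
  have t: "\<exists>h\<in>H. t g = g \<otimes> h" if "g \<in> carrier G" for g
  proof -
    have "g \<otimes> \<one> \<in> g <# H" using subgroup.one_closed[OF H] unfolding l_coset_def by blast
    then have "t g \<in> g <# H" unfolding t_def by (rule someI)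
    then show ?thesis unfolding l_coset_def by blast
  qed
  have inv: "t (g \<otimes> h) = t g" if "g \<in> carrier G" "h \<in> H" for g h
  proof -
    have "(g \<otimes> h) <# H = g <# (h <# H)" using lcos_m_assoc[OF HG] that HG by auto
    also have "h <# H = H" using coset_join3[OF _ H that(2)] that(2) HG by blast
    finally show ?thesis unfolding t_def by simp
  qed
  show ?thesis
  proof (rule that[of "\<lambda>g. inv (t g) \<otimes> g"])
    fix g assume g: "g \<in> carrier G"
    obtain h where h: "h \<in> H" "t g = g \<otimes> h" using t[OF g] by blast
    then have hc: "h \<in> carrier G" using HG by blast
    have "inv (t g) \<otimes> g = inv h" using h hc g by (simp add: inv_mult_group m_assoc)
    then show "inv (t g) \<otimes> g \<in> H" using h subgroup.m_inv_closed[OF H] by simp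
    fix h' assume h': "h' \<in> H"
    then show "inv (t (g \<otimes> h')) \<otimes> (g \<otimes> h') = inv (t g) \<otimes> g \<otimes> h'"
      using inv[OF g h'] h hc g HG by (simp add: m_assoc subset_iff)
  qed
qed

context fa_kgraph
begin

lemma continuous_map_boundary_iff:
  assumes "X \<subseteq> boundary_paths \<Lambda>"
  shows "continuous_map (subtopology (boundary_topology \<Lambda>) X) euclideanreal f \<longleftrightarrow>
     (\<forall>x\<in>X. \<forall>\<epsilon>>0. \<exists>L. finite L \<and> (\<forall>y\<in>X. init y \<inter> L = init x \<inter> L \<longrightarrow> \<bar>f y - f x\<bar> < \<epsilon>))"
proof
  assume f: "continuous_map (subtopology (boundary_topology \<Lambda>) X) euclideanreal f"
  show "\<forall>x\<in>X. \<forall>\<epsilon>>0. \<exists>L. finite L \<and> (\<forall>y\<in>X. init y \<inter> L = init x \<inter> L \<longrightarrow> \<bar>f y - f x\<bar> < \<epsilon>)"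
  proof (intro ballI allI impI)
    fix x and \<epsilon> :: real assume x: "x \<in> X" and e: "\<epsilon> > 0"
    have "openin (subtopology (boundary_topology \<Lambda>) X)
        {y \<in> topspace (subtopology (boundary_topology \<Lambda>) X). f y \<in> ball (f x) \<epsilon>}"
      using f unfolding continuous_map_def by auto
    then obtain T where T: "openin (boundary_topology \<Lambda>) T"
      "{y \<in> topspace (subtopology (boundary_topology \<Lambda>) X). f y \<in> ball (f x) \<epsilon>} = T \<inter> X"
      unfolding openin_subtopology by blast
    have top: "topspace (subtopology (boundary_topology \<Lambda>) X) = X" using assms topspace_boundary by auto
    then have "x \<in> T" using T(2) x e by auto
    then obtain L where "finite L" "\<forall>y\<in>boundary_paths \<Lambda>. init y \<inter> L = init x \<inter> L \<longrightarrow> y \<in> T"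
      using T(1) unfolding openin_boundary_iff by blast
    moreover have "\<bar>f y - f x\<bar> < \<epsilon>" if "y \<in> T" "y \<in> X" for y
    proof -
      have "f y \<in> ball (f x) \<epsilon>" using T(2) that by blast
      then show ?thesis by (simp add: dist_real_def abs_minus_commute)
    qed
    ultimately show "\<exists>L. finite L \<and> (\<forall>y\<in>X. init y \<inter> L = init x \<inter> L \<longrightarrow> \<bar>f y - f x\<bar> < \<epsilon>)"
      using assms by (intro exI[of _ L]) blast
  qed
next
  assume *: "\<forall>x\<in>X. \<forall>\<epsilon>>0. \<exists>L. finite L \<and> (\<forall>y\<in>X. init y \<inter> L = init x \<inter> L \<longrightarrow> \<bar>f y - f x\<bar> < \<epsilon>)"
  show "continuous_map (subtopology (boundary_topology \<Lambda>) X) euclideanreal f"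
    unfolding continuous_map_def
  proof (intro conjI allI impI)
    fix U assume "openin euclideanreal U"
    then have U: "open U" by simp
    have top: "topspace (subtopology (boundary_topology \<Lambda>) X) = X" using assms topspace_boundary by auto
    show "openin (subtopology (boundary_topology \<Lambda>) X) {y \<in> topspace (subtopology (boundary_topology \<Lambda>) X). f y \<in> U}"
      unfolding top
    proof (subst openin_subopen, intro ballI)
      fix x assume "x \<in> {y \<in> X. f y \<in> U}"
      then have x: "x \<in> X" "f x \<in> U" by auto
      then obtain \<epsilon> where e: "\<epsilon> > 0" "ball (f x) \<epsilon> \<subseteq> U" using U open_contains_ball by blast
      then obtain L where L: "finite L" "\<And>y. y \<in> X \<Longrightarrow> init y \<inter> L = init x \<inter> L \<Longrightarrow> \<bar>f y - f x\<bar> < \<epsilon>"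
        using *[rule_format, OF x(1) e(1)] by blast
      let ?T = "{y \<in> boundary_paths \<Lambda>. init y \<inter> L = init x \<inter> L} \<inter> X"
      have "openin (subtopology (boundary_topology \<Lambda>) X) ?T"
        using openin_class[OF L(1)] by (auto simp: openin_subtopology)
      moreover have "x \<in> ?T" using x assms by auto
      moreover have "?T \<subseteq> {y \<in> X. f y \<in> U}"
      proof
        fix y assume y: "y \<in> ?T"
        then have "\<bar>f y - f x\<bar> < \<epsilon>" using L(2) by blast
        then have "f y \<in> ball (f x) \<epsilon>" by (simp add: dist_real_def abs_minus_commute)
        then show "y \<in> {y \<in> X. f y \<in> U}" using e y by blast
      qed
      ultimately show "\<exists>T. openin (subtopology (boundary_topology \<Lambda>) X) T \<and> x \<in> T \<and> T \<subseteq> {y \<in> X. f y \<in> U}" by blast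
    qed
  qed simp
qed

lemma continuous_boundary_iff:
  "continuous_map (boundary_topology \<Lambda>) euclideanreal f \<longleftrightarrow>
     (\<forall>x\<in>boundary_paths \<Lambda>. \<forall>\<epsilon>>0. \<exists>L. finite L \<and>
        (\<forall>y\<in>boundary_paths \<Lambda>. init y \<inter> L = init x \<inter> L \<longrightarrow> \<bar>f y - f x\<bar> < \<epsilon>))"
  using continuous_map_boundary_iff[OF subset_refl, of f] subtopology_topspace[of "boundary_topology \<Lambda>"]
  unfolding topspace_boundary by simp

text \<open>Pointwise continuity improves to continuity in norm because the total mass is constantly
  1: if finitely many values carry almost all mass at \<open>x\<close> and hardly change, little
  mass is left for the others at \<open>y\<close>.\<close>

lemma l1_continuous:
  assumes f: "\<And>g. g \<in> A \<Longrightarrow> continuous_map (boundary_topology \<Lambda>) euclideanreal (f g)"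
    "\<And>g x. g \<in> A \<Longrightarrow> x \<in> boundary_paths \<Lambda> \<Longrightarrow> 0 \<le> f g x"
    "\<And>x. x \<in> boundary_paths \<Lambda> \<Longrightarrow> ((\<lambda>g. f g x) has_sum 1) A"
    and x: "x \<in> boundary_paths \<Lambda>" and d: "\<delta> > 0"
  obtains L where "finite L"
    "\<And>y. y \<in> boundary_paths \<Lambda> \<Longrightarrow> init y \<inter> L = init x \<inter> L \<Longrightarrow> fsum_le (\<lambda>g. \<bar>f g y - f g x\<bar>) A \<delta>"
proof -
  obtain X where X: "finite X" "X \<subseteq> A" "dist (\<Sum>g\<in>X. f g x) 1 \<le> \<delta> / 4"
    using has_sum_finite_approximation[OF f(3)[OF x], of "\<delta> / 4"] d by auto
  \<comment> \<open>The errors on \<open>X\<close> then add up to at most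
    \<open>\<delta> / 4\<close>; the mass outside \<open>X\<close> is at most
    \<open>\<delta> / 4\<close> at \<open>x\<close> and \<open>\<delta> / 2\<close> at
    \<open>y\<close>. The \<open>+ 1\<close> covers an empty \<open>X\<close>.\<close>
  define \<eta> where "\<eta> = \<delta> / (4 * (card X + 1))"
  have eta: "\<eta> > 0" using d unfolding \<eta>_def by simp
  have "\<exists>L. finite L \<and> (\<forall>y\<in>boundary_paths \<Lambda>. init y \<inter> L = init x \<inter> L \<longrightarrow> \<bar>f g y - f g x\<bar> < \<eta>)" if "g \<in> X" for g
    using f(1)[of g] that X(2) x eta unfolding continuous_boundary_iff by blast
  then obtain L where L: "\<And>g. g \<in> X \<Longrightarrow> finite (L g)"
    "\<And>g y. g \<in> X \<Longrightarrow> y \<in> boundary_paths \<Lambda> \<Longrightarrow> init y \<inter> L g = init x \<inter> L g \<Longrightarrow> \<bar>f g y - f g x\<bar> < \<eta>"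
    by metis
  show ?thesis
  proof (rule that[of "\<Union>(L ` X)"])
    show "finite (\<Union>(L ` X))" using X(1) L(1) by blast
    fix y assume y: "y \<in> boundary_paths \<Lambda>" and eq: "init y \<inter> \<Union>(L ` X) = init x \<inter> \<Union>(L ` X)"
    have "(\<Sum>g\<in>X. \<bar>f g y - f g x\<bar>) \<le> card X * \<eta>"
    proof (rule sum_bounded_above)
      fix g assume g: "g \<in> X"
      then have "init y \<inter> L g = init x \<inter> L g" using eq by blast
      then show "\<bar>f g y - f g x\<bar> \<le> \<eta>" using L(2)[OF g y] by simp
    qed
    also have "\<dots> \<le> (card X + 1) * \<eta>" using eta by simp
    also have "\<dots> = \<delta> / 4" unfolding \<eta>_def by (simp add: field_simps)
    finally have dX: "(\<Sum>g\<in>X. \<bar>f g y - f g x\<bar>) \<le> \<delta> / 4" .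
    have "\<bar>(\<Sum>g\<in>X. f g y) - (\<Sum>g\<in>X. f g x)\<bar> \<le> (\<Sum>g\<in>X. \<bar>f g y - f g x\<bar>)"
      unfolding sum_subtractf[symmetric] by (rule sum_abs)
    with dX X(3)[unfolded dist_real_def]
    have sX: "(\<Sum>g\<in>X. f g x) \<ge> 1 - \<delta> / 4" "(\<Sum>g\<in>X. f g y) \<ge> 1 - \<delta> / 2"
      by linarith+
    show "fsum_le (\<lambda>g. \<bar>f g y - f g x\<bar>) A \<delta>"
      unfolding fsum_le_def
    proof (intro allI impI)
      fix Y assume Y: "finite Y" "Y \<subseteq> A"
      have rest: "(\<Sum>g\<in>Y - X. f g z) \<le> 1 - (\<Sum>g\<in>X. f g z)" if z: "z \<in> boundary_paths \<Lambda>" for z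
      proof -
        have "(\<Sum>g\<in>Y - X. f g z) + (\<Sum>g\<in>X. f g z) = (\<Sum>g\<in>(Y - X) \<union> X. f g z)"
          by (rule sum.union_disjoint[symmetric]) (use X Y in auto)
        also have "\<dots> \<le> 1"
          by (rule finite_sum_le_has_sum[OF f(3)[OF z]]) (use X Y f(2) z in auto)
        finally show ?thesis by simp
      qed
      have "(\<Sum>g\<in>Y. \<bar>f g y - f g x\<bar>) \<le> (\<Sum>g\<in>(Y - X) \<union> X. \<bar>f g y - f g x\<bar>)"
        by (rule sum_mono2) (use X Y in auto)
      also have "\<dots> = (\<Sum>g\<in>Y - X. \<bar>f g y - f g x\<bar>) + (\<Sum>g\<in>X. \<bar>f g y - f g x\<bar>)"
        by (rule sum.union_disjoint) (use X Y in auto)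
      also have "(\<Sum>g\<in>Y - X. \<bar>f g y - f g x\<bar>) \<le> (\<Sum>g\<in>Y - X. f g y + f g x)"
      proof (rule sum_mono)
        fix g assume "g \<in> Y - X"
        then have "0 \<le> f g y" "0 \<le> f g x" using Y f(2)[of g x] f(2)[of g y] x y by blast+
        then show "\<bar>f g y - f g x\<bar> \<le> f g y + f g x" by linarith
      qed
      also have "\<dots> = (\<Sum>g\<in>Y - X. f g y) + (\<Sum>g\<in>Y - X. f g x)" by (rule sum.distrib)
      finally show "(\<Sum>g\<in>Y. \<bar>f g y - f g x\<bar>) \<le> \<delta>"
        using rest[OF y] rest[OF x] sX dX by linarith
    qed
  qed
qed

end

context ss_kgraph
begin

lemma amenable_boundary_iff:
  "amenable_action G (boundary_topology \<Lambda>) pact \<longleftrightarrow>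
    (\<forall>S C \<epsilon>. finite S \<longrightarrow> S \<subseteq> carrier G \<longrightarrow> compactin (boundary_topology \<Lambda>) C \<longrightarrow> \<epsilon> > 0 \<longrightarrow>
     (\<exists>f. (\<forall>g\<in>carrier G. continuous_map (boundary_topology \<Lambda>) euclideanreal (f g))
        \<and> (\<forall>g\<in>carrier G. \<forall>x\<in>boundary_paths \<Lambda>. 0 \<le> f g x)
        \<and> (\<forall>x\<in>boundary_paths \<Lambda>. ((\<lambda>g. f g x) has_sum 1) (carrier G))
        \<and> (\<forall>h\<in>S. \<forall>x\<in>C. fsum_le (\<lambda>g. \<bar>f (g \<otimes>\<^bsub>G\<^esub> h) x - f g (pact h x)\<bar>) (carrier G) \<epsilon>)))"
proof -
  have "\<And>g x. g \<in> carrier G \<Longrightarrow> x \<in> topspace (boundary_topology \<Lambda>) \<Longrightarrow> pact g x \<in> topspace (boundary_topology \<Lambda>)"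
    unfolding topspace_boundary by (rule boundary_act)
  from amenable_action_iff[OF gr.is_group this] show ?thesis unfolding topspace_boundary .
qed

lemma stabilizer_group:
  assumes "v \<in> Mor \<Lambda>"
  shows "subgroup (stabilizer G act v) G" "group (G\<lparr>carrier := stabilizer G act v\<rparr>)"
  using stabilizer_subgroup[OF assms] subgroup.subgroup_is_group[OF _ gr.is_group] by auto

text \<open>One density is chosen for the stabilizer of one representative per vertex orbit and
  translated along the orbit. Moving a vertex by \<open>h\<close> then becomes right translation
  inside that stabilizer by the cocycle \<open>k h v\<close>.\<close>

theorem amenable_action_if_stabilizers:
  assumes am: "\<And>v. v \<in> vertices \<Lambda> \<Longrightarrow> amenable_group (G\<lparr>carrier := stabilizer G act v\<rparr>)"
  shows "amenable_action G (boundary_topology \<Lambda>) pact"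
  unfolding amenable_boundary_iff
proof (intro allI impI)
  fix S C and \<epsilon> :: real
  assume S: "finite S" "S \<subseteq> carrier G" and C: "compactin (boundary_topology \<Lambda>) C" and e: "\<epsilon> > 0"
  have CB: "C \<subseteq> boundary_paths \<Lambda>" using compactin_subset_topspace[OF C] topspace_boundary by simp
  \<comment> \<open>Only finitely many vertices matter, since the cylinders of vertices form an open
    cover of \<open>C\<close>.\<close>
  define W where "W = prng ` C"
  have W: "finite W" "W \<subseteq> vertices \<Lambda>"
  proof -
    let ?U = "\<lambda>x. {y \<in> boundary_paths \<Lambda>. prng x \<in> init y}"
    have "\<exists>\<F>. finite \<F> \<and> \<F> \<subseteq> ?U ` C \<and> C \<subseteq> \<Union>\<F>"
      using C unfolding compactin_def
    proof (elim conjE allE impE)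
      show "(\<forall>U\<in>?U ` C. openin (boundary_topology \<Lambda>) U) \<and> C \<subseteq> \<Union> (?U ` C)"
      proof (intro conjI ballI subsetI)
        show "openin (boundary_topology \<Lambda>) U" if "U \<in> ?U ` C" for U
          using that openin_boundary_init(1) by auto
        fix x assume "x \<in> C"
        then have "x \<in> ?U x" using CB prng_init boundary_paths by blast
        then show "x \<in> \<Union> (?U ` C)" using \<open>x \<in> C\<close> by blast
      qed
    qed
    then obtain \<F> where F: "finite \<F>" "\<F> \<subseteq> ?U ` C" "C \<subseteq> \<Union>\<F>" by blast
    then obtain D where D: "D \<subseteq> C" "finite D" "\<F> = ?U ` D" using finite_subset_image[OF F(1,2)] by blast
    have "W \<subseteq> prng ` D"
    proof
      fix v assume "v \<in> W"
      then obtain y where y: "y \<in> C" "v = prng y" unfolding W_def by blast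
      then obtain x where x: "x \<in> D" "prng x \<in> init y" using D(3) F(3) by blast
      have "x \<in> paths \<Lambda>" "y \<in> paths \<Lambda>" using x y D(1) CB boundary_paths by blast+
      then have "prng x = prng y" using init_rng[of y "prng x"] x(2) vertexD(2)[OF prng_vertex(1)] by simp
      then show "v \<in> prng ` D" using imageI[OF x(1), of prng] y(2) by simp
    qed
    then show "finite W" using D(2) finite_subset by blast
    show "W \<subseteq> vertices \<Lambda>" unfolding W_def using prng_vertex(1) CB boundary_paths by blast
  qed
  define Ob where "Ob v = {act g v | g. g \<in> carrier G}" for v
  \<comment> \<open>Chosen from the orbit as a set, so equal orbits give the same
    representative.\<close>
  define rep where "rep v = (SOME w. w \<in> Ob v)" for v
  define c where "c v = (SOME g. g \<in> carrier G \<and> act g (rep v) = v)" for v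
  have Ob: "Ob (act g v) = Ob v" if "g \<in> carrier G" "v \<in> vertices \<Lambda>" for g v
  proof -
    note v = vertexD(1)[OF that(2)]
    show ?thesis
    proof (intro equalityI subsetI)
      fix w assume "w \<in> Ob (act g v)"
      then obtain h where h: "h \<in> carrier G" "w = act h (act g v)" unfolding Ob_def by blast
      then have "w = act (h \<otimes>\<^bsub>G\<^esub> g) v" using act_mult[OF h(1) that(1) v] by simp
      then show "w \<in> Ob v" unfolding Ob_def using gr.m_closed[OF h(1) that(1)] by blast
    next
      fix w assume "w \<in> Ob v"
      then obtain h where h: "h \<in> carrier G" "w = act h v" unfolding Ob_def by blast
      have gi: "inv\<^bsub>G\<^esub> g \<in> carrier G" using that(1) by simp
      have "w = act (h \<otimes>\<^bsub>G\<^esub> inv\<^bsub>G\<^esub> g) (act g v)"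
        using act_mult[OF h(1) gi act_closed[OF that(1) v]] act_inv_act[OF that(1) v] h(2) by simp
      then show "w \<in> Ob (act g v)" unfolding Ob_def using gr.m_closed[OF h(1) gi] by blast
    qed
  qed
  have rep_act: "rep (act g v) = rep v" if "g \<in> carrier G" "v \<in> vertices \<Lambda>" for g v
    unfolding rep_def Ob[OF that] ..
  have rep: "rep v \<in> vertices \<Lambda>" "c v \<in> carrier G" "act (c v) (rep v) = v" if v: "v \<in> vertices \<Lambda>" for v
  proof -
    have "act \<one>\<^bsub>G\<^esub> v \<in> Ob v" unfolding Ob_def by blast
    then have "rep v \<in> Ob v" unfolding rep_def by (rule someI)
    then obtain g where g: "g \<in> carrier G" "rep v = act g v" unfolding Ob_def by blast
    then show "rep v \<in> vertices \<Lambda>" using act_vertex v by simp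
    have "\<exists>g. g \<in> carrier G \<and> act g (rep v) = v"
      using g act_inv_act[OF g(1) vertexD(1)[OF v]] by (intro exI[of _ "inv\<^bsub>G\<^esub> g"]) simp
    from someI_ex[OF this] show "c v \<in> carrier G" "act (c v) (rep v) = v" unfolding c_def by auto
  qed
  \<comment> \<open>The cocycle of the chosen transporters, determined by
    \<open>c (act h v) \<otimes> k h v = h \<otimes> c v\<close>; it fixes \<open>rep v\<close>
    because both sides carry \<open>rep v\<close> to \<open>act h v\<close>.\<close>
  define k where "k h v = inv\<^bsub>G\<^esub> (c (act h v)) \<otimes>\<^bsub>G\<^esub> (h \<otimes>\<^bsub>G\<^esub> c v)" for h v
  have k: "k h v \<in> stabilizer G act (rep v)" if h: "h \<in> carrier G" and v: "v \<in> vertices \<Lambda>" for h v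
  proof -
    have v': "act h v \<in> vertices \<Lambda>" using act_vertex[OF h v] .
    have "act (k h v) (rep v) = act (inv\<^bsub>G\<^esub> (c (act h v))) (act h v)"
      unfolding k_def using act_mult rep[OF v] rep[OF v'] h vertexD(1) by simp
    also have "\<dots> = rep v"
      using act_inv_act[OF rep(2)[OF v'] vertexD(1)[OF rep(1)[OF v]]] rep(3)[OF v'] rep_act[OF h v] by simp
    finally show ?thesis unfolding stabilizer_def k_def using rep(2)[OF v] rep(2)[OF v'] h by simp
  qed
  \<comment> \<open>The finitely many cocycle values under which the density at the representative
    \<open>w\<close> has to be almost invariant.\<close>
  define T where "T w = {k h v | h v. h \<in> S \<and> v \<in> W \<and> rep v = w}" for w
  have T: "finite (T w)" "T w \<subseteq> stabilizer G act w" for w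
  proof -
    have "T w \<subseteq> (\<lambda>(h, v). k h v) ` (S \<times> W)" unfolding T_def by auto
    then show "finite (T w)" using S(1) W(1) by (meson finite_SigmaI finite_imageI finite_subset)
    show "T w \<subseteq> stabilizer G act w" unfolding T_def using k S(2) W(2) by auto
  qed
  define P where "P w f \<longleftrightarrow> (\<forall>g\<in>stabilizer G act w. 0 \<le> f g) \<and> (f has_sum 1) (stabilizer G act w)
        \<and> (\<forall>h\<in>T w. fsum_le (\<lambda>g. \<bar>f (g \<otimes>\<^bsub>G\<^esub> h) - f g\<bar>) (stabilizer G act w) \<epsilon>)" for w f
  have ex: "\<exists>f. P w f" if w: "w \<in> vertices \<Lambda>" for w
    using am[OF w] T[of w] e unfolding P_def amenable_group_iff[OF stabilizer_group(2)[OF vertexD(1)[OF w]]] by simp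
  define \<phi> where "\<phi> w = (SOME f. P w f)" for w
  have "P w (\<phi> w)" if w: "w \<in> vertices \<Lambda>" for w unfolding \<phi>_def by (rule someI_ex[OF ex[OF w]])
  then have phi: "\<And>w g. w \<in> vertices \<Lambda> \<Longrightarrow> g \<in> stabilizer G act w \<Longrightarrow> 0 \<le> \<phi> w g"
    "\<And>w. w \<in> vertices \<Lambda> \<Longrightarrow> (\<phi> w has_sum 1) (stabilizer G act w)"
    "\<And>w h. w \<in> vertices \<Lambda> \<Longrightarrow> h \<in> T w \<Longrightarrow>
        fsum_le (\<lambda>g. \<bar>\<phi> w (g \<otimes>\<^bsub>G\<^esub> h) - \<phi> w g\<bar>) (stabilizer G act w) \<epsilon>"
    unfolding P_def by simp_all
  \<comment> \<open>The density of the stabilizer of \<open>rep v\<close>, carried by its coset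
    through the inverse of \<open>c v\<close>.\<close>
  define F where "F g v = (if g \<otimes>\<^bsub>G\<^esub> c v \<in> stabilizer G act (rep v) then \<phi> (rep v) (g \<otimes>\<^bsub>G\<^esub> c v) else 0)" for g v
  show "\<exists>f. (\<forall>g\<in>carrier G. continuous_map (boundary_topology \<Lambda>) euclideanreal (f g))
        \<and> (\<forall>g\<in>carrier G. \<forall>x\<in>boundary_paths \<Lambda>. 0 \<le> f g x)
        \<and> (\<forall>x\<in>boundary_paths \<Lambda>. ((\<lambda>g. f g x) has_sum 1) (carrier G))
        \<and> (\<forall>h\<in>S. \<forall>x\<in>C. fsum_le (\<lambda>g. \<bar>f (g \<otimes>\<^bsub>G\<^esub> h) x - f g (pact h x)\<bar>) (carrier G) \<epsilon>)"
  proof (intro exI[of _ "\<lambda>g x. F g (prng x)"] conjI ballI)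
    fix g
    show "continuous_map (boundary_topology \<Lambda>) euclideanreal (\<lambda>x. F g (prng x))"
      unfolding continuous_boundary_iff
    proof (intro ballI allI impI)
      fix x and \<epsilon> :: real assume x: "x \<in> boundary_paths \<Lambda>" and e: "\<epsilon> > 0"
      have "prng y = prng x" if y: "y \<in> boundary_paths \<Lambda>" "init y \<inter> {prng x} = init x \<inter> {prng x}" for y
      proof -
        have "prng x \<in> init y" using y(2) prng_init[OF boundary_paths[OF x]] by blast
        then show ?thesis using init_rng[OF boundary_paths[OF y(1)]]
            vertexD(2)[OF prng_vertex(1)[OF boundary_paths[OF x]]] by metis
      qed
      then show "\<exists>L. finite L \<and> (\<forall>y\<in>boundary_paths \<Lambda>. init y \<inter> L = init x \<inter> L \<longrightarrow>
          \<bar>F g (prng y) - F g (prng x)\<bar> < \<epsilon>)" using e by (intro exI[of _ "{prng x}"]) simp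
    qed
  next
    fix g x assume "x \<in> boundary_paths \<Lambda>"
    then have "prng x \<in> vertices \<Lambda>" using prng_vertex(1) boundary_paths by blast
    then show "0 \<le> F g (prng x)" unfolding F_def using phi(1) rep(1) by simp
  next
    fix x assume "x \<in> boundary_paths \<Lambda>"
    then have v: "prng x \<in> vertices \<Lambda>" using prng_vertex(1) boundary_paths by blast
    let ?H = "stabilizer G act (rep (prng x))"
    have "?H \<subseteq> carrier G" unfolding stabilizer_def by blast
    then have "((\<lambda>m. if m \<in> ?H then \<phi> (rep (prng x)) m else 0) has_sum 1) (carrier G)"
      by (intro iffD2[OF has_sum_cong_neutral[where T = "?H" and g = "\<phi> (rep (prng x))"] phi(2)[OF rep(1)[OF v]]]) auto
    then show "((\<lambda>g. F g (prng x)) has_sum 1) (carrier G)"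
      unfolding F_def
      using has_sum_reindex_bij_betw[OF gr.bij_betw_r_mult[OF rep(2)[OF v]],
          of "\<lambda>m. if m \<in> ?H then \<phi> (rep (prng x)) m else 0" 1] by simp
  next
    fix h x assume h: "h \<in> S" and x: "x \<in> C"
    have hG: "h \<in> carrier G" using h S by blast
    have xB: "x \<in> boundary_paths \<Lambda>" using x CB by blast
    let ?v = "prng x"
    have v: "?v \<in> vertices \<Lambda>" "?v \<in> W" using prng_vertex(1) xB boundary_paths x unfolding W_def by auto
    have v': "act h ?v \<in> vertices \<Lambda>" using act_vertex[OF hG v(1)] .
    have pv: "prng (pact h x) = act h ?v" using prng_path_act[OF hG boundary_paths[OF xB]] .
    let ?H = "stabilizer G act (rep ?v)" and ?k = "k h ?v" and ?c = "c (act h ?v)" and ?p = "\<phi> (rep ?v)"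
    have sub: "subgroup ?H G" using stabilizer_group(1) vertexD(1)[OF rep(1)[OF v(1)]] by blast
    have kH: "?k \<in> ?H" "?k \<in> carrier G" using k[OF hG v(1)] unfolding stabilizer_def by auto
    have "?k \<in> T (rep ?v)" unfolding T_def using h v(2) by blast
    note le = fsum_le_extend[OF phi(3)[OF rep(1)[OF v(1)] this], of "carrier G"]
    have cG: "?c \<in> carrier G" using rep(2)[OF v'] .
    have "fsum_le (\<lambda>g. if g \<otimes>\<^bsub>G\<^esub> ?c \<in> ?H then \<bar>?p (g \<otimes>\<^bsub>G\<^esub> ?c \<otimes>\<^bsub>G\<^esub> ?k) - ?p (g \<otimes>\<^bsub>G\<^esub> ?c)\<bar> else 0) (carrier G) \<epsilon>"
      by (rule fsum_le_reindex[OF le]) (use gr.bij_betw_r_mult[OF cG] in \<open>auto simp: bij_betw_def\<close>)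
    then show "fsum_le (\<lambda>g. \<bar>F (g \<otimes>\<^bsub>G\<^esub> h) (prng x) - F g (prng (pact h x))\<bar>) (carrier G) \<epsilon>"
    proof (rule fsum_le_mono)
      fix g assume g: "g \<in> carrier G"
      \<comment> \<open>By the defining property of the cocycle, the arguments of \<open>F\<close>
        before and after \<open>h\<close> differ by right multiplication with \<open>?k\<close>,
        which also preserves the support.\<close>
      have "g \<otimes>\<^bsub>G\<^esub> ?c \<otimes>\<^bsub>G\<^esub> ?k = g \<otimes>\<^bsub>G\<^esub> (?c \<otimes>\<^bsub>G\<^esub> ?k)" using g cG kH by (simp add: gr.m_assoc)
      also have "?c \<otimes>\<^bsub>G\<^esub> ?k = h \<otimes>\<^bsub>G\<^esub> c ?v"
        unfolding k_def using cG hG rep(2)[OF v(1)] by (simp add: gr.m_assoc[symmetric])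
      also have "g \<otimes>\<^bsub>G\<^esub> (h \<otimes>\<^bsub>G\<^esub> c ?v) = g \<otimes>\<^bsub>G\<^esub> h \<otimes>\<^bsub>G\<^esub> c ?v"
        by (rule gr.m_assoc[symmetric, OF g hG rep(2)[OF v(1)]])
      finally have eq: "g \<otimes>\<^bsub>G\<^esub> h \<otimes>\<^bsub>G\<^esub> c ?v = g \<otimes>\<^bsub>G\<^esub> ?c \<otimes>\<^bsub>G\<^esub> ?k" ..
      have iff: "g \<otimes>\<^bsub>G\<^esub> ?c \<otimes>\<^bsub>G\<^esub> ?k \<in> ?H \<longleftrightarrow> g \<otimes>\<^bsub>G\<^esub> ?c \<in> ?H"
        by (rule gr.subgroup_r_mult_iff[OF sub kH(1)]) (use g cG in simp)
      show "\<bar>F (g \<otimes>\<^bsub>G\<^esub> h) (prng x) - F g (prng (pact h x))\<bar>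
          \<le> (if g \<otimes>\<^bsub>G\<^esub> ?c \<in> ?H then \<bar>?p (g \<otimes>\<^bsub>G\<^esub> ?c \<otimes>\<^bsub>G\<^esub> ?k) - ?p (g \<otimes>\<^bsub>G\<^esub> ?c)\<bar> else 0)"
        unfolding F_def pv rep_act[OF hG v(1)] eq iff by simp
    qed simp
  qed
qed

subsection \<open>Amenability of vertex stabilizers\<close>

definition boundary_mean :: "('g \<Rightarrow> ('a, 'k) path \<Rightarrow> real) \<Rightarrow> bool" where
  "boundary_mean f \<longleftrightarrow> (\<forall>g\<in>carrier G. continuous_map (boundary_topology \<Lambda>) euclideanreal (f g))
        \<and> (\<forall>g\<in>carrier G. \<forall>x\<in>boundary_paths \<Lambda>. 0 \<le> f g x)
        \<and> (\<forall>x\<in>boundary_paths \<Lambda>. ((\<lambda>g. f g x) has_sum 1) (carrier G))"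

lemma boundary_meanD:
  assumes "boundary_mean f"
  shows "\<And>g. g \<in> carrier G \<Longrightarrow> continuous_map (boundary_topology \<Lambda>) euclideanreal (f g)"
    "\<And>g x. g \<in> carrier G \<Longrightarrow> x \<in> boundary_paths \<Lambda> \<Longrightarrow> 0 \<le> f g x"
    "\<And>x. x \<in> boundary_paths \<Lambda> \<Longrightarrow> ((\<lambda>g. f g x) has_sum 1) (carrier G)"
  using assms unfolding boundary_mean_def by simp_all

lemma amenable_boundary_obtain:
  assumes "amenable_action G (boundary_topology \<Lambda>) pact" "finite S" "S \<subseteq> carrier G"
    "compactin (boundary_topology \<Lambda>) C" "\<epsilon> > 0"
  obtains f where "boundary_mean f"
    "\<forall>h\<in>S. \<forall>x\<in>C. fsum_le (\<lambda>g. \<bar>f (g \<otimes>\<^bsub>G\<^esub> h) x - f g (pact h x)\<bar>) (carrier G) \<epsilon>"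
proof -
  from assms(1)[unfolded amenable_boundary_iff, rule_format, OF assms(2-5)] obtain f where
    f: "(\<forall>g\<in>carrier G. continuous_map (boundary_topology \<Lambda>) euclideanreal (f g))
        \<and> (\<forall>g\<in>carrier G. \<forall>x\<in>boundary_paths \<Lambda>. 0 \<le> f g x)
        \<and> (\<forall>x\<in>boundary_paths \<Lambda>. ((\<lambda>g. f g x) has_sum 1) (carrier G))
        \<and> (\<forall>h\<in>S. \<forall>x\<in>C. fsum_le (\<lambda>g. \<bar>f (g \<otimes>\<^bsub>G\<^esub> h) x - f g (pact h x)\<bar>) (carrier G) \<epsilon>)"
    by (rule exE)
  show ?thesis
  proof (rule that[of f])
    show "boundary_mean f" unfolding boundary_mean_def using f by (intro conjI; elim conjE)
  qed (rule conjunct2[OF conjunct2[OF conjunct2[OF f]]])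
qed

text \<open>The finite-orbit hypothesis allows the finite test set that describes the density up to
  \<open>\<epsilon>\<close> to be made invariant. The stabilizer then permutes the finitely many
  traces of paths on it, and averaging over the traces removes the dependence on the path.\<close>

theorem amenable_stabilizer:
  assumes am: "amenable_action G (boundary_topology \<Lambda>) pact" and v: "v \<in> vertices \<Lambda>"
    and K: "compactin (boundary_topology \<Lambda>) K" "K \<noteq> {}"
    and Kinv: "\<And>g x. g \<in> stabilizer G act v \<Longrightarrow> x \<in> K \<Longrightarrow> pact g x \<in> K"
    and Kfin: "\<And>x \<mu>. x \<in> K \<Longrightarrow> \<mu> \<in> init x \<Longrightarrow> finite ((\<lambda>g. act g \<mu>) ` stabilizer G act v)"
  shows "amenable_group (G\<lparr>carrier := stabilizer G act v\<rparr>)"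
proof -
  define H where "H = stabilizer G act v"
  note grp = stabilizer_group[OF vertexD(1)[OF v], folded H_def]
  have HG: "H \<subseteq> carrier G" using subgroup.subset[OF grp(1)] .
  have KB: "K \<subseteq> boundary_paths \<Lambda>" using compactin_subset_topspace[OF K(1)] topspace_boundary by simp
  have Kp: "\<And>x. x \<in> K \<Longrightarrow> x \<in> paths \<Lambda>" using KB boundary_paths by blast
  show ?thesis
    unfolding H_def[symmetric] amenable_group_iff[OF grp(2)] partial_object.simps monoid.simps
  proof (intro allI impI)
    fix S and \<epsilon> :: real
    assume S: "finite S" "S \<subseteq> carrier (G\<lparr>carrier := H\<rparr>)" and e: "\<epsilon> > 0"
    then have SH: "S \<subseteq> H" "S \<subseteq> carrier G" using HG by auto
    \<comment> \<open>Half of \<open>\<epsilon>\<close> is spent on the invariance of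
      \<open>f\<close>, two quarters on comparing two paths with the same trace through a common
      centre.\<close>
    have "\<epsilon> / 2 > 0" "\<epsilon> / 4 > 0" using e by auto
    obtain f where fm: "boundary_mean f" and f4:
        "\<forall>h\<in>S. \<forall>x\<in>K. fsum_le (\<lambda>g. \<bar>f (g \<otimes>\<^bsub>G\<^esub> h) x - f g (pact h x)\<bar>) (carrier G) (\<epsilon> / 2)"
      using amenable_boundary_obtain[OF am S(1) SH(2) K(1) \<open>\<epsilon> / 2 > 0\<close>] .
    note f = boundary_meanD[OF fm] f4[rule_format]
    define Q where "Q x L \<longleftrightarrow> finite L \<and> (\<forall>y\<in>boundary_paths \<Lambda>. init y \<inter> L = init x \<inter> L \<longrightarrow>
        fsum_le (\<lambda>g. \<bar>f g y - f g x\<bar>) (carrier G) (\<epsilon> / 4))" for x L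
    have "\<forall>x\<in>K. \<exists>L. Q x L"
    proof
      fix x assume "x \<in> K"
      then have x: "x \<in> boundary_paths \<Lambda>" using KB by blast
      show "\<exists>L. Q x L"
        by (rule l1_continuous[where A = "carrier G" and f = f, OF f(1-3) x \<open>\<epsilon> / 4 > 0\<close>])
          (assumption+, rule exI, unfold Q_def, rule conjI, assumption, blast)
    qed
    from bchoice[OF this] obtain L where LQ: "\<forall>x\<in>K. Q x (L x)" by (rule exE)
    have L: "\<And>x. x \<in> K \<Longrightarrow> finite (L x)"
      "\<And>x y. x \<in> K \<Longrightarrow> y \<in> boundary_paths \<Lambda> \<Longrightarrow> init y \<inter> L x = init x \<inter> L x \<Longrightarrow>
        fsum_le (\<lambda>g. \<bar>f g y - f g x\<bar>) (carrier G) (\<epsilon> / 4)" using LQ unfolding Q_def by simp_all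
    let ?U = "\<lambda>x. {y \<in> boundary_paths \<Lambda>. init y \<inter> L x = init x \<inter> L x}"
    have "\<exists>\<F>. finite \<F> \<and> \<F> \<subseteq> ?U ` K \<and> K \<subseteq> \<Union>\<F>"
      using K(1) unfolding compactin_def
    proof (elim conjE allE impE)
      show "(\<forall>U\<in>?U ` K. openin (boundary_topology \<Lambda>) U) \<and> K \<subseteq> \<Union> (?U ` K)"
      proof (intro conjI ballI subsetI)
        show "openin (boundary_topology \<Lambda>) U" if "U \<in> ?U ` K" for U
          using that openin_class L(1) by auto
        fix x assume "x \<in> K"
        then have "x \<in> ?U x" using KB by blast
        then show "x \<in> \<Union> (?U ` K)" using \<open>x \<in> K\<close> by blast
      qed
    qed
    then obtain \<F> where F: "finite \<F>" "\<F> \<subseteq> ?U ` K" "K \<subseteq> \<Union>\<F>" by blast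
    then obtain D where D: "D \<subseteq> K" "finite D" "\<F> = ?U ` D" using finite_subset_image[OF F(1,2)] by blast
    \<comment> \<open>Restricted to segments of paths in \<open>K\<close>, since only their orbits
      are known to be finite; for paths in \<open>K\<close> this loses no information.\<close>
    define L0 where "L0 = \<Union>(L ` D) \<inter> \<Union>(init ` K)"
    have L0: "finite L0" using D L(1) unfolding L0_def by blast
    have close: "fsum_le (\<lambda>g. \<bar>f g y - f g y'\<bar>) (carrier G) (\<epsilon> / 2)"
      if y: "y \<in> K" "y' \<in> K" "init y \<inter> L0 = init y' \<inter> L0" for y y'
    proof -
      obtain x where x: "x \<in> D" "init y \<inter> L x = init x \<inter> L x" using y(1) F(3) D(3) by blast
      have "init y \<inter> L x = init y \<inter> L0 \<inter> L x" "init y' \<inter> L x = init y' \<inter> L0 \<inter> L x"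
        using y(1,2) x(1) unfolding L0_def by blast+
      then have x': "init y' \<inter> L x = init x \<inter> L x" using x(2) y(3) by simp
      have xK: "x \<in> K" using x(1) D(1) by blast
      have 1: "fsum_le (\<lambda>g. \<bar>f g y - f g x\<bar>) (carrier G) (\<epsilon> / 4)"
        using L(2)[OF xK _ x(2)] y KB by blast
      have "fsum_le (\<lambda>g. \<bar>f g y' - f g x\<bar>) (carrier G) (\<epsilon> / 4)"
        using L(2)[OF xK _ x'] y KB by blast
      then have 2: "fsum_le (\<lambda>g. \<bar>f g x - f g y'\<bar>) (carrier G) (\<epsilon> / 4)" by (simp add: abs_minus_commute)
      show ?thesis using fsum_le_triangle[OF 1 2] by (rule fsum_le_weaken) simp
    qed
    \<comment> \<open>The hull of \<open>L0\<close> under the stabilizer, so that traces on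
      \<open>M\<close> are moved equivariantly.\<close>
    define M where "M = (\<Union>\<mu>\<in>L0. (\<lambda>g. act g \<mu>) ` H)"
    have finM: "finite M" unfolding M_def
    proof (rule finite_UN_I[OF L0])
      fix \<mu> assume "\<mu> \<in> L0"
      then show "finite ((\<lambda>g. act g \<mu>) ` H)" using Kfin unfolding L0_def H_def by blast
    qed
    have L0M: "L0 \<subseteq> Mor \<Lambda>" unfolding L0_def using Kp init_Mor by blast
    have one: "\<one>\<^bsub>G\<^esub> \<in> H" using subgroup.one_closed[OF grp(1)] .
    have sub: "L0 \<subseteq> M"
    proof
      fix \<mu> assume m: "\<mu> \<in> L0"
      then have "\<mu> = act \<one>\<^bsub>G\<^esub> \<mu>" using act_one L0M by auto
      then show "\<mu> \<in> M" unfolding M_def using m one by blast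
    qed
    have Minv: "act h \<mu> \<in> M" if h: "h \<in> H" "\<mu> \<in> M" for h \<mu>
    proof -
      obtain g \<nu> where g: "g \<in> H" "\<nu> \<in> L0" "\<mu> = act g \<nu>" using h(2) unfolding M_def by blast
      then have "act h \<mu> = act (h \<otimes>\<^bsub>G\<^esub> g) \<nu>" using act_mult h HG L0M by (simp add: subset_iff)
      moreover have "h \<otimes>\<^bsub>G\<^esub> g \<in> H" using subgroup.m_closed[OF grp(1)] h g by blast
      ultimately show ?thesis unfolding M_def using g by blast
    qed
    have MM: "M \<subseteq> Mor \<Lambda>" unfolding M_def using act_closed HG L0M by blast
    \<comment> \<open>The traces of the paths in \<open>K\<close> on \<open>M\<close>; each is
      represented by the path \<open>r c\<close>.\<close>
    define \<C> where "\<C> = (\<lambda>y. init y \<inter> M) ` K"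
    have finC: "finite \<C>" "\<C> \<noteq> {}"
      using finM finite_subset[of \<C> "Pow M"] K(2) unfolding \<C>_def by auto
    define r where "r c = (SOME y. y \<in> K \<and> init y \<inter> M = c)" for c
    have r: "r c \<in> K" "init (r c) \<inter> M = c" if "c \<in> \<C>" for c
      using someI_ex[of "\<lambda>y. y \<in> K \<and> init y \<inter> M = c"] that unfolding \<C>_def r_def by auto
    have hC: "init (pact h y) \<inter> M = act h ` (init y \<inter> M)" if h: "h \<in> H" and y: "y \<in> K" for h y
    proof -
      have hG: "h \<in> carrier G" "inv\<^bsub>G\<^esub> h \<in> H" using h HG subgroup.m_inv_closed[OF grp(1)] by auto
      have "init (pact h y) \<inter> M = act h ` init y \<inter> M" using path_act_init[OF hG(1) Kp[OF y]] by simp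
      also have "\<dots> = act h ` (init y \<inter> M)"
      proof (intro equalityI subsetI)
        fix \<mu> assume "\<mu> \<in> act h ` init y \<inter> M"
        then obtain \<nu> where n: "\<nu> \<in> init y" "\<mu> = act h \<nu>" "\<mu> \<in> M" by blast
        then have "\<nu> = act (inv\<^bsub>G\<^esub> h) \<mu>" using act_inv_act[OF hG(1)] init_Mor[OF Kp[OF y]] by simp
        then show "\<mu> \<in> act h ` (init y \<inter> M)" using n Minv[OF hG(2)] by blast
      qed (use Minv[OF h] in blast)
      finally show ?thesis .
    qed
    have bij: "bij_betw (\<lambda>c. act h ` c) \<C> \<C>" if h: "h \<in> H" for h
    proof -
      have hG: "h \<in> carrier G" using h HG by blast
      have "inj_on (\<lambda>c. act h ` c) \<C>"
      proof (rule inj_onI)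
        fix c c' assume c: "c \<in> \<C>" "c' \<in> \<C>" "act h ` c = act h ` c'"
        then have "c \<subseteq> Mor \<Lambda>" "c' \<subseteq> Mor \<Lambda>" using MM unfolding \<C>_def by auto
        then show "c = c'" using c(3) inj_on_image_eq_iff[OF inj_prop[OF hG]] by blast
      qed
      moreover have "(\<lambda>c. act h ` c) ` \<C> \<subseteq> \<C>"
      proof (rule image_subsetI)
        fix c assume "c \<in> \<C>"
        then obtain y where y: "y \<in> K" "c = init y \<inter> M" unfolding \<C>_def by blast
        then have "act h ` c = init (pact h y) \<inter> M" using hC[OF h y(1)] by simp
        moreover have "pact h y \<in> K" using Kinv[of h y] h y(1) unfolding H_def by blast
        ultimately show "act h ` c \<in> \<C>" unfolding \<C>_def by blast
      qed
      ultimately show ?thesis using finC(1) endo_inj_surj by (simp add: bij_betw_def)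
    qed
    define N where "N = real (card \<C>)"
    have N: "N > 0" unfolding N_def using finC by (simp add: card_gt_0_iff)
    define \<phi> where "\<phi> g = (1 / N) * (\<Sum>c\<in>\<C>. f g (r c))" for g
    have rB: "r c \<in> boundary_paths \<Lambda>" if "c \<in> \<C>" for c using r(1)[OF that] KB by blast
    have phi_nn: "0 \<le> \<phi> g" if "g \<in> carrier G" for g
      unfolding \<phi>_def using N f(2)[OF that] rB by (intro mult_nonneg_nonneg sum_nonneg) auto
    have "((\<lambda>g. \<Sum>c\<in>\<C>. f g (r c)) has_sum (\<Sum>c\<in>\<C>. 1)) (carrier G)"
      by (rule has_sum_finite_sum[OF finC(1)]) (rule f(3)[OF rB])
    then have "(\<phi> has_sum (1 / N) * (\<Sum>c\<in>\<C>. 1)) (carrier G)" unfolding \<phi>_def by (rule has_sum_cmult_right)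
    then have phi1: "(\<phi> has_sum 1) (carrier G)" using N by (simp add: N_def)
    have phi_inv: "fsum_le (\<lambda>g. \<bar>\<phi> (g \<otimes>\<^bsub>G\<^esub> h) - \<phi> g\<bar>) (carrier G) \<epsilon>" if h: "h \<in> S" for h
    proof -
      have hH: "h \<in> H" "h \<in> carrier G" using h SH by auto
      have "fsum_le (\<lambda>g. \<bar>f (g \<otimes>\<^bsub>G\<^esub> h) (r c) - f g (r (act h ` c))\<bar>) (carrier G) \<epsilon>" if c: "c \<in> \<C>" for c
      proof -
        have c': "act h ` c \<in> \<C>" using bij[OF hH(1)] c by (auto simp: bij_betw_def)
        have hr: "pact h (r c) \<in> K" using Kinv[of h "r c"] hH(1) r(1)[OF c] unfolding H_def by blast
        have "init (pact h (r c)) \<inter> M = init (r (act h ` c)) \<inter> M"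
          using hC[OF hH(1) r(1)[OF c]] r(2)[OF c] r(2)[OF c'] by simp
        \<comment> \<open>The moved representative and the representative of the moved trace are
          different paths in general, but have equal traces, so their densities are close.\<close>
        then have "init (pact h (r c)) \<inter> L0 = init (r (act h ` c)) \<inter> L0" using sub by blast
        from fsum_le_triangle[OF f(4)[OF h r(1)[OF c]] close[OF hr r(1)[OF c'] this]]
        show ?thesis by (rule fsum_le_weaken) simp
      qed
      then have "fsum_le (\<lambda>g. \<Sum>c\<in>\<C>. \<bar>f (g \<otimes>\<^bsub>G\<^esub> h) (r c) - f g (r (act h ` c))\<bar>) (carrier G) (\<Sum>c\<in>\<C>. \<epsilon>)"
        by (rule fsum_le_sum)
      then have "fsum_le (\<lambda>g. (1 / N) * (\<Sum>c\<in>\<C>. \<bar>f (g \<otimes>\<^bsub>G\<^esub> h) (r c) - f g (r (act h ` c))\<bar>)) (carrier G)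
          ((1 / N) * (\<Sum>c\<in>\<C>. \<epsilon>))"
        by (rule fsum_le_cmult) (use N in simp)
      then show ?thesis
      proof (rule fsum_le_mono)
        fix g assume g: "g \<in> carrier G"
        have "(\<Sum>c\<in>\<C>. f g (r c)) = (\<Sum>c\<in>\<C>. f g (r (act h ` c)))"
          using sum.reindex_bij_betw[OF bij[OF hH(1)], of "\<lambda>c. f g (r c)"] by simp
        then have "\<phi> (g \<otimes>\<^bsub>G\<^esub> h) - \<phi> g = (1 / N) * (\<Sum>c\<in>\<C>. f (g \<otimes>\<^bsub>G\<^esub> h) (r c) - f g (r (act h ` c)))"
          unfolding \<phi>_def by (simp add: sum_subtractf right_diff_distrib diff_divide_distrib)
        then have "\<bar>\<phi> (g \<otimes>\<^bsub>G\<^esub> h) - \<phi> g\<bar> = (1 / N) * \<bar>\<Sum>c\<in>\<C>. f (g \<otimes>\<^bsub>G\<^esub> h) (r c) - f g (r (act h ` c))\<bar>"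
          using N by (simp add: abs_mult)
        also have "\<dots> \<le> (1 / N) * (\<Sum>c\<in>\<C>. \<bar>f (g \<otimes>\<^bsub>G\<^esub> h) (r c) - f g (r (act h ` c))\<bar>)"
          by (rule mult_left_mono[OF sum_abs]) (use N in simp)
        finally show "\<bar>\<phi> (g \<otimes>\<^bsub>G\<^esub> h) - \<phi> g\<bar> \<le> (1 / N) * (\<Sum>c\<in>\<C>. \<bar>f (g \<otimes>\<^bsub>G\<^esub> h) (r c) - f g (r (act h ` c))\<bar>)" .
      next
        show "(1 / N) * (\<Sum>c\<in>\<C>. \<epsilon>) \<le> \<epsilon>" using N by (simp add: N_def)
      qed
    qed
    \<comment> \<open>The averaged density lives on all of \<open>G\<close> and is invariant under
      \<open>S\<close> only from the right; pushing it along this map lands in the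
      stabilizer.\<close>
    obtain \<kappa> where k: "\<And>g. g \<in> carrier G \<Longrightarrow> \<kappa> g \<in> H"
      "\<And>g h. g \<in> carrier G \<Longrightarrow> h \<in> H \<Longrightarrow> \<kappa> (g \<otimes>\<^bsub>G\<^esub> h) = \<kappa> g \<otimes>\<^bsub>G\<^esub> h"
      using gr.coset_transversal[OF grp(1)] by blast
    have kH: "\<kappa> ` carrier G \<subseteq> H" using k(1) by blast
    define \<psi> where "\<psi> b = (\<Sum>\<^sub>\<infinity>g\<in>{g \<in> carrier G. \<kappa> g = b}. \<phi> g)" for b
    have "0 \<le> \<psi> b" for b unfolding \<psi>_def by (rule infsum_nonneg) (use phi_nn in blast)
    moreover have "(\<psi> has_sum 1) H" unfolding \<psi>_def by (rule has_sum_pushforward[OF phi1 phi_nn kH])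
    moreover have "fsum_le (\<lambda>b. \<bar>\<psi> (b \<otimes>\<^bsub>G\<^esub> h) - \<psi> b\<bar>) H \<epsilon>" if h: "h \<in> S" for h
    proof -
      have hH: "h \<in> H" "h \<in> carrier G" using h SH by auto
      have "inj_on (\<lambda>b. b \<otimes>\<^bsub>G\<^esub> h) H"
        using gr.bij_betw_r_mult[OF hH(2)] HG by (meson bij_betw_imp_inj_on inj_on_subset)
      with phi_inv[OF h] show ?thesis
        unfolding \<psi>_def
        by (intro fsum_le_pushforward[where \<rho> = "\<lambda>g. g \<otimes>\<^bsub>G\<^esub> h" and A' = "carrier G" and A = "carrier G"])
          (use phi_nn has_sum_imp_summable[OF phi1] gr.bij_betw_r_mult[OF hH(2)] kH k(2) hH in auto)
    qed
    ultimately show "\<exists>f. (\<forall>g\<in>carrier (G\<lparr>carrier := H\<rparr>). 0 \<le> f g) \<and> (f has_sum 1) (carrier (G\<lparr>carrier := H\<rparr>)) \<and>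
        (\<forall>h\<in>S. fsum_le (\<lambda>g. \<bar>f (g \<otimes>\<^bsub>G\<lparr>carrier := H\<rparr>\<^esub> h) - f g\<bar>) (carrier (G\<lparr>carrier := H\<rparr>)) \<epsilon>)"
      by (intro exI[of _ \<psi>]) simp
  qed
qed

text \<open>All boundary paths from \<open>v\<close> will do: the orbit of a segment of degree
  \<open>n\<close> lies in the finite set of morphisms of degree \<open>n\<close> with range
  \<open>v\<close>.\<close>

corollary amenable_stabilizer_row_finite:
  assumes am: "amenable_action G (boundary_topology \<Lambda>) pact" and v: "v \<in> vertices \<Lambda>" and rf: "row_finite \<Lambda>"
  shows "amenable_group (G\<lparr>carrier := stabilizer G act v\<rparr>)"
proof (rule amenable_stabilizer[OF am v compactin_Z[of v]])
  show "{x \<in> boundary_paths \<Lambda>. v \<in> init x} \<noteq> {}" using boundary_nonempty[OF v] by blast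
  fix g x assume g: "g \<in> stabilizer G act v" and x: "x \<in> {x \<in> boundary_paths \<Lambda>. v \<in> init x}"
  then have "g \<in> carrier G" "act g v = v" by (auto simp: stabilizer_def)
  then show "pact g x \<in> {x \<in> boundary_paths \<Lambda>. v \<in> init x}"
    using x act_init_iff[of g x v] boundary_act[of g x] boundary_paths[of x] vertexD(1)[OF v] by auto
next
  fix x \<mu> assume x: "x \<in> {x \<in> boundary_paths \<Lambda>. v \<in> init x}" and m: "\<mu> \<in> init x"
  then have xp: "x \<in> paths \<Lambda>" using boundary_paths by blast
  have mM: "\<mu> \<in> Mor \<Lambda>" "rng \<Lambda> \<mu> = v"
    using init_Mor[OF xp m] init_rng[OF xp m] init_rng[OF xp, of v] x vertexD(2)[OF v] by auto
  have "(\<lambda>g. act g \<mu>) ` stabilizer G act v \<subseteq> starting \<Lambda> v \<inter> level \<Lambda> (deg \<Lambda> \<mu>)"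
  proof
    fix \<nu> assume "\<nu> \<in> (\<lambda>g. act g \<mu>) ` stabilizer G act v"
    then obtain g where g: "g \<in> carrier G" "act g v = v" "\<nu> = act g \<mu>" by (auto simp: stabilizer_def)
    then show "\<nu> \<in> starting \<Lambda> v \<inter> level \<Lambda> (deg \<Lambda> \<mu>)"
      using act_closed[OF g(1) mM(1)] act_deg[OF g(1) mM(1)] act_rng[OF g(1) mM(1)] mM(2)
      by (simp add: starting_def level_def)
  qed
  then show "finite ((\<lambda>g. act g \<mu>) ` stabilizer G act v)"
    using rf v finite_subset unfolding row_finite_def by blast
qed

subsection \<open>Rank one\<close>

text \<open>In rank one these are the edges received by \<open>v\<close>.\<close>

definition edges :: "'a \<Rightarrow> 'a set" where
  "edges v = {e \<in> starting \<Lambda> v. deg \<Lambda> e = (\<lambda>_. 1)}"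

text \<open>In rank one the boundary paths from a vertex that avoid the following invariant set stop at the
  first infinite receiver they meet. They form a compact set even if the graph is not row-finite.\<close>

definition beyond_infinite :: "'a set" where
  "beyond_infinite = {\<nu>. \<exists>\<mu>. pre \<mu> \<nu> \<and> \<mu> \<noteq> \<nu> \<and> infinite (edges (src \<Lambda> \<mu>))}"

lemma finite_edges_act:
  assumes h: "h \<in> carrier G" and v: "v \<in> Mor \<Lambda>" and fin: "finite (edges v)"
  shows "finite (edges (act h v))"
proof (rule finite_subset)
  show "edges (act h v) \<subseteq> act h ` edges v"
  proof
    fix e assume "e \<in> edges (act h v)"
    then have e: "e \<in> Mor \<Lambda>" "rng \<Lambda> e = act h v" "deg \<Lambda> e = (\<lambda>_. 1)" by (auto simp: edges_def starting_def)
    let ?e = "act (inv\<^bsub>G\<^esub> h) e"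
    have i: "inv\<^bsub>G\<^esub> h \<in> carrier G" using h by simp
    have "?e \<in> edges v"
      using e act_closed[OF i e(1)] act_rng[OF i e(1)] act_deg[OF i e(1)] act_inv_act[OF h v]
      by (simp add: edges_def starting_def)
    moreover have "e = act h ?e" using act_act_inv[OF h e(1)] by simp
    ultimately show "e \<in> act h ` edges v" by blast
  qed
qed (use fin in simp)

lemma beyond_infinite_act:
  assumes g: "g \<in> carrier G" and n: "\<nu> \<in> beyond_infinite"
  shows "act g \<nu> \<in> beyond_infinite"
proof -
  obtain \<mu> where m: "pre \<mu> \<nu>" "\<mu> \<noteq> \<nu>" "infinite (edges (src \<Lambda> \<mu>))" using n unfolding beyond_infinite_def by blast
  note M = pre_Mor[OF m(1)]
  let ?h = "res g \<mu>"
  have h: "?h \<in> carrier G" using res_closed[OF g M(1)] .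
  have s: "src \<Lambda> (act g \<mu>) = act ?h (src \<Lambda> \<mu>)" using act_res_src[OF g M(1)] act_src[OF g M(1)] by simp
  have "infinite (edges (src \<Lambda> (act g \<mu>)))"
  proof
    assume "finite (edges (src \<Lambda> (act g \<mu>)))"
    then have "finite (edges (act (inv\<^bsub>G\<^esub> ?h) (act ?h (src \<Lambda> \<mu>))))"
      unfolding s using finite_edges_act[of "inv\<^bsub>G\<^esub> ?h"] h act_closed[OF h src_closed[OF M(1)]] by simp
    then show False using m(3) act_inv_act[OF h src_closed[OF M(1)]] by simp
  qed
  then show ?thesis unfolding beyond_infinite_def using act_pre[OF g m(1)] act_inject[OF g M] m(2) by blast
qed

lemma beyond_infinite_up: "\<mu> \<in> beyond_infinite \<Longrightarrow> pre \<mu> \<nu> \<Longrightarrow> \<nu> \<in> beyond_infinite"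
proof -
  assume "\<mu> \<in> beyond_infinite" and p: "pre \<mu> \<nu>"
  then obtain \<xi> where x: "pre \<xi> \<mu>" "\<xi> \<noteq> \<mu>" "infinite (edges (src \<Lambda> \<xi>))" unfolding beyond_infinite_def by blast
  have "\<xi> \<noteq> \<nu>"
  proof
    assume "\<xi> = \<nu>"
    then have "deg \<Lambda> \<xi> = deg \<Lambda> \<mu>" using pre_deg[OF x(1)] pre_deg[OF p] by simp
    then show False using pre_same_deg[OF x(1)] x(2) by simp
  qed
  then show "\<nu> \<in> beyond_infinite" unfolding beyond_infinite_def using pre_trans[OF x(1) p] x(3) by blast
qed

context
  assumes rank1: "CARD('k) = 1"
begin

text \<open>With one coordinate the order on degrees is total; the second alternative is the strict
  inequality, written additively so that it matches appending an edge.\<close>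

lemma le_total: "(n :: 'k \<Rightarrow> nat) \<le> m \<or> m + (\<lambda>_. 1) \<le> n"
proof -
  obtain i :: 'k where i: "(UNIV :: 'k set) = {i}" using card_1_singletonE[OF rank1] by blast
  then have j: "j = i" for j by (metis UNIV_I singletonD)
  have "n \<le> m" if "n i \<le> m i" unfolding le_fun_def using that j by metis
  moreover have "m + (\<lambda>_. 1) \<le> n" if "\<not> n i \<le> m i"
    unfolding le_fun_def
  proof
    fix x
    show "(m + (\<lambda>_. 1)) x \<le> n x" using that unfolding j[of x] by simp
  qed
  ultimately show ?thesis by blast
qed

text \<open>Induction on the length: the last edge is received at the source of a proper prefix, and
  that vertex receives finitely many edges, as otherwise the path would lie beyond it.\<close>

lemma rank1_finite:
  assumes v: "v \<in> vertices \<Lambda>"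
  shows "finite {\<mu> \<in> Mor \<Lambda>. rng \<Lambda> \<mu> = v \<and> \<mu> \<notin> beyond_infinite \<and> deg \<Lambda> \<mu> = n}"
proof -
  let ?P = "\<lambda>n. {\<mu> \<in> Mor \<Lambda>. rng \<Lambda> \<mu> = v \<and> \<mu> \<notin> beyond_infinite \<and> deg \<Lambda> \<mu> = n}"
  have "finite (?P (\<lambda>_. m))" for m
  proof (induction m)
    case 0
    have "?P (\<lambda>_. 0) \<subseteq> {v}" using deg_0D vertexD(2) by (auto simp: zero_fun_def)
    then show ?case using finite_subset by blast
  next
    case (Suc m)
    \<comment> \<open>Replaced by the empty set at infinite receivers, which keeps the union finite
      without changing what is covered.\<close>
    let ?E = "\<lambda>\<alpha>. if finite (edges (src \<Lambda> \<alpha>)) then edges (src \<Lambda> \<alpha>) else {}"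
    have "?P (\<lambda>_. Suc m) \<subseteq> (\<Union>\<alpha>\<in>?P (\<lambda>_. m). (\<cdot>) \<alpha> ` ?E \<alpha>)"
    proof
      fix \<mu> assume m: "\<mu> \<in> ?P (\<lambda>_. Suc m)"
      then have "(\<lambda>_. m) \<le> deg \<Lambda> \<mu>" by (simp add: le_fun_def)
      then obtain \<alpha> e where ae: "cpb \<alpha> e" "deg \<Lambda> \<alpha> = (\<lambda>_. m)" "deg \<Lambda> e = deg \<Lambda> \<mu> - (\<lambda>_. m)" "\<mu> = \<alpha> \<cdot> e"
        using factor_obtain[of \<mu> "\<lambda>_. m"] m by blast
      have de: "deg \<Lambda> e = (\<lambda>_. 1)" using ae(3) m by (auto simp: fun_eq_iff)
      have p: "pre \<alpha> \<mu>" using pre_cmp[OF ae(1)] ae(4) by simp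
      have ne: "\<alpha> \<noteq> \<mu>"
      proof
        assume "\<alpha> = \<mu>"
        then have "(\<lambda>_ :: 'k. m) = (\<lambda>_. Suc m)" using ae(2) m by simp
        then show False by (simp add: fun_eq_iff)
      qed
      have aP: "\<alpha> \<in> ?P (\<lambda>_. m)" using ae m p beyond_infinite_up pre_rng[OF p] by auto
      have "finite (edges (src \<Lambda> \<alpha>))" using m p ne unfolding beyond_infinite_def by blast
      then have "e \<in> ?E \<alpha>" using ae(1) de by (simp add: edges_def starting_def)
      then show "\<mu> \<in> (\<Union>\<alpha>\<in>?P (\<lambda>_. m). (\<cdot>) \<alpha> ` ?E \<alpha>)" using aP ae(4) by blast
    qed
    moreover have "finite (\<Union>\<alpha>\<in>?P (\<lambda>_. m). (\<cdot>) \<alpha> ` ?E \<alpha>)" using Suc by auto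
    ultimately show ?case by (rule finite_subset)
  qed
  note fin = this
  obtain i :: 'k where i: "(UNIV :: 'k set) = {i}" using card_1_singletonE[OF rank1] by blast
  then have "n j = n i" for j by (metis UNIV_I singletonD)
  then have eq: "n = (\<lambda>_. n i)" by (rule ext)
  show ?thesis by (subst eq) (rule fin)
qed

text \<open>A path ending at an infinite receiver is already a boundary path: each member of a
  finite \<open>B\<close> follows at most one of the infinitely many edges behind
  \<open>\<mu>\<close>, so for some edge the member compatible with it must stop before the
  edge.\<close>

lemma rank1_finite_path:
  assumes l: "\<mu> \<in> Mor \<Lambda>" and inf: "infinite (edges (src \<Lambda> \<mu>))" and x: "x \<in> paths \<Lambda>" "init x = {\<kappa>. pre \<kappa> \<mu>}"
  shows "x \<in> boundary_paths \<Lambda>"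
  unfolding boundary_iff
proof (intro conjI ballI allI impI)
  fix \<nu> B assume "\<nu> \<in> init x" and B: "finite B \<and> exhaustive \<Lambda> (src \<Lambda> \<nu>) B"
  then obtain \<kappa> where k: "cpb \<nu> \<kappa>" "\<mu> = \<nu> \<cdot> \<kappa>" using x(2) unfolding pre_def by blast
  have s: "src \<Lambda> \<mu> = src \<Lambda> \<kappa>" using k src_cmp by simp
  have ck: "cpb \<kappa> e" if "e \<in> edges (src \<Lambda> \<mu>)" for e using that k(1) s by (simp add: edges_def starting_def)
  have "finite (\<Union>\<beta>\<in>B. {e \<in> edges (src \<Lambda> \<mu>). pre (\<kappa> \<cdot> e) \<beta>})"
  proof (rule finite_UN_I)
    fix \<beta>
    have "e = e'" if "e \<in> edges (src \<Lambda> \<mu>)" "pre (\<kappa> \<cdot> e) \<beta>" "e' \<in> edges (src \<Lambda> \<mu>)" "pre (\<kappa> \<cdot> e') \<beta>" for e e'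
    proof -
      have "deg \<Lambda> (\<kappa> \<cdot> e) = deg \<Lambda> (\<kappa> \<cdot> e')"
        using deg_cmp[of \<kappa>] ck[OF that(1)] ck[OF that(3)] that(1,3) by (simp add: edges_def)
      then have "\<kappa> \<cdot> e = \<kappa> \<cdot> e'" using pre_deg_eq[OF that(2,4)] by blast
      then show ?thesis using cmp_cancel[OF ck[OF that(1)] ck[OF that(3)]] by blast
    qed
    then have "{e \<in> edges (src \<Lambda> \<mu>). pre (\<kappa> \<cdot> e) \<beta>} \<subseteq> {SOME e. e \<in> edges (src \<Lambda> \<mu>) \<and> pre (\<kappa> \<cdot> e) \<beta>}"
      using someI[of "\<lambda>e. e \<in> edges (src \<Lambda> \<mu>) \<and> pre (\<kappa> \<cdot> e) \<beta>"] by blast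
    then show "finite {e \<in> edges (src \<Lambda> \<mu>). pre (\<kappa> \<cdot> e) \<beta>}" using finite_subset by blast
  qed (use B in blast)
  \<comment> \<open>An edge followed by no member of \<open>B\<close>. The member compatible with it
    has degree at most that of \<open>\<kappa>\<close>, hence is a prefix of
    \<open>\<kappa>\<close>.\<close>
  from infinite_imp_nonempty[OF Diff_infinite_finite[OF this inf]]
  obtain e where e: "e \<in> edges (src \<Lambda> \<mu>)" "\<And>\<beta>. \<beta> \<in> B \<Longrightarrow> \<not> pre (\<kappa> \<cdot> e) \<beta>" by blast
  have c: "cpb \<kappa> e" using ck[OF e(1)] .
  then have "\<kappa> \<cdot> e \<in> starting \<Lambda> (src \<Lambda> \<nu>)" using k(1) cmp_closed rng_cmp by (simp add: starting_def)
  then obtain \<beta> \<omega> where b: "\<beta> \<in> B" "pre (\<kappa> \<cdot> e) \<omega>" "pre \<beta> \<omega>" using B unfolding exhaustive_iff by blast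
  have "\<not> deg \<Lambda> (\<kappa> \<cdot> e) \<le> deg \<Lambda> \<beta>" using pre_linear[OF b(2,3)] e(2)[OF b(1)] by blast
  moreover have "deg \<Lambda> (\<kappa> \<cdot> e) = deg \<Lambda> \<kappa> + (\<lambda>_. 1)" using deg_cmp c e(1) by (simp add: edges_def)
  ultimately have "deg \<Lambda> \<beta> \<le> deg \<Lambda> \<kappa>" using le_total[of "deg \<Lambda> \<beta>" "deg \<Lambda> \<kappa>"] by auto
  then have "pre \<beta> \<kappa>" using pre_linear[OF b(3)] pre_trans[OF pre_cmp[OF c] b(2)] by blast
  moreover have "cpb \<nu> \<beta>" using B b(1) k(1) by (auto simp: exhaustive_iff starting_def)
  ultimately have "pre (\<nu> \<cdot> \<beta>) \<mu>" using pre_left[of \<nu> \<beta> \<kappa>] k(2) by simp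
  then show "\<exists>\<beta>\<in>B. \<nu> \<cdot> \<beta> \<in> init x" using b(1) x(2) by blast
qed (rule x(1))

text \<open>If an infinite receiver can be reached without passing another one, stop there.
  Otherwise every boundary path from \<open>v\<close> qualifies, since its shortest segment beyond
  an infinite receiver would exhibit such a receiver.\<close>

lemma rank1_nonempty:
  assumes v: "v \<in> vertices \<Lambda>"
  shows "{x \<in> boundary_paths \<Lambda>. v \<in> init x \<and> init x \<inter> beyond_infinite = {}} \<noteq> {}"
proof (cases "\<exists>\<mu>\<in>Mor \<Lambda>. rng \<Lambda> \<mu> = v \<and> \<mu> \<notin> beyond_infinite \<and> infinite (edges (src \<Lambda> \<mu>))")
  case True
  then obtain \<mu> where m: "\<mu> \<in> Mor \<Lambda>" "rng \<Lambda> \<mu> = v" "\<mu> \<notin> beyond_infinite" "infinite (edges (src \<Lambda> \<mu>))" by blast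
  obtain x where x: "x \<in> paths \<Lambda>" "init x = {\<kappa>. pre \<kappa> \<mu>}" using filt_path[OF filt_principal[OF m(1)]] .
  have "x \<in> boundary_paths \<Lambda>" by (rule rank1_finite_path[OF m(1,4) x])
  moreover have "v \<in> init x" using x(2) pre_vertex[OF m(1)] m(2) by simp
  moreover have "init x \<inter> beyond_infinite = {}" using x(2) m(3) beyond_infinite_up by blast
  ultimately show ?thesis by blast
next
  case False
  obtain x where x: "x \<in> boundary_paths \<Lambda>" "v \<in> init x" using boundary_nonempty[OF v] .
  have xp: "x \<in> paths \<Lambda>" using x boundary_paths by blast
  obtain i :: 'k where i: "(UNIV :: 'k set) = {i}" using card_1_singletonE[OF rank1] by blast
  then have j: "\<And>j. j = i" by auto
  have "init x \<inter> beyond_infinite = {}"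
  proof (rule ccontr)
    assume "init x \<inter> beyond_infinite \<noteq> {}"
    then obtain \<nu>0 where "\<nu>0 \<in> init x \<inter> beyond_infinite" by blast
    \<comment> \<open>Minimality makes the proper prefix \<open>\<mu>\<close> ending at an infinite
      receiver lie outside \<open>beyond_infinite\<close>, as the excluded case requires.\<close>
    from ex_has_least_nat[of "\<lambda>\<nu>. \<nu> \<in> init x \<inter> beyond_infinite", OF this, of "\<lambda>\<nu>. deg \<Lambda> \<nu> i"]
    obtain \<nu> where n: "\<nu> \<in> init x \<inter> beyond_infinite"
      "\<And>\<xi>. \<xi> \<in> init x \<inter> beyond_infinite \<Longrightarrow> deg \<Lambda> \<nu> i \<le> deg \<Lambda> \<xi> i" by blast
    then obtain \<mu> where m: "pre \<mu> \<nu>" "\<mu> \<noteq> \<nu>" "infinite (edges (src \<Lambda> \<mu>))" unfolding beyond_infinite_def by blast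
    have mi: "\<mu> \<in> init x" using init_hered[OF xp _ m(1)] n(1) by blast
    have "deg \<Lambda> \<mu> \<noteq> deg \<Lambda> \<nu>" using pre_same_deg[OF m(1)] m(2) by blast
    then have "deg \<Lambda> \<mu> i \<noteq> deg \<Lambda> \<nu> i" using j by (metis ext)
    then have "deg \<Lambda> \<mu> i < deg \<Lambda> \<nu> i" using le_funD[OF pre_deg[OF m(1)], of i] by simp
    then have "\<mu> \<notin> beyond_infinite" using n(2)[of \<mu>] mi by auto
    moreover have "rng \<Lambda> \<mu> = v" using init_rng[OF xp mi] init_rng[OF xp x(2)] vertexD(2)[OF v] by simp
    ultimately show False using False m(3) init_Mor[OF xp mi] by blast
  qed
  then show ?thesis using x by blast
qed

corollary amenable_stabilizer_rank1:
  assumes am: "amenable_action G (boundary_topology \<Lambda>) pact" and v: "v \<in> vertices \<Lambda>"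
  shows "amenable_group (G\<lparr>carrier := stabilizer G act v\<rparr>)"
proof (rule amenable_stabilizer[OF am v compactin_boundary_init rank1_nonempty[OF v]])
  let ?K = "{x \<in> boundary_paths \<Lambda>. v \<in> init x \<and> init x \<inter> beyond_infinite = {}}"
  fix g x assume "g \<in> stabilizer G act v" and x: "x \<in> ?K"
  then have g: "g \<in> carrier G" "act g v = v" by (auto simp: stabilizer_def)
  have xp: "x \<in> paths \<Lambda>" using x boundary_paths by blast
  have "init (pact g x) \<inter> beyond_infinite = {}"
  proof (rule ccontr)
    assume "init (pact g x) \<inter> beyond_infinite \<noteq> {}"
    then obtain \<mu> where m: "\<mu> \<in> init x" "act g \<mu> \<in> beyond_infinite" using path_act_init[OF g(1) xp] by auto
    then have "\<mu> \<in> beyond_infinite"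
      using beyond_infinite_act[of "inv\<^bsub>G\<^esub> g" "act g \<mu>"] g(1) act_inv_act[OF g(1) init_Mor[OF xp m(1)]] by simp
    then show False using m(1) x by blast
  qed
  then show "pact g x \<in> ?K"
    using x act_init_iff[OF g(1) xp vertexD(1)[OF v]] g boundary_act[OF g(1)] by auto
next
  fix x \<mu> assume x: "x \<in> {x \<in> boundary_paths \<Lambda>. v \<in> init x \<and> init x \<inter> beyond_infinite = {}}" and m: "\<mu> \<in> init x"
  then have xp: "x \<in> paths \<Lambda>" using boundary_paths by blast
  have mM: "\<mu> \<in> Mor \<Lambda>" "rng \<Lambda> \<mu> = v" "\<mu> \<notin> beyond_infinite"
    using init_Mor[OF xp m] init_rng[OF xp m] init_rng[OF xp, of v] x m vertexD(2)[OF v] by auto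
  have "(\<lambda>g. act g \<mu>) ` stabilizer G act v
      \<subseteq> {\<nu> \<in> Mor \<Lambda>. rng \<Lambda> \<nu> = v \<and> \<nu> \<notin> beyond_infinite \<and> deg \<Lambda> \<nu> = deg \<Lambda> \<mu>}"
  proof
    fix \<nu> assume "\<nu> \<in> (\<lambda>g. act g \<mu>) ` stabilizer G act v"
    then obtain g where g: "g \<in> carrier G" "act g v = v" "\<nu> = act g \<mu>" by (auto simp: stabilizer_def)
    have "act g \<mu> \<notin> beyond_infinite"
      using beyond_infinite_act[of "inv\<^bsub>G\<^esub> g" "act g \<mu>"] g(1) act_inv_act[OF g(1) mM(1)] mM(3) by auto
    then show "\<nu> \<in> {\<nu> \<in> Mor \<Lambda>. rng \<Lambda> \<nu> = v \<and> \<nu> \<notin> beyond_infinite \<and> deg \<Lambda> \<nu> = deg \<Lambda> \<mu>}"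
      using act_closed[OF g(1) mM(1)] act_deg[OF g(1) mM(1)] act_rng[OF g(1) mM(1)] mM(2) g by simp
  qed
  then show "finite ((\<lambda>g. act g \<mu>) ` stabilizer G act v)" using rank1_finite[OF v] finite_subset by blast
qed

end

end

section \<open>Calculus of the Exel--Pardo groupoid\<close>

text \<open>The meet of \<open>n\<close> and \<open>d(x)\<close>, finite even in directions where
  \<open>d(x)\<close> is infinite; the expression is the one in \<open>path_res\<close>.\<close>

definition trunc_deg :: "('a, 'k) path \<Rightarrow> ('k \<Rightarrow> nat) \<Rightarrow> 'k \<Rightarrow> nat" where
  "trunc_deg x n = (\<lambda>i. the_enat (min (enat (n i)) (pdeg x i)))"

abbreviation trunc :: "('a, 'k) path \<Rightarrow> ('k \<Rightarrow> nat) \<Rightarrow> 'a" where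
  "trunc x n \<equiv> seg x 0 (trunc_deg x n)"

lemma trunc_deg_le: "enatv (trunc_deg x n) \<le> pdeg x"
proof -
  have "enat (the_enat (min (enat (n i)) (pdeg x i))) \<le> pdeg x i" for i
    by (cases "pdeg x i") (auto simp: min_def)
  then show ?thesis by (simp add: le_fun_def trunc_deg_def)
qed

lemma trunc_deg_shift:
  assumes "enatv m \<le> pdeg x"
  shows "trunc_deg x (m + n) = m + trunc_deg (shift m x) n"
proof
  fix i
  have "enat (m i) \<le> pdeg x i" using assms by (auto simp: le_fun_def)
  then show "trunc_deg x (m + n) i = (m + trunc_deg (shift m x) n) i"
    unfolding trunc_deg_def pdeg_shift by (cases "pdeg x i") (auto simp: min_def)
qed

context ss_kgraph
begin

abbreviation cl where "cl f \<equiv> Qrel G `` {f}"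

lemma Qclass_eq_iff:
  assumes "f \<in> UNIV \<rightarrow> carrier G" "f' \<in> UNIV \<rightarrow> carrier G"
  shows "cl f = cl f' \<longleftrightarrow> (\<exists>m. \<forall>n\<ge>m. f n = f' n)"
proof
  assume "cl f = cl f'"
  moreover have "f' \<in> cl f'" using assms by (auto simp: Qrel_def)
  ultimately have "f' \<in> cl f" by simp
  then show "\<exists>m. \<forall>n\<ge>m. f n = f' n" by (simp add: Qrel_def)
next
  assume ex: "\<exists>m. \<forall>n\<ge>m. f n = f' n"
  have sub: "cl f \<subseteq> cl f'" if f: "f \<in> UNIV \<rightarrow> carrier G" "f' \<in> UNIV \<rightarrow> carrier G" "\<exists>m. \<forall>n\<ge>m. f n = f' n" for f f'
  proof
    fix h assume "h \<in> cl f"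
    then obtain m' where h: "h \<in> UNIV \<rightarrow> carrier G" "\<forall>n\<ge>m'. f n = h n" by (auto simp: Qrel_def)
    obtain m where "\<forall>n\<ge>m. f n = f' n" using f(3) by blast
    then have "\<forall>n\<ge>sup m m'. f' n = h n" using h(2) by (metis le_sup_iff)
    then show "h \<in> cl f'" using h(1) f(2) unfolding Qrel_def by blast
  qed
  have ex': "\<exists>m. \<forall>n\<ge>m. f' n = f n" using ex by (elim exE) (metis)
  show "cl f = cl f'" using sub[OF assms ex] sub[OF assms(2,1) ex'] by (rule equalityI)
qed

lemma translate_closed: "f \<in> UNIV \<rightarrow> carrier G \<Longrightarrow> translate G m f \<in> UNIV \<rightarrow> carrier G"
  by (auto simp: translate_def)

lemma Qtranslate_class:
  assumes f: "f \<in> UNIV \<rightarrow> carrier G"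
  shows "Qtranslate G m (cl f) = cl (translate G m f)"
proof -
  have "cl (translate G m h) = cl (translate G m f)" if "h \<in> cl f" for h
  proof -
    from that obtain n0 where h: "h \<in> UNIV \<rightarrow> carrier G" "\<And>n. n \<ge> n0 \<Longrightarrow> f n = h n" by (auto simp: Qrel_def)
    \<comment> \<open>The threshold is \<open>n0 + m\<close>, cut off at 0 because \<open>m\<close>
      may be negative; beyond it the translated argument is at least \<open>n0\<close>.\<close>
    have "translate G m h n = translate G m f n" if "n \<ge> (\<lambda>i. nat (int (n0 i) + m i))" for n
    proof -
      have "n0 \<le> (\<lambda>i. nat (int (n i) - m i))"
      proof (rule le_funI)
        fix i have "nat (int (n0 i) + m i) \<le> n i" using le_funD[OF that, of i] .
        then show "n0 i \<le> nat (int (n i) - m i)" by linarith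
      qed
      then show ?thesis using h(2) by (simp add: translate_def)
    qed
    then show ?thesis using Qclass_eq_iff[OF translate_closed[OF h(1)] translate_closed[OF f]] by blast
  qed
  moreover have "f \<in> cl f" using f by (auto simp: Qrel_def)
  ultimately show ?thesis unfolding Qtranslate_def by blast
qed

lemma Qmult_class:
  assumes f: "f \<in> UNIV \<rightarrow> carrier G" "f' \<in> UNIV \<rightarrow> carrier G"
  shows "cl f \<otimes>\<^bsub>Qgroup G\<^esub> cl f' = cl (\<lambda>n. f n \<otimes>\<^bsub>G\<^esub> f' n)"
proof -
  have closed: "(\<lambda>n. f n \<otimes>\<^bsub>G\<^esub> f' n) \<in> UNIV \<rightarrow> carrier G" using f by (auto simp: Pi_iff)
  have "cl (\<lambda>n. h n \<otimes>\<^bsub>G\<^esub> h' n) = cl (\<lambda>n. f n \<otimes>\<^bsub>G\<^esub> f' n)" if "h \<in> cl f" "h' \<in> cl f'" for h h'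
  proof -
    from that obtain m m' where h: "h \<in> UNIV \<rightarrow> carrier G" "\<And>n. n \<ge> m \<Longrightarrow> f n = h n"
      "h' \<in> UNIV \<rightarrow> carrier G" "\<And>n. n \<ge> m' \<Longrightarrow> f' n = h' n" by (auto simp: Qrel_def)
    have "\<forall>n\<ge>sup m m'. h n \<otimes>\<^bsub>G\<^esub> h' n = f n \<otimes>\<^bsub>G\<^esub> f' n" using h(2,4) by (metis le_sup_iff)
    moreover have "(\<lambda>n. h n \<otimes>\<^bsub>G\<^esub> h' n) \<in> UNIV \<rightarrow> carrier G" using h by (auto simp: Pi_iff)
    ultimately show ?thesis using Qclass_eq_iff[OF _ closed] by blast
  qed
  moreover have "f \<in> cl f" "f' \<in> cl f'" using f by (auto simp: Qrel_def)
  ultimately show ?thesis unfolding Qgroup_def monoid.simps by blast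
qed

lemma trunc_init: "trunc x n \<in> init x"
  by (rule init_seg) (rule trunc_deg_le)

lemma deg_trunc: "x \<in> paths \<Lambda> \<Longrightarrow> deg \<Lambda> (trunc x n) = trunc_deg x n"
  by (rule seg0_deg, assumption, rule trunc_deg_le)

lemma trunc_Mor: "x \<in> paths \<Lambda> \<Longrightarrow> trunc x n \<in> Mor \<Lambda>"
  using init_Mor trunc_init by blast

lemma trunc_tail:
  assumes x: "x \<in> paths \<Lambda>" and m: "\<mu> \<in> init x"
  shows "cpb \<mu> (trunc (tail \<mu> x) n)" "trunc x (deg \<Lambda> \<mu> + n) = \<mu> \<cdot> trunc (tail \<mu> x) n"
proof -
  have *: "cpb \<mu> (trunc (tail \<mu> x) n) \<and> \<mu> \<cdot> trunc (tail \<mu> x) n \<in> init x"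
    using tail_init[OF x m] trunc_init by blast
  then show "cpb \<mu> (trunc (tail \<mu> x) n)" by blast
  have "deg \<Lambda> (\<mu> \<cdot> trunc (tail \<mu> x) n) = deg \<Lambda> (trunc x (deg \<Lambda> \<mu> + n))"
  proof -
    have "deg \<Lambda> (\<mu> \<cdot> trunc (tail \<mu> x) n) = deg \<Lambda> \<mu> + trunc_deg (tail \<mu> x) n"
      using * deg_cmp[of \<mu> "trunc (tail \<mu> x) n"] deg_trunc[OF tail_paths[OF x m]] by simp
    also have "\<dots> = trunc_deg x (deg \<Lambda> \<mu> + n)" by (rule trunc_deg_shift[OF init_deg(1)[OF x m], symmetric])
    also have "\<dots> = deg \<Lambda> (trunc x (deg \<Lambda> \<mu> + n))" by (rule deg_trunc[OF x, symmetric])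
    finally show ?thesis .
  qed
  then show "trunc x (deg \<Lambda> \<mu> + n) = \<mu> \<cdot> trunc (tail \<mu> x) n"
    using init_deg_eq[OF x trunc_init] * by metis
qed

lemma trunc_act: "g \<in> carrier G \<Longrightarrow> x \<in> paths \<Lambda> \<Longrightarrow> trunc (pact g x) n = act g (trunc x n)"
proof -
  assume "g \<in> carrier G" "x \<in> paths \<Lambda>"
  moreover have "trunc_deg (pact g x) n = trunc_deg x n" by (simp add: trunc_deg_def)
  ultimately show ?thesis using path_act_seg0 trunc_deg_le by metis
qed

abbreviation rseq where "rseq g x \<equiv> (\<lambda>n. res g (trunc x n))"

lemma rseq_closed: "g \<in> carrier G \<Longrightarrow> x \<in> paths \<Lambda> \<Longrightarrow> rseq g x \<in> UNIV \<rightarrow> carrier G"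
  using res_closed trunc_Mor by blast

lemma path_res_eq: "path_res G res g x = cl (rseq g x)"
  by (simp add: path_res_def trunc_deg_def)

abbreviation ep where "ep \<equiv> ep_quadruple G \<Lambda> act res"

lemma ep_eq:
  assumes "g \<in> carrier G" "x \<in> paths \<Lambda>"
  shows "ep \<mu> g \<nu> x = (path_concat \<Lambda> \<mu> (pact g x), cl (translate G (intv (deg \<Lambda> \<mu>)) (rseq g x)),
    intv (deg \<Lambda> \<mu>) - intv (deg \<Lambda> \<nu>), path_concat \<Lambda> \<nu> x)"
  unfolding ep_quadruple_def path_res_eq Qtranslate_class[OF rseq_closed[OF assms]] ..

lemma translate_intv:
  "d \<le> n \<Longrightarrow> translate G (intv d) f n = f (n - d)"
proof -
  assume "d \<le> n"
  then have "(\<lambda>i. nat (int (n i) - int (d i))) = n - d" by (auto simp: le_fun_def fun_eq_iff)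
  moreover have "intv d \<le> intv n" using \<open>d \<le> n\<close> by (simp add: le_fun_def)
  ultimately show ?thesis by (simp add: translate_def)
qed

text \<open>The indices of the basic bisections: for such data \<open>ep \<mu> g \<nu>\<close> is a
  parametrization of one by the boundary paths from \<open>src \<nu>\<close>.\<close>

definition triple :: "'a \<Rightarrow> 'g \<Rightarrow> 'a \<Rightarrow> bool" where
  "triple \<mu> g \<nu> \<longleftrightarrow> \<mu> \<in> Mor \<Lambda> \<and> g \<in> carrier G \<and> \<nu> \<in> Mor \<Lambda> \<and> src \<Lambda> \<mu> = act g (src \<Lambda> \<nu>)"

definition bpaths :: "'a \<Rightarrow> ('a, 'k) path set" where
  "bpaths v = {x \<in> boundary_paths \<Lambda>. prng x = v}"

lemma bpathsD: "x \<in> bpaths v \<Longrightarrow> x \<in> paths \<Lambda>" "x \<in> bpaths v \<Longrightarrow> x \<in> boundary_paths \<Lambda>" "x \<in> bpaths v \<Longrightarrow> prng x = v"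
  by (auto simp: bpaths_def dest: boundary_paths)

lemma bpaths_tail: "x \<in> boundary_paths \<Lambda> \<Longrightarrow> \<kappa> \<in> init x \<Longrightarrow> tail \<kappa> x \<in> bpaths (src \<Lambda> \<kappa>)"
  using boundary_tail tail_prng boundary_paths by (auto simp: bpaths_def)

lemma bpaths_act: "g \<in> carrier G \<Longrightarrow> x \<in> bpaths v \<Longrightarrow> pact g x \<in> bpaths (act g v)"
  using boundary_act prng_path_act boundary_paths by (auto simp: bpaths_def)

lemma bpaths_concat: "\<mu> \<in> Mor \<Lambda> \<Longrightarrow> x \<in> bpaths (src \<Lambda> \<mu>) \<Longrightarrow> path_concat \<Lambda> \<mu> x \<in> bpaths (rng \<Lambda> \<mu>)"
  using boundary_concat prng_concat boundary_paths by (auto simp: bpaths_def)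

lemma bpaths_init: "x \<in> bpaths (src \<Lambda> \<nu>) \<Longrightarrow> \<nu> \<in> Mor \<Lambda> \<Longrightarrow> \<kappa> \<in> init x \<Longrightarrow> cpb \<nu> \<kappa>"
  using init_Mor init_rng bpathsD by metis

lemma tripleD:
  assumes "triple \<mu> g \<nu>"
  shows "\<mu> \<in> Mor \<Lambda>" "g \<in> carrier G" "\<nu> \<in> Mor \<Lambda>" "src \<Lambda> \<mu> = act g (src \<Lambda> \<nu>)"
  using assms by (auto simp: triple_def)

lemma triple_refine:
  assumes t: "triple \<mu> g \<nu>" and c: "cpb \<nu> \<kappa>"
  shows "cpb \<mu> (act g \<kappa>)" "triple (\<mu> \<cdot> act g \<kappa>) (res g \<kappa>) (\<nu> \<cdot> \<kappa>)"
proof -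
  note t' = tripleD[OF t]
  show *: "cpb \<mu> (act g \<kappa>)" using t' c act_closed[OF t'(2)] act_rng[OF t'(2)] by auto
  show "triple (\<mu> \<cdot> act g \<kappa>) (res g \<kappa>) (\<nu> \<cdot> \<kappa>)"
    unfolding triple_def using * c t' cmp_closed src_cmp res_closed act_src[OF t'(2)] act_res_src[OF t'(2)] by simp
qed

lemma triple_inv: "triple \<mu> g \<nu> \<Longrightarrow> triple \<nu> (inv\<^bsub>G\<^esub> g) \<mu>"
  unfolding triple_def using act_inv_act src_closed by simp

lemma ep_grng: "grng (exel_pardo_groupoid G \<Lambda> act res) (ep \<mu> g \<nu> x) = path_concat \<Lambda> \<mu> (pact g x)"
  and ep_gsrc: "gsrc (exel_pardo_groupoid G \<Lambda> act res) (ep \<mu> g \<nu> x) = path_concat \<Lambda> \<nu> x"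
  by (simp_all add: exel_pardo_groupoid_def ep_quadruple_def)

text \<open>The refinement principle. The degree component is a difference and does not see the
  common extension; the germs agree for all \<open>n\<close> above
  \<open>deg \<mu> + deg \<kappa>\<close>, because restriction along a product is iterated
  restriction.\<close>

lemma ep_refine:
  assumes t: "triple \<mu> g \<nu>" and x: "x \<in> bpaths (src \<Lambda> \<nu>)" and k: "\<kappa> \<in> init x"
  shows "ep \<mu> g \<nu> x = ep (\<mu> \<cdot> act g \<kappa>) (res g \<kappa>) (\<nu> \<cdot> \<kappa>) (tail \<kappa> x)"
proof -
  note t' = tripleD[OF t] and x' = bpathsD[OF x]
  have c: "cpb \<nu> \<kappa>" using bpaths_init[OF x t'(3) k] .
  note r = triple_refine[OF t c] 
  note r' = tripleD[OF r(2)]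
  have tp: "tail \<kappa> x \<in> paths \<Lambda>" "prng (tail \<kappa> x) = src \<Lambda> \<kappa>" using tail_paths[OF x'(1) k] tail_prng[OF x'(1) k] by auto
  have ta: "pact (res g \<kappa>) (tail \<kappa> x) \<in> paths \<Lambda>" using path_act_paths[OF r'(2) tp(1)] .
  have gk: "act g \<kappa> \<in> init (pact g x)" using act_init_iff[OF t'(2) x'(1)] c k by blast
  have 1: "path_concat \<Lambda> (act g \<kappa>) (pact (res g \<kappa>) (tail \<kappa> x)) = pact g x"
    using concat_tail[OF path_act_paths[OF t'(2) x'(1)] gk] tail_act[OF t'(2) x'(1) k] by simp
  have s: "src \<Lambda> (act g \<kappa>) = prng (pact (res g \<kappa>) (tail \<kappa> x))"
    using prng_path_act[OF r'(2) tp(1)] tp(2) act_src[OF t'(2)] act_res_src[OF t'(2)] c by simp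
  have 2: "path_concat \<Lambda> (\<mu> \<cdot> act g \<kappa>) (pact (res g \<kappa>) (tail \<kappa> x)) = path_concat \<Lambda> \<mu> (pact g x)"
    using concat_assoc[OF ta r(1) s] 1 by simp
  have 3: "path_concat \<Lambda> (\<nu> \<cdot> \<kappa>) (tail \<kappa> x) = path_concat \<Lambda> \<nu> x"
    using concat_assoc[OF tp(1) c] tp(2) concat_tail[OF x'(1) k] by simp
  have dm: "deg \<Lambda> (\<mu> \<cdot> act g \<kappa>) = deg \<Lambda> \<mu> + deg \<Lambda> \<kappa>" using deg_cmp r(1) act_deg[OF t'(2)] c by simp
  have dn: "deg \<Lambda> (\<nu> \<cdot> \<kappa>) = deg \<Lambda> \<nu> + deg \<Lambda> \<kappa>" using deg_cmp c by simp
  have 4: "intv (deg \<Lambda> (\<mu> \<cdot> act g \<kappa>)) - intv (deg \<Lambda> (\<nu> \<cdot> \<kappa>)) = intv (deg \<Lambda> \<mu>) - intv (deg \<Lambda> \<nu>)"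
    unfolding dm dn by (auto simp: fun_eq_iff)
  have "translate G (intv (deg \<Lambda> \<mu>)) (rseq g x) n
      = translate G (intv (deg \<Lambda> (\<mu> \<cdot> act g \<kappa>))) (rseq (res g \<kappa>) (tail \<kappa> x)) n"
    if n: "deg \<Lambda> \<mu> + deg \<Lambda> \<kappa> \<le> n" for n
  proof -
    have "deg \<Lambda> \<mu> \<le> deg \<Lambda> \<mu> + deg \<Lambda> \<kappa>" by (simp add: le_fun_def)
    then have n1: "deg \<Lambda> \<mu> \<le> n" using n by (rule order_trans)
    have n2: "n - deg \<Lambda> \<mu> = deg \<Lambda> \<kappa> + (n - (deg \<Lambda> \<mu> + deg \<Lambda> \<kappa>))"
    proof
      fix i have "deg \<Lambda> \<mu> i + deg \<Lambda> \<kappa> i \<le> n i" using le_funD[OF n, of i] by simp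
      then show "(n - deg \<Lambda> \<mu>) i = (deg \<Lambda> \<kappa> + (n - (deg \<Lambda> \<mu> + deg \<Lambda> \<kappa>))) i" by simp
    qed
    show ?thesis
      unfolding dm translate_intv[OF n1] translate_intv[OF n] n2 trunc_tail(2)[OF x'(1) k]
      by (rule res_cmp[OF t'(2)]) (use trunc_tail(1)[OF x'(1) k] in auto)
  qed
  then have "cl (translate G (intv (deg \<Lambda> \<mu>)) (rseq g x))
      = cl (translate G (intv (deg \<Lambda> (\<mu> \<cdot> act g \<kappa>))) (rseq (res g \<kappa>) (tail \<kappa> x)))"
    using Qclass_eq_iff[OF translate_closed[OF rseq_closed[OF t'(2) x'(1)]] translate_closed[OF rseq_closed[OF r'(2) tp(1)]]]
    by blast
  then show ?thesis unfolding ep_eq[OF t'(2) x'(1)] ep_eq[OF r'(2) tp(1)] 2 3 4 by simp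
qed

text \<open>With a common middle morphism the two translations combine to one by
  \<open>deg \<mu>\<close>, and on germs the product is \<open>res_mult\<close> at the truncations
  of \<open>x\<close>.\<close>

lemma ep_mult:
  assumes t: "triple \<mu> g \<nu>" "triple \<nu> h \<kappa>" and x: "x \<in> bpaths (src \<Lambda> \<kappa>)"
  shows "gmult (exel_pardo_groupoid G \<Lambda> act res) (ep \<mu> g \<nu> (pact h x)) (ep \<nu> h \<kappa> x) = ep \<mu> (g \<otimes>\<^bsub>G\<^esub> h) \<kappa> x"
proof -
  note g = tripleD(2)[OF t(1)] and h = tripleD(2)[OF t(2)] and xp = bpathsD(1)[OF x]
  have hx: "pact h x \<in> paths \<Lambda>" using path_act_paths[OF h xp] .
  have gh: "g \<otimes>\<^bsub>G\<^esub> h \<in> carrier G" using g h by simp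
  let ?m = "intv (deg \<Lambda> \<mu>)" and ?n = "intv (deg \<Lambda> \<nu>)"
  let ?f = "translate G ?m (rseq g (pact h x))" and ?f' = "translate G (?m - ?n) (translate G ?n (rseq h x))"
  have cf: "?f \<in> UNIV \<rightarrow> carrier G" "translate G ?n (rseq h x) \<in> UNIV \<rightarrow> carrier G" "?f' \<in> UNIV \<rightarrow> carrier G"
    by (intro translate_closed rseq_closed g h hx xp)+
  have "?f n \<otimes>\<^bsub>G\<^esub> ?f' n = translate G ?m (rseq (g \<otimes>\<^bsub>G\<^esub> h) x) n" if n: "deg \<Lambda> \<mu> \<le> n" for n
  proof -
    let ?k = "\<lambda>i. nat (int (n i) - (?m - ?n) i)"
    have ni: "deg \<Lambda> \<mu> i \<le> n i" for i using le_funD[OF n] .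
    have "?m - ?n \<le> intv n"
      by (rule le_funI) (use ni in \<open>simp add: add_increasing2 diff_le_eq trans_le_add1\<close>)
    then have "?f' n = translate G ?n (rseq h x) ?k" by (simp add: translate_def)
    also have "\<dots> = rseq h x (?k - deg \<Lambda> \<nu>)"
    proof (rule translate_intv)
      show "deg \<Lambda> \<nu> \<le> ?k"
      proof (rule le_funI)
        fix i show "deg \<Lambda> \<nu> i \<le> ?k i" using ni[of i] by simp
      qed
    qed
    also have "?k - deg \<Lambda> \<nu> = n - deg \<Lambda> \<mu>"
    proof
      fix i show "(?k - deg \<Lambda> \<nu>) i = (n - deg \<Lambda> \<mu>) i" using ni[of i] by simp
    qed
    finally have 1: "?f' n = rseq h x (n - deg \<Lambda> \<mu>)" .
    show ?thesis
      unfolding 1 translate_intv[OF n] trunc_act[OF h xp]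
      by (rule res_mult[symmetric, OF g h trunc_Mor[OF xp]])
  qed
  then have "cl (\<lambda>n. ?f n \<otimes>\<^bsub>G\<^esub> ?f' n) = cl (translate G ?m (rseq (g \<otimes>\<^bsub>G\<^esub> h) x))"
    using Qclass_eq_iff[of "\<lambda>n. ?f n \<otimes>\<^bsub>G\<^esub> ?f' n", OF _ translate_closed[OF rseq_closed[OF gh xp]]] cf
    by (auto simp: Pi_iff)
  then have "cl ?f \<otimes>\<^bsub>Qgroup G\<^esub> Qtranslate G (?m - ?n) (cl (translate G ?n (rseq h x)))
      = cl (translate G ?m (rseq (g \<otimes>\<^bsub>G\<^esub> h) x))"
    using Qmult_class[OF cf(1,3)] Qtranslate_class[OF cf(2)] by simp
  moreover have "?m - ?n + (?n - intv (deg \<Lambda> \<kappa>)) = ?m - intv (deg \<Lambda> \<kappa>)" by (auto simp: fun_eq_iff)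
  ultimately show ?thesis
    unfolding ep_eq[OF g hx] ep_eq[OF h xp] ep_eq[OF gh xp] path_act_mult[OF g h xp]
    by (simp add: exel_pardo_groupoid_def)
qed

end

locale pf_kgraph = ss_kgraph G \<Lambda> act res
  for G :: "('g, 'b) monoid_scheme" and \<Lambda> :: "('a, 'k::finite) kgraph" (structure)
    and act :: "'g \<Rightarrow> 'a \<Rightarrow> 'a" and res :: "'g \<Rightarrow> 'a \<Rightarrow> 'g" +
  assumes pf: "pseudo_free G \<Lambda> act res"
begin

lemma pseudo_free_inject:
  assumes g: "g \<in> carrier G" "g' \<in> carrier G" and m: "\<mu> \<in> Mor \<Lambda>"
    and eq: "act g \<mu> = act g' \<mu>" "res g \<mu> = res g' \<mu>"
  shows "g = g'"
proof -
  let ?k = "inv\<^bsub>G\<^esub> g' \<otimes>\<^bsub>G\<^esub> g"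
  have k: "?k \<in> carrier G" using g by simp
  have "act ?k \<mu> = \<mu>" using act_mult[of "inv\<^bsub>G\<^esub> g'" g \<mu>] g m eq(1) act_inv_act by simp
  moreover have "res ?k \<mu> = \<one>\<^bsub>G\<^esub>"
    using res_mult[of "inv\<^bsub>G\<^esub> g'" g \<mu>] g m eq res_inv[OF g(2) m] res_closed[OF g(2) m] by simp
  ultimately have "?k = \<one>\<^bsub>G\<^esub>" using pf k m unfolding pseudo_free_def by blast
  then have "g' \<otimes>\<^bsub>G\<^esub> ?k = g'" using g by simp
  then show "g = g'" using g by (simp add: gr.m_assoc[symmetric])
qed

text \<open>The degree component fixes \<open>deg \<mu>\<close>, and the range path then fixes
  \<open>\<mu>\<close> and the image of \<open>x\<close>. So \<open>g\<close> and \<open>g'\<close>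
  act alike on every segment of \<open>x\<close>; the germ makes their restrictions equal on a long
  one, and pseudo-freeness applies.\<close>

lemma ep_unique:
  assumes t: "triple \<mu> g \<nu>" "triple \<mu>' g' \<nu>" and x: "x \<in> bpaths (src \<Lambda> \<nu>)"
    and eq: "ep \<mu> g \<nu> x = ep \<mu>' g' \<nu> x"
  shows "\<mu> = \<mu>'" "g = g'"
proof -
  note g = tripleD(2)[OF t(1)] and g' = tripleD(2)[OF t(2)] and xp = bpathsD(1)[OF x]
  have d: "deg \<Lambda> \<mu> = deg \<Lambda> \<mu>'"
  proof
    fix i
    have "(intv (deg \<Lambda> \<mu>) - intv (deg \<Lambda> \<nu>)) i = (intv (deg \<Lambda> \<mu>') - intv (deg \<Lambda> \<nu>)) i"
      using eq[unfolded ep_eq[OF g xp] ep_eq[OF g' xp]] by (metis prod.inject)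
    then show "deg \<Lambda> \<mu> i = deg \<Lambda> \<mu>' i" by simp
  qed
  have z: "path_concat \<Lambda> \<mu> (pact g x) = path_concat \<Lambda> \<mu>' (pact g' x)"
    and Q: "cl (translate G (intv (deg \<Lambda> \<mu>)) (rseq g x)) = cl (translate G (intv (deg \<Lambda> \<mu>')) (rseq g' x))"
    using eq[unfolded ep_eq[OF g xp] ep_eq[OF g' xp]] by (simp_all only: prod.inject)
  have s: "src \<Lambda> \<mu> = prng (pact g x)" "src \<Lambda> \<mu>' = prng (pact g' x)"
    using prng_path_act[OF g xp] prng_path_act[OF g' xp] tripleD(4)[OF t(1)] tripleD(4)[OF t(2)] bpathsD(3)[OF x] by auto
  note c = concat[OF path_act_paths[OF g xp] tripleD(1)[OF t(1)] s(1)]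
  note c' = concat[OF path_act_paths[OF g' xp] tripleD(1)[OF t(2)] s(2)]
  show m: "\<mu> = \<mu>'" using init_deg_eq[OF c(1,2)] c'(2) z d by simp
  have "tail \<mu> (path_concat \<Lambda> \<mu> (pact g x)) = tail \<mu>' (path_concat \<Lambda> \<mu>' (pact g' x))"
    unfolding z unfolding m ..
  then have ga: "pact g x = pact g' x" unfolding c(3) c'(3) .
  from Q obtain m where m': "\<forall>n\<ge>m. translate G (intv (deg \<Lambda> \<mu>)) (rseq g x) n = translate G (intv (deg \<Lambda> \<mu>')) (rseq g' x) n"
    using Qclass_eq_iff[OF translate_closed[OF rseq_closed[OF g xp]] translate_closed[OF rseq_closed[OF g' xp]]] by blast
  \<comment> \<open>Above the threshold of the germ and above \<open>deg \<mu>\<close>, so that both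
    translates can be evaluated there.\<close>
  let ?n = "m + deg \<Lambda> \<mu>"
  have n: "m \<le> ?n" "deg \<Lambda> \<mu> \<le> ?n" by (simp_all add: le_fun_def)
  define \<tau> where "\<tau> = trunc x (?n - deg \<Lambda> \<mu>)"
  have r: "res g \<tau> = res g' \<tau>"
    using m'[rule_format, OF n(1)] unfolding m[symmetric] translate_intv[OF n(2)] \<tau>_def .
  have a: "act g \<tau> = act g' \<tau>"
    using trunc_act[OF g xp, of "?n - deg \<Lambda> \<mu>"] trunc_act[OF g' xp, of "?n - deg \<Lambda> \<mu>"] ga unfolding \<tau>_def by simp
  have tM: "\<tau> \<in> Mor \<Lambda>" unfolding \<tau>_def using trunc_Mor[OF xp] .
  show "g = g'" by (rule pseudo_free_inject[OF g g' tM a r])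
qed

subsection \<open>Topology\<close>

abbreviation EP where "EP \<equiv> exel_pardo_groupoid G \<Lambda> act res"
abbreviation ET where "ET \<equiv> ep_topology G \<Lambda> act res"

lemma EP_simps: "arrow_top EP = ET" "unit_set EP = boundary_paths \<Lambda>"
  by (simp_all add: exel_pardo_groupoid_def)

lemma ep_arrow: "triple \<mu> g \<nu> \<Longrightarrow> x \<in> bpaths (src \<Lambda> \<nu>) \<Longrightarrow> ep \<mu> g \<nu> x \<in> topspace ET"
  unfolding topspace_ep_topology bpaths_def triple_def
  by (intro CollectI exI[of _ \<mu>] exI[of _ g] exI[of _ \<nu>] exI[of _ x]) simp

lemma arrow_cases:
  assumes "a \<in> topspace ET"
  obtains \<mu> g \<nu> x where "triple \<mu> g \<nu>" "x \<in> bpaths (src \<Lambda> \<nu>)" "a = ep \<mu> g \<nu> x"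
proof -
  obtain \<mu> g \<nu> x where *: "a = ep \<mu> g \<nu> x" "x \<in> boundary_paths \<Lambda>" "g \<in> carrier G" "\<mu> \<in> Mor \<Lambda>" "\<nu> \<in> Mor \<Lambda>"
      "src \<Lambda> \<nu> = prng x" "src \<Lambda> \<mu> = act g (prng x)"
    using assms unfolding topspace_ep_topology by blast
  then have "triple \<mu> g \<nu>" "x \<in> bpaths (src \<Lambda> \<nu>)" by (simp_all add: triple_def bpaths_def)
  then show ?thesis using that *(1) by blast
qed

lemma join_concat:
  assumes n: "\<nu> \<in> Mor \<Lambda>" "\<nu>' \<in> Mor \<Lambda>" and x: "x \<in> bpaths (src \<Lambda> \<nu>)" "x' \<in> bpaths (src \<Lambda> \<nu>')"
    and eq: "path_concat \<Lambda> \<nu> x = path_concat \<Lambda> \<nu>' x'"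
  obtains \<kappa> \<kappa>' where "\<kappa> \<in> init x" "\<kappa>' \<in> init x'" "cpb \<nu> \<kappa>" "cpb \<nu>' \<kappa>'" "\<nu> \<cdot> \<kappa> = \<nu>' \<cdot> \<kappa>'" "\<nu> \<cdot> \<kappa> \<in> mce \<nu> \<nu>'"
    "tail \<kappa> x = tail \<kappa>' x'"
proof -
  let ?w = "path_concat \<Lambda> \<nu> x"
  have s: "src \<Lambda> \<nu> = prng x" "src \<Lambda> \<nu>' = prng x'" using bpathsD(3) x by auto
  note c = concat[OF bpathsD(1)[OF x(1)] n(1) s(1)] and c' = concat[OF bpathsD(1)[OF x(2)] n(2) s(2), folded eq]
  obtain \<omega> where w: "\<omega> \<in> init ?w" "\<omega> \<in> mce \<nu> \<nu>'" using init_directed[OF c(1,2) c'(2)] .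
  obtain \<kappa> where k: "cpb \<nu> \<kappa>" "\<omega> = \<nu> \<cdot> \<kappa>" using w(2) unfolding mce_def pre_def by blast
  obtain \<kappa>' where k': "cpb \<nu>' \<kappa>'" "\<omega> = \<nu>' \<cdot> \<kappa>'" using w(2) unfolding mce_def pre_def by blast
  have "\<kappa> \<in> init x" using tail_init[OF c(1,2)] c(3) k w(1) by simp
  moreover have "\<kappa>' \<in> init x'" using tail_init[OF c'(1,2)] c'(3) k' w(1) by simp
  moreover have "tail \<kappa> x = tail \<omega> ?w" using tail_tail[OF c(1) k(1)] k(2) w(1) c(3) by simp
  moreover have "tail \<kappa>' x' = tail \<omega> ?w" using tail_tail[OF c'(1) k'(1)] k'(2) w(1) c'(3) by simp
  ultimately show ?thesis using that[of \<kappa> \<kappa>'] k k' w(2) by simp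
qed

text \<open>The places where two presentations become literally equal after refinement to a minimal
  common extension of \<open>\<nu>\<close> and \<open>\<nu>'\<close>. First components range over a
  finite set, whatever the group elements are.\<close>

definition ext_match :: "'a \<Rightarrow> 'g \<Rightarrow> 'a \<Rightarrow> 'a \<Rightarrow> 'g \<Rightarrow> 'a \<Rightarrow> ('a \<times> 'a) set" where
  "ext_match \<mu> g \<nu> \<mu>' g' \<nu>' = {(\<kappa>, \<kappa>'). cpb \<nu> \<kappa> \<and> cpb \<nu>' \<kappa>' \<and> \<nu> \<cdot> \<kappa> = \<nu>' \<cdot> \<kappa>' \<and> \<nu> \<cdot> \<kappa> \<in> mce \<nu> \<nu>'
     \<and> \<mu> \<cdot> act g \<kappa> = \<mu>' \<cdot> act g' \<kappa>' \<and> res g \<kappa> = res g' \<kappa>'}"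

lemma ep_eqD:
  assumes t: "triple \<mu> g \<nu>" "triple \<mu>' g' \<nu>'" and x: "x \<in> bpaths (src \<Lambda> \<nu>)" "x' \<in> bpaths (src \<Lambda> \<nu>')"
    and eq: "ep \<mu> g \<nu> x = ep \<mu>' g' \<nu>' x'"
  obtains \<kappa> \<kappa>' where "(\<kappa>, \<kappa>') \<in> ext_match \<mu> g \<nu> \<mu>' g' \<nu>'" "\<kappa> \<in> init x" "\<kappa>' \<in> init x'" "tail \<kappa> x = tail \<kappa>' x'"
proof -
  have "path_concat \<Lambda> \<nu> x = path_concat \<Lambda> \<nu>' x'" using eq by (simp add: ep_quadruple_def)
  then obtain \<kappa> \<kappa>' where k: "\<kappa> \<in> init x" "\<kappa>' \<in> init x'" "cpb \<nu> \<kappa>" "cpb \<nu>' \<kappa>'" "\<nu> \<cdot> \<kappa> = \<nu>' \<cdot> \<kappa>'" "\<nu> \<cdot> \<kappa> \<in> mce \<nu> \<nu>'"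
    "tail \<kappa> x = tail \<kappa>' x'" using join_concat[OF tripleD(3)[OF t(1)] tripleD(3)[OF t(2)] x] by blast
  note r = triple_refine(2)[OF t(1) k(3)] and r' = triple_refine(2)[OF t(2) k(4)]
  have y: "tail \<kappa> x \<in> bpaths (src \<Lambda> (\<nu> \<cdot> \<kappa>))" using bpaths_tail[OF bpathsD(2)[OF x(1)] k(1)] src_cmp k(3) by simp
  have "ep (\<mu> \<cdot> act g \<kappa>) (res g \<kappa>) (\<nu> \<cdot> \<kappa>) (tail \<kappa> x) = ep (\<mu>' \<cdot> act g' \<kappa>') (res g' \<kappa>') (\<nu> \<cdot> \<kappa>) (tail \<kappa> x)"
    using ep_refine[OF t(1) x(1) k(1)] ep_refine[OF t(2) x(2) k(2)] eq k(5,7) by simp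
  from ep_unique[OF r r'[folded k(5)] y this]
  show ?thesis using that[of \<kappa> \<kappa>'] k by (simp add: ext_match_def)
qed

lemma ep_matchI:
  assumes t: "triple \<mu> g \<nu>" "triple \<mu>' g' \<nu>'" and x: "x \<in> bpaths (src \<Lambda> \<nu>)"
    and k: "(\<kappa>, \<kappa>') \<in> ext_match \<mu> g \<nu> \<mu>' g' \<nu>'" "\<kappa> \<in> init x"
  shows "path_concat \<Lambda> \<kappa>' (tail \<kappa> x) \<in> bpaths (src \<Lambda> \<nu>')"
    "ep \<mu> g \<nu> x = ep \<mu>' g' \<nu>' (path_concat \<Lambda> \<kappa>' (tail \<kappa> x))"
    "\<kappa>' \<in> init (path_concat \<Lambda> \<kappa>' (tail \<kappa> x))" "tail \<kappa>' (path_concat \<Lambda> \<kappa>' (tail \<kappa> x)) = tail \<kappa> x"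
proof -
  let ?y = "path_concat \<Lambda> \<kappa>' (tail \<kappa> x)"
  have c: "cpb \<nu> \<kappa>" "cpb \<nu>' \<kappa>'" "\<nu> \<cdot> \<kappa> = \<nu>' \<cdot> \<kappa>'" "\<mu> \<cdot> act g \<kappa> = \<mu>' \<cdot> act g' \<kappa>'" "res g \<kappa> = res g' \<kappa>'"
    using k(1) by (auto simp: ext_match_def)
  have s: "src \<Lambda> \<kappa> = src \<Lambda> \<kappa>'" using c src_cmp by metis
  have tb: "tail \<kappa> x \<in> bpaths (src \<Lambda> \<kappa>')" using bpaths_tail[OF bpathsD(2)[OF x] k(2)] s by simp
  show y: "?y \<in> bpaths (src \<Lambda> \<nu>')" using bpaths_concat[OF _ tb] c by simp
  note cc = concat[OF bpathsD(1)[OF tb] _ bpathsD(3)[OF tb, symmetric]]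
  show ki: "\<kappa>' \<in> init ?y" and tl: "tail \<kappa>' ?y = tail \<kappa> x" using cc c by auto
  show "ep \<mu> g \<nu> x = ep \<mu>' g' \<nu>' ?y"
    using ep_refine[OF t(1) x k(2)] ep_refine[OF t(2) y ki] tl c by simp
qed

definition ep_set :: "'a \<Rightarrow> 'g \<Rightarrow> 'a \<Rightarrow> ('g, 'a, 'k) ep_arrow set" where
  "ep_set \<mu> g \<nu> = ep \<mu> g \<nu> ` bpaths (src \<Lambda> \<nu>)"

text \<open>By uniqueness, coincidence of arrows is visible at a minimal common extension. Lying in
  a bisection therefore depends on finitely many initial segments of \<open>x\<close>.\<close>

lemma ep_set_iff:
  assumes t: "triple \<mu> g \<nu>" "triple \<mu>' g' \<nu>'" and x: "x \<in> bpaths (src \<Lambda> \<nu>)"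
  shows "ep \<mu> g \<nu> x \<in> ep_set \<mu>' g' \<nu>' \<longleftrightarrow> (\<exists>(\<kappa>, \<kappa>')\<in>ext_match \<mu> g \<nu> \<mu>' g' \<nu>'. \<kappa> \<in> init x)"
proof
  assume "ep \<mu> g \<nu> x \<in> ep_set \<mu>' g' \<nu>'"
  then obtain x' where "x' \<in> bpaths (src \<Lambda> \<nu>')" "ep \<mu> g \<nu> x = ep \<mu>' g' \<nu>' x'" unfolding ep_set_def by blast
  then show "\<exists>(\<kappa>, \<kappa>')\<in>ext_match \<mu> g \<nu> \<mu>' g' \<nu>'. \<kappa> \<in> init x"
    using ep_eqD[OF t x] by (metis (no_types, lifting) case_prodI)
next
  assume "\<exists>(\<kappa>, \<kappa>')\<in>ext_match \<mu> g \<nu> \<mu>' g' \<nu>'. \<kappa> \<in> init x"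
  then obtain \<kappa> \<kappa>' where "(\<kappa>, \<kappa>') \<in> ext_match \<mu> g \<nu> \<mu>' g' \<nu>'" "\<kappa> \<in> init x" by blast
  then show "ep \<mu> g \<nu> x \<in> ep_set \<mu>' g' \<nu>'" unfolding ep_set_def using ep_matchI[OF t x] by blast
qed

lemma ZF_bpaths:
  assumes v: "v \<in> vertices \<Lambda>" and F: "F \<subseteq> starting \<Lambda> v"
  shows "ZF \<Lambda> v F \<inter> boundary_paths \<Lambda> = {x \<in> bpaths v. \<forall>\<alpha>\<in>F. \<alpha> \<notin> init x}"
proof -
  have "x \<in> ZF \<Lambda> v F \<longleftrightarrow> x \<in> paths \<Lambda> \<and> v \<in> init x \<and> (\<forall>\<alpha>\<in>F. \<alpha> \<notin> init x)" for x
  proof -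
    have "v \<cdot> \<alpha> = \<alpha>" if "\<alpha> \<in> F" for \<alpha> using F that rng_cmp_id by (auto simp: starting_def)
    then show ?thesis using ZF_iff[OF vertexD(1)[OF v]] F vertexD(3)[OF v] by simp
  qed
  moreover have "v \<in> init x \<longleftrightarrow> prng x = v" if "x \<in> paths \<Lambda>" for x
    using init_rng[OF that, of v] prng_init[OF that] vertexD(2)[OF v] by auto
  ultimately show ?thesis unfolding bpaths_def using boundary_paths by blast
qed

text \<open>Each bisection carries the topology of its space of parameters. Both directions are
  refinements: excluded segments of one presentation are rewritten as excluded segments of another
  one through minimal common extensions.\<close>

lemma openin_ep_iff:
  "openin ET V \<longleftrightarrow> V \<subseteq> topspace ET \<and> (\<forall>\<mu> g \<nu>. triple \<mu> g \<nu> \<longrightarrow> (\<forall>x\<in>bpaths (src \<Lambda> \<nu>). ep \<mu> g \<nu> x \<in> V \<longrightarrow>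
     (\<exists>L. finite L \<and> (\<forall>y\<in>bpaths (src \<Lambda> \<nu>). init y \<inter> L = init x \<inter> L \<longrightarrow> ep \<mu> g \<nu> y \<in> V))))"
proof (intro iffI conjI allI impI ballI)
  assume V: "openin ET V"
  then show "V \<subseteq> topspace ET" by (rule openin_subset)
  fix \<mu> g \<nu> x assume t: "triple \<mu> g \<nu>" and x: "x \<in> bpaths (src \<Lambda> \<nu>)" and e: "ep \<mu> g \<nu> x \<in> V"
  from V[unfolded ep_topology_def openin_topology_generated_by_iff] e
  show "\<exists>L. finite L \<and> (\<forall>y\<in>bpaths (src \<Lambda> \<nu>). init y \<inter> L = init x \<inter> L \<longrightarrow> ep \<mu> g \<nu> y \<in> V)"
  proof induction
    case (Int a b)
    then have "ep \<mu> g \<nu> x \<in> a" "ep \<mu> g \<nu> x \<in> b" by auto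
    obtain L where "finite L" "\<forall>y\<in>bpaths (src \<Lambda> \<nu>). init y \<inter> L = init x \<inter> L \<longrightarrow> ep \<mu> g \<nu> y \<in> a"
      using Int.IH(1)[OF \<open>ep \<mu> g \<nu> x \<in> a\<close>] by blast
    moreover obtain M where "finite M" "\<forall>y\<in>bpaths (src \<Lambda> \<nu>). init y \<inter> M = init x \<inter> M \<longrightarrow> ep \<mu> g \<nu> y \<in> b"
      using Int.IH(2)[OF \<open>ep \<mu> g \<nu> x \<in> b\<close>] by blast
    ultimately show ?case by (intro exI[of _ "L \<union> M"]) blast
  next
    case (UN K)
    then obtain k where "k \<in> K" "ep \<mu> g \<nu> x \<in> k" by blast
    with UN.IH[OF this] show ?case by blast
  next
    case (Basis s)
    then obtain \<mu>' g' \<nu>' F where s: "s = ep \<mu>' g' \<nu>' ` (ZF \<Lambda> (src \<Lambda> \<nu>') F \<inter> boundary_paths \<Lambda>)"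
      and t': "triple \<mu>' g' \<nu>'" and F: "finite F" "F \<subseteq> starting \<Lambda> (src \<Lambda> \<nu>')" unfolding triple_def by blast
    note ZB = ZF_bpaths[OF src_vertex[OF tripleD(3)[OF t']] F(2)]
    obtain x' where x': "x' \<in> bpaths (src \<Lambda> \<nu>')" "\<And>\<alpha>. \<alpha> \<in> F \<Longrightarrow> \<alpha> \<notin> init x'" "ep \<mu> g \<nu> x = ep \<mu>' g' \<nu>' x'"
      using Basis(2) unfolding s ZB by blast
    obtain \<kappa> \<kappa>' where k: "(\<kappa>, \<kappa>') \<in> ext_match \<mu> g \<nu> \<mu>' g' \<nu>'" "\<kappa> \<in> init x" "\<kappa>' \<in> init x'" "tail \<kappa> x = tail \<kappa>' x'"
      using ep_eqD[OF t t' x x'(1) x'(3)] by blast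
    \<comment> \<open>Contains \<open>\<kappa>\<close>, to keep the match, and all translations of
      the ways in which a path through \<open>\<kappa>'\<close> can pass through some
      \<open>\<alpha>\<close> in \<open>F\<close>.\<close>
    define L where "L = insert \<kappa> (\<Union>\<alpha>\<in>F. (\<cdot>) \<kappa> ` {\<beta>. cpb \<kappa>' \<beta> \<and> \<kappa>' \<cdot> \<beta> \<in> mce \<kappa>' \<alpha>})"
    have "finite L" unfolding L_def using F(1) finite_ext by auto
    moreover have "ep \<mu> g \<nu> y \<in> s" if y: "y \<in> bpaths (src \<Lambda> \<nu>)" and eq: "init y \<inter> L = init x \<inter> L" for y
    proof -
      have ky: "\<kappa> \<in> init y" using eq k(2) unfolding L_def by blast
      let ?y = "path_concat \<Lambda> \<kappa>' (tail \<kappa> y)"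
      note m = ep_matchI[OF t t' y k(1) ky]
      have "\<alpha> \<notin> init ?y" if a: "\<alpha> \<in> F" for \<alpha>
      proof
        assume "\<alpha> \<in> init ?y"
        then obtain \<omega> where w: "\<omega> \<in> init ?y" "\<omega> \<in> mce \<kappa>' \<alpha>" using init_directed[OF bpathsD(1)[OF m(1)] m(3)] by blast
        then obtain \<beta> where b: "cpb \<kappa>' \<beta>" "\<omega> = \<kappa>' \<cdot> \<beta>" unfolding mce_def pre_def by blast
        then have "\<beta> \<in> init (tail \<kappa> y)" using tail_init[OF bpathsD(1)[OF m(1)] m(3)] w m(4) by simp
        then have "\<kappa> \<cdot> \<beta> \<in> init y" using tail_init[OF bpathsD(1)[OF y] ky] by blast
        moreover have "\<kappa> \<cdot> \<beta> \<in> L" unfolding L_def using a b w by blast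
        ultimately have kb: "\<kappa> \<cdot> \<beta> \<in> init x" using eq by blast
        have "cpb \<kappa> \<beta>" using \<open>\<beta> \<in> init (tail \<kappa> y)\<close> tail_init[OF bpathsD(1)[OF y] ky] by blast
        then have "\<beta> \<in> init (tail \<kappa>' x')" using tail_init[OF bpathsD(1)[OF x] k(2)] kb k(4) by simp
        then have "\<omega> \<in> init x'" using tail_init[OF bpathsD(1)[OF x'(1)] k(3)] b by simp
        then have "\<alpha> \<in> init x'" using init_hered[OF bpathsD(1)[OF x'(1)]] w(2) unfolding mce_def by blast
        then show False using x'(2) a by blast
      qed
      then show ?thesis unfolding s ZB m(2) using m(1) by blast
    qed
    ultimately show ?case by blast
  qed simp
next
  assume V: "V \<subseteq> topspace ET \<and> (\<forall>\<mu> g \<nu>. triple \<mu> g \<nu> \<longrightarrow> (\<forall>x\<in>bpaths (src \<Lambda> \<nu>). ep \<mu> g \<nu> x \<in> V \<longrightarrow>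
     (\<exists>L. finite L \<and> (\<forall>y\<in>bpaths (src \<Lambda> \<nu>). init y \<inter> L = init x \<inter> L \<longrightarrow> ep \<mu> g \<nu> y \<in> V))))"
  show "openin ET V"
  proof (subst openin_subopen, intro ballI)
    fix a assume a: "a \<in> V"
    then obtain \<mu> g \<nu> x where t: "triple \<mu> g \<nu>" and x: "x \<in> bpaths (src \<Lambda> \<nu>)" and e: "a = ep \<mu> g \<nu> x"
      using arrow_cases V by blast
    then obtain L where L: "finite L" "\<And>y. y \<in> bpaths (src \<Lambda> \<nu>) \<Longrightarrow> init y \<inter> L = init x \<inter> L \<Longrightarrow> ep \<mu> g \<nu> y \<in> V"
      using V[THEN conjunct2, rule_format, OF t x] a by blast
    have xp: "x \<in> paths \<Lambda>" using bpathsD(1)[OF x] .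
    \<comment> \<open>This segment enforces the positive conditions of \<open>L\<close>; the
      negative ones become the finite exclusion set \<open>F\<close> behind it.\<close>
    obtain \<kappa> where k: "\<kappa> \<in> init x" "\<And>\<xi>. \<xi> \<in> L \<inter> init x \<Longrightarrow> pre \<xi> \<kappa>"
      using filt_ub[OF filt_init[OF xp], of "L \<inter> init x"] L(1) by blast
    have c: "cpb \<nu> \<kappa>" using bpaths_init[OF x tripleD(3)[OF t] k(1)] .
    note r = triple_refine(2)[OF t c]
    have s: "src \<Lambda> (\<nu> \<cdot> \<kappa>) = src \<Lambda> \<kappa>" using c src_cmp by simp
    define F where "F = (\<Union>\<xi>\<in>L - init x. {\<alpha>. cpb \<kappa> \<alpha> \<and> \<kappa> \<cdot> \<alpha> \<in> mce \<kappa> \<xi>})"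
    have F: "finite F" "F \<subseteq> starting \<Lambda> (src \<Lambda> (\<nu> \<cdot> \<kappa>))"
      unfolding F_def s using L(1) finite_ext by (auto simp: starting_def)
    let ?S = "ep (\<mu> \<cdot> act g \<kappa>) (res g \<kappa>) (\<nu> \<cdot> \<kappa>) ` (ZF \<Lambda> (src \<Lambda> (\<nu> \<cdot> \<kappa>)) F \<inter> boundary_paths \<Lambda>)"
    note ZB = ZF_bpaths[OF src_vertex[OF tripleD(3)[OF r]] F(2)]
    have "openin ET ?S"
      unfolding ep_topology_def by (rule topology_generated_by_Basis) (use r F in \<open>unfold triple_def, blast\<close>)
    moreover have "a \<in> ?S"
    proof -
      have "\<alpha> \<notin> init (tail \<kappa> x)" if al: "\<alpha> \<in> F" for \<alpha>
      proof
        assume "\<alpha> \<in> init (tail \<kappa> x)"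
        then have "\<kappa> \<cdot> \<alpha> \<in> init x" using tail_init[OF xp k(1)] by blast
        moreover obtain \<xi> where "\<xi> \<notin> init x" "\<kappa> \<cdot> \<alpha> \<in> mce \<kappa> \<xi>" using al unfolding F_def by blast
        ultimately show False using init_hered[OF xp] unfolding mce_def by blast
      qed
      moreover have "tail \<kappa> x \<in> bpaths (src \<Lambda> (\<nu> \<cdot> \<kappa>))" using bpaths_tail[OF bpathsD(2)[OF x] k(1)] s by simp
      ultimately show ?thesis unfolding ZB e ep_refine[OF t x k(1)] by blast
    qed
    moreover have "?S \<subseteq> V"
    proof
      fix b assume "b \<in> ?S"
      then obtain z where z0: "z \<in> bpaths (src \<Lambda> (\<nu> \<cdot> \<kappa>))" "\<forall>\<alpha>\<in>F. \<alpha> \<notin> init z"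
        and b: "b = ep (\<mu> \<cdot> act g \<kappa>) (res g \<kappa>) (\<nu> \<cdot> \<kappa>) z" unfolding ZB by blast
      then have z: "z \<in> bpaths (src \<Lambda> \<kappa>)" "\<And>\<alpha>. \<alpha> \<in> F \<Longrightarrow> \<alpha> \<notin> init z" unfolding s by auto
      let ?y = "path_concat \<Lambda> \<kappa> z"
      note cc = concat[OF bpathsD(1)[OF z(1)] _ bpathsD(3)[OF z(1), symmetric]]
      have ky: "\<kappa> \<in> init ?y" and tl: "tail \<kappa> ?y = z" and yp: "?y \<in> paths \<Lambda>" using cc c by auto
      have y: "?y \<in> bpaths (src \<Lambda> \<nu>)" using bpaths_concat[OF _ z(1)] c by simp
      have "init ?y \<inter> L = init x \<inter> L"
      proof (intro equalityI subsetI)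
        fix \<xi> assume "\<xi> \<in> init x \<inter> L"
        then show "\<xi> \<in> init ?y \<inter> L" using k(2) init_hered[OF yp ky] by blast
      next
        fix \<xi> assume xi: "\<xi> \<in> init ?y \<inter> L"
        show "\<xi> \<in> init x \<inter> L"
        proof (rule ccontr)
          assume n: "\<xi> \<notin> init x \<inter> L"
          obtain \<omega> where w: "\<omega> \<in> init ?y" "\<omega> \<in> mce \<kappa> \<xi>" using init_directed[OF yp ky] xi by blast
          then obtain \<alpha> where al: "cpb \<kappa> \<alpha>" "\<omega> = \<kappa> \<cdot> \<alpha>" unfolding mce_def pre_def by blast
          then have "\<alpha> \<in> init z" using tail_init[OF yp ky] w(1) tl by simp
          moreover have "\<alpha> \<in> F" unfolding F_def using al w(2) xi n by blast
          ultimately show False using z(2) by blast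
        qed
      qed
      then have "ep \<mu> g \<nu> ?y \<in> V" using L(2)[OF y] by blast
      then show "b \<in> V" using ep_refine[OF t y ky] tl b by simp
    qed
    ultimately show "\<exists>T. openin ET T \<and> a \<in> T \<and> T \<subseteq> V" by blast
  qed
qed

lemma openin_ep_set:
  assumes t': "triple \<mu>' g' \<nu>'" shows "openin ET (ep_set \<mu>' g' \<nu>')"
  unfolding openin_ep_iff
proof (intro conjI allI impI ballI)
  show "ep_set \<mu>' g' \<nu>' \<subseteq> topspace ET" unfolding ep_set_def using ep_arrow[OF t'] by blast
  fix \<mu> g \<nu> x assume t: "triple \<mu> g \<nu>" and x: "x \<in> bpaths (src \<Lambda> \<nu>)" and e: "ep \<mu> g \<nu> x \<in> ep_set \<mu>' g' \<nu>'"
  then obtain \<kappa> \<kappa>' where k: "(\<kappa>, \<kappa>') \<in> ext_match \<mu> g \<nu> \<mu>' g' \<nu>'" "\<kappa> \<in> init x" unfolding ep_set_iff[OF t t' x] by blast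
  have "ep \<mu> g \<nu> y \<in> ep_set \<mu>' g' \<nu>'" if "y \<in> bpaths (src \<Lambda> \<nu>)" "init y \<inter> {\<kappa>} = init x \<inter> {\<kappa>}" for y
    unfolding ep_set_iff[OF t t' that(1)] using k that(2) by blast
  then show "\<exists>L. finite L \<and> (\<forall>y\<in>bpaths (src \<Lambda> \<nu>). init y \<inter> L = init x \<inter> L \<longrightarrow> ep \<mu> g \<nu> y \<in> ep_set \<mu>' g' \<nu>')"
    by (intro exI[of _ "{\<kappa>}"]) blast
qed

lemma continuous_ep_iff:
  "continuous_map ET euclideanreal F \<longleftrightarrow> (\<forall>\<mu> g \<nu>. triple \<mu> g \<nu> \<longrightarrow> (\<forall>x\<in>bpaths (src \<Lambda> \<nu>). \<forall>\<epsilon>>0.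
     \<exists>L. finite L \<and> (\<forall>y\<in>bpaths (src \<Lambda> \<nu>). init y \<inter> L = init x \<inter> L \<longrightarrow> \<bar>F (ep \<mu> g \<nu> y) - F (ep \<mu> g \<nu> x)\<bar> < \<epsilon>)))"
proof
  assume F: "continuous_map ET euclideanreal F"
  show "\<forall>\<mu> g \<nu>. triple \<mu> g \<nu> \<longrightarrow> (\<forall>x\<in>bpaths (src \<Lambda> \<nu>). \<forall>\<epsilon>>0.
     \<exists>L. finite L \<and> (\<forall>y\<in>bpaths (src \<Lambda> \<nu>). init y \<inter> L = init x \<inter> L \<longrightarrow> \<bar>F (ep \<mu> g \<nu> y) - F (ep \<mu> g \<nu> x)\<bar> < \<epsilon>))"
  proof (intro allI impI ballI)
    fix \<mu> g \<nu> x and \<epsilon> :: real assume t: "triple \<mu> g \<nu>" and x: "x \<in> bpaths (src \<Lambda> \<nu>)" and e: "\<epsilon> > 0"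
    have "openin ET {a \<in> topspace ET. F a \<in> ball (F (ep \<mu> g \<nu> x)) \<epsilon>}"
      using F unfolding continuous_map_def by auto
    moreover have "ep \<mu> g \<nu> x \<in> {a \<in> topspace ET. F a \<in> ball (F (ep \<mu> g \<nu> x)) \<epsilon>}" using ep_arrow[OF t x] e by simp
    ultimately obtain L where L: "finite L" "\<forall>y\<in>bpaths (src \<Lambda> \<nu>). init y \<inter> L = init x \<inter> L \<longrightarrow>
        ep \<mu> g \<nu> y \<in> {a \<in> topspace ET. F a \<in> ball (F (ep \<mu> g \<nu> x)) \<epsilon>}"
      unfolding openin_ep_iff using t x by blast
    then show "\<exists>L. finite L \<and> (\<forall>y\<in>bpaths (src \<Lambda> \<nu>). init y \<inter> L = init x \<inter> L \<longrightarrow>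
        \<bar>F (ep \<mu> g \<nu> y) - F (ep \<mu> g \<nu> x)\<bar> < \<epsilon>)"
      by (intro exI[of _ L]) (simp add: dist_real_def abs_minus_commute)
  qed
next
  assume *: "\<forall>\<mu> g \<nu>. triple \<mu> g \<nu> \<longrightarrow> (\<forall>x\<in>bpaths (src \<Lambda> \<nu>). \<forall>\<epsilon>>0.
     \<exists>L. finite L \<and> (\<forall>y\<in>bpaths (src \<Lambda> \<nu>). init y \<inter> L = init x \<inter> L \<longrightarrow> \<bar>F (ep \<mu> g \<nu> y) - F (ep \<mu> g \<nu> x)\<bar> < \<epsilon>))"
  show "continuous_map ET euclideanreal F"
    unfolding continuous_map_def
  proof (intro conjI allI impI)
    fix W assume "openin euclideanreal W"
    then have W: "open W" by simp
    show "openin ET {a \<in> topspace ET. F a \<in> W}"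
      unfolding openin_ep_iff
    proof (intro conjI allI impI ballI)
      fix \<mu> g \<nu> x assume t: "triple \<mu> g \<nu>" and x: "x \<in> bpaths (src \<Lambda> \<nu>)" and e: "ep \<mu> g \<nu> x \<in> {a \<in> topspace ET. F a \<in> W}"
      then obtain \<epsilon> where e: "\<epsilon> > 0" "ball (F (ep \<mu> g \<nu> x)) \<epsilon> \<subseteq> W" using W open_contains_ball by blast
      obtain L where L: "finite L" "\<forall>y\<in>bpaths (src \<Lambda> \<nu>). init y \<inter> L = init x \<inter> L \<longrightarrow> \<bar>F (ep \<mu> g \<nu> y) - F (ep \<mu> g \<nu> x)\<bar> < \<epsilon>"
        using *[rule_format, OF t x e(1)] by blast
      have "ep \<mu> g \<nu> y \<in> {a \<in> topspace ET. F a \<in> W}" if y: "y \<in> bpaths (src \<Lambda> \<nu>)" "init y \<inter> L = init x \<inter> L" for y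
      proof -
        have "\<bar>F (ep \<mu> g \<nu> y) - F (ep \<mu> g \<nu> x)\<bar> < \<epsilon>" using L(2) y by blast
        then have "F (ep \<mu> g \<nu> y) \<in> ball (F (ep \<mu> g \<nu> x)) \<epsilon>" by (simp add: dist_real_def abs_minus_commute)
        then show ?thesis using e(2) ep_arrow[OF t y(1)] by blast
      qed
      then show "\<exists>L. finite L \<and> (\<forall>y\<in>bpaths (src \<Lambda> \<nu>). init y \<inter> L = init x \<inter> L \<longrightarrow> ep \<mu> g \<nu> y \<in> {a \<in> topspace ET. F a \<in> W})"
        using L(1) by blast
    qed blast
  qed simp
qed

subsection \<open>Multiplication\<close>

text \<open>An arrow can be presented at any sufficiently long segment of its source, so finitely
  many arrows with one source admit presentations at a common level.\<close>

lemma fibre_rep: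
  assumes w: "w \<in> boundary_paths \<Lambda>" and a: "a \<in> source_fibre EP w"
  obtains \<nu> where "\<nu> \<in> init w" "\<And>\<omega>. \<omega> \<in> init w \<Longrightarrow> pre \<nu> \<omega> \<Longrightarrow> \<exists>\<alpha> g. triple \<alpha> g \<omega> \<and> a = ep \<alpha> g \<omega> (tail \<omega> w)"
proof -
  have "a \<in> topspace ET" "gsrc EP a = w" using a unfolding source_fibre_def EP_simps by auto
  then obtain \<mu> g \<nu> x where t: "triple \<mu> g \<nu>" and x: "x \<in> bpaths (src \<Lambda> \<nu>)" and e: "a = ep \<mu> g \<nu> x"
    using arrow_cases by blast
  then have wc: "w = path_concat \<Lambda> \<nu> x" using \<open>gsrc EP a = w\<close> ep_gsrc by simp
  note c = concat[OF bpathsD(1)[OF x] tripleD(3)[OF t] bpathsD(3)[OF x, symmetric], folded wc]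
  show ?thesis
  proof (rule that[OF c(2)])
    fix \<omega> assume o: "\<omega> \<in> init w" "pre \<nu> \<omega>"
    then obtain \<kappa> where k: "cpb \<nu> \<kappa>" "\<omega> = \<nu> \<cdot> \<kappa>" unfolding pre_def by blast
    then have ki: "\<kappa> \<in> init x" using tail_init[OF c(1,2)] o(1) c(3) by simp
    have "tail \<kappa> x = tail \<omega> w" using tail_tail[OF c(1) k(1)] k(2) o(1) c(3) by simp
    then have "a = ep (\<mu> \<cdot> act g \<kappa>) (res g \<kappa>) \<omega> (tail \<omega> w)" using ep_refine[OF t x ki] e k(2) by simp
    then show "\<exists>\<alpha> g. triple \<alpha> g \<omega> \<and> a = ep \<alpha> g \<omega> (tail \<omega> w)" using triple_refine(2)[OF t k(1)] k(2) by blast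
  qed
qed

lemma ep_in_fibre:
  assumes "triple \<mu> g \<nu>" "x \<in> bpaths (src \<Lambda> \<nu>)"
  shows "ep \<mu> g \<nu> x \<in> source_fibre EP (path_concat \<Lambda> \<nu> x)"
  unfolding source_fibre_def EP_simps using ep_arrow[OF assms] ep_gsrc by simp

lemma range_level:
  assumes t: "triple \<mu> h \<nu>" and z: "z \<in> bpaths (src \<Lambda> \<nu>)" and k: "\<kappa> \<in> init z"
  shows "\<mu> \<cdot> act h \<kappa> \<in> init (path_concat \<Lambda> \<mu> (pact h z))"
    "tail (\<mu> \<cdot> act h \<kappa>) (path_concat \<Lambda> \<mu> (pact h z)) = pact (res h \<kappa>) (tail \<kappa> z)"
proof -
  note h = tripleD(2)[OF t] and zp = bpathsD(1)[OF z]
  have c: "cpb \<nu> \<kappa>" using bpaths_init[OF z tripleD(3)[OF t] k] .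
  have hz: "pact h z \<in> bpaths (src \<Lambda> \<mu>)" using bpaths_act[OF h z] tripleD(4)[OF t] by simp
  have hk: "act h \<kappa> \<in> init (pact h z)" using act_init_iff[OF h zp] c k by simp
  note cc = concat[OF bpathsD(1)[OF hz] tripleD(1)[OF t] bpathsD(3)[OF hz, symmetric]]
  note ck = triple_refine(1)[OF t c]
  show *: "\<mu> \<cdot> act h \<kappa> \<in> init (path_concat \<Lambda> \<mu> (pact h z))"
    using concat_init_cmp[OF bpathsD(1)[OF hz] ck bpathsD(3)[OF hz, symmetric]] hk by blast
  show "tail (\<mu> \<cdot> act h \<kappa>) (path_concat \<Lambda> \<mu> (pact h z)) = pact (res h \<kappa>) (tail \<kappa> z)"
    using tail_tail[OF cc(1) ck *] cc(3) tail_act[OF h zp k] by simp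
qed

text \<open>The segments of the range path that correspond to segments of \<open>z\<close> are
  cofinal, so arrows to be composed with \<open>ep \<mu> h \<nu> z\<close> can be presented at one
  of them.\<close>

lemma range_level_above:
  assumes t: "triple \<mu> h \<nu>" and z: "z \<in> bpaths (src \<Lambda> \<nu>)" and o: "\<omega> \<in> init (path_concat \<Lambda> \<mu> (pact h z))"
  obtains \<kappa> where "\<kappa> \<in> init z" "pre \<omega> (\<mu> \<cdot> act h \<kappa>)"
proof -
  note h = tripleD(2)[OF t] and zp = bpathsD(1)[OF z]
  have hz: "pact h z \<in> bpaths (src \<Lambda> \<mu>)" using bpaths_act[OF h z] tripleD(4)[OF t] by simp
  note cc = concat[OF bpathsD(1)[OF hz] tripleD(1)[OF t] bpathsD(3)[OF hz, symmetric]]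
  obtain \<theta> where th: "\<theta> \<in> init (path_concat \<Lambda> \<mu> (pact h z))" "\<theta> \<in> mce \<mu> \<omega>" using init_directed[OF cc(1,2) o] .
  then obtain \<kappa>' where k': "cpb \<mu> \<kappa>'" "\<theta> = \<mu> \<cdot> \<kappa>'" unfolding mce_def pre_def by blast
  then have "\<kappa>' \<in> init (pact h z)" using tail_init[OF cc(1,2)] th(1) cc(3) by simp
  then obtain \<kappa> where "\<kappa> \<in> init z" "\<kappa>' = act h \<kappa>" using path_act_init[OF h zp] by auto
  then show ?thesis using that[of \<kappa>] th(2) k'(2) by (simp add: mce_def)
qed

text \<open>The right factor is refined to the matching level first. Composition then only
  multiplies the group element by \<open>res h \<kappa>\<close> and leaves the range morphism
  \<open>\<alpha>\<close> alone.\<close>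

lemma ep_mult_level:
  assumes t: "triple \<mu> h \<nu>" and z: "z \<in> bpaths (src \<Lambda> \<nu>)" and k: "\<kappa> \<in> init z"
    and a: "triple \<alpha> g (\<mu> \<cdot> act h \<kappa>)"
  shows "gmult EP (ep \<alpha> g (\<mu> \<cdot> act h \<kappa>) (tail (\<mu> \<cdot> act h \<kappa>) (path_concat \<Lambda> \<mu> (pact h z)))) (ep \<mu> h \<nu> z)
     = ep \<alpha> (g \<otimes>\<^bsub>G\<^esub> res h \<kappa>) (\<nu> \<cdot> \<kappa>) (tail \<kappa> z)"
    "triple \<alpha> (g \<otimes>\<^bsub>G\<^esub> res h \<kappa>) (\<nu> \<cdot> \<kappa>)" "tail \<kappa> z \<in> bpaths (src \<Lambda> (\<nu> \<cdot> \<kappa>))"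
    "path_concat \<Lambda> (\<nu> \<cdot> \<kappa>) (tail \<kappa> z) = path_concat \<Lambda> \<nu> z"
proof -
  have c: "cpb \<nu> \<kappa>" using bpaths_init[OF z tripleD(3)[OF t] k] .
  note r = triple_refine(2)[OF t c]
  show tz: "tail \<kappa> z \<in> bpaths (src \<Lambda> (\<nu> \<cdot> \<kappa>))" using bpaths_tail[OF bpathsD(2)[OF z] k] c src_cmp by simp
  show "gmult EP (ep \<alpha> g (\<mu> \<cdot> act h \<kappa>) (tail (\<mu> \<cdot> act h \<kappa>) (path_concat \<Lambda> \<mu> (pact h z)))) (ep \<mu> h \<nu> z)
     = ep \<alpha> (g \<otimes>\<^bsub>G\<^esub> res h \<kappa>) (\<nu> \<cdot> \<kappa>) (tail \<kappa> z)"
    unfolding range_level(2)[OF t z k] ep_refine[OF t z k] by (rule ep_mult[OF a r tz])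
  show "triple \<alpha> (g \<otimes>\<^bsub>G\<^esub> res h \<kappa>) (\<nu> \<cdot> \<kappa>)"
    using tripleD[OF a] tripleD[OF r] act_mult src_closed unfolding triple_def by simp
  show "path_concat \<Lambda> (\<nu> \<cdot> \<kappa>) (tail \<kappa> z) = path_concat \<Lambda> \<nu> z"
    using ep_refine[OF t z k] by (simp add: ep_quadruple_def)
qed

text \<open>These are the hypotheses of \<open>amenable_groupoid_iff\<close>. For injectivity both
  arrows are presented at a common level, where \<open>ep_unique\<close> allows cancellation of
  \<open>res k \<kappa>\<close>.\<close>

lemma EP_groupoid:
  assumes h: "h \<in> topspace (arrow_top EP)"
  shows "grng EP h \<in> unit_set EP \<and> gsrc EP h \<in> unit_set EP"
    and "\<And>a. a \<in> source_fibre EP (grng EP h) \<Longrightarrow> gmult EP a h \<in> source_fibre EP (gsrc EP h)"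
    and "inj_on (\<lambda>a. gmult EP a h) (source_fibre EP (grng EP h))"
proof -
  obtain \<mu> k \<nu> z where t: "triple \<mu> k \<nu>" and z: "z \<in> bpaths (src \<Lambda> \<nu>)" and e: "h = ep \<mu> k \<nu> z"
    using arrow_cases h unfolding EP_simps by blast
  let ?w = "path_concat \<Lambda> \<mu> (pact k z)"
  have kz: "pact k z \<in> bpaths (src \<Lambda> \<mu>)" using bpaths_act[OF tripleD(2)[OF t] z] tripleD(4)[OF t] by simp
  have rs: "grng EP h = ?w" "gsrc EP h = path_concat \<Lambda> \<nu> z" unfolding e ep_grng ep_gsrc by simp_all
  have w: "?w \<in> boundary_paths \<Lambda>" using bpathsD(2)[OF bpaths_concat[OF tripleD(1)[OF t] kz]] .
  have wp: "?w \<in> paths \<Lambda>" using boundary_paths[OF w] .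
  show "grng EP h \<in> unit_set EP \<and> gsrc EP h \<in> unit_set EP"
    unfolding rs EP_simps using w bpathsD(2)[OF bpaths_concat[OF tripleD(3)[OF t] z]] by blast
  show "gmult EP a h \<in> source_fibre EP (gsrc EP h)" if a: "a \<in> source_fibre EP (grng EP h)" for a
  proof -
    obtain \<omega> where o: "\<omega> \<in> init ?w" "\<And>\<theta>. \<theta> \<in> init ?w \<Longrightarrow> pre \<omega> \<theta> \<Longrightarrow> \<exists>\<alpha> g. triple \<alpha> g \<theta> \<and> a = ep \<alpha> g \<theta> (tail \<theta> ?w)"
      using fibre_rep[OF w] a unfolding rs by blast
    obtain \<kappa> where k: "\<kappa> \<in> init z" "pre \<omega> (\<mu> \<cdot> act k \<kappa>)" using range_level_above[OF t z o(1)] .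
    obtain \<alpha> g where a: "triple \<alpha> g (\<mu> \<cdot> act k \<kappa>)" "a = ep \<alpha> g (\<mu> \<cdot> act k \<kappa>) (tail (\<mu> \<cdot> act k \<kappa>) ?w)"
      using o(2)[OF range_level(1)[OF t z k(1)] k(2)] by blast
    note m = ep_mult_level[OF t z k(1) a(1)]
    show ?thesis using ep_in_fibre[OF m(2,3)] m(1,4) unfolding a(2) e ep_gsrc by simp
  qed
  show "inj_on (\<lambda>a. gmult EP a h) (source_fibre EP (grng EP h))"
  proof (rule inj_onI)
    fix a b assume ab: "a \<in> source_fibre EP (grng EP h)" "b \<in> source_fibre EP (grng EP h)" "gmult EP a h = gmult EP b h"
    obtain \<omega> where o: "\<omega> \<in> init ?w" "\<And>\<theta>. \<theta> \<in> init ?w \<Longrightarrow> pre \<omega> \<theta> \<Longrightarrow> \<exists>\<alpha> g. triple \<alpha> g \<theta> \<and> a = ep \<alpha> g \<theta> (tail \<theta> ?w)"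
      using fibre_rep[OF w] ab(1) unfolding rs by blast
    obtain \<omega>' where o': "\<omega>' \<in> init ?w" "\<And>\<theta>. \<theta> \<in> init ?w \<Longrightarrow> pre \<omega>' \<theta> \<Longrightarrow> \<exists>\<alpha> g. triple \<alpha> g \<theta> \<and> b = ep \<alpha> g \<theta> (tail \<theta> ?w)"
      using fibre_rep[OF w] ab(2) unfolding rs by blast
    obtain \<psi> where p: "\<psi> \<in> init ?w" "pre \<omega> \<psi>" "pre \<omega>' \<psi>" using init_directed[OF wp o(1) o'(1)] unfolding mce_def by blast
    obtain \<kappa> where k: "\<kappa> \<in> init z" "pre \<psi> (\<mu> \<cdot> act k \<kappa>)" using range_level_above[OF t z p(1)] .
    note lv = range_level(1)[OF t z k(1)]
    obtain \<alpha> g where a: "triple \<alpha> g (\<mu> \<cdot> act k \<kappa>)" "a = ep \<alpha> g (\<mu> \<cdot> act k \<kappa>) (tail (\<mu> \<cdot> act k \<kappa>) ?w)"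
      using o(2)[OF lv pre_trans[OF p(2) k(2)]] by blast
    obtain \<beta> g' where b: "triple \<beta> g' (\<mu> \<cdot> act k \<kappa>)" "b = ep \<beta> g' (\<mu> \<cdot> act k \<kappa>) (tail (\<mu> \<cdot> act k \<kappa>) ?w)"
      using o'(2)[OF lv pre_trans[OF p(3) k(2)]] by blast
    note m = ep_mult_level[OF t z k(1) a(1)] and m' = ep_mult_level[OF t z k(1) b(1)]
    have "ep \<alpha> (g \<otimes>\<^bsub>G\<^esub> res k \<kappa>) (\<nu> \<cdot> \<kappa>) (tail \<kappa> z) = ep \<beta> (g' \<otimes>\<^bsub>G\<^esub> res k \<kappa>) (\<nu> \<cdot> \<kappa>) (tail \<kappa> z)"
      using ab(3) m(1) m'(1) unfolding a(2) b(2) e by simp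
    from ep_unique[OF m(2) m'(2) m(3) this]
    have "\<alpha> = \<beta>" "g = g'"
      using tripleD(2)[OF a(1)] tripleD(2)[OF b(1)] res_closed[OF tripleD(2)[OF t] init_Mor[OF bpathsD(1)[OF z] k(1)]]
      by auto
    then show "a = b" using a(2) b(2) by simp
  qed
qed

lemma amenable_EP_iff:
  "amenable_groupoid EP \<longleftrightarrow> (\<forall>K \<epsilon>. compactin ET K \<longrightarrow> \<epsilon> > 0 \<longrightarrow>
     (\<exists>f. fibre_density EP f \<and>
       (\<forall>h\<in>K. fsum_le (\<lambda>a. \<bar>f (gmult EP a h) - f a\<bar>) (source_fibre EP (grng EP h)) \<epsilon>)))"
  using amenable_groupoid_iff[OF EP_groupoid] unfolding EP_simps .

end

section \<open>From the boundary action to the groupoid\<close>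

lemma card_increases_le:
  fixes R :: "nat \<Rightarrow> nat"
  assumes "\<And>i. R i \<le> R (Suc i)"
  shows "card {i. i < M \<and> R i < R (Suc i)} \<le> R M"
proof (induction M)
  case (Suc M)
  have "{i. i < Suc M \<and> R i < R (Suc i)} \<subseteq> {i. i < M \<and> R i < R (Suc i)} \<union> (if R M < R (Suc M) then {M} else {})"
    by (auto simp: less_Suc_eq)
  then have "card {i. i < Suc M \<and> R i < R (Suc i)} \<le> card ({i. i < M \<and> R i < R (Suc i)} \<union> (if R M < R (Suc M) then {M} else {}))"
    by (intro card_mono) auto
  also have "\<dots> \<le> card {i. i < M \<and> R i < R (Suc i)} + (if R M < R (Suc M) then 1 else 0)"
    by (rule order_trans[OF card_Un_le]) auto
  also have "\<dots> \<le> R (Suc M)" using Suc assms[of M] by auto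
  finally show ?case .
qed simp

text \<open>The parametrization \<open>r\<close> may repeat values; each finite sum uses one
  parameter per value.\<close>

lemma fsum_le_support:
  assumes "\<And>a. a \<in> A \<Longrightarrow> a \<notin> r ` B \<Longrightarrow> F a = 0" "fsum_le (\<lambda>b. F (r b)) B c"
  shows "fsum_le F A c"
  unfolding fsum_le_def
proof (intro allI impI)
  fix X assume X: "finite X" "X \<subseteq> A"
  obtain Y where Y: "Y \<subseteq> B" "inj_on r Y" "X \<inter> r ` B = r ` Y" using subset_image_inj[of "X \<inter> r ` B" r B] by blast
  have fY: "finite Y" using finite_imageD[OF _ Y(2)] X(1) Y(3) by (metis finite_Int)
  have "sum F X = sum F (X \<inter> r ` B)" by (rule sum.mono_neutral_right) (use X assms(1) in auto)
  also have "\<dots> = (\<Sum>b\<in>Y. F (r b))" unfolding Y(3) using sum.reindex[OF Y(2), of F] by (simp add: o_def)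
  also have "\<dots> \<le> c" by (rule fsum_leD[OF assms(2) fY Y(1)])
  finally show "sum F X \<le> c" .
qed

text \<open>Two sums over one cube are matched after different shifts \<open>s\<close> and
  \<open>t\<close>; what remains outside the images is paid for in full.\<close>

lemma abs_diff_sum_le:
  fixes f g :: "'i \<Rightarrow> real"
  assumes I: "finite I" and nn: "\<And>i. i \<in> I \<Longrightarrow> 0 \<le> f i" "\<And>i. i \<in> I \<Longrightarrow> 0 \<le> g i"
    and s: "inj_on s C" "s ` C \<subseteq> I" and t: "inj_on t C" "t ` C \<subseteq> I"
  shows "\<bar>sum f I - sum g I\<bar> \<le> (\<Sum>m\<in>C. \<bar>f (s m) - g (t m)\<bar>) + sum f (I - s ` C) + sum g (I - t ` C)"
proof -
  have "sum f I = sum f (I - s ` C) + (\<Sum>m\<in>C. f (s m))"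
    using sum.subset_diff[OF s(2) I, of f] sum.reindex[OF s(1), of f] by (simp add: o_def)
  moreover have "sum g I = sum g (I - t ` C) + (\<Sum>m\<in>C. g (t m))"
    using sum.subset_diff[OF t(2) I, of g] sum.reindex[OF t(1), of g] by (simp add: o_def)
  moreover have "\<bar>(\<Sum>m\<in>C. f (s m)) - (\<Sum>m\<in>C. g (t m))\<bar> \<le> (\<Sum>m\<in>C. \<bar>f (s m) - g (t m)\<bar>)"
    unfolding sum_subtractf[symmetric] by (rule sum_abs)
  moreover have "0 \<le> sum f (I - s ` C)" "0 \<le> sum g (I - t ` C)" using nn by (auto intro!: sum_nonneg)
  ultimately show ?thesis by linarith
qed

definition cube :: "nat \<Rightarrow> ('k::finite \<Rightarrow> nat) set" where
  "cube N = {n. \<forall>i. n i < N}"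

lemma cube_PiE: "cube N = (PiE UNIV (\<lambda>_. {..<N}))"
  by (auto simp: cube_def PiE_def)

lemma finite_cube: "finite (cube N)"
  unfolding cube_PiE by (intro finite_PiE) auto

lemma card_cube: "card (cube N :: ('k::finite \<Rightarrow> nat) set) = N ^ CARD('k)"
  unfolding cube_PiE by (subst card_PiE) auto

lemma cube_shift:
  fixes d :: "'k::finite \<Rightarrow> nat"
  assumes "\<And>i. d i \<le> D" "D \<le> N"
  shows "inj_on ((+) d) (cube (N - D))" "(+) d ` cube (N - D) \<subseteq> cube N"
    "card (cube N - (+) d ` cube (N - D)) = N ^ CARD('k) - (N - D) ^ CARD('k)"
proof -
  show i: "inj_on ((+) d) (cube (N - D))" by (simp add: inj_on_def)
  show s: "(+) d ` cube (N - D) \<subseteq> cube N"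
  proof (clarsimp simp: cube_def)
    fix n :: "'k \<Rightarrow> nat" and i assume "\<forall>i. n i < N - D"
    then have "n i < N - D" by blast
    then show "d i + n i < N" using assms(1)[of i] assms(2) by linarith
  qed
  have "card ((+) d ` cube (N - D)) = (N - D) ^ CARD('k)" using card_image[OF i] card_cube by metis
  then show "card (cube N - (+) d ` cube (N - D)) = N ^ CARD('k) - (N - D) ^ CARD('k)"
    using card_Diff_subset[OF finite_subset[OF s finite_cube] s] card_cube by metis
qed

text \<open>A Folner estimate. By Bernoulli's inequality the boundary layer has relative size at
  most \<open>k * D / N\<close>, which explains the choice of \<open>N\<close>.\<close>

lemma cube_boundary:
  assumes "0 < \<epsilon>"
  obtains N where "0 < N" "D \<le> N" "real (N ^ k - (N - D) ^ k) \<le> \<epsilon> * real (N ^ k)"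
proof -
  obtain N :: nat where N: "real N > real k * real D / \<epsilon> + real D" using reals_Archimedean2 by blast
  have "real k * real D / \<epsilon> \<ge> 0" using assms by simp
  then have ND: "real N > real D" using N by linarith
  then have N0: "N > 0" "D \<le> N" by auto
  have "real k * real D / \<epsilon> < real N" using N by linarith
  then have le: "real k * (real D / real N) \<le> \<epsilon>" using assms N0 by (simp add: field_simps)
  have "1 + real k * (- (real D / real N)) \<le> (1 + (- (real D / real N))) ^ k"
    by (rule Bernoulli_inequality) (use ND N0 in \<open>simp add: field_simps\<close>)
  then have "1 - \<epsilon> \<le> (1 - real D / real N) ^ k" using le by simp
  then have "(1 - \<epsilon>) * real N ^ k \<le> (1 - real D / real N) ^ k * real N ^ k" by (rule mult_right_mono) simp
  also have "\<dots> = (real N - real D) ^ k" using N0 by (simp add: power_mult_distrib[symmetric] left_diff_distrib)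
  finally have "real N ^ k - real (N - D) ^ k \<le> \<epsilon> * real N ^ k" using N0 by (simp add: of_nat_diff algebra_simps)
  moreover have "(N - D) ^ k \<le> N ^ k" by (rule power_mono) auto
  ultimately have "real (N ^ k - (N - D) ^ k) \<le> \<epsilon> * real (N ^ k)" by (simp add: of_nat_diff)
  then show ?thesis using that N0 by blast
qed

section \<open>Locally constant levels on paths\<close>

context fa_kgraph
begin

definition ext :: "'a \<Rightarrow> 'a \<Rightarrow> 'a set" where
  "ext \<nu> \<xi> = {\<kappa>. cpb \<nu> \<kappa> \<and> \<nu> \<cdot> \<kappa> \<in> mce \<nu> \<xi>}"

lemma finite_ext': "finite (ext \<nu> \<xi>)"
  unfolding ext_def by (rule finite_ext)

text \<open>A condition on \<open>\<nu>y\<close> becomes a finite disjunction of conditions on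
  \<open>y\<close>; this is how test sets are moved across a concatenation.\<close>

lemma concat_init_ext:
  assumes "y \<in> paths \<Lambda>" "\<nu> \<in> Mor \<Lambda>" "src \<Lambda> \<nu> = prng y"
  shows "\<xi> \<in> init (path_concat \<Lambda> \<nu> y) \<longleftrightarrow> (\<exists>\<kappa>\<in>ext \<nu> \<xi>. \<kappa> \<in> init y)"
proof
  note c = concat[OF assms]
  assume "\<xi> \<in> init (path_concat \<Lambda> \<nu> y)"
  then obtain \<omega> where w: "\<omega> \<in> init (path_concat \<Lambda> \<nu> y)" "\<omega> \<in> mce \<nu> \<xi>" using init_directed[OF c(1,2)] by blast
  then obtain \<kappa> where k: "cpb \<nu> \<kappa>" "\<omega> = \<nu> \<cdot> \<kappa>" unfolding mce_def pre_def by blast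
  then have "\<kappa> \<in> init y" using tail_init[OF c(1,2)] w(1) c(3) by simp
  then show "\<exists>\<kappa>\<in>ext \<nu> \<xi>. \<kappa> \<in> init y" unfolding ext_def using k w(2) by blast
next
  assume "\<exists>\<kappa>\<in>ext \<nu> \<xi>. \<kappa> \<in> init y"
  then obtain \<kappa> where k: "cpb \<nu> \<kappa>" "\<nu> \<cdot> \<kappa> \<in> mce \<nu> \<xi>" "\<kappa> \<in> init y" unfolding ext_def by blast
  then have "\<nu> \<cdot> \<kappa> \<in> init (path_concat \<Lambda> \<nu> y)" using concat_init_cmp[OF assms(1) k(1) assms(3)] by blast
  then show "\<xi> \<in> init (path_concat \<Lambda> \<nu> y)" using init_hered[OF concat_paths[OF assms]] k(2) unfolding mce_def by blast
qed

text \<open>The inserted 0 is the join of the empty family and is neutral otherwise.\<close>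

definition join_deg :: "'a set \<Rightarrow> 'k \<Rightarrow> nat" where
  "join_deg A = (\<lambda>i. Max (insert 0 ((\<lambda>\<xi>. deg \<Lambda> \<xi> i) ` A)))"

lemma join_deg_le_iff: "finite A \<Longrightarrow> join_deg A \<le> q \<longleftrightarrow> (\<forall>\<xi>\<in>A. deg \<Lambda> \<xi> \<le> q)"
  unfolding join_deg_def le_fun_def by auto

lemma join_deg_upper: "finite A \<Longrightarrow> \<xi> \<in> A \<Longrightarrow> deg \<Lambda> \<xi> \<le> join_deg A"
  using join_deg_le_iff by blast

lemma join_deg_insert: "finite A \<Longrightarrow> join_deg (insert a A) = sup (deg \<Lambda> a) (join_deg A)"
proof (rule antisym)
  assume A: "finite A"
  show "join_deg (insert a A) \<le> sup (deg \<Lambda> a) (join_deg A)"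
    using A join_deg_upper[OF A] by (auto simp: join_deg_le_iff intro: le_supI1 le_supI2)
  show "sup (deg \<Lambda> a) (join_deg A) \<le> join_deg (insert a A)"
    using A join_deg_upper[of "insert a A"] by (intro sup_least) (auto simp: join_deg_le_iff)
qed

text \<open>Along different paths the join of \<open>A\<close> can be different morphisms, but
  \<open>A\<close> has finitely many minimal common extensions by finite alignment. The vertex
  \<open>v\<close> accounts for an empty \<open>A\<close>.\<close>

lemma finite_joins:
  assumes "finite A"
  shows "\<exists>J. finite J \<and> (\<forall>x\<in>paths \<Lambda>. prng x = v \<longrightarrow> A \<subseteq> init x \<longrightarrow> (\<exists>\<omega>\<in>J. \<omega> \<in> init x \<and> deg \<Lambda> \<omega> = join_deg A))"
  using assms
proof induction
  case empty
  have "\<exists>\<omega>\<in>{v}. \<omega> \<in> init x \<and> deg \<Lambda> \<omega> = join_deg {}" if x: "x \<in> paths \<Lambda>" "prng x = v" for x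
    using prng_init[OF x(1)] vertexD(4)[OF prng_vertex(1)[OF x(1)]] x(2) by (simp add: join_deg_def zero_fun_def)
  then show ?case by (intro exI[of _ "{v}"] conjI) (simp, blast)
next
  case (insert a A)
  then obtain J where J: "finite J"
    "\<And>x. x \<in> paths \<Lambda> \<Longrightarrow> prng x = v \<Longrightarrow> A \<subseteq> init x \<Longrightarrow> \<exists>\<omega>\<in>J. \<omega> \<in> init x \<and> deg \<Lambda> \<omega> = join_deg A" by blast
  have "\<exists>\<omega>\<in>(\<Union>\<theta>\<in>J. mce a \<theta>). \<omega> \<in> init x \<and> deg \<Lambda> \<omega> = join_deg (insert a A)"
    if x: "x \<in> paths \<Lambda>" "prng x = v" "insert a A \<subseteq> init x" for x
  proof -
    obtain \<theta> where th: "\<theta> \<in> J" "\<theta> \<in> init x" "deg \<Lambda> \<theta> = join_deg A" using J(2)[OF x(1,2)] x(3) by blast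
    obtain \<omega> where w: "\<omega> \<in> init x" "\<omega> \<in> mce a \<theta>" using init_directed[OF x(1) _ th(2), of a] x(3) by blast
    then have "deg \<Lambda> \<omega> = join_deg (insert a A)"
      using th(3) join_deg_insert[OF insert.hyps(1)] by (simp add: mce_def)
    then show ?thesis using w th(1) by blast
  qed
  moreover have "finite (\<Union>\<theta>\<in>J. mce a \<theta>)" using J(1) finite_mce by blast
  ultimately show ?case by blast
qed

text \<open>The level used for \<open>x\<close>. It depends on \<open>init x \<inter> E\<close>
  only, hence is locally constant, and grows with \<open>E\<close>.\<close>

definition cut :: "'a set \<Rightarrow> ('k \<Rightarrow> nat) \<Rightarrow> ('a, 'k) path \<Rightarrow> 'k \<Rightarrow> nat" where
  "cut E n x = join_deg {\<xi> \<in> E. \<xi> \<in> init x \<and> deg \<Lambda> \<xi> \<le> n}"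

lemma cut_le_iff: "finite E \<Longrightarrow> cut E n x \<le> q \<longleftrightarrow> (\<forall>\<xi>\<in>E. \<xi> \<in> init x \<longrightarrow> deg \<Lambda> \<xi> \<le> n \<longrightarrow> deg \<Lambda> \<xi> \<le> q)"
  unfolding cut_def by (subst join_deg_le_iff) auto

lemma cut_le: "finite E \<Longrightarrow> cut E n x \<le> n"
  by (simp add: cut_le_iff)

lemma cut_upper: "finite E \<Longrightarrow> \<xi> \<in> E \<Longrightarrow> \<xi> \<in> init x \<Longrightarrow> deg \<Lambda> \<xi> \<le> n \<Longrightarrow> deg \<Lambda> \<xi> \<le> cut E n x"
  using cut_le_iff[of E n x "cut E n x"] by blast

lemma cut_mono: "finite E' \<Longrightarrow> E \<subseteq> E' \<Longrightarrow> cut E n x \<le> cut E' n x"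
proof -
  assume f: "finite E'" and s: "E \<subseteq> E'"
  show ?thesis unfolding cut_le_iff[OF finite_subset[OF s f]] using cut_upper[OF f] s by blast
qed

lemma cut_local: "init y \<inter> E = init x \<inter> E \<Longrightarrow> cut E n y = cut E n x"
proof -
  assume "init y \<inter> E = init x \<inter> E"
  then have "{\<xi> \<in> E. \<xi> \<in> init y \<and> deg \<Lambda> \<xi> \<le> n} = {\<xi> \<in> E. \<xi> \<in> init x \<and> deg \<Lambda> \<xi> \<le> n}" by blast
  then show ?thesis by (simp add: cut_def)
qed

text \<open>For every \<open>n\<close> the level is the join of one of the finitely many subsets of
  \<open>E\<close>, so one finite set works for all \<open>n\<close> and all paths from
  \<open>v\<close>.\<close>

lemma finite_cut_levels:
  assumes "finite E"
  shows "\<exists>J. finite J \<and> (\<forall>x\<in>paths \<Lambda>. prng x = v \<longrightarrow> (\<forall>n. \<exists>\<omega>\<in>J. \<omega> \<in> init x \<and> deg \<Lambda> \<omega> = cut E n x))"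
proof -
  have "\<forall>A\<in>Pow E. \<exists>J. finite J \<and>
      (\<forall>x\<in>paths \<Lambda>. prng x = v \<longrightarrow> A \<subseteq> init x \<longrightarrow> (\<exists>\<omega>\<in>J. \<omega> \<in> init x \<and> deg \<Lambda> \<omega> = join_deg A))"
    using finite_joins assms finite_subset by (metis PowD)
  from bchoice[OF this] obtain J where J: "\<forall>A\<in>Pow E. finite (J A) \<and>
      (\<forall>x\<in>paths \<Lambda>. prng x = v \<longrightarrow> A \<subseteq> init x \<longrightarrow> (\<exists>\<omega>\<in>J A. \<omega> \<in> init x \<and> deg \<Lambda> \<omega> = join_deg A))" by (rule exE)
  show ?thesis
  proof (intro exI[of _ "\<Union>(J ` Pow E)"] conjI ballI impI allI)
    show "finite (\<Union>(J ` Pow E))" using J assms by blast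
    fix x n assume x: "x \<in> paths \<Lambda>" "prng x = v"
    let ?A = "{\<xi> \<in> E. \<xi> \<in> init x \<and> deg \<Lambda> \<xi> \<le> n}"
    have "?A \<in> Pow E" "?A \<subseteq> init x" by auto
    then have "\<exists>\<omega>\<in>J ?A. \<omega> \<in> init x \<and> deg \<Lambda> \<omega> = join_deg ?A" using J x by blast
    then show "\<exists>\<omega>\<in>\<Union>(J ` Pow E). \<omega> \<in> init x \<and> deg \<Lambda> \<omega> = cut E n x" using \<open>?A \<in> Pow E\<close> unfolding cut_def by blast
  qed
qed

end

section \<open>Weights on arrows at a given level\<close>

context pf_kgraph
begin

text \<open>The range morphism is a vertex: the arrow leads from \<open>\<omega>y\<close> to the
  image of \<open>y\<close> under \<open>g\<close>.\<close>

abbreviation vep :: "'g \<Rightarrow> 'a \<Rightarrow> ('a, 'k) path \<Rightarrow> ('g, 'a, 'k) ep_arrow" where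
  "vep g \<omega> y \<equiv> ep (act g (src \<Lambda> \<omega>)) g \<omega> y"

lemma triple_vep: "g \<in> carrier G \<Longrightarrow> \<omega> \<in> Mor \<Lambda> \<Longrightarrow> triple (act g (src \<Lambda> \<omega>)) g \<omega>"
  using act_closed src_closed vertexD(3)[OF act_vertex[OF _ src_vertex]] by (simp add: triple_def)

text \<open>For an arrow \<open>a\<close> with source \<open>x\<close> this is the weight \<open>\<phi> g (shift p x)\<close> if \<open>a\<close> is the composite of
  \<open>(g, shift p x)\<close> with the arrow from \<open>x\<close> to \<open>shift p x\<close>, and zero if \<open>a\<close> is no such composite.\<close>

definition theta :: "('g \<Rightarrow> ('a, 'k) path \<Rightarrow> real) \<Rightarrow> ('k \<Rightarrow> nat) \<Rightarrow> ('g, 'a, 'k) ep_arrow \<Rightarrow> real" where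
  "theta \<phi> p a = (let x = gsrc EP a; P = (\<lambda>g. g \<in> carrier G \<and> a = vep g (seg x 0 p) (shift p x))
     in if \<exists>g. P g then \<phi> (SOME g. P g) (shift p x) else 0)"

lemma theta_vep:
  assumes w: "w \<in> boundary_paths \<Lambda>" and o: "\<omega> \<in> init w" and g: "g \<in> carrier G"
  shows "theta \<phi> (deg \<Lambda> \<omega>) (vep g \<omega> (tail \<omega> w)) = \<phi> g (tail \<omega> w)"
proof -
  note wp = boundary_paths[OF w]
  have oM: "\<omega> \<in> Mor \<Lambda>" using init_Mor[OF wp o] .
  have s: "gsrc EP (vep g \<omega> (tail \<omega> w)) = w" unfolding ep_gsrc using concat_tail[OF wp o] .
  have so: "seg w 0 (deg \<Lambda> \<omega>) = \<omega>" using init_deg(2)[OF wp o] .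
  have "g' = g" if "g' \<in> carrier G \<and> vep g \<omega> (tail \<omega> w) = vep g' \<omega> (tail \<omega> w)" for g'
    using ep_unique(2)[OF triple_vep[OF g oM] triple_vep[OF conjunct1[OF that] oM] bpaths_tail[OF w o] conjunct2[OF that]] by simp
  then have "(SOME g'. g' \<in> carrier G \<and> vep g \<omega> (tail \<omega> w) = vep g' \<omega> (tail \<omega> w)) = g"
    by (intro some_equality) (use g in auto)
  then show ?thesis unfolding theta_def s so Let_def using g by auto
qed

lemma theta_not_vep:
  assumes w: "w \<in> boundary_paths \<Lambda>" and o: "\<omega> \<in> init w" and a: "a \<in> source_fibre EP w"
    and n: "a \<notin> (\<lambda>g. vep g \<omega> (tail \<omega> w)) ` carrier G"
  shows "theta \<phi> (deg \<Lambda> \<omega>) a = 0"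
proof -
  have s: "gsrc EP a = w" using a unfolding source_fibre_def by simp
  have so: "seg w 0 (deg \<Lambda> \<omega>) = \<omega>" using init_deg(2)[OF boundary_paths[OF w] o] .
  show ?thesis unfolding theta_def s so Let_def using n by auto
qed

lemma theta_cases:
  assumes w: "w \<in> boundary_paths \<Lambda>" and o: "\<omega> \<in> init w" and a: "a \<in> source_fibre EP w"
  shows "theta \<phi> (deg \<Lambda> \<omega>) a = 0 \<or> (\<exists>g\<in>carrier G. a = vep g \<omega> (tail \<omega> w) \<and> theta \<phi> (deg \<Lambda> \<omega>) a = \<phi> g (tail \<omega> w))"
  using theta_not_vep[OF assms] theta_vep[OF w o] by blast

lemma theta_nonneg:
  assumes "boundary_mean \<phi>" "w \<in> boundary_paths \<Lambda>" "\<omega> \<in> init w" "a \<in> source_fibre EP w"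
  shows "0 \<le> theta \<phi> (deg \<Lambda> \<omega>) a"
  using theta_cases[OF assms(2-4), of \<phi>] boundary_meanD(2)[OF assms(1) _ boundary_tail[OF assms(2,3)]] by auto

lemma vep_in_fibre:
  assumes w: "w \<in> boundary_paths \<Lambda>" and o: "\<omega> \<in> init w" and g: "g \<in> carrier G"
  shows "vep g \<omega> (tail \<omega> w) \<in> source_fibre EP w"
  using ep_in_fibre[OF triple_vep[OF g init_Mor[OF boundary_paths[OF w] o]] bpaths_tail[OF w o]]
    concat_tail[OF boundary_paths[OF w] o] by simp

lemma theta_has_sum:
  assumes m: "boundary_mean \<phi>" and w: "w \<in> boundary_paths \<Lambda>" and o: "\<omega> \<in> init w"
  shows "(theta \<phi> (deg \<Lambda> \<omega>) has_sum 1) (source_fibre EP w)"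
proof -
  let ?r = "\<lambda>g. vep g \<omega> (tail \<omega> w)"
  have oM: "\<omega> \<in> Mor \<Lambda>" using init_Mor[OF boundary_paths[OF w] o] .
  have inj: "inj_on ?r (carrier G)"
    by (rule inj_onI) (use ep_unique(2)[OF triple_vep[OF _ oM] triple_vep[OF _ oM] bpaths_tail[OF w o]] in blast)
  have "((\<lambda>g. \<phi> g (tail \<omega> w)) has_sum 1) (carrier G)"
    by (rule boundary_meanD(3)[OF m boundary_tail[OF w o]])
  then have "((theta \<phi> (deg \<Lambda> \<omega>) \<circ> ?r) has_sum 1) (carrier G)"
    by (rule has_sum_cong[THEN iffD1, rotated]) (simp add: theta_vep[OF w o])
  then have "(theta \<phi> (deg \<Lambda> \<omega>) has_sum 1) (?r ` carrier G)" using has_sum_reindex[OF inj] by blast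
  then show ?thesis
    by (rule has_sum_cong_neutral[THEN iffD1, rotated -1])
      (use theta_not_vep[OF w o] vep_in_fibre[OF w o] in auto)
qed

text \<open>Both levels cut off the same segment \<open>\<kappa>\<close> of \<open>z\<close>. Right
  multiplication by the arrow then matches the two supports via
  \<open>g \<mapsto> g \<otimes> res h \<kappa>\<close>, and the estimate is the invariance of
  \<open>\<phi>\<close> under \<open>res h \<kappa>\<close> at the tail.\<close>

lemma theta_invariant:
  assumes t: "triple \<mu> h \<nu>" and z: "z \<in> bpaths (src \<Lambda> \<nu>)" and k: "\<kappa> \<in> init z"
    and le: "fsum_le (\<lambda>g. \<bar>\<phi> (g \<otimes>\<^bsub>G\<^esub> res h \<kappa>) (tail \<kappa> z) - \<phi> g (pact (res h \<kappa>) (tail \<kappa> z))\<bar>) (carrier G) \<epsilon>"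
  shows "fsum_le (\<lambda>a. \<bar>theta \<phi> (deg \<Lambda> \<nu> + deg \<Lambda> \<kappa>) (gmult EP a (ep \<mu> h \<nu> z)) - theta \<phi> (deg \<Lambda> \<mu> + deg \<Lambda> \<kappa>) a\<bar>)
     (source_fibre EP (path_concat \<Lambda> \<mu> (pact h z))) \<epsilon>"
proof -
  let ?w = "path_concat \<Lambda> \<mu> (pact h z)" and ?x = "path_concat \<Lambda> \<nu> z" and ?o = "\<mu> \<cdot> act h \<kappa>" and ?h = "ep \<mu> h \<nu> z"
  note lv = range_level[OF t z k]
  have hG: "h \<in> carrier G" using tripleD(2)[OF t] .
  have kM: "\<kappa> \<in> Mor \<Lambda>" using init_Mor[OF bpathsD(1)[OF z] k] .
  have c: "cpb \<nu> \<kappa>" using bpaths_init[OF z tripleD(3)[OF t] k] .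
  note r = triple_refine[OF t c]
  have kG: "res h \<kappa> \<in> carrier G" using res_closed[OF hG kM] .
  have hz: "pact h z \<in> bpaths (src \<Lambda> \<mu>)" using bpaths_act[OF hG z] tripleD(4)[OF t] by simp
  have w: "?w \<in> boundary_paths \<Lambda>" using bpathsD(2)[OF bpaths_concat[OF tripleD(1)[OF t] hz]] .
  have x: "?x \<in> boundary_paths \<Lambda>" using bpathsD(2)[OF bpaths_concat[OF tripleD(3)[OF t] z]] .
  have xo: "\<nu> \<cdot> \<kappa> \<in> init ?x" "tail (\<nu> \<cdot> \<kappa>) ?x = tail \<kappa> z"
  proof -
    note cz = concat[OF bpathsD(1)[OF z] tripleD(3)[OF t] bpathsD(3)[OF z, symmetric]]
    show *: "\<nu> \<cdot> \<kappa> \<in> init ?x" using concat_init_cmp[OF bpathsD(1)[OF z] c bpathsD(3)[OF z, symmetric]] k by blast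
    show "tail (\<nu> \<cdot> \<kappa>) ?x = tail \<kappa> z" using tail_tail[OF cz(1) c *] cz(3) by simp
  qed
  have d: "deg \<Lambda> ?o = deg \<Lambda> \<mu> + deg \<Lambda> \<kappa>" "deg \<Lambda> (\<nu> \<cdot> \<kappa>) = deg \<Lambda> \<nu> + deg \<Lambda> \<kappa>"
    using deg_cmp r(1) c act_deg[OF hG kM] by auto
  have oM: "?o \<in> Mor \<Lambda>" "\<nu> \<cdot> \<kappa> \<in> Mor \<Lambda>" using r(1) c cmp_closed by auto
  have so: "src \<Lambda> ?o = act (res h \<kappa>) (src \<Lambda> (\<nu> \<cdot> \<kappa>))" using tripleD(4)[OF r(2)] .
  have vo: "src \<Lambda> (\<nu> \<cdot> \<kappa>) \<in> Mor \<Lambda>" using src_closed[OF oM(2)] .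
  have mult: "gmult EP (vep g ?o (tail ?o ?w)) ?h = vep (g \<otimes>\<^bsub>G\<^esub> res h \<kappa>) (\<nu> \<cdot> \<kappa>) (tail (\<nu> \<cdot> \<kappa>) ?x)" if g: "g \<in> carrier G" for g
    using ep_mult_level(1)[OF t z k triple_vep[OF g oM(1)]] act_mult[OF g kG vo] so xo(2) by simp
  let ?F = "\<lambda>a. \<bar>theta \<phi> (deg \<Lambda> \<nu> + deg \<Lambda> \<kappa>) (gmult EP a ?h) - theta \<phi> (deg \<Lambda> \<mu> + deg \<Lambda> \<kappa>) a\<bar>"
  have ha: "?h \<in> topspace (arrow_top EP)" using ep_arrow[OF t z] unfolding EP_simps .
  note gd = EP_groupoid[OF ha, unfolded ep_grng ep_gsrc]
  show ?thesis
  proof (rule fsum_le_support[where r = "\<lambda>g. vep g ?o (tail ?o ?w)" and B = "carrier G"])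
    fix a assume a: "a \<in> source_fibre EP ?w" and n: "a \<notin> (\<lambda>g. vep g ?o (tail ?o ?w)) ` carrier G"
    \<comment> \<open>The supports correspond exactly: if the product were in the support at the
      source, cancelling the arrow would put \<open>a\<close> in the support at the range.\<close>
    have "gmult EP a ?h \<notin> (\<lambda>g. vep g (\<nu> \<cdot> \<kappa>) (tail (\<nu> \<cdot> \<kappa>) ?x)) ` carrier G"
    proof
      assume "gmult EP a ?h \<in> (\<lambda>g. vep g (\<nu> \<cdot> \<kappa>) (tail (\<nu> \<cdot> \<kappa>) ?x)) ` carrier G"
      then obtain g where g: "g \<in> carrier G" "gmult EP a ?h = vep g (\<nu> \<cdot> \<kappa>) (tail (\<nu> \<cdot> \<kappa>) ?x)" by blast
      let ?g = "g \<otimes>\<^bsub>G\<^esub> inv\<^bsub>G\<^esub> (res h \<kappa>)"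
      have g': "?g \<in> carrier G" "?g \<otimes>\<^bsub>G\<^esub> res h \<kappa> = g" using g(1) kG by (simp_all add: gr.m_assoc)
      have "gmult EP a ?h = gmult EP (vep ?g ?o (tail ?o ?w)) ?h" using mult[OF g'(1)] g'(2) g(2) by simp
      then have "a = vep ?g ?o (tail ?o ?w)" using gd(3) a vep_in_fibre[OF w lv(1) g'(1)] unfolding inj_on_def by blast
      then show False using n g'(1) by blast
    qed
    then show "?F a = 0"
      using theta_not_vep[OF w lv(1) a n, of \<phi>] theta_not_vep[OF x xo(1) gd(2)[OF a], of \<phi>] unfolding d by simp
  next
    show "fsum_le (\<lambda>g. ?F (vep g ?o (tail ?o ?w))) (carrier G) \<epsilon>"
    proof (rule fsum_le_mono[OF le])
      fix g assume g: "g \<in> carrier G"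
      have gk: "g \<otimes>\<^bsub>G\<^esub> res h \<kappa> \<in> carrier G" using g kG by simp
      show "?F (vep g ?o (tail ?o ?w)) \<le> \<bar>\<phi> (g \<otimes>\<^bsub>G\<^esub> res h \<kappa>) (tail \<kappa> z) - \<phi> g (pact (res h \<kappa>) (tail \<kappa> z))\<bar>"
        using theta_vep[OF w lv(1) g, of \<phi>] theta_vep[OF x xo(1) gk, of \<phi>] mult[OF g] lv(2) xo(2) unfolding d by simp
    qed simp
  qed
qed

text \<open>Near \<open>z0\<close> the level is constant. Whether the arrow has the required form
  for a given \<open>g\<close> is then decided by the one segment \<open>\<kappa>\<close>, so either
  the weight vanishes nearby or it is \<open>\<phi> g\<close> for a fixed \<open>g\<close> at a tail
  that varies continuously.\<close>

lemma theta_cut_continuous: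
  assumes m: "boundary_mean \<phi>" and E: "finite E"
  shows "continuous_map ET euclideanreal (\<lambda>a. theta \<phi> (cut E n (gsrc EP a)) a)"
  unfolding continuous_ep_iff
proof (intro allI impI ballI)
  fix \<mu> h \<nu> z0 and \<epsilon> :: real
  assume t: "triple \<mu> h \<nu>" and z0: "z0 \<in> bpaths (src \<Lambda> \<nu>)" and e: "\<epsilon> > 0"
  note nM = tripleD(3)[OF t]
  let ?c = "path_concat \<Lambda> \<nu>"
  have xB: "?c z \<in> bpaths (rng \<Lambda> \<nu>)" if "z \<in> bpaths (src \<Lambda> \<nu>)" for z using bpaths_concat[OF nM that] .
  have xi: "\<xi> \<in> init (?c z) \<longleftrightarrow> (\<exists>\<kappa>\<in>ext \<nu> \<xi>. \<kappa> \<in> init z)" if "z \<in> bpaths (src \<Lambda> \<nu>)" for z \<xi>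
    using concat_init_ext[OF bpathsD(1)[OF that] nM bpathsD(3)[OF that, symmetric]] .
  have cz: "?c z \<in> paths \<Lambda>" "\<nu> \<in> init (?c z)" "tail \<nu> (?c z) = z" if "z \<in> bpaths (src \<Lambda> \<nu>)" for z
    using concat[OF bpathsD(1)[OF that] nM bpathsD(3)[OF that, symmetric]] .
  obtain J where "\<forall>x\<in>paths \<Lambda>. prng x = rng \<Lambda> \<nu> \<longrightarrow> (\<forall>n. \<exists>\<omega>\<in>J. \<omega> \<in> init x \<and> deg \<Lambda> \<omega> = cut E n x)"
    using finite_cut_levels[OF E, of "rng \<Lambda> \<nu>"] by blast
  then obtain \<omega> where o: "\<omega> \<in> init (?c z0)" "deg \<Lambda> \<omega> = cut E n (?c z0)"
    using bpathsD(1,3)[OF xB[OF z0]] by blast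
  have oM: "\<omega> \<in> Mor \<Lambda>" using init_Mor[OF cz(1)[OF z0] o(1)] .
  obtain \<theta> where th: "\<theta> \<in> init (?c z0)" "\<theta> \<in> mce \<nu> \<omega>" using init_directed[OF cz(1,2)[OF z0] o(1)] .
  obtain \<kappa> where k: "cpb \<nu> \<kappa>" "\<theta> = \<nu> \<cdot> \<kappa>" using th(2) unfolding mce_def pre_def by blast
  have kz0: "\<kappa> \<in> init z0" using tail_init[OF cz(1,2)[OF z0]] th(1) k cz(3)[OF z0] by simp
  have oi: "\<omega> \<in> init (?c z)" "\<theta> \<in> init (?c z)" if z: "z \<in> bpaths (src \<Lambda> \<nu>)" "\<kappa> \<in> init z" for z
  proof -
    show "\<theta> \<in> init (?c z)" unfolding k(2)
      using concat_init_cmp[OF bpathsD(1)[OF z(1)] k(1) bpathsD(3)[OF z(1), symmetric]] z(2) by blast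
    then show "\<omega> \<in> init (?c z)" using init_hered[OF cz(1)[OF z(1)]] th(2) unfolding mce_def by blast
  qed
  have vep_iff: "ep \<mu> h \<nu> z = vep g \<omega> (tail \<omega> (?c z)) \<longleftrightarrow>
      (\<exists>\<kappa>'. (\<kappa>, \<kappa>') \<in> ext_match \<mu> h \<nu> (act g (src \<Lambda> \<omega>)) g \<omega>)"
    if z: "z \<in> bpaths (src \<Lambda> \<nu>)" "\<kappa> \<in> init z" and g: "g \<in> carrier G" for z g
  proof -
    note t' = triple_vep[OF g oM]
    have tb: "tail \<omega> (?c z) \<in> bpaths (src \<Lambda> \<omega>)" using bpaths_tail[OF bpathsD(2)[OF xB[OF z(1)]] oi(1)[OF z]] .
    have "ep \<mu> h \<nu> z = vep g \<omega> (tail \<omega> (?c z)) \<longleftrightarrow> ep \<mu> h \<nu> z \<in> ep_set (act g (src \<Lambda> \<omega>)) g \<omega>"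
    proof
      assume "ep \<mu> h \<nu> z \<in> ep_set (act g (src \<Lambda> \<omega>)) g \<omega>"
      then obtain y where y: "y \<in> bpaths (src \<Lambda> \<omega>)" "ep \<mu> h \<nu> z = vep g \<omega> y" unfolding ep_set_def by blast
      then have "?c z = path_concat \<Lambda> \<omega> y" by (simp add: ep_quadruple_def)
      then have "tail \<omega> (?c z) = y" using tail_concat[OF bpathsD(1)[OF y(1)] oM bpathsD(3)[OF y(1), symmetric]] by simp
      then show "ep \<mu> h \<nu> z = vep g \<omega> (tail \<omega> (?c z))" using y by simp
    qed (use tb in \<open>simp add: ep_set_def\<close>)
    also have "\<dots> \<longleftrightarrow> (\<exists>(\<kappa>1, \<kappa>')\<in>ext_match \<mu> h \<nu> (act g (src \<Lambda> \<omega>)) g \<omega>. \<kappa>1 \<in> init z)"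
      by (rule ep_set_iff[OF t t' z(1)])
    also have "\<dots> \<longleftrightarrow> (\<exists>\<kappa>'. (\<kappa>, \<kappa>') \<in> ext_match \<mu> h \<nu> (act g (src \<Lambda> \<omega>)) g \<omega>)"
    proof -
      \<comment> \<open>Minimal common extensions of \<open>\<nu>\<close> and
        \<open>\<omega>\<close> all have one degree, and a path has only one initial segment of that
        degree.\<close>
      have "\<kappa>1 = \<kappa>" if "(\<kappa>1, \<kappa>') \<in> ext_match \<mu> h \<nu> (act g (src \<Lambda> \<omega>)) g \<omega>" "\<kappa>1 \<in> init z" for \<kappa>1 \<kappa>'
      proof -
        have c1: "cpb \<nu> \<kappa>1" "\<nu> \<cdot> \<kappa>1 \<in> mce \<nu> \<omega>" using that(1) by (auto simp: ext_match_def)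
        have "\<nu> \<cdot> \<kappa>1 \<in> init (?c z)"
          using concat_init_cmp[OF bpathsD(1)[OF z(1)] c1(1) bpathsD(3)[OF z(1), symmetric]] that(2) by blast
        moreover have "deg \<Lambda> (\<nu> \<cdot> \<kappa>1) = deg \<Lambda> \<theta>" using c1(2) th(2) by (simp add: mce_def)
        ultimately have "\<nu> \<cdot> \<kappa>1 = \<nu> \<cdot> \<kappa>" using init_deg_eq[OF cz(1)[OF z(1)] _ oi(2)[OF z]] k(2) by blast
        then show ?thesis using cmp_cancel[OF c1(1) k(1)] by blast
      qed
      then show ?thesis using z(2) by blast
    qed
    finally show ?thesis .
  qed
  define L1 where "L1 = insert \<kappa> (\<Union>\<xi>\<in>E. ext \<nu> \<xi>)"
  have L1: "finite L1" unfolding L1_def using E finite_ext' by blast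
  have cutL: "cut E n (?c z) = deg \<Lambda> \<omega>" "\<kappa> \<in> init z"
    if z: "z \<in> bpaths (src \<Lambda> \<nu>)" and eq: "init z \<inter> L1 = init z0 \<inter> L1" for z
  proof -
    show "\<kappa> \<in> init z" using eq kz0 unfolding L1_def by blast
    have "init (?c z) \<inter> E = init (?c z0) \<inter> E"
    proof -
      have "\<xi> \<in> init (?c z) \<longleftrightarrow> \<xi> \<in> init (?c z0)" if "\<xi> \<in> E" for \<xi>
        unfolding xi[OF z] xi[OF z0] using eq that unfolding L1_def by blast
      then show ?thesis by blast
    qed
    then show "cut E n (?c z) = deg \<Lambda> \<omega>" using cut_local o(2) by metis
  qed
  have z0f: "ep \<mu> h \<nu> z0 \<in> source_fibre EP (?c z0)" using ep_in_fibre[OF t z0] .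
  show "\<exists>L. finite L \<and> (\<forall>z\<in>bpaths (src \<Lambda> \<nu>). init z \<inter> L = init z0 \<inter> L \<longrightarrow>
      \<bar>theta \<phi> (cut E n (gsrc EP (ep \<mu> h \<nu> z))) (ep \<mu> h \<nu> z) - theta \<phi> (cut E n (gsrc EP (ep \<mu> h \<nu> z0))) (ep \<mu> h \<nu> z0)\<bar> < \<epsilon>)"
  proof (cases "\<exists>g\<in>carrier G. \<exists>\<kappa>'. (\<kappa>, \<kappa>') \<in> ext_match \<mu> h \<nu> (act g (src \<Lambda> \<omega>)) g \<omega>")
    case True
    then obtain g where g: "g \<in> carrier G" "\<exists>\<kappa>'. (\<kappa>, \<kappa>') \<in> ext_match \<mu> h \<nu> (act g (src \<Lambda> \<omega>)) g \<omega>" by blast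
    have val: "theta \<phi> (deg \<Lambda> \<omega>) (ep \<mu> h \<nu> z) = \<phi> g (tail \<omega> (?c z))" if z: "z \<in> bpaths (src \<Lambda> \<nu>)" "\<kappa> \<in> init z" for z
      using vep_iff[OF z g(1)] g(2) theta_vep[OF bpathsD(2)[OF xB[OF z(1)]] oi(1)[OF z] g(1), of \<phi>] by simp
    have t0: "tail \<omega> (?c z0) \<in> boundary_paths \<Lambda>" using boundary_tail[OF bpathsD(2)[OF xB[OF z0]] o(1)] .
    obtain L' where L': "finite L'" "\<And>y. y \<in> boundary_paths \<Lambda> \<Longrightarrow> init y \<inter> L' = init (tail \<omega> (?c z0)) \<inter> L' \<Longrightarrow>
        \<bar>\<phi> g y - \<phi> g (tail \<omega> (?c z0))\<bar> < \<epsilon>"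
      using boundary_meanD(1)[OF m g(1), unfolded continuous_boundary_iff, rule_format, OF t0 e] by blast
    \<comment> \<open>Adds to the test set for the level the conditions on the tail behind
      \<open>\<omega>\<close>, rewritten as conditions on \<open>z\<close>.\<close>
    define L where "L = L1 \<union> (\<Union>\<beta>\<in>L'. ext \<nu> (\<omega> \<cdot> \<beta>))"
    have "finite L" unfolding L_def using L1 L'(1) finite_ext' by blast
    moreover have "\<bar>theta \<phi> (cut E n (?c z)) (ep \<mu> h \<nu> z) - theta \<phi> (cut E n (?c z0)) (ep \<mu> h \<nu> z0)\<bar> < \<epsilon>"
      if z: "z \<in> bpaths (src \<Lambda> \<nu>)" and eq: "init z \<inter> L = init z0 \<inter> L" for z
    proof -
      have eq1: "init z \<inter> L1 = init z0 \<inter> L1" using eq unfolding L_def by blast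
      note cl = cutL[OF z eq1]
      have tz: "tail \<omega> (?c z) \<in> boundary_paths \<Lambda>" using boundary_tail[OF bpathsD(2)[OF xB[OF z]] oi(1)[OF z cl(2)]] .
      have "\<beta> \<in> init (tail \<omega> (?c z)) \<longleftrightarrow> \<beta> \<in> init (tail \<omega> (?c z0))" if "\<beta> \<in> L'" for \<beta>
      proof -
        have "\<omega> \<cdot> \<beta> \<in> init (?c z) \<longleftrightarrow> \<omega> \<cdot> \<beta> \<in> init (?c z0)"
          unfolding xi[OF z] xi[OF z0] using eq that unfolding L_def by blast
        then show ?thesis using tail_init[OF cz(1)[OF z] oi(1)[OF z cl(2)]] tail_init[OF cz(1)[OF z0] o(1)] by simp
      qed
      then have "init (tail \<omega> (?c z)) \<inter> L' = init (tail \<omega> (?c z0)) \<inter> L'" by blast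
      then show ?thesis unfolding cl(1) o(2)[symmetric] val[OF z cl(2)] val[OF z0 kz0] by (rule L'(2)[OF tz])
    qed
    ultimately show ?thesis unfolding ep_gsrc by blast
  next
    case False
    have val: "theta \<phi> (deg \<Lambda> \<omega>) (ep \<mu> h \<nu> z) = 0" if z: "z \<in> bpaths (src \<Lambda> \<nu>)" "\<kappa> \<in> init z" for z
    proof (rule theta_not_vep[OF bpathsD(2)[OF xB[OF z(1)]] oi(1)[OF z] ep_in_fibre[OF t z(1)]])
      show "ep \<mu> h \<nu> z \<notin> (\<lambda>g. vep g \<omega> (tail \<omega> (?c z))) ` carrier G" using vep_iff[OF z] False by blast
    qed
    have "\<bar>theta \<phi> (cut E n (?c z)) (ep \<mu> h \<nu> z) - theta \<phi> (cut E n (?c z0)) (ep \<mu> h \<nu> z0)\<bar> < \<epsilon>"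
      if z: "z \<in> bpaths (src \<Lambda> \<nu>)" and eq: "init z \<inter> L1 = init z0 \<inter> L1" for z
      using cutL[OF z eq] o(2) val[OF z] val[OF z0 kz0] e by simp
    then show ?thesis unfolding ep_gsrc using L1 by blast
  qed
qed

end

lemma interlaced_card:
  fixes P Q :: "nat \<Rightarrow> 'k::finite \<Rightarrow> nat"
  assumes mono: "\<And>i. P i \<le> P (Suc i)" "\<And>i. Q i \<le> Q (Suc i)"
    and bounds: "\<And>i. p \<le> P i" "\<And>i. P i \<le> p + m" "\<And>i. q \<le> Q i" "\<And>i. Q i \<le> q + m"
    and inter: "\<And>i. P i + q \<le> Q (Suc i) + p" "\<And>i. Q i + p \<le> P (Suc i) + q"
  shows "card {i. i < M \<and> P i + q \<noteq> Q i + p} \<le> 2 * (\<Sum>c\<in>UNIV. m c)"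
proof -
  text \<open>The total height \<open>R\<close> grows strictly at every index where the two sequences differ.\<close>
  define R where "R i = (\<Sum>c\<in>UNIV. (P i c - p c) + (Q i c - q c))" for i
  note le = le_funD
  have le1: "P i c - p c + (Q i c - q c) \<le> P (Suc i) c - p c + (Q (Suc i) c - q c)" for i c
    using le[OF mono(1), of i c] le[OF mono(2), of i c] by linarith
  have mR: "R i \<le> R (Suc i)" for i unfolding R_def by (rule sum_mono) (rule le1)
  have str: "R i < R (Suc i)" if ne: "P i + q \<noteq> Q i + p" for i
  proof -
    obtain c where c: "P i c + q c \<noteq> Q i c + p c" using ne by (auto simp: fun_eq_iff)
    \<comment> \<open>In a coordinate where the heights differ, the lower one must reach the higher
      one at the next index by interlacing, so the total increases.\<close>
    have "P i c - p c + (Q i c - q c) < P (Suc i) c - p c + (Q (Suc i) c - q c)"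
      using c le[OF mono(1), of i c] le[OF mono(2), of i c] le[OF bounds(1), of c i] le[OF bounds(3), of c i]
        le[OF inter(1), of i c] le[OF inter(2), of i c] by simp
    then show ?thesis unfolding R_def by (intro sum_strict_mono_ex1) (use le1 in auto)
  qed
  have "card {i. i < M \<and> P i + q \<noteq> Q i + p} \<le> card {i. i < M \<and> R i < R (Suc i)}"
    by (rule card_mono) (use str in auto)
  also have "\<dots> \<le> R M" by (rule card_increases_le) (rule mR)
  also have "\<dots> \<le> (\<Sum>c\<in>UNIV. 2 * m c)" unfolding R_def
  proof (rule sum_mono)
    fix c
    show "P M c - p c + (Q M c - q c) \<le> 2 * m c" using le[OF bounds(2), of M c] le[OF bounds(4), of M c] by simp
  qed
  finally show ?thesis by (simp add: sum_distrib_left)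
qed

section \<open>Averaging over levels\<close>

context pf_kgraph
begin

lemma cut_level:
  assumes "x \<in> paths \<Lambda>" "finite E"
  obtains \<omega> where "\<omega> \<in> init x" "deg \<Lambda> \<omega> = cut E n x"
  using finite_cut_levels[OF assms(2), of "prng x"] assms(1) by blast

lemma concat_path_facts:
  assumes t: "triple \<mu> h \<nu>" and z: "z \<in> bpaths (src \<Lambda> \<nu>)"
  shows "path_concat \<Lambda> \<nu> z \<in> boundary_paths \<Lambda>" "path_concat \<Lambda> \<mu> (pact h z) \<in> boundary_paths \<Lambda>"
    "\<nu> \<in> init (path_concat \<Lambda> \<nu> z)" "\<mu> \<in> init (path_concat \<Lambda> \<mu> (pact h z))"
    "prng (path_concat \<Lambda> \<nu> z) = rng \<Lambda> \<nu>" "pact h z \<in> bpaths (src \<Lambda> \<mu>)"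
proof -
  show hz: "pact h z \<in> bpaths (src \<Lambda> \<mu>)" using bpaths_act[OF tripleD(2)[OF t] z] tripleD(4)[OF t] by simp
  note c = bpaths_concat[OF tripleD(3)[OF t] z] bpaths_concat[OF tripleD(1)[OF t] hz]
  show "path_concat \<Lambda> \<nu> z \<in> boundary_paths \<Lambda>" "path_concat \<Lambda> \<mu> (pact h z) \<in> boundary_paths \<Lambda>"
    "prng (path_concat \<Lambda> \<nu> z) = rng \<Lambda> \<nu>" using bpathsD[OF c(1)] bpathsD[OF c(2)] by auto
  show "\<nu> \<in> init (path_concat \<Lambda> \<nu> z)"
    using concat_init[OF bpathsD(1)[OF z] tripleD(3)[OF t] bpathsD(3)[OF z, symmetric]] .
  show "\<mu> \<in> init (path_concat \<Lambda> \<mu> (pact h z))"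
    using concat_init[OF bpathsD(1)[OF hz] tripleD(1)[OF t] bpathsD(3)[OF hz, symmetric]] .
qed

text \<open>One half of the interlacing. A segment \<open>\<xi>\<close> counted at the source lies
  below \<open>\<nu> \<cdot> \<kappa>\<close>, whose degree is the join of those of
  \<open>\<nu>\<close> and \<open>\<xi>\<close>, hence at most \<open>deg \<nu> + m\<close>. The
  matching segment \<open>\<mu> \<cdot> act h \<kappa>\<close> is in \<open>E'\<close> and within
  the bound at the range.\<close>

lemma cut_step:
  assumes t: "triple \<mu> h \<nu>" and z: "z \<in> bpaths (src \<Lambda> \<nu>)" and E: "finite E" "finite E'"
    and sub: "(\<Union>\<xi>\<in>E. (\<lambda>\<kappa>. \<mu> \<cdot> act h \<kappa>) ` ext \<nu> \<xi>) \<subseteq> E'" and mE: "\<mu> \<in> E'"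
  shows "cut E (deg \<Lambda> \<nu> + m) (path_concat \<Lambda> \<nu> z) + deg \<Lambda> \<mu>
    \<le> cut E' (deg \<Lambda> \<mu> + m) (path_concat \<Lambda> \<mu> (pact h z)) + deg \<Lambda> \<nu>"
proof -
  let ?x = "path_concat \<Lambda> \<nu> z" and ?y = "path_concat \<Lambda> \<mu> (pact h z)"
  let ?c = "cut E' (deg \<Lambda> \<mu> + m) ?y"
  note cp = concat_path_facts[OF t z]
  have "deg \<Lambda> \<mu> \<le> deg \<Lambda> \<mu> + m" by (simp add: le_fun_def)
  \<comment> \<open>Needed because subtraction of naturals is truncated: the level at the range is
    at least \<open>deg \<mu>\<close>.\<close>
  then have mc: "deg \<Lambda> \<mu> \<le> ?c" using cut_upper[OF E(2) mE cp(4)] by blast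
  have "cut E (deg \<Lambda> \<nu> + m) ?x \<le> ?c + deg \<Lambda> \<nu> - deg \<Lambda> \<mu>"
    unfolding cut_le_iff[OF E(1)]
  proof (intro ballI impI)
    fix \<xi> assume xi: "\<xi> \<in> E" "\<xi> \<in> init ?x" "deg \<Lambda> \<xi> \<le> deg \<Lambda> \<nu> + m"
    obtain \<kappa> where k: "\<kappa> \<in> ext \<nu> \<xi>" "\<kappa> \<in> init z"
      using concat_init_ext[OF bpathsD(1)[OF z] tripleD(3)[OF t] bpathsD(3)[OF z, symmetric]] xi(2) by blast
    have c: "cpb \<nu> \<kappa>" "deg \<Lambda> (\<nu> \<cdot> \<kappa>) = sup (deg \<Lambda> \<nu>) (deg \<Lambda> \<xi>)" using k(1) by (auto simp: ext_def mce_def)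
    have d: "deg \<Lambda> \<nu> + deg \<Lambda> \<kappa> = sup (deg \<Lambda> \<nu>) (deg \<Lambda> \<xi>)" using c deg_cmp by simp
    have dk: "deg \<Lambda> \<nu> i + deg \<Lambda> \<kappa> i = max (deg \<Lambda> \<nu> i) (deg \<Lambda> \<xi> i)" for i
      using fun_cong[OF d, of i] by (simp add: sup_max)
    have dx: "deg \<Lambda> \<xi> i \<le> deg \<Lambda> \<nu> i + m i" for i using le_funD[OF xi(3), of i] by simp
    have d2: "deg \<Lambda> (\<mu> \<cdot> act h \<kappa>) = deg \<Lambda> \<mu> + deg \<Lambda> \<kappa>"
      using deg_cmp triple_refine(1)[OF t c(1)] act_deg[OF tripleD(2)[OF t]] c(1) by simp
    have "deg \<Lambda> (\<mu> \<cdot> act h \<kappa>) \<le> deg \<Lambda> \<mu> + m"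
    proof (rule le_funI)
      fix i show "deg \<Lambda> (\<mu> \<cdot> act h \<kappa>) i \<le> (deg \<Lambda> \<mu> + m) i" using dk[of i] dx[of i] unfolding d2 by simp
    qed
    moreover have "\<mu> \<cdot> act h \<kappa> \<in> E'" using sub xi(1) k(1) by blast
    ultimately have up: "deg \<Lambda> \<mu> + deg \<Lambda> \<kappa> \<le> ?c" using cut_upper[OF E(2) _ range_level(1)[OF t z k(2)]] d2 by metis
    show "deg \<Lambda> \<xi> \<le> ?c + deg \<Lambda> \<nu> - deg \<Lambda> \<mu>"
    proof (rule le_funI)
      fix i
      have "deg \<Lambda> \<mu> i + deg \<Lambda> \<kappa> i \<le> ?c i" using le_funD[OF up, of i] by simp
      then show "deg \<Lambda> \<xi> i \<le> (?c + deg \<Lambda> \<nu> - deg \<Lambda> \<mu>) i" using dk[of i] by simp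
    qed
  qed
  then have le: "cut E (deg \<Lambda> \<nu> + m) ?x i \<le> ?c i + deg \<Lambda> \<nu> i - deg \<Lambda> \<mu> i" for i using le_funD by fastforce
  show ?thesis
  proof (rule le_funI)
    fix i show "(cut E (deg \<Lambda> \<nu> + m) ?x + deg \<Lambda> \<mu>) i \<le> (?c + deg \<Lambda> \<nu>) i" using le[of i] le_funD[OF mc, of i] by simp
  qed
qed

text \<open>Budget: \<open>\<epsilon> / 2\<close> for the invariance of \<open>\<phi>\<close>,
  \<open>\<epsilon> / 4\<close> for indices where the levels at source and range do not correspond,
  and \<open>\<epsilon> / 4\<close> for the two boundary layers of the cube.\<close>

theorem amenable_groupoid_if_action:
  assumes am: "amenable_action G (boundary_topology \<Lambda>) pact"
  shows "amenable_groupoid EP"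
  unfolding amenable_EP_iff
proof (intro allI impI)
  fix K and \<epsilon> :: real assume K: "compactin ET K" and e: "\<epsilon> > 0"
  let ?T = "{(\<mu>, h, \<nu>). triple \<mu> h \<nu>}" and ?U = "\<lambda>(\<mu>, h, \<nu>). ep_set \<mu> h \<nu>"
  have "\<exists>\<F>. finite \<F> \<and> \<F> \<subseteq> ?U ` ?T \<and> K \<subseteq> \<Union>\<F>"
    using K unfolding compactin_def
  proof (elim conjE allE impE)
    assume KT: "K \<subseteq> topspace ET"
    show "(\<forall>U\<in>?U ` ?T. openin ET U) \<and> K \<subseteq> \<Union> (?U ` ?T)"
    proof (intro conjI ballI subsetI)
      show "openin ET U" if "U \<in> ?U ` ?T" for U using that openin_ep_set by auto
      fix a assume "a \<in> K"
      then obtain \<mu> h \<nu> z where "triple \<mu> h \<nu>" "z \<in> bpaths (src \<Lambda> \<nu>)" "a = ep \<mu> h \<nu> z" using arrow_cases KT by blast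
      then have "(\<mu>, h, \<nu>) \<in> ?T" "a \<in> ?U (\<mu>, h, \<nu>)" by (auto simp: ep_set_def)
      then show "a \<in> \<Union> (?U ` ?T)" by blast
    qed
  qed
  then obtain \<F> where F: "finite \<F>" "\<F> \<subseteq> ?U ` ?T" "K \<subseteq> \<Union>\<F>" by blast
  then obtain R0 where R0: "R0 \<subseteq> ?T" "finite R0" "\<F> = ?U ` R0" using finite_subset_image[OF F(1,2)] by blast
  \<comment> \<open>The inverses are included because the interlacing is wanted from source to range
    and back.\<close>
  define R where "R = R0 \<union> (\<lambda>(\<mu>, h, \<nu>). (\<nu>, inv\<^bsub>G\<^esub> h, \<mu>)) ` R0"
  have R: "finite R" "\<And>\<mu> h \<nu>. (\<mu>, h, \<nu>) \<in> R \<Longrightarrow> triple \<mu> h \<nu>"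
    unfolding R_def using R0(1,2) triple_inv by auto
  \<comment> \<open>Adds all images on the range side of segments seen on the source side; this is
    the closure hypothesis of \<open>cut_step\<close>.\<close>
  define step where "step E = E \<union> (\<Union>(\<mu>, h, \<nu>)\<in>R. \<Union>\<xi>\<in>E. (\<lambda>\<kappa>. \<mu> \<cdot> act h \<kappa>) ` ext \<nu> \<xi>)" for E
  \<comment> \<open>With \<open>\<mu>\<close> and \<open>\<nu>\<close> present from the start, the
    levels never fall below their degrees, so some \<open>\<kappa>\<close> is really cut
    off.\<close>
  define E0 where "E0 = (\<Union>(\<mu>, h, \<nu>)\<in>R. {\<mu>, \<nu>})"
  define E where "E i = (step ^^ i) E0" for i
  have ES: "E (Suc i) = step (E i)" for i unfolding E_def by simp
  have finE: "finite (E i)" for i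
  proof (induction i)
    case 0
    then show ?case unfolding E_def E0_def using R(1) by auto
  next
    case (Suc i)
    then show ?case unfolding ES step_def using R(1) finite_ext' by auto
  qed
  have Emono: "E i \<subseteq> E (Suc i)" for i unfolding ES step_def by blast
  have E0: "E0 \<subseteq> E i" for i
  proof (induction i)
    case 0
    then show ?case by (simp add: E_def)
  qed (use Emono in blast)
  have Estep: "(\<Union>\<xi>\<in>E i. (\<lambda>\<kappa>. \<mu> \<cdot> act h \<kappa>) ` ext \<nu> \<xi>) \<subseteq> E (Suc i)" if "(\<mu>, h, \<nu>) \<in> R" for \<mu> h \<nu> i
    unfolding ES step_def using that by blast
  have Evert: "\<mu> \<in> E i" "\<nu> \<in> E i" if "(\<mu>, h, \<nu>) \<in> R" for \<mu> h \<nu> i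
    using E0[of i] that unfolding E0_def by blast+
  define D where "D = Max (insert 0 (\<Union>\<xi>\<in>E0. range (deg \<Lambda> \<xi>)))"
  have D: "deg \<Lambda> \<xi> c \<le> D" if "\<xi> \<in> E0" for \<xi> c
    unfolding D_def by (rule Max_ge) (use that finE[of 0] in \<open>auto simp: E_def\<close>)
  let ?k = "CARD('k)"
  \<comment> \<open>Each of the shifts by \<open>deg \<nu>\<close> and \<open>deg \<mu>\<close>
    misses at most the fraction \<open>\<epsilon> / 8\<close> of the cube.\<close>
  obtain N where N: "0 < N" "D \<le> N" "real (N ^ ?k - (N - D) ^ ?k) \<le> \<epsilon> / 8 * real (N ^ ?k)"
    using cube_boundary[of "\<epsilon> / 8" D ?k] e by auto
  \<comment> \<open>For each \<open>m\<close> at most \<open>2 * k * N\<close> indices are bad and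
    each costs 2; this choice makes the total \<open>4 * k * N\<close> at most
    \<open>M * \<epsilon> / 4\<close>. It depends on \<open>N\<close>, so it comes second.\<close>
  obtain M :: nat where M: "real M > 16 * real ?k * real N / \<epsilon>" using reals_Archimedean2 by blast
  have M0: "0 < M"
  proof -
    have "16 * real ?k * real N / \<epsilon> \<ge> 0" using e by simp
    then show ?thesis using M by (cases M) auto
  qed
  \<comment> \<open>The possible cut segments must be listed before \<open>\<phi>\<close> is chosen,
    since they determine where \<open>\<phi>\<close> has to be almost invariant.\<close>
  define J where "J i v = (SOME J. finite J \<and> (\<forall>x\<in>paths \<Lambda>. prng x = v \<longrightarrow> (\<forall>n. \<exists>\<omega>\<in>J. \<omega> \<in> init x \<and> deg \<Lambda> \<omega> = cut (E i) n x)))" for i v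
  have J: "finite (J i v)" "\<And>x n. x \<in> paths \<Lambda> \<Longrightarrow> prng x = v \<Longrightarrow> \<exists>\<omega>\<in>J i v. \<omega> \<in> init x \<and> deg \<Lambda> \<omega> = cut (E i) n x" for i v
    using someI_ex[OF finite_cut_levels[OF finE[of i], of v]] unfolding J_def[symmetric] by blast+
  define Kp where "Kp \<nu> = {\<kappa>. cpb \<nu> \<kappa> \<and> \<nu> \<cdot> \<kappa> \<in> (\<Union>i<M. J i (rng \<Lambda> \<nu>))}" for \<nu>
  have Kp: "finite (Kp \<nu>)" for \<nu>
  proof (rule finite_imageD)
    show "finite ((\<cdot>) \<nu> ` Kp \<nu>)" by (rule finite_subset[of _ "\<Union>i<M. J i (rng \<Lambda> \<nu>)"]) (use J(1) in \<open>auto simp: Kp_def\<close>)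
    show "inj_on ((\<cdot>) \<nu>) (Kp \<nu>)" using cmp_cancel by (auto simp: inj_on_def Kp_def)
  qed
  \<comment> \<open>\<open>S\<close> and \<open>Cs\<close> collect the group elements and the points
    at which \<open>theta_invariant\<close> will be applied.\<close>
  define S where "S = (\<Union>(\<mu>, h, \<nu>)\<in>R0. (\<lambda>\<kappa>. res h \<kappa>) ` Kp \<nu>)"
  define Cs where "Cs = (\<Union>(\<mu>, h, \<nu>)\<in>R0. (\<lambda>\<kappa>. {x \<in> boundary_paths \<Lambda>. src \<Lambda> \<kappa> \<in> init x}) ` Kp \<nu>)"
  have S: "finite S" "S \<subseteq> carrier G"
    unfolding S_def using R0 Kp res_closed by (auto simp: triple_def Kp_def)
  have C: "compactin (boundary_topology \<Lambda>) (\<Union>Cs)"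
  proof (rule compactin_Union)
    show "finite Cs" unfolding Cs_def using R0(2) Kp by auto
    show "compactin (boundary_topology \<Lambda>) X" if "X \<in> Cs" for X
      using that compactin_Z unfolding Cs_def by auto
  qed
  have e2: "\<epsilon> / 2 > 0" using e by simp
  obtain \<phi> where m: "boundary_mean \<phi>" and inv0:
    "\<forall>h\<in>S. \<forall>x\<in>\<Union>Cs. fsum_le (\<lambda>g. \<bar>\<phi> (g \<otimes>\<^bsub>G\<^esub> h) x - \<phi> g (pact h x)\<bar>) (carrier G) (\<epsilon> / 2)"
    using amenable_boundary_obtain[OF am S C e2] by blast
  define Q where "Q = real M * real (N ^ ?k)"
  have Q: "Q > 0" unfolding Q_def using M0 N(1) by simp
  define f where "f a = (1 / Q) * (\<Sum>i<M. \<Sum>n\<in>cube N. theta \<phi> (cut (E i) n (gsrc EP a)) a)" for a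
  have dens: "fibre_density EP f"
  proof (intro conjI ballI)
    show "continuous_map (arrow_top EP) euclideanreal f"
      unfolding f_def EP_simps
      by (intro continuous_map_real_mult_left continuous_map_sum theta_cut_continuous m finE finite_cube finite_lessThan)
  next
    fix a assume a: "a \<in> topspace (arrow_top EP)"
    have x: "gsrc EP a \<in> boundary_paths \<Lambda>" using EP_groupoid(1)[OF a] unfolding EP_simps by blast
    have af: "a \<in> source_fibre EP (gsrc EP a)" using a unfolding source_fibre_def by simp
    have "0 \<le> theta \<phi> (cut (E i) n (gsrc EP a)) a" for i n
      using cut_level[OF boundary_paths[OF x] finE[of i], of n] theta_nonneg[OF m x _ af] by metis
    then show "0 \<le> f a" unfolding f_def using Q by (intro mult_nonneg_nonneg sum_nonneg) auto
  next
    fix x assume "x \<in> unit_set EP"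
    then have x: "x \<in> boundary_paths \<Lambda>" unfolding EP_simps .
    have "(theta \<phi> (cut (E i) n x) has_sum 1) (source_fibre EP x)" for i n
      using cut_level[OF boundary_paths[OF x] finE[of i], of n] theta_has_sum[OF m x] by metis
    then have "((\<lambda>a. \<Sum>i<M. \<Sum>n\<in>cube N. theta \<phi> (cut (E i) n x) a) has_sum (\<Sum>i<M. \<Sum>n\<in>(cube N :: ('k \<Rightarrow> nat) set). 1)) (source_fibre EP x)"
      by (intro has_sum_finite_sum finite_cube finite_lessThan)
    then have "((\<lambda>a. (1 / Q) * (\<Sum>i<M. \<Sum>n\<in>cube N. theta \<phi> (cut (E i) n x) a)) has_sum
        ((1 / Q) * (\<Sum>i<M. \<Sum>n\<in>(cube N :: ('k \<Rightarrow> nat) set). 1))) (source_fibre EP x)"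
      by (rule has_sum_cmult_right)
    moreover have "(1 / Q) * (\<Sum>i<M. \<Sum>n\<in>(cube N :: ('k \<Rightarrow> nat) set). 1) = 1"
      using M0 N(1) unfolding Q_def by (simp add: card_cube)
    ultimately have "((\<lambda>a. (1 / Q) * (\<Sum>i<M. \<Sum>n\<in>cube N. theta \<phi> (cut (E i) n x) a)) has_sum 1) (source_fibre EP x)" by (simp only:)
    then show "(f has_sum 1) (source_fibre EP x)"
      by (rule has_sum_cong[THEN iffD1, rotated]) (simp add: f_def source_fibre_def)
  qed
  moreover have "fsum_le (\<lambda>a. \<bar>f (gmult EP a h) - f a\<bar>) (source_fibre EP (grng EP h)) \<epsilon>" if hK: "h \<in> K" for h
  proof -
    obtain \<mu> g \<nu> where r: "(\<mu>, g, \<nu>) \<in> R0" "h \<in> ep_set \<mu> g \<nu>" using hK F(3) R0(3) by blast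
    then obtain z where z: "z \<in> bpaths (src \<Lambda> \<nu>)" and h: "h = ep \<mu> g \<nu> z" unfolding ep_set_def by blast
    have rR: "(\<mu>, g, \<nu>) \<in> R" "(\<nu>, inv\<^bsub>G\<^esub> g, \<mu>) \<in> R" using r(1) unfolding R_def by force+
    have t: "triple \<mu> g \<nu>" "triple \<nu> (inv\<^bsub>G\<^esub> g) \<mu>" using rR R(2) by blast+
    let ?x = "path_concat \<Lambda> \<nu> z" and ?y = "path_concat \<Lambda> \<mu> (pact g z)"
    note cp = concat_path_facts[OF t(1) z]
    have xy: "grng EP h = ?y" "gsrc EP h = ?x" unfolding h ep_grng ep_gsrc by simp_all
    have hT: "h \<in> topspace (arrow_top EP)" unfolding h EP_simps using ep_arrow[OF t(1) z] .
    note gd = EP_groupoid[OF hT, unfolded xy]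
    let ?d = "deg \<Lambda> \<nu>" and ?d' = "deg \<Lambda> \<mu>" and ?A = "source_fibre EP ?y"
    have bk: "path_concat \<Lambda> \<nu> (pact (inv\<^bsub>G\<^esub> g) (pact g z)) = ?x"
      using path_act_inv(2)[OF tripleD(2)[OF t(1)] bpathsD(1)[OF z]] by simp
    \<comment> \<open>Bounds \<open>deg \<nu> + m\<close> at the source and
      \<open>deg \<mu> + m\<close> at the range leave the same room \<open>m\<close> beyond the
      arrow; only then can the levels interlace.\<close>
    define P where "P m i = cut (E i) (?d + m) ?x" for m i
    define P' where "P' m i = cut (E i) (?d' + m) ?y" for m i
    have bad: "card {i. i < M \<and> P m i + ?d' \<noteq> P' m i + ?d} \<le> 2 * (\<Sum>c\<in>UNIV. m c)" for m
    proof (rule interlaced_card)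
      fix i
      show "P m i \<le> P m (Suc i)" "P' m i \<le> P' m (Suc i)"
        unfolding P_def P'_def using cut_mono[OF finE Emono] by blast+
      show "P m i \<le> ?d + m" "P' m i \<le> ?d' + m" unfolding P_def P'_def using cut_le[OF finE] by blast+
      have "?d \<le> ?d + m" "?d' \<le> ?d' + m" by (simp_all add: le_fun_def)
      then show "?d \<le> P m i" "?d' \<le> P' m i"
        unfolding P_def P'_def using cut_upper[OF finE Evert(2)[OF rR(1)] cp(3)] cut_upper[OF finE Evert(1)[OF rR(1)] cp(4)] by blast+
      show "P m i + ?d' \<le> P' m (Suc i) + ?d" unfolding P_def P'_def
        by (rule cut_step[OF t(1) z finE finE Estep[OF rR(1)] Evert(1)[OF rR(1)]])
      show "P' m i + ?d \<le> P m (Suc i) + ?d'" unfolding P_def P'_def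
        using cut_step[OF t(2) cp(6) finE[of i] finE[of "Suc i"] Estep[OF rR(2)] Evert(1)[OF rR(2)], where m = m] unfolding bk .
    qed
    let ?C = "cube (N - D) :: ('k \<Rightarrow> nat) set" and ?I = "cube N :: ('k \<Rightarrow> nat) set"
    have dD: "?d c \<le> D" "?d' c \<le> D" for c using D Evert[OF rR(1), of 0] by (auto simp: E_def)
    note sh = cube_shift[of ?d, OF dD(1) N(2)] and sh' = cube_shift[of ?d', OF dD(2) N(2)]
    define a1 where "a1 i n a = theta \<phi> (cut (E i) n ?x) (gmult EP a h)" for i n a
    define a2 where "a2 i n a = theta \<phi> (cut (E i) n ?y) a" for i n a
    have nn: "0 \<le> a1 i n a" "0 \<le> a2 i n a" if a: "a \<in> ?A" for i n a
    proof -
      obtain \<omega> where o: "\<omega> \<in> init ?x" "deg \<Lambda> \<omega> = cut (E i) n ?x" using cut_level[OF boundary_paths[OF cp(1)] finE] .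
      obtain \<omega>' where o': "\<omega>' \<in> init ?y" "deg \<Lambda> \<omega>' = cut (E i) n ?y" using cut_level[OF boundary_paths[OF cp(2)] finE] .
      show "0 \<le> a1 i n a" unfolding a1_def o(2)[symmetric] by (rule theta_nonneg[OF m cp(1) o(1) gd(2)[OF a]])
      show "0 \<le> a2 i n a" unfolding a2_def o'(2)[symmetric] by (rule theta_nonneg[OF m cp(2) o'(1) a])
    qed
    have one: "fsum_le (a1 i n) ?A 1" "fsum_le (a2 i n) ?A 1" for i n
    proof -
      obtain \<omega> where o: "\<omega> \<in> init ?x" "deg \<Lambda> \<omega> = cut (E i) n ?x" using cut_level[OF boundary_paths[OF cp(1)] finE] .
      obtain \<omega>' where o': "\<omega>' \<in> init ?y" "deg \<Lambda> \<omega>' = cut (E i) n ?y" using cut_level[OF boundary_paths[OF cp(2)] finE] .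
      have "fsum_le (theta \<phi> (cut (E i) n ?x)) (source_fibre EP ?x) 1"
        unfolding o(2)[symmetric] by (rule fsum_le_has_sum[OF theta_has_sum[OF m cp(1) o(1)]]) (rule theta_nonneg[OF m cp(1) o(1)])
      then show "fsum_le (a1 i n) ?A 1" unfolding a1_def
        by (rule fsum_le_reindex[OF _ gd(3)]) (use gd(2) in blast)
      show "fsum_le (a2 i n) ?A 1" unfolding a2_def
        unfolding o'(2)[symmetric] by (rule fsum_le_has_sum[OF theta_has_sum[OF m cp(2) o'(1)]]) (rule theta_nonneg[OF m cp(2) o'(1)])
    qed
    let ?good = "\<lambda>m i. P m i + ?d' = P' m i + ?d"
    have diff: "fsum_le (\<lambda>a. \<bar>a1 i (?d + m) a - a2 i (?d' + m) a\<bar>) ?A (\<epsilon> / 2 + (if ?good m i then 0 else 2))"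
      if i: "i < M" for i m
    proof (cases "?good m i")
      \<comment> \<open>Equal heights above \<open>\<nu>\<close> and \<open>\<mu>\<close> mean that
        both levels cut off one and the same \<open>\<kappa>\<close>.\<close>
      case True
      have "?d \<le> ?d + m" by (simp add: le_fun_def)
      then have dP: "?d \<le> P m i"
        unfolding P_def using cut_upper[OF finE Evert(2)[OF rR(1)] cp(3)] by blast
      obtain \<omega> where o: "\<omega> \<in> J i (rng \<Lambda> \<nu>)" "\<omega> \<in> init ?x" "deg \<Lambda> \<omega> = P m i"
        unfolding P_def using J(2)[OF boundary_paths[OF cp(1)] cp(5)] by blast
      have "pre \<nu> \<omega>" using init_linear[OF boundary_paths[OF cp(1)] cp(3) o(2)] dP o(3) by simp
      then obtain \<kappa> where k: "cpb \<nu> \<kappa>" "\<omega> = \<nu> \<cdot> \<kappa>" unfolding pre_def by blast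
      have kz: "\<kappa> \<in> init z" using concat_init_cmp[OF bpathsD(1)[OF z] k(1) bpathsD(3)[OF z, symmetric]] o(2) k(2) by simp
      have kK: "\<kappa> \<in> Kp \<nu>" unfolding Kp_def using k o(1) i by blast
      have dk: "P m i = ?d + deg \<Lambda> \<kappa>" using o(3) k deg_cmp by simp
      have dk': "P' m i = ?d' + deg \<Lambda> \<kappa>"
      proof
        fix c show "P' m i c = (?d' + deg \<Lambda> \<kappa>) c" using fun_cong[OF True, of c] fun_cong[OF dk, of c] by simp
      qed
      have "res g \<kappa> \<in> S" unfolding S_def using r(1) kK by blast
      moreover have "tail \<kappa> z \<in> \<Union>Cs"
      proof -
        have tb: "tail \<kappa> z \<in> bpaths (src \<Lambda> \<kappa>)" using bpaths_tail[OF bpathsD(2)[OF z] kz] .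
        have "src \<Lambda> \<kappa> \<in> init (tail \<kappa> z)" using prng_init[OF bpathsD(1)[OF tb]] bpathsD(3)[OF tb] by simp
        then have "tail \<kappa> z \<in> {x \<in> boundary_paths \<Lambda>. src \<Lambda> \<kappa> \<in> init x}" using bpathsD(2)[OF tb] by blast
        moreover have "{x \<in> boundary_paths \<Lambda>. src \<Lambda> \<kappa> \<in> init x} \<in> Cs" unfolding Cs_def using r(1) kK by blast
        ultimately show ?thesis by blast
      qed
      ultimately have "fsum_le (\<lambda>g'. \<bar>\<phi> (g' \<otimes>\<^bsub>G\<^esub> res g \<kappa>) (tail \<kappa> z) - \<phi> g' (pact (res g \<kappa>) (tail \<kappa> z))\<bar>) (carrier G) (\<epsilon> / 2)"
        using inv0 by blast
      from theta_invariant[OF t(1) z kz this] show ?thesis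
        using True unfolding a1_def a2_def P_def[symmetric] P'_def[symmetric] dk dk' h by simp
    next
      case False
      have "fsum_le (\<lambda>a. \<bar>a1 i (?d + m) a - a2 i (?d' + m) a\<bar>) ?A (1 + 1)"
        by (rule fsum_le_abs_diff[OF one]) (use nn in auto)
      then show ?thesis by (rule fsum_le_weaken) (use False e in simp)
    qed
    let ?rest = "N ^ ?k - (N - D) ^ ?k"
    \<comment> \<open>The shifted cubes are matched term by term; the two last sums are the boundary
      layers, where each weight has mass at most 1.\<close>
    let ?G = "\<lambda>i a. (\<Sum>m\<in>?C. \<bar>a1 i (?d + m) a - a2 i (?d' + m) a\<bar>)
        + (\<Sum>n\<in>?I - (+) ?d ` ?C. a1 i n a) + (\<Sum>n\<in>?I - (+) ?d' ` ?C. a2 i n a)"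
    have "fsum_le (?G i) ?A ((\<Sum>m\<in>?C. \<epsilon> / 2 + (if ?good m i then 0 else 2)) + (\<Sum>n\<in>?I - (+) ?d ` ?C. 1) + (\<Sum>n\<in>?I - (+) ?d' ` ?C. 1))"
      if "i < M" for i
      by (intro fsum_le_add fsum_le_sum diff that one)
    then have "fsum_le (\<lambda>a. \<Sum>i<M. ?G i a) ?A (\<Sum>i<M. (\<Sum>m\<in>?C. \<epsilon> / 2 + (if ?good m i then 0 else 2))
        + (\<Sum>n\<in>?I - (+) ?d ` ?C. 1) + (\<Sum>n\<in>?I - (+) ?d' ` ?C. 1))"
      by (intro fsum_le_sum) simp
    then have "fsum_le (\<lambda>a. (1 / Q) * (\<Sum>i<M. ?G i a)) ?A ((1 / Q) * (\<Sum>i<M. (\<Sum>m\<in>?C. \<epsilon> / 2 + (if ?good m i then 0 else 2))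
        + (\<Sum>n\<in>?I - (+) ?d ` ?C. 1) + (\<Sum>n\<in>?I - (+) ?d' ` ?C. 1)))"
      by (rule fsum_le_cmult) (use Q in simp)
    then show ?thesis
      unfolding xy
    proof (rule fsum_le_mono)
      fix a assume a: "a \<in> ?A"
      have s: "gsrc EP a = ?y" "gsrc EP (gmult EP a h) = ?x" using a gd(2)[OF a] unfolding source_fibre_def by auto
      have "f (gmult EP a h) - f a = (1 / Q) * (\<Sum>i<M. sum (\<lambda>n. a1 i n a) ?I - sum (\<lambda>n. a2 i n a) ?I)"
        unfolding f_def s a1_def a2_def by (simp add: sum_subtractf diff_divide_distrib)
      then have "\<bar>f (gmult EP a h) - f a\<bar> = (1 / Q) * \<bar>\<Sum>i<M. sum (\<lambda>n. a1 i n a) ?I - sum (\<lambda>n. a2 i n a) ?I\<bar>"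
        using Q by (simp add: abs_mult)
      also have "\<dots> \<le> (1 / Q) * (\<Sum>i<M. ?G i a)"
      proof (rule mult_left_mono)
        have "\<bar>\<Sum>i<M. sum (\<lambda>n. a1 i n a) ?I - sum (\<lambda>n. a2 i n a) ?I\<bar> \<le> (\<Sum>i<M. \<bar>sum (\<lambda>n. a1 i n a) ?I - sum (\<lambda>n. a2 i n a) ?I\<bar>)"
          by (rule sum_abs)
        also have "\<dots> \<le> (\<Sum>i<M. ?G i a)"
          by (intro sum_mono abs_diff_sum_le finite_cube nn a sh(1,2) sh'(1,2))
        finally show "\<bar>\<Sum>i<M. sum (\<lambda>n. a1 i n a) ?I - sum (\<lambda>n. a2 i n a) ?I\<bar> \<le> (\<Sum>i<M. ?G i a)" .
      qed (use Q in simp)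
      finally show "\<bar>f (gmult EP a h) - f a\<bar> \<le> (1 / Q) * (\<Sum>i<M. ?G i a)" .
    next
      have bound: "(\<Sum>i<M. if ?good m i then 0 else 2 :: real) \<le> 4 * real ?k * real N" if mC: "m \<in> ?C" for m
      proof -
        have "(\<Sum>i<M. if ?good m i then 0 else 2 :: real) = (\<Sum>i\<in>{i. i < M \<and> \<not> ?good m i}. 2)"
          by (rule sum.mono_neutral_cong_right) auto
        also have "\<dots> = 2 * real (card {i. i < M \<and> \<not> ?good m i})" by simp
        also have "\<dots> \<le> 2 * real (2 * (?k * N))"
        proof (rule mult_left_mono, rule of_nat_mono)
          have "(\<Sum>c\<in>UNIV. m c) \<le> (\<Sum>c\<in>(UNIV :: 'k set). N)"
          proof (rule sum_mono)
            fix c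
            have "m c < N - D" using mC by (simp add: cube_def)
            then show "m c \<le> N" by linarith
          qed
          then have "2 * (\<Sum>c\<in>UNIV. m c) \<le> 2 * (?k * N)" by simp
          then show "card {i. i < M \<and> \<not> ?good m i} \<le> 2 * (?k * N)" by (rule order_trans[OF bad])
        qed simp
        finally show ?thesis by simp
      qed
      have "(\<Sum>i<M. (\<Sum>m\<in>?C. \<epsilon> / 2 + (if ?good m i then 0 else 2)) + (\<Sum>n\<in>?I - (+) ?d ` ?C. 1) + (\<Sum>n\<in>?I - (+) ?d' ` ?C. 1))
        = (\<Sum>m\<in>?C. \<Sum>i<M. \<epsilon> / 2 + (if ?good m i then 0 else 2)) + 2 * real M * real ?rest"
        unfolding sum.distrib sum.swap[of _ ?C] by (simp add: sh(3) sh'(3))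
      also have "\<dots> \<le> (\<Sum>m\<in>?C. real M * (\<epsilon> / 2) + 4 * real ?k * real N) + 2 * real M * (\<epsilon> / 8 * real (N ^ ?k))"
      proof (rule add_mono)
        show "(\<Sum>m\<in>?C. \<Sum>i<M. \<epsilon> / 2 + (if ?good m i then 0 else 2)) \<le> (\<Sum>m\<in>?C. real M * (\<epsilon> / 2) + 4 * real ?k * real N)"
          by (rule sum_mono) (use bound in \<open>simp add: sum.distrib\<close>)
        show "2 * real M * real ?rest \<le> 2 * real M * (\<epsilon> / 8 * real (N ^ ?k))" by (rule mult_left_mono[OF N(3)]) simp
      qed
      also have "\<dots> \<le> real (N ^ ?k) * (real M * (\<epsilon> / 2) + real M * (\<epsilon> / 4)) + 2 * real M * (\<epsilon> / 8 * real (N ^ ?k))"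
      proof (rule add_right_mono)
        have "(\<Sum>m\<in>?C. real M * (\<epsilon> / 2) + 4 * real ?k * real N) = real (card ?C) * (real M * (\<epsilon> / 2) + 4 * real ?k * real N)"
          by (rule sum_constant)
        also have "\<dots> \<le> real (N ^ ?k) * (real M * (\<epsilon> / 2) + 4 * real ?k * real N)"
        proof (rule mult_right_mono)
          have "(N - D) ^ ?k \<le> N ^ ?k" by (rule power_mono) auto
          then show "real (card ?C) \<le> real (N ^ ?k)" unfolding card_cube by (rule of_nat_mono)
        qed (use e in simp)
        also have "\<dots> \<le> real (N ^ ?k) * (real M * (\<epsilon> / 2) + real M * (\<epsilon> / 4))"
        proof (intro mult_left_mono add_mono)
          show "4 * real ?k * real N \<le> real M * (\<epsilon> / 4)" using M e by (simp add: field_simps)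
        qed simp_all
        finally show "(\<Sum>m\<in>?C. real M * (\<epsilon> / 2) + 4 * real ?k * real N) \<le> real (N ^ ?k) * (real M * (\<epsilon> / 2) + real M * (\<epsilon> / 4))" .
      qed
      finally have tot: "(\<Sum>i<M. (\<Sum>m\<in>?C. \<epsilon> / 2 + (if ?good m i then 0 else 2)) + (\<Sum>n\<in>?I - (+) ?d ` ?C. 1) + (\<Sum>n\<in>?I - (+) ?d' ` ?C. 1))
        \<le> real (N ^ ?k) * (real M * (\<epsilon> / 2) + real M * (\<epsilon> / 4)) + 2 * real M * (\<epsilon> / 8 * real (N ^ ?k))" .
      have QE: "\<dots> = Q * \<epsilon>" unfolding Q_def by (simp add: algebra_simps)
      have tot': "(\<Sum>i<M. (\<Sum>m\<in>?C. \<epsilon> / 2 + (if ?good m i then 0 else 2)) + (\<Sum>n\<in>?I - (+) ?d ` ?C. 1) + (\<Sum>n\<in>?I - (+) ?d' ` ?C. 1))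
        \<le> Q * \<epsilon>" using tot unfolding QE .
      have "(1 / Q) * (\<Sum>i<M. (\<Sum>m\<in>?C. \<epsilon> / 2 + (if ?good m i then 0 else 2)) + (\<Sum>n\<in>?I - (+) ?d ` ?C. 1) + (\<Sum>n\<in>?I - (+) ?d' ` ?C. 1))
         \<le> (1 / Q) * (Q * \<epsilon>)" by (rule mult_left_mono[OF tot']) (use Q in simp)
      then show "(1 / Q) * (\<Sum>i<M. (\<Sum>m\<in>?C. \<epsilon> / 2 + (if ?good m i then 0 else 2)) + (\<Sum>n\<in>?I - (+) ?d ` ?C. 1) + (\<Sum>n\<in>?I - (+) ?d' ` ?C. 1)) \<le> \<epsilon>"
        using Q by simp
    qed
  qed
  ultimately show "\<exists>f. fibre_density EP f \<and>
       (\<forall>h\<in>K. fsum_le (\<lambda>a. \<bar>f (gmult EP a h) - f a\<bar>) (source_fibre EP (grng EP h)) \<epsilon>)" by blast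
qed

section \<open>From the groupoid to the action\<close>

lemma tail_prng_self:
  assumes x: "x \<in> paths \<Lambda>" shows "tail (prng x) x = x"
proof (rule paths_eqI[OF tail_paths[OF x prng_init[OF x]] x])
  have v: "prng x \<in> vertices \<Lambda>" using rng_vertex[OF init_Mor[OF x prng_init[OF x]]] init_rng[OF x prng_init[OF x]] by simp
  have "cpb (prng x) \<kappa> \<and> prng x \<cdot> \<kappa> \<in> init x \<longleftrightarrow> \<kappa> \<in> init x" for \<kappa>
    using vertexD[OF v] init_Mor[OF x, of \<kappa>] init_rng[OF x, of \<kappa>] rng_cmp_id[of \<kappa>] by metis
  then show "init (tail (prng x) x) = init x" using tail_init[OF x prng_init[OF x]] by blast
qed

lemma concat_prng: "x \<in> paths \<Lambda> \<Longrightarrow> path_concat \<Lambda> (prng x) x = x"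
  using concat_tail[OF _ prng_init, of x] tail_prng_self by simp

text \<open>The copy of the transformation groupoid inside the Exel--Pardo groupoid: both morphisms
  are vertices.\<close>

definition iota :: "'g \<Rightarrow> ('a, 'k) path \<Rightarrow> ('g, 'a, 'k) ep_arrow" where
  "iota h x = ep (act h (prng x)) h (prng x) x"

lemma iota_triple:
  assumes "h \<in> carrier G" "x \<in> boundary_paths \<Lambda>"
  shows "triple (act h (prng x)) h (prng x)" "x \<in> bpaths (src \<Lambda> (prng x))" "prng x \<in> vertices \<Lambda>"
proof -
  note xp = boundary_paths[OF assms(2)]
  show v: "prng x \<in> vertices \<Lambda>" using rng_vertex[OF init_Mor[OF xp prng_init[OF xp]]] init_rng[OF xp prng_init[OF xp]] by simp
  show "triple (act h (prng x)) h (prng x)"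
    unfolding triple_def using vertexD[OF v] vertexD[OF act_vertex[OF assms(1) v]] assms(1) by simp
  show "x \<in> bpaths (src \<Lambda> (prng x))" unfolding bpaths_def vertexD(3)[OF v] using assms(2) by blast
qed

lemma iota_arrow:
  assumes h: "h \<in> carrier G" and x: "x \<in> boundary_paths \<Lambda>"
  shows "iota h x \<in> topspace ET" "grng EP (iota h x) = pact h x" "gsrc EP (iota h x) = x"
proof -
  note t = iota_triple[OF h x] and xp = boundary_paths[OF x]
  show "iota h x \<in> topspace ET" unfolding iota_def by (rule ep_arrow[OF t(1,2)])
  show "grng EP (iota h x) = pact h x"
    unfolding iota_def ep_grng prng_path_act[OF h xp, symmetric] by (rule concat_prng[OF path_act_paths[OF h xp]])
  show "gsrc EP (iota h x) = x" unfolding iota_def ep_gsrc by (rule concat_prng[OF xp])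
qed

text \<open>An arrow presented at \<open>\<nu>\<close> is multiplied with a group arrow by pulling
  \<open>\<nu>\<close> back along \<open>h\<close>; the range morphism stays and the degree
  component is unchanged.\<close>

lemma iota_mult:
  assumes h: "h \<in> carrier G" and x: "x \<in> boundary_paths \<Lambda>" and t: "triple \<mu> g \<nu>" and n: "\<nu> \<in> init (pact h x)"
    and n': "\<nu>' = act (inv\<^bsub>G\<^esub> h) \<nu>"
  shows "\<nu>' \<in> init x" "act h \<nu>' = \<nu>" "triple \<mu> (g \<otimes>\<^bsub>G\<^esub> res h \<nu>') \<nu>'"
    "gmult EP (ep \<mu> g \<nu> (tail \<nu> (pact h x))) (iota h x) = ep \<mu> (g \<otimes>\<^bsub>G\<^esub> res h \<nu>') \<nu>' (tail \<nu>' x)"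
proof -
  note i = iota_triple[OF h x] and xp = boundary_paths[OF x] and nM = tripleD(3)[OF t]
  let ?v = "prng x"
  show ni: "\<nu>' \<in> init x" using path_act_init_iff[OF h xp nM] n unfolding n' by blast
  show hn: "act h \<nu>' = \<nu>" unfolding n' using act_act_inv[OF h nM] .
  have v: "?v \<cdot> \<nu>' = \<nu>'" using rng_cmp_id[OF init_Mor[OF xp ni]] init_rng[OF xp ni] by simp
  have hv: "act h ?v \<cdot> act h \<nu>' = \<nu>"
    unfolding hn using rng_cmp_id[OF nM] init_rng[OF path_act_paths[OF h xp] n] prng_path_act[OF h xp] by simp
  have w: "path_concat \<Lambda> (act h ?v) (pact h x) = pact h x" using iota_arrow(2)[OF h x] unfolding iota_def ep_grng .
  have t': "triple \<mu> g (act h ?v \<cdot> act h \<nu>')" unfolding hv by (rule t)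
  note m = ep_mult_level[OF i(1,2) ni t', unfolded hv v w]
  show "triple \<mu> (g \<otimes>\<^bsub>G\<^esub> res h \<nu>') \<nu>'" by (rule m(2))
  show "gmult EP (ep \<mu> g \<nu> (tail \<nu> (pact h x))) (iota h x) = ep \<mu> (g \<otimes>\<^bsub>G\<^esub> res h \<nu>') \<nu>' (tail \<nu>' x)"
    unfolding iota_def by (rule m(1))
qed

lemma fibre_section:
  assumes w: "w \<in> boundary_paths \<Lambda>" and a: "a \<in> source_fibre EP w"
  obtains \<mu> g \<nu> where "triple \<mu> g \<nu>" "\<nu> \<in> init w" "a = ep \<mu> g \<nu> (tail \<nu> w)"
proof (rule fibre_rep[OF w a])
  fix \<nu> assume n: "\<nu> \<in> init w" "\<And>\<omega>. \<omega> \<in> init w \<Longrightarrow> pre \<nu> \<omega> \<Longrightarrow> \<exists>\<alpha> g. triple \<alpha> g \<omega> \<and> a = ep \<alpha> g \<omega> (tail \<omega> w)"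
  have "\<exists>\<alpha> g. triple \<alpha> g \<nu> \<and> a = ep \<alpha> g \<nu> (tail \<nu> w)"
    using n(2)[OF n(1) pre_refl[OF init_Mor[OF boundary_paths[OF w] n(1)]]] .
  then show ?thesis using that n(1) by blast
qed

lemma section_in_fibre:
  assumes w: "w \<in> boundary_paths \<Lambda>" and t: "triple \<mu> g \<nu>" and n: "\<nu> \<in> init w"
  shows "ep \<mu> g \<nu> (tail \<nu> w) \<in> source_fibre EP w" "tail \<nu> w \<in> bpaths (src \<Lambda> \<nu>)"
proof -
  show b: "tail \<nu> w \<in> bpaths (src \<Lambda> \<nu>)" by (rule bpaths_tail[OF w n])
  show "ep \<mu> g \<nu> (tail \<nu> w) \<in> source_fibre EP w"
    using ep_in_fibre[OF t b] concat_tail[OF boundary_paths[OF w] n] by simp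
qed

lemma ep_set_fibre:
  assumes t: "triple \<mu> g \<nu>" and a: "a \<in> source_fibre EP w"
  shows "a \<in> ep_set \<mu> g \<nu> \<longleftrightarrow> w \<in> boundary_paths \<Lambda> \<and> \<nu> \<in> init w \<and> a = ep \<mu> g \<nu> (tail \<nu> w)"
proof
  assume "a \<in> ep_set \<mu> g \<nu>"
  then obtain y where y: "y \<in> bpaths (src \<Lambda> \<nu>)" "a = ep \<mu> g \<nu> y" unfolding ep_set_def by blast
  have "w = path_concat \<Lambda> \<nu> y" using a ep_gsrc y(2) unfolding source_fibre_def by simp
  then show "w \<in> boundary_paths \<Lambda> \<and> \<nu> \<in> init w \<and> a = ep \<mu> g \<nu> (tail \<nu> w)"
    using concat[OF bpathsD(1)[OF y(1)] tripleD(3)[OF t] bpathsD(3)[OF y(1), symmetric]]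
      bpathsD(2)[OF bpaths_concat[OF tripleD(3)[OF t] y(1)]] y(2) by simp
qed (use bpaths_tail in \<open>auto simp: ep_set_def\<close>)

lemma iota_cancel:
  assumes h: "h \<in> carrier G" and x: "x \<in> boundary_paths \<Lambda>" and a: "a \<in> source_fibre EP (pact h x)"
  shows "gmult EP a (iota h x) \<in> source_fibre EP x"
    "gmult EP (gmult EP a (iota h x)) (iota (inv\<^bsub>G\<^esub> h) (pact h x)) = a"
proof -
  note hx = boundary_act[OF h x] and xp = boundary_paths[OF x]
  have hi: "inv\<^bsub>G\<^esub> h \<in> carrier G" using h by simp
  obtain \<mu> g \<nu> where t: "triple \<mu> g \<nu>" and n: "\<nu> \<in> init (pact h x)" and e: "a = ep \<mu> g \<nu> (tail \<nu> (pact h x))"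
    using fibre_section[OF hx a] .
  define \<nu>' where "\<nu>' = act (inv\<^bsub>G\<^esub> h) \<nu>"
  note m = iota_mult[OF h x t n \<nu>'_def]
  show "gmult EP a (iota h x) \<in> source_fibre EP x" unfolding e m(4) by (rule section_in_fibre(1)[OF x m(3,1)])
  have nM: "\<nu>' \<in> Mor \<Lambda>" using init_Mor[OF xp m(1)] .
  have r: "res h \<nu>' \<in> carrier G" "g \<in> carrier G" using res_closed[OF h nM] tripleD(2)[OF t] by auto
  have xx: "pact (inv\<^bsub>G\<^esub> h) (pact h x) = x" by (rule path_act_inv(2)[OF h xp])
  have nn: "\<nu> = act (inv\<^bsub>G\<^esub> (inv\<^bsub>G\<^esub> h)) \<nu>'" using m(2) h by simp
  have ni: "\<nu>' \<in> init (pact (inv\<^bsub>G\<^esub> h) (pact h x))" unfolding xx by (rule m(1))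
  note m' = iota_mult[OF hi hx m(3) ni nn]
  have "res (inv\<^bsub>G\<^esub> h) \<nu> = inv\<^bsub>G\<^esub> (res h \<nu>')" using res_inv[OF h nM] m(2) by simp
  then have "g \<otimes>\<^bsub>G\<^esub> res h \<nu>' \<otimes>\<^bsub>G\<^esub> res (inv\<^bsub>G\<^esub> h) \<nu> = g" using r by (simp add: gr.m_assoc)
  then show "gmult EP (gmult EP a (iota h x)) (iota (inv\<^bsub>G\<^esub> h) (pact h x)) = a"
    using m(4) m'(4) unfolding xx e by simp
qed

lemma iota_bij:
  assumes h: "h \<in> carrier G" and x: "x \<in> boundary_paths \<Lambda>"
  shows "bij_betw (\<lambda>a. gmult EP a (iota h x)) (source_fibre EP (pact h x)) (source_fibre EP x)"
proof (rule bij_betw_byWitness[where f' = "\<lambda>a. gmult EP a (iota (inv\<^bsub>G\<^esub> h) (pact h x))"])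
  have hi: "inv\<^bsub>G\<^esub> h \<in> carrier G" "inv\<^bsub>G\<^esub> (inv\<^bsub>G\<^esub> h) = h" using h by simp_all
  have xx: "pact (inv\<^bsub>G\<^esub> h) (pact h x) = x" by (rule path_act_inv(2)[OF h boundary_paths[OF x]])
  note c = iota_cancel[OF h x] and c' = iota_cancel[OF hi(1) boundary_act[OF h x], unfolded xx hi(2)]
  show "\<forall>a\<in>source_fibre EP (pact h x). gmult EP (gmult EP a (iota h x)) (iota (inv\<^bsub>G\<^esub> h) (pact h x)) = a"
    using c(2) by blast
  show "\<forall>a\<in>source_fibre EP x. gmult EP (gmult EP a (iota (inv\<^bsub>G\<^esub> h) (pact h x))) (iota h x) = a"
    using c'(2) by blast
  show "(\<lambda>a. gmult EP a (iota h x)) ` source_fibre EP (pact h x) \<subseteq> source_fibre EP x" using c(1) by blast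
  show "(\<lambda>a. gmult EP a (iota (inv\<^bsub>G\<^esub> h) (pact h x))) ` source_fibre EP x \<subseteq> source_fibre EP (pact h x)" using c'(1) by blast
qed

lemma iota_compact:
  assumes h: "h \<in> carrier G" and C: "compactin (boundary_topology \<Lambda>) C"
  shows "compactin ET (iota h ` C)"
proof (rule image_compactin[OF C])
  show "continuous_map (boundary_topology \<Lambda>) ET (iota h)"
    unfolding continuous_map_def topspace_boundary
  proof (intro conjI allI impI)
    show "iota h \<in> boundary_paths \<Lambda> \<rightarrow> topspace ET" using iota_arrow(1)[OF h] by blast
    fix U assume U: "openin ET U"
    show "openin (boundary_topology \<Lambda>) {x \<in> boundary_paths \<Lambda>. iota h x \<in> U}"
      unfolding openin_boundary_iff
    proof (intro conjI ballI)
      fix x assume "x \<in> {x \<in> boundary_paths \<Lambda>. iota h x \<in> U}"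
      then have x: "x \<in> boundary_paths \<Lambda>" and xU: "ep (act h (prng x)) h (prng x) x \<in> U" unfolding iota_def by auto
      note t = iota_triple[OF h x]
      obtain L where L: "finite L" "\<forall>y\<in>bpaths (src \<Lambda> (prng x)). init y \<inter> L = init x \<inter> L \<longrightarrow> ep (act h (prng x)) h (prng x) y \<in> U"
        using U[unfolded openin_ep_iff, THEN conjunct2, rule_format, OF t(1,2) xU] by blast
      have "y \<in> {x \<in> boundary_paths \<Lambda>. iota h x \<in> U}"
        if y: "y \<in> boundary_paths \<Lambda>" and eq: "init y \<inter> insert (prng x) L = init x \<inter> insert (prng x) L" for y
      proof -
        have "prng x \<in> init y" using eq prng_init[OF boundary_paths[OF x]] by blast
        then have p: "prng y = prng x" using init_rng[OF boundary_paths[OF y]] vertexD(2)[OF t(3)] by metis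
        then have "y \<in> bpaths (src \<Lambda> (prng x))" using y vertexD(3)[OF t(3)] unfolding bpaths_def by simp
        moreover have "init y \<inter> L = init x \<inter> L" using eq by blast
        ultimately have "ep (act h (prng x)) h (prng x) y \<in> U" using L(2) by blast
        then have "iota h y \<in> U" unfolding iota_def p .
        then show ?thesis using y by blast
      qed
      then show "\<exists>L. finite L \<and> (\<forall>y\<in>boundary_paths \<Lambda>. init y \<inter> L = init x \<inter> L \<longrightarrow> y \<in> {x \<in> boundary_paths \<Lambda>. iota h x \<in> U})"
        using L(1) by (intro exI[of _ "insert (prng x) L"]) blast
    qed blast
  qed
qed

text \<open>A presentation of an arrow over \<open>x\<close> extends to a continuous local section
  over the source paths through \<open>\<nu>\<close>. Along such sections the arrows of a fibre move
  to neighbouring fibres.\<close>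

lemma section_open:
  assumes V: "openin ET V" and t: "triple \<mu> g \<nu>" and x: "x \<in> boundary_paths \<Lambda>" and n: "\<nu> \<in> init x"
    and xV: "ep \<mu> g \<nu> (tail \<nu> x) \<in> V"
  shows "\<exists>L. finite L \<and> (\<forall>y\<in>boundary_paths \<Lambda>. init y \<inter> L = init x \<inter> L \<longrightarrow> \<nu> \<in> init y \<and> ep \<mu> g \<nu> (tail \<nu> y) \<in> V)"
proof -
  have tx: "tail \<nu> x \<in> bpaths (src \<Lambda> \<nu>)" using bpaths_tail[OF x n] .
  obtain L where L: "finite L" "\<forall>z\<in>bpaths (src \<Lambda> \<nu>). init z \<inter> L = init (tail \<nu> x) \<inter> L \<longrightarrow> ep \<mu> g \<nu> z \<in> V"
    using V[unfolded openin_ep_iff, THEN conjunct2, rule_format, OF t tx xV] by blast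
  define L' where "L' = insert \<nu> ((\<cdot>) \<nu> ` L)"
  have "\<nu> \<in> init y \<and> ep \<mu> g \<nu> (tail \<nu> y) \<in> V" if y: "y \<in> boundary_paths \<Lambda>" and eq: "init y \<inter> L' = init x \<inter> L'" for y
  proof -
    have ny: "\<nu> \<in> init y" using eq n unfolding L'_def by blast
    have "\<kappa> \<in> init (tail \<nu> y) \<longleftrightarrow> \<kappa> \<in> init (tail \<nu> x)" if "\<kappa> \<in> L" for \<kappa>
      unfolding tail_init[OF boundary_paths[OF y] ny] tail_init[OF boundary_paths[OF x] n]
      using eq that unfolding L'_def by blast
    then have "init (tail \<nu> y) \<inter> L = init (tail \<nu> x) \<inter> L" by blast
    then show ?thesis using L(2) bpaths_tail[OF y ny] ny by blast
  qed
  moreover have "finite L'" unfolding L'_def using L(1) by simp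
  ultimately show ?thesis by blast
qed

text \<open>By \<open>ep_set_iff\<close> only segments in the finite set
  \<open>ext \<nu> \<nu>'\<close> can witness membership, so its failure is locally constant
  too.\<close>

lemma closedin_ep_set:
  assumes t': "triple \<mu>' g' \<nu>'" shows "closedin ET (ep_set \<mu>' g' \<nu>')"
  unfolding closedin_def
proof
  show "ep_set \<mu>' g' \<nu>' \<subseteq> topspace ET" using openin_subset[OF openin_ep_set[OF t']] .
  show "openin ET (topspace ET - ep_set \<mu>' g' \<nu>')"
    unfolding openin_ep_iff
  proof (intro conjI allI impI ballI)
    fix \<mu> g \<nu> x assume t: "triple \<mu> g \<nu>" and x: "x \<in> bpaths (src \<Lambda> \<nu>)" and e: "ep \<mu> g \<nu> x \<in> topspace ET - ep_set \<mu>' g' \<nu>'"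
    have "ep \<mu> g \<nu> y \<in> topspace ET - ep_set \<mu>' g' \<nu>'"
      if y: "y \<in> bpaths (src \<Lambda> \<nu>)" and eq: "init y \<inter> ext \<nu> \<nu>' = init x \<inter> ext \<nu> \<nu>'" for y
    proof
      show "ep \<mu> g \<nu> y \<in> topspace ET" by (rule ep_arrow[OF t y])
      show "ep \<mu> g \<nu> y \<notin> ep_set \<mu>' g' \<nu>'"
      proof
        assume "ep \<mu> g \<nu> y \<in> ep_set \<mu>' g' \<nu>'"
        then obtain \<kappa> \<kappa>' where k: "(\<kappa>, \<kappa>') \<in> ext_match \<mu> g \<nu> \<mu>' g' \<nu>'" "\<kappa> \<in> init y"
          unfolding ep_set_iff[OF t t' y] by blast
        then have "\<kappa> \<in> ext \<nu> \<nu>'" by (auto simp: ext_match_def ext_def)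
        then have "\<kappa> \<in> init x" using eq k(2) by blast
        then show False using e k(1) unfolding Diff_iff ep_set_iff[OF t t' x] by blast
      qed
    qed
    then show "\<exists>L. finite L \<and> (\<forall>y\<in>bpaths (src \<Lambda> \<nu>). init y \<inter> L = init x \<inter> L \<longrightarrow> ep \<mu> g \<nu> y \<in> topspace ET - ep_set \<mu>' g' \<nu>')"
      using finite_ext' by blast
  qed blast
qed

text \<open>The translate of the bisection of \<open>(\<mu>, k, \<nu>)\<close> by an element \<open>g\<close> of the transformation groupoid.\<close>

definition orb :: "'a \<times> 'g \<times> 'a \<Rightarrow> 'g \<Rightarrow> ('g, 'a, 'k) ep_arrow set" where
  "orb = (\<lambda>(\<mu>, k, \<nu>) g. ep_set \<mu> (k \<otimes>\<^bsub>G\<^esub> res g (act (inv\<^bsub>G\<^esub> g) \<nu>)) (act (inv\<^bsub>G\<^esub> g) \<nu>))"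

lemma orb_triple:
  assumes t: "triple \<mu> k \<nu>" and g: "g \<in> carrier G" and n: "\<nu>' = act (inv\<^bsub>G\<^esub> g) \<nu>"
  shows "triple \<mu> (k \<otimes>\<^bsub>G\<^esub> res g \<nu>') \<nu>'" "act g \<nu>' = \<nu>" "deg \<Lambda> \<nu>' = deg \<Lambda> \<nu>" "\<nu>' \<in> Mor \<Lambda>"
    "orb (\<mu>, k, \<nu>) g = ep_set \<mu> (k \<otimes>\<^bsub>G\<^esub> res g \<nu>') \<nu>'"
proof -
  note t' = tripleD[OF t]
  have gi: "inv\<^bsub>G\<^esub> g \<in> carrier G" using g by simp
  show nM: "\<nu>' \<in> Mor \<Lambda>" unfolding n by (rule act_closed[OF gi t'(3)])
  show gn: "act g \<nu>' = \<nu>" unfolding n by (rule act_act_inv[OF g t'(3)])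
  show "deg \<Lambda> \<nu>' = deg \<Lambda> \<nu>" unfolding n by (rule act_deg[OF gi t'(3)])
  have r: "res g \<nu>' \<in> carrier G" using res_closed[OF g nM] .
  have "act (res g \<nu>') (src \<Lambda> \<nu>') = src \<Lambda> \<nu>" using act_res_src[OF g nM] act_src[OF g nM] gn by simp
  then show "triple \<mu> (k \<otimes>\<^bsub>G\<^esub> res g \<nu>') \<nu>'"
    unfolding triple_def using t' nM r act_mult[OF t'(2) r src_closed[OF nM]] by simp
  show "orb (\<mu>, k, \<nu>) g = ep_set \<mu> (k \<otimes>\<^bsub>G\<^esub> res g \<nu>') \<nu>'" unfolding orb_def n by simp
qed

lemma orb_one:
  assumes t: "triple \<mu> k \<nu>" shows "orb (\<mu>, k, \<nu>) \<one>\<^bsub>G\<^esub> = ep_set \<mu> k \<nu>"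
  using res_one[OF tripleD(3)[OF t]] act_one[OF tripleD(3)[OF t]] tripleD(2)[OF t] by (simp add: orb_def)

text \<open>An arrow in two translates determines both translating elements on a common morphism, so that
  pseudo-freeness applies.\<close>

lemma orb_unique:
  assumes t: "triple \<mu> k \<nu>" and g: "g \<in> carrier G" "g' \<in> carrier G"
    and a: "a \<in> orb (\<mu>, k, \<nu>) g" "a \<in> orb (\<mu>, k, \<nu>) g'"
  shows "g = g'"
proof -
  define \<nu>1 where "\<nu>1 = act (inv\<^bsub>G\<^esub> g) \<nu>"
  define \<nu>2 where "\<nu>2 = act (inv\<^bsub>G\<^esub> g') \<nu>"
  note o1 = orb_triple[OF t g(1) \<nu>1_def] and o2 = orb_triple[OF t g(2) \<nu>2_def]
  let ?k1 = "k \<otimes>\<^bsub>G\<^esub> res g \<nu>1" and ?k2 = "k \<otimes>\<^bsub>G\<^esub> res g' \<nu>2"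
  have kG: "k \<in> carrier G" using tripleD(2)[OF t] .
  have rG: "res g \<nu>1 \<in> carrier G" "res g' \<nu>2 \<in> carrier G" using res_closed g o1(4) o2(4) by auto
  from a(1) obtain x where x: "x \<in> bpaths (src \<Lambda> \<nu>1)" "a = ep \<mu> ?k1 \<nu>1 x" unfolding o1(5) ep_set_def by blast
  from a(2) obtain x' where x': "x' \<in> bpaths (src \<Lambda> \<nu>2)" "a = ep \<mu> ?k2 \<nu>2 x'" unfolding o2(5) ep_set_def by blast
  obtain \<kappa> \<kappa>' where "(\<kappa>, \<kappa>') \<in> ext_match \<mu> ?k1 \<nu>1 \<mu> ?k2 \<nu>2"
    using ep_eqD[OF o1(1) o2(1) x(1) x'(1)] x(2) x'(2) by blast
  then have c: "cpb \<nu>1 \<kappa>" "cpb \<nu>2 \<kappa>'" "\<nu>1 \<cdot> \<kappa> = \<nu>2 \<cdot> \<kappa>'" "\<mu> \<cdot> act ?k1 \<kappa> = \<mu> \<cdot> act ?k2 \<kappa>'" "res ?k1 \<kappa> = res ?k2 \<kappa>'"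
    by (auto simp: ext_match_def)
  have kM: "\<kappa> \<in> Mor \<Lambda>" "\<kappa>' \<in> Mor \<Lambda>" using c by blast+
  let ?a = "act (res g \<nu>1) \<kappa>" and ?b = "act (res g' \<nu>2) \<kappa>'"
  have abM: "?a \<in> Mor \<Lambda>" "?b \<in> Mor \<Lambda>" using act_closed rG kM by auto
  have "act ?k1 \<kappa> = act ?k2 \<kappa>'"
    by (rule cmp_cancel[OF triple_refine(1)[OF o1(1) c(1)] triple_refine(1)[OF o2(1) c(2)] c(4)])
  then have "act k ?a = act k ?b" using act_mult[OF kG rG(1) kM(1)] act_mult[OF kG rG(2) kM(2)] by simp
  then have ab: "?a = ?b" by (rule act_inject[OF kG abM])
  have "res k ?a \<otimes>\<^bsub>G\<^esub> res (res g \<nu>1) \<kappa> = res k ?a \<otimes>\<^bsub>G\<^esub> res (res g' \<nu>2) \<kappa>'"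
    using c(5) res_mult[OF kG rG(1) kM(1)] res_mult[OF kG rG(2) kM(2)] ab by simp
  then have rr: "res (res g \<nu>1) \<kappa> = res (res g' \<nu>2) \<kappa>'"
    using res_closed[OF kG abM(1)] res_closed[OF rG(1) kM(1)] res_closed[OF rG(2) kM(2)] by simp
  show ?thesis
  proof (rule pseudo_free_inject[OF g])
    show "\<nu>1 \<cdot> \<kappa> \<in> Mor \<Lambda>" using cmp_closed c(1) by blast
    have "act g (\<nu>1 \<cdot> \<kappa>) = \<nu> \<cdot> ?a" using act_cmp[OF g(1)] c(1) o1(2) by simp
    moreover have "act g' (\<nu>2 \<cdot> \<kappa>') = \<nu> \<cdot> ?b" using act_cmp[OF g(2)] c(2) o2(2) by simp
    ultimately show "act g (\<nu>1 \<cdot> \<kappa>) = act g' (\<nu>1 \<cdot> \<kappa>)" using ab c(3) by simp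
    have "res g (\<nu>1 \<cdot> \<kappa>) = res (res g \<nu>1) \<kappa>" using res_cmp[OF g(1)] c(1) by simp
    moreover have "res g' (\<nu>2 \<cdot> \<kappa>') = res (res g' \<nu>2) \<kappa>'" using res_cmp[OF g(2)] c(2) by simp
    ultimately show "res g (\<nu>1 \<cdot> \<kappa>) = res g' (\<nu>1 \<cdot> \<kappa>)" using rr c(3) by simp
  qed
qed

text \<open>Equivariance of the family: by \<open>res_mult\<close>, pulling back first by
  \<open>g\<close> and then by \<open>h\<close> is pulling back by
  \<open>g \<otimes> h\<close>.\<close>

lemma orb_mult:
  assumes t: "triple \<mu> k \<nu>" and g: "g \<in> carrier G" and h: "h \<in> carrier G" and x: "x \<in> boundary_paths \<Lambda>"
    and a: "a \<in> source_fibre EP (pact h x)" "a \<in> orb (\<mu>, k, \<nu>) g"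
  shows "gmult EP a (iota h x) \<in> orb (\<mu>, k, \<nu>) (g \<otimes>\<^bsub>G\<^esub> h)"
proof -
  define \<nu>1 where "\<nu>1 = act (inv\<^bsub>G\<^esub> g) \<nu>"
  define \<nu>2 where "\<nu>2 = act (inv\<^bsub>G\<^esub> h) \<nu>1"
  note o1 = orb_triple[OF t g \<nu>1_def]
  have gh: "g \<otimes>\<^bsub>G\<^esub> h \<in> carrier G" using g h by simp
  have n2: "\<nu>2 = act (inv\<^bsub>G\<^esub> (g \<otimes>\<^bsub>G\<^esub> h)) \<nu>"
    unfolding \<nu>2_def \<nu>1_def gr.inv_mult_group[OF g h] using act_mult[of "inv\<^bsub>G\<^esub> h" "inv\<^bsub>G\<^esub> g" \<nu>] g h tripleD(3)[OF t] by simp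
  note o2 = orb_triple[OF t gh n2]
  have n: "\<nu>1 \<in> init (pact h x)" "a = ep \<mu> (k \<otimes>\<^bsub>G\<^esub> res g \<nu>1) \<nu>1 (tail \<nu>1 (pact h x))"
    using a(2) unfolding o1(5) ep_set_fibre[OF o1(1) a(1)] by blast+
  note m = iota_mult[OF h x o1(1) n(1) \<nu>2_def]
  have "res (g \<otimes>\<^bsub>G\<^esub> h) \<nu>2 = res g \<nu>1 \<otimes>\<^bsub>G\<^esub> res h \<nu>2" using res_mult[OF g h o2(4)] m(2) by simp
  then have e: "k \<otimes>\<^bsub>G\<^esub> res (g \<otimes>\<^bsub>G\<^esub> h) \<nu>2 = k \<otimes>\<^bsub>G\<^esub> res g \<nu>1 \<otimes>\<^bsub>G\<^esub> res h \<nu>2"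
    using gr.m_assoc[OF tripleD(2)[OF t] res_closed[OF g o1(4)] res_closed[OF h o2(4)]] by simp
  show ?thesis unfolding o2(5) e n(2) m(4) ep_set_def using bpaths_tail[OF x m(1)] by blast
qed

lemma orb_mult_iff:
  assumes t: "triple \<mu> k \<nu>" and h: "h \<in> carrier G" and x: "x \<in> boundary_paths \<Lambda>" and a: "a \<in> source_fibre EP (pact h x)"
  shows "(\<exists>g\<in>carrier G. gmult EP a (iota h x) \<in> orb (\<mu>, k, \<nu>) g) \<longleftrightarrow> (\<exists>g\<in>carrier G. a \<in> orb (\<mu>, k, \<nu>) g)"
proof
  assume "\<exists>g\<in>carrier G. gmult EP a (iota h x) \<in> orb (\<mu>, k, \<nu>) g"
  then obtain g where g: "g \<in> carrier G" "gmult EP a (iota h x) \<in> orb (\<mu>, k, \<nu>) g" by blast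
  note c = iota_cancel[OF h x a]
  have hi: "inv\<^bsub>G\<^esub> h \<in> carrier G" using h by simp
  have "gmult EP a (iota h x) \<in> source_fibre EP (pact (inv\<^bsub>G\<^esub> h) (pact h x))"
    unfolding path_act_inv(2)[OF h boundary_paths[OF x]] by (rule c(1))
  from orb_mult[OF t g(1) hi boundary_act[OF h x] this g(2)]
  have "a \<in> orb (\<mu>, k, \<nu>) (g \<otimes>\<^bsub>G\<^esub> inv\<^bsub>G\<^esub> h)" unfolding c(2) .
  then show "\<exists>g\<in>carrier G. a \<in> orb (\<mu>, k, \<nu>) g" using g(1) hi gr.m_closed by blast
next
  assume "\<exists>g\<in>carrier G. a \<in> orb (\<mu>, k, \<nu>) g"
  then show "\<exists>g\<in>carrier G. gmult EP a (iota h x) \<in> orb (\<mu>, k, \<nu>) g"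
    using orb_mult[OF t _ h x a] h gr.m_closed by blast
qed

text \<open>Finitely many minimal extensions decide membership in all translates at once, because the
  extension on the range side is a minimal common extension of \<open>\<mu>'\<close> and \<open>\<mu>\<close>.\<close>

lemma orb_local:
  assumes t': "triple \<mu>' k' \<nu>'" and t: "triple \<mu> k \<nu>"
  obtains L where "finite L" "\<And>z z0 g. z \<in> bpaths (src \<Lambda> \<nu>') \<Longrightarrow> z0 \<in> bpaths (src \<Lambda> \<nu>') \<Longrightarrow> init z \<inter> L = init z0 \<inter> L
     \<Longrightarrow> g \<in> carrier G \<Longrightarrow> ep \<mu>' k' \<nu>' z \<in> orb (\<mu>, k, \<nu>) g \<Longrightarrow> ep \<mu>' k' \<nu>' z0 \<in> orb (\<mu>, k, \<nu>) g"
proof -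
  note kG = tripleD(2)[OF t']
  define L where "L = {\<kappa> \<in> Mor \<Lambda>. act k' \<kappa> \<in> ext \<mu>' \<mu>}"
  have "finite L"
  proof (rule finite_imageD)
    show "finite (act k' ` L)" by (rule finite_subset[OF _ finite_ext'[of \<mu>' \<mu>]]) (auto simp: L_def)
    show "inj_on (act k') L" by (rule inj_onI) (use act_inject[OF kG] in \<open>auto simp: L_def\<close>)
  qed
  moreover have "ep \<mu>' k' \<nu>' z0 \<in> orb (\<mu>, k, \<nu>) g"
    if z: "z \<in> bpaths (src \<Lambda> \<nu>')" "z0 \<in> bpaths (src \<Lambda> \<nu>')" and eq: "init z \<inter> L = init z0 \<inter> L"
      and g: "g \<in> carrier G" and m: "ep \<mu>' k' \<nu>' z \<in> orb (\<mu>, k, \<nu>) g" for z z0 g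
  proof -
    define \<nu>1 where "\<nu>1 = act (inv\<^bsub>G\<^esub> g) \<nu>"
    note o1 = orb_triple[OF t g \<nu>1_def]
    obtain \<kappa> \<kappa>' where k: "(\<kappa>, \<kappa>') \<in> ext_match \<mu>' k' \<nu>' \<mu> (k \<otimes>\<^bsub>G\<^esub> res g \<nu>1) \<nu>1" "\<kappa> \<in> init z"
      using m unfolding o1(5) ep_set_iff[OF t' o1(1) z(1)] by blast
    then have c: "cpb \<nu>' \<kappa>" "cpb \<nu>1 \<kappa>'" "\<nu>' \<cdot> \<kappa> = \<nu>1 \<cdot> \<kappa>'" "\<nu>' \<cdot> \<kappa> \<in> mce \<nu>' \<nu>1"
      "\<mu>' \<cdot> act k' \<kappa> = \<mu> \<cdot> act (k \<otimes>\<^bsub>G\<^esub> res g \<nu>1) \<kappa>'" by (auto simp: ext_match_def)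
    note r = triple_refine(1)[OF t' c(1)] and r1 = triple_refine(1)[OF o1(1) c(2)]
    have d1: "deg \<Lambda> \<nu>' + deg \<Lambda> \<kappa> = sup (deg \<Lambda> \<nu>') (deg \<Lambda> \<nu>1)"
      using deg_cmp c(1,4) by (simp add: mce_def)
    have d2: "deg \<Lambda> \<nu>' + deg \<Lambda> \<kappa> = deg \<Lambda> \<nu>1 + deg \<Lambda> \<kappa>'"
      using deg_cmp[of \<nu>' \<kappa>] deg_cmp[of \<nu>1 \<kappa>'] c(1-3) by simp
    have d3: "deg \<Lambda> (\<mu>' \<cdot> act k' \<kappa>) = deg \<Lambda> \<mu>' + deg \<Lambda> \<kappa>"
      using deg_cmp r act_deg[OF kG] c(1) by simp
    have d4: "deg \<Lambda> (\<mu>' \<cdot> act k' \<kappa>) = deg \<Lambda> \<mu> + deg \<Lambda> \<kappa>'"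
      unfolding c(5) using deg_cmp r1 act_deg[OF tripleD(2)[OF o1(1)]] c(2) by simp
    have "deg \<Lambda> (\<mu>' \<cdot> act k' \<kappa>) = sup (deg \<Lambda> \<mu>') (deg \<Lambda> \<mu>)"
    proof
      fix i
      show "deg \<Lambda> (\<mu>' \<cdot> act k' \<kappa>) i = sup (deg \<Lambda> \<mu>') (deg \<Lambda> \<mu>) i"
        using fun_cong[OF d1, of i] fun_cong[OF d2, of i] fun_cong[OF d3, of i] fun_cong[OF d4, of i]
        by (simp add: sup_max max_def split: if_splits)
    qed
    then have "\<mu>' \<cdot> act k' \<kappa> \<in> mce \<mu>' \<mu>"
      unfolding mce_def pre_def using r r1 c(5) by blast
    then have "\<kappa> \<in> L" unfolding L_def ext_def using r c(1) by blast
    then have "\<kappa> \<in> init z0" using eq k(2) by blast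
    then show ?thesis unfolding o1(5) ep_set_iff[OF t' o1(1) z(2)] using k(1) by blast
  qed
  ultimately show ?thesis using that by blast
qed

text \<open>Only membership in the union of all translates is asked, which right translation by
  \<open>G\<close> preserves; the index is therefore invariant.\<close>

definition orb_index :: "(nat \<Rightarrow> 'a \<times> 'g \<times> 'a) \<Rightarrow> ('g, 'a, 'k) ep_arrow \<Rightarrow> nat" where
  "orb_index T a = (LEAST n. \<exists>g\<in>carrier G. a \<in> orb (T n) g)"

definition colour :: "(nat \<Rightarrow> 'a \<times> 'g \<times> 'a) \<Rightarrow> ('g, 'a, 'k) ep_arrow \<Rightarrow> 'g" where
  "colour T a = (SOME g. g \<in> carrier G \<and> a \<in> orb (T (orb_index T a)) g)"

context
  fixes T :: "nat \<Rightarrow> 'a \<times> 'g \<times> 'a"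
  assumes T: "range T = {(\<mu>, g, \<nu>). triple \<mu> g \<nu>}"
begin

lemma T_cases: obtains \<mu> g \<nu> where "T n = (\<mu>, g, \<nu>)" "triple \<mu> g \<nu>"
  using T rangeI[of T n] that by (cases "T n") auto

lemma colour:
  assumes "a \<in> topspace ET"
  shows "colour T a \<in> carrier G" "a \<in> orb (T (orb_index T a)) (colour T a)"
proof -
  obtain \<mu> g \<nu> x where t: "triple \<mu> g \<nu>" "x \<in> bpaths (src \<Lambda> \<nu>)" "a = ep \<mu> g \<nu> x" using arrow_cases[OF assms] .
  then have "(\<mu>, g, \<nu>) \<in> range T" unfolding T by simp
  then obtain n where "T n = (\<mu>, g, \<nu>)" by auto
  moreover have "a \<in> orb (\<mu>, g, \<nu>) \<one>\<^bsub>G\<^esub>" unfolding orb_one[OF t(1)] ep_set_def using t by blast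
  ultimately have "\<exists>n. \<exists>g\<in>carrier G. a \<in> orb (T n) g" by (intro exI[of _ n] bexI[of _ "\<one>\<^bsub>G\<^esub>"]) simp_all
  from LeastI_ex[OF this] have "\<exists>g. g \<in> carrier G \<and> a \<in> orb (T (orb_index T a)) g" unfolding orb_index_def by blast
  from someI_ex[OF this] show "colour T a \<in> carrier G" "a \<in> orb (T (orb_index T a)) (colour T a)"
    unfolding colour_def by blast+
qed

lemma colour_eqI:
  assumes a: "a \<in> topspace ET" and g: "g \<in> carrier G" "a \<in> orb (T (orb_index T a)) g"
  shows "colour T a = g"
proof -
  obtain \<mu> k \<nu> where t: "T (orb_index T a) = (\<mu>, k, \<nu>)" "triple \<mu> k \<nu>" by (rule T_cases)
  show ?thesis using orb_unique[OF t(2) colour(1)[OF a] g(1)] colour(2)[OF a] g(2) unfolding t(1) by blast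
qed

lemma colour_mult:
  assumes h: "h \<in> carrier G" and x: "x \<in> boundary_paths \<Lambda>" and a: "a \<in> source_fibre EP (pact h x)"
  shows "colour T (gmult EP a (iota h x)) = colour T a \<otimes>\<^bsub>G\<^esub> h"
proof -
  have aT: "a \<in> topspace ET" using a unfolding source_fibre_def EP_simps by blast
  have bT: "gmult EP a (iota h x) \<in> topspace ET" using iota_cancel(1)[OF h x a] unfolding source_fibre_def EP_simps by blast
  have "(\<exists>g\<in>carrier G. gmult EP a (iota h x) \<in> orb (T n) g) \<longleftrightarrow> (\<exists>g\<in>carrier G. a \<in> orb (T n) g)" for n
  proof -
    obtain \<mu> k \<nu> where t: "T n = (\<mu>, k, \<nu>)" "triple \<mu> k \<nu>" by (rule T_cases)
    show ?thesis unfolding t(1) by (rule orb_mult_iff[OF t(2) h x a])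
  qed
  then have i: "orb_index T (gmult EP a (iota h x)) = orb_index T a" unfolding orb_index_def by simp
  obtain \<mu> k \<nu> where t: "T (orb_index T a) = (\<mu>, k, \<nu>)" "triple \<mu> k \<nu>" by (rule T_cases)
  have "gmult EP a (iota h x) \<in> orb (T (orb_index T a)) (colour T a \<otimes>\<^bsub>G\<^esub> h)"
    unfolding t(1) by (rule orb_mult[OF t(2) colour(1)[OF aT] h x a colour(2)[OF aT, unfolded t(1)]])
  then show ?thesis using colour_eqI[OF bT] colour(1)[OF aT] h unfolding i by simp
qed

text \<open>To fix the index near an arrow it is enough to control the families up to this index,
  finitely many, each by the finite set from \<open>orb_local\<close>; within the selected family
  the translate is preserved by the same sets.\<close>

lemma openin_colour: "openin ET {a \<in> topspace ET. colour T a = c}"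
  unfolding openin_ep_iff
proof (intro conjI allI impI ballI)
  fix \<mu> g \<nu> x assume t: "triple \<mu> g \<nu>" and x: "x \<in> bpaths (src \<Lambda> \<nu>)" and e: "ep \<mu> g \<nu> x \<in> {a \<in> topspace ET. colour T a = c}"
  let ?P = "\<lambda>n L. finite L \<and> (\<forall>z\<in>bpaths (src \<Lambda> \<nu>). \<forall>z0\<in>bpaths (src \<Lambda> \<nu>). init z \<inter> L = init z0 \<inter> L \<longrightarrow>
     (\<forall>g'\<in>carrier G. ep \<mu> g \<nu> z \<in> orb (T n) g' \<longrightarrow> ep \<mu> g \<nu> z0 \<in> orb (T n) g'))"
  have "\<exists>L. ?P n L" for n
  proof -
    obtain \<mu>1 k1 \<nu>1 where t1: "T n = (\<mu>1, k1, \<nu>1)" "triple \<mu>1 k1 \<nu>1" by (rule T_cases)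
    show ?thesis unfolding t1(1) by (rule orb_local[OF t t1(2)]) blast
  qed
  then obtain L where L: "\<And>n. ?P n (L n)" by metis
  let ?a = "ep \<mu> g \<nu> x"
  let ?n = "orb_index T ?a"
  define M where "M = (\<Union>n\<le>?n. L n)"
  have "ep \<mu> g \<nu> y \<in> {a \<in> topspace ET. colour T a = c}"
    if y: "y \<in> bpaths (src \<Lambda> \<nu>)" and eq: "init y \<inter> M = init x \<inter> M" for y
  proof -
    let ?b = "ep \<mu> g \<nu> y"
    have aT: "?a \<in> topspace ET" and bT: "?b \<in> topspace ET" using ep_arrow[OF t] x y by blast+
    have iff: "?b \<in> orb (T n) g' \<longleftrightarrow> ?a \<in> orb (T n) g'" if n: "n \<le> ?n" and g': "g' \<in> carrier G" for n g'
    proof -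
      have eq': "init y \<inter> L n = init x \<inter> L n" using eq n unfolding M_def by blast
      show ?thesis using L[of n] x y eq' eq'[symmetric] g' by blast
    qed
    have cl: "?b \<in> orb (T ?n) (colour T ?a)" using iff[OF order_refl colour(1)[OF aT]] colour(2)[OF aT] by blast
    have "orb_index T ?b = ?n"
      unfolding orb_index_def[of T ?b]
    proof (rule Least_equality)
      show "\<exists>g'\<in>carrier G. ?b \<in> orb (T ?n) g'" using cl colour(1)[OF aT] by blast
      fix n assume n: "\<exists>g'\<in>carrier G. ?b \<in> orb (T n) g'"
      show "?n \<le> n"
      proof (rule ccontr)
        assume nn: "\<not> ?n \<le> n"
        then have "\<exists>g'\<in>carrier G. ?a \<in> orb (T n) g'" using n iff[of n] by auto
        then have "?n \<le> n" unfolding orb_index_def by (rule Least_le)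
        then show False using nn by blast
      qed
    qed
    then have "colour T ?b = colour T ?a" using colour_eqI[OF bT colour(1)[OF aT]] cl by simp
    then show ?thesis using e bT by simp
  qed
  moreover have "finite M" unfolding M_def using L by simp
  ultimately show "\<exists>L. finite L \<and> (\<forall>y\<in>bpaths (src \<Lambda> \<nu>). init y \<inter> L = init x \<inter> L \<longrightarrow> ep \<mu> g \<nu> y \<in> {a \<in> topspace ET. colour T a = c})"
    by blast
qed blast

text \<open>Finitely many arrows carry almost all of the mass of a fibre and move continuously to
  neighbouring fibres, keeping their colours; since the total mass is constant, no mass is lost or
  gained by a colour class.\<close>

lemma continuous_colour_sum:
  assumes f: "fibre_density EP f"
  shows "continuous_map (boundary_topology \<Lambda>) euclideanreal (\<lambda>x. \<Sum>\<^sub>\<infinity>a\<in>{a \<in> source_fibre EP x. colour T a = c}. f a)"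
  unfolding continuous_boundary_iff
proof (intro ballI allI impI)
  fix x and \<epsilon> :: real assume x: "x \<in> boundary_paths \<Lambda>" and e: "\<epsilon> > 0"
  let ?A = "source_fibre EP"
  have fc: "continuous_map ET euclideanreal f" and f0: "\<And>a. a \<in> topspace ET \<Longrightarrow> 0 \<le> f a"
    and f1: "\<And>x. x \<in> boundary_paths \<Lambda> \<Longrightarrow> (f has_sum 1) (?A x)"
    using f unfolding EP_simps by blast+
  have AT: "?A x \<subseteq> topspace ET" for x unfolding source_fibre_def EP_simps by blast
  have nn: "0 \<le> f a" if "a \<in> ?A w" for a w using f0 AT that by blast
  \<comment> \<open>One share for the mass of the fibre over \<open>x\<close> missed by
    \<open>X\<close>, another for the total change of the weights on \<open>X\<close>.\<close>
  have "\<epsilon> / 8 > 0" using e by simp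
  then obtain X where X: "finite X" "X \<subseteq> ?A x" "dist (sum f X) 1 \<le> \<epsilon> / 8"
    using has_sum_finite_approximation[OF f1[OF x]] by blast
  have "\<forall>a\<in>X. \<exists>t. triple (fst t) (fst (snd t)) (snd (snd t)) \<and> snd (snd t) \<in> init x
      \<and> a = ep (fst t) (fst (snd t)) (snd (snd t)) (tail (snd (snd t)) x)"
  proof
    fix a assume "a \<in> X"
    then obtain \<mu> g \<nu> where "triple \<mu> g \<nu>" "\<nu> \<in> init x" "a = ep \<mu> g \<nu> (tail \<nu> x)"
      using fibre_section[OF x] X(2) by blast
    then show "\<exists>t. triple (fst t) (fst (snd t)) (snd (snd t)) \<and> snd (snd t) \<in> init x
      \<and> a = ep (fst t) (fst (snd t)) (snd (snd t)) (tail (snd (snd t)) x)"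
      by (intro exI[of _ "(\<mu>, g, \<nu>)"]) simp
  qed
  then obtain \<tau> where tau: "\<forall>a\<in>X. triple (fst (\<tau> a)) (fst (snd (\<tau> a))) (snd (snd (\<tau> a))) \<and> snd (snd (\<tau> a)) \<in> init x
      \<and> a = ep (fst (\<tau> a)) (fst (snd (\<tau> a))) (snd (snd (\<tau> a))) (tail (snd (snd (\<tau> a))) x)"
    unfolding bchoice_iff by blast
  define m k n where "m a = fst (\<tau> a)" "k a = fst (snd (\<tau> a))" "n a = snd (snd (\<tau> a))" for a
  have t: "triple (m a) (k a) (n a)" and ni: "n a \<in> init x" and ea: "ep (m a) (k a) (n a) (tail (n a) x) = a" if "a \<in> X" for a
    using tau[rule_format, OF that] unfolding m_k_n_def by simp_all
  define b where "b y a = ep (m a) (k a) (n a) (tail (n a) y)" for y a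
  define \<delta> where "\<delta> = \<epsilon> / (8 * (real (card X) + 1))"
  have d: "\<delta> > 0" unfolding \<delta>_def using e by simp
  \<comment> \<open>Besides weight and colour, the neighbourhood avoids the bisections of the other
    chosen arrows, so that the moved arrows remain distinct. This uses that bisections are
    closed.\<close>
  define V where "V a = {b \<in> topspace ET. f b \<in> ball (f a) \<delta>} \<inter> {b \<in> topspace ET. colour T b = colour T a}
      \<inter> (topspace ET - (\<Union>a'\<in>X - {a}. ep_set (m a') (k a') (n a')))" for a
  have "\<exists>L. finite L \<and> (\<forall>y\<in>boundary_paths \<Lambda>. init y \<inter> L = init x \<inter> L \<longrightarrow> n a \<in> init y \<and> b y a \<in> V a)"
    if a: "a \<in> X" for a
    unfolding b_def
  proof (rule section_open[OF _ t[OF a] x ni[OF a]])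
    show "openin ET (V a)" unfolding V_def
    proof (intro openin_Int openin_colour openin_diff openin_topspace closedin_Union)
      show "openin ET {b \<in> topspace ET. f b \<in> ball (f a) \<delta>}"
        using fc unfolding continuous_map_def by auto
      show "finite ((\<lambda>a'. ep_set (m a') (k a') (n a')) ` (X - {a}))" using X(1) by simp
      show "closedin ET S" if "S \<in> (\<lambda>a'. ep_set (m a') (k a') (n a')) ` (X - {a})" for S
        using that closedin_ep_set[OF t] by blast
    qed
    have aA: "a \<in> ?A x" using a X(2) by blast
    have "a \<notin> ep_set (m a') (k a') (n a')" if a': "a' \<in> X - {a}" for a'
    proof
      assume "a \<in> ep_set (m a') (k a') (n a')"
      then have "a = a'" using ep_set_fibre[OF t aA, of a'] ea[of a'] a' by simp
      then show False using a' by blast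
    qed
    then show "ep (m a) (k a) (n a) (tail (n a) x) \<in> V a"
      unfolding ea[OF a] V_def using aA AT[of x] d by auto
  qed
  then obtain L where L: "\<And>a. a \<in> X \<Longrightarrow> finite (L a)"
    "\<And>a y. a \<in> X \<Longrightarrow> y \<in> boundary_paths \<Lambda> \<Longrightarrow> init y \<inter> L a = init x \<inter> L a \<Longrightarrow> n a \<in> init y \<and> b y a \<in> V a"
    by metis
  let ?\<psi> = "\<lambda>x. \<Sum>\<^sub>\<infinity>a\<in>{a \<in> ?A x. colour T a = c}. f a"
  have "\<bar>?\<psi> y - ?\<psi> x\<bar> < \<epsilon>" if y: "y \<in> boundary_paths \<Lambda>" and eq: "init y \<inter> (\<Union>a\<in>X. L a) = init x \<inter> (\<Union>a\<in>X. L a)" for y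
  proof -
    have nb: "n a \<in> init y" "b y a \<in> V a" if a: "a \<in> X" for a
    proof -
      have "init y \<inter> L a = init x \<inter> L a" using eq a by blast
      then show "n a \<in> init y" "b y a \<in> V a" using L(2)[OF a y] by blast+
    qed
    have bA: "b y a \<in> ?A y" "b y a \<in> ep_set (m a) (k a) (n a)" if a: "a \<in> X" for a
      using section_in_fibre[OF y t[OF a] nb(1)[OF a]] unfolding b_def ep_set_def by auto
    have inj: "inj_on (b y) X"
    proof (rule inj_onI, rule ccontr)
      fix a a' assume a: "a \<in> X" "a' \<in> X" "b y a = b y a'" "a \<noteq> a'"
      have "b y a \<notin> ep_set (m a') (k a') (n a')" using nb(2)[OF a(1)] a(2,4) unfolding V_def by blast
      then show False using bA(2)[OF a(2)] a(3) by simp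
    qed
    have col: "colour T (b y a) = colour T a" and fb: "\<bar>f (b y a) - f a\<bar> < \<delta>" if "a \<in> X" for a
      using nb(2)[OF that] unfolding V_def by (auto simp: dist_real_def abs_minus_commute)
    have img: "sum f {d \<in> b y ` X. Q (colour T d)} = (\<Sum>a\<in>{a \<in> X. Q (colour T a)}. f (b y a))" for Q
    proof -
      have "{d \<in> b y ` X. Q (colour T d)} = b y ` {a \<in> X. Q (colour T a)}" using col by auto
      then show ?thesis using sum.reindex[OF inj_on_subset[OF inj], of "{a \<in> X. Q (colour T a)}" f] by simp
    qed
    have close: "\<bar>(\<Sum>a\<in>Y. f (b y a)) - sum f Y\<bar> \<le> \<epsilon> / 8" if Y: "Y \<subseteq> X" for Y
    proof -
      have "\<bar>(\<Sum>a\<in>Y. f (b y a)) - sum f Y\<bar> = \<bar>\<Sum>a\<in>Y. f (b y a) - f a\<bar>" by (simp add: sum_subtractf)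
      also have "\<dots> \<le> (\<Sum>a\<in>Y. \<bar>f (b y a) - f a\<bar>)" by (rule sum_abs)
      also have "\<dots> \<le> (\<Sum>a\<in>Y. \<delta>)" by (rule sum_mono, rule less_imp_le, rule fb) (use Y in blast)
      also have "\<dots> = real (card Y) * \<delta>" by simp
      also have "\<dots> \<le> (real (card X) + 1) * \<delta>"
        by (rule mult_right_mono) (use card_mono[OF X(1) Y] d in auto)
      also have "\<dots> = \<epsilon> / 8"
      proof -
        have *: "r * (\<epsilon> / (8 * r)) = \<epsilon> / 8" if "r > 0" for r using that by simp
        show ?thesis unfolding \<delta>_def by (rule *) simp
      qed
      finally show ?thesis .
    qed
    let ?Y = "{a \<in> X. colour T a = c}" and ?Y' = "{a \<in> X. colour T a \<noteq> c}"
    have bX: "finite (b y ` X)" "b y ` X \<subseteq> ?A y" using X(1) bA(1) by auto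
    note cx = class_sum_bounds[OF f1[OF x] nn[of _ x] X(1,2), where P = "\<lambda>a. colour T a = c"]
      and cy = class_sum_bounds[OF f1[OF y] nn[of _ y] bX, where P = "\<lambda>a. colour T a = c"]
    have "sum f X = sum f ?Y + sum f ?Y'"
      using sum.union_disjoint[of ?Y ?Y' f] X(1) by (simp add: Collect_disj_eq[symmetric] conj_disj_distribL[symmetric] disjoint_iff)
    moreover have "1 - sum f X \<le> \<epsilon> / 8" using X(3) unfolding dist_real_def by linarith
    moreover have "\<bar>(\<Sum>a\<in>?Y. f (b y a)) - sum f ?Y\<bar> \<le> \<epsilon> / 8" "\<bar>(\<Sum>a\<in>?Y'. f (b y a)) - sum f ?Y'\<bar> \<le> \<epsilon> / 8"
      by (rule close, blast)+
    \<comment> \<open>Each class mass lies between its visible part and 1 minus the visible part of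
      the other class. Over \<open>x\<close> the gap is at most \<open>\<epsilon> / 8\<close>, and
      passing to \<open>y\<close> changes either bound by at most
      \<open>\<epsilon> / 8\<close>.\<close>
    ultimately show ?thesis
      using cx cy[unfolded img[of "\<lambda>d. d = c"] img[of "\<lambda>d. d \<noteq> c"]] e by linarith
  qed
  moreover have "finite (\<Union>a\<in>X. L a)" using X(1) L(1) by blast
  ultimately show "\<exists>L. finite L \<and> (\<forall>y\<in>boundary_paths \<Lambda>. init y \<inter> L = init x \<inter> L \<longrightarrow> \<bar>?\<psi> y - ?\<psi> x\<bar> < \<epsilon>)" by blast
qed

end

theorem amenable_action_if_groupoid:
  assumes am: "amenable_groupoid EP" and cnt: "countable (carrier G)" "countable (Mor \<Lambda>)"
  shows "amenable_action G (boundary_topology \<Lambda>) pact"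
  unfolding amenable_boundary_iff
proof (intro allI impI)
  fix S C and \<epsilon> :: real
  assume S: "finite S" "S \<subseteq> carrier G" and C: "compactin (boundary_topology \<Lambda>) C" and e: "\<epsilon> > 0"
  let ?T = "{(\<mu>, g, \<nu>). triple \<mu> g \<nu>}"
  show "\<exists>f. (\<forall>g\<in>carrier G. continuous_map (boundary_topology \<Lambda>) euclideanreal (f g))
        \<and> (\<forall>g\<in>carrier G. \<forall>x\<in>boundary_paths \<Lambda>. 0 \<le> f g x)
        \<and> (\<forall>x\<in>boundary_paths \<Lambda>. ((\<lambda>g. f g x) has_sum 1) (carrier G))
        \<and> (\<forall>h\<in>S. \<forall>x\<in>C. fsum_le (\<lambda>g. \<bar>f (g \<otimes>\<^bsub>G\<^esub> h) x - f g (pact h x)\<bar>) (carrier G) \<epsilon>)"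
  proof (cases "boundary_paths \<Lambda> = {}")
    \<comment> \<open>Treated apart because an enumeration by the naturals requires at least one
      triple.\<close>
    case True
    have "C = {}" using compactin_subset_topspace[OF C] True topspace_boundary by simp
    then show ?thesis using True by (intro exI[of _ "\<lambda>_ _. 0"]) simp
  next
    case False
    have "?T \<noteq> {}" using False iota_triple(1)[OF gr.one_closed] by auto
    moreover have "countable ?T"
    proof (rule countable_subset)
      show "?T \<subseteq> Mor \<Lambda> \<times> carrier G \<times> Mor \<Lambda>" by (auto simp: triple_def)
      show "countable (Mor \<Lambda> \<times> carrier G \<times> Mor \<Lambda>)" using cnt by simp
    qed
    ultimately have T: "range (from_nat_into ?T) = ?T" by (rule range_from_nat_into)
    let ?c = "colour (from_nat_into ?T)"
    let ?A = "source_fibre EP"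
    have AT: "?A x \<subseteq> topspace ET" for x unfolding source_fibre_def EP_simps by blast
    have cA: "?c ` ?A x \<subseteq> carrier G" for x using colour(1)[OF T] AT by blast
    have "compactin ET (\<Union>h\<in>S. iota h ` C)"
      by (rule compactin_Union) (use S iota_compact[OF _ C] in auto)
    from am[unfolded amenable_EP_iff, rule_format, OF this e]
    obtain f where f: "fibre_density EP f"
      and inv: "\<forall>h\<in>\<Union>h\<in>S. iota h ` C. fsum_le (\<lambda>a. \<bar>f (gmult EP a h) - f a\<bar>) (?A (grng EP h)) \<epsilon>" by blast
    have nn: "0 \<le> f a" if "a \<in> ?A x" for a x using f AT[of x] that unfolding EP_simps by blast
    have f1: "(f has_sum 1) (?A x)" if "x \<in> boundary_paths \<Lambda>" for x using f that unfolding EP_simps by blast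
    \<comment> \<open>The density is transported from source fibres to \<open>G\<close> by summing
      over the arrows of one colour.\<close>
    define \<psi> where "\<psi> g x = (\<Sum>\<^sub>\<infinity>a\<in>{a \<in> ?A x. ?c a = g}. f a)" for g x
    show ?thesis
    proof (intro exI[of _ \<psi>] conjI ballI)
      show "continuous_map (boundary_topology \<Lambda>) euclideanreal (\<psi> g)" for g
        unfolding \<psi>_def by (rule continuous_colour_sum[OF T f])
      show "0 \<le> \<psi> g x" for g x unfolding \<psi>_def by (rule infsum_nonneg) (use nn in blast)
      show "((\<lambda>g. \<psi> g x) has_sum 1) (carrier G)" if "x \<in> boundary_paths \<Lambda>" for x
        unfolding \<psi>_def by (rule has_sum_pushforward[OF f1[OF that] nn cA])
    next
      fix h x assume h: "h \<in> S" and xC: "x \<in> C"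
      have hG: "h \<in> carrier G" using h S(2) by blast
      have x: "x \<in> boundary_paths \<Lambda>" using compactin_subset_topspace[OF C] xC topspace_boundary by blast
      have le: "fsum_le (\<lambda>a. \<bar>f (gmult EP a (iota h x)) - f a\<bar>) (?A (pact h x)) \<epsilon>"
      proof -
        have "iota h x \<in> (\<Union>h\<in>S. iota h ` C)" using h xC by blast
        from bspec[OF inv this] show ?thesis unfolding iota_arrow(2)[OF hG x] .
      qed
      show "fsum_le (\<lambda>g. \<bar>\<psi> (g \<otimes>\<^bsub>G\<^esub> h) x - \<psi> g (pact h x)\<bar>) (carrier G) \<epsilon>"
        unfolding \<psi>_def
      \<comment> \<open>Right multiplication by \<open>iota h x\<close> matches the fibres and right
        multiplication by \<open>h\<close> matches the colours.\<close>
      proof (rule fsum_le_pushforward[OF has_sum_imp_summable[OF f1[OF boundary_act[OF hG x]]] nn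
            has_sum_imp_summable[OF f1[OF x]] nn iota_bij[OF hG x] cA _ _ le])
        show "inj_on (\<lambda>g. g \<otimes>\<^bsub>G\<^esub> h) (carrier G)" using gr.bij_betw_r_mult[OF hG] by (rule bij_betw_imp_inj_on)
        show "?c (gmult EP a (iota h x)) = ?c a \<otimes>\<^bsub>G\<^esub> h" if "a \<in> ?A (pact h x)" for a
          by (rule colour_mult[OF T hG x that])
      qed
    qed
  qed
qed

end

theorem theorem3p15:
  fixes G :: "('g, 'b) monoid_scheme"
    and \<Lambda> :: "('a, 'k::finite) kgraph"
    and act :: "'g \<Rightarrow> 'a \<Rightarrow> 'a"
    and res :: "'g \<Rightarrow> 'a \<Rightarrow> 'g"
  assumes "self_similar_kgraph G \<Lambda> act res"
    and "finitely_aligned \<Lambda>"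
    and "pseudo_free G \<Lambda> act res"
  shows "let cond1 = amenable_groupoid (exel_pardo_groupoid G \<Lambda> act res);
             cond2 = amenable_action G (boundary_topology \<Lambda>) (path_act act res);
             cond3 = (\<forall>v\<in>vertices \<Lambda>. amenable_group (G\<lparr>carrier := stabilizer G act v\<rparr>))
         in (cond3 \<longrightarrow> cond2) \<and> (cond2 \<longrightarrow> cond1)
            \<and> (countable_kgraph_action G \<Lambda> \<longrightarrow> cond1 \<longrightarrow> cond2)
            \<and> (row_finite \<Lambda> \<or> CARD('k) = 1 \<longrightarrow> cond2 \<longrightarrow> cond3)
            \<and> ((row_finite \<Lambda> \<or> CARD('k) = 1) \<and> countable_kgraph_action G \<Lambda>
                 \<longrightarrow> (cond1 \<longleftrightarrow> cond2) \<and> (cond2 \<longleftrightarrow> cond3))"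
proof -
  interpret self_similar_kgraph G \<Lambda> act res by (rule assms(1))
  interpret pf_kgraph G \<Lambda> act res by unfold_locales (use assms in simp_all)
  let ?c1 = "amenable_groupoid (exel_pardo_groupoid G \<Lambda> act res)"
    and ?c2 = "amenable_action G (boundary_topology \<Lambda>) (path_act act res)"
    and ?c3 = "\<forall>v\<in>vertices \<Lambda>. amenable_group (G\<lparr>carrier := stabilizer G act v\<rparr>)"
  have "?c3 \<longrightarrow> ?c2" using amenable_action_if_stabilizers by blast
  moreover have "?c2 \<longrightarrow> ?c1" using amenable_groupoid_if_action by blast
  moreover have "countable_kgraph_action G \<Lambda> \<longrightarrow> ?c1 \<longrightarrow> ?c2"
    using amenable_action_if_groupoid unfolding countable_kgraph_action_def by blast
  moreover have "row_finite \<Lambda> \<or> CARD('k) = 1 \<longrightarrow> ?c2 \<longrightarrow> ?c3"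
    using amenable_stabilizer_row_finite amenable_stabilizer_rank1 by blast
  ultimately show ?thesis unfolding Let_def by blast
qed

end
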